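(* Let $\Bbbk$ be an algebraically closed field of characteristic zero. For a symmetric pair $(\mathfrak g,\mathfrak g_0)$ over $\Bbbk$ with $\sigma$-eigenspace decomposition $\mathfrak g=\mathfrak g_0\oplus\mathfrak g_1$, let $$\mathfrak C(\mathfrak g_1)=\{(x,y)\in\mathfrak g_1\times\mathfrak g_1\mid[x,y]=0\}.$$ Then $\mathfrak C(\mathfrak g_1)$ is reducible for each of the following symmetric pairs: (1) $(\mathfrak{gl}_{n+m},\mathfrak{gl}_n\oplus\mathfrak{gl}_m)$ with $n,m\ge 1$ and $n\ne m$; (2) $(\mathfrak{so}_{2n},\mathfrak{gl}_n)$ with $n$ odd and $n\ge 3$; (3) $(E_6,\mathfrak{so}_{10}\oplus\Bbbk)$.
   Context: A symmetric pair $(\mathfrak g,\mathfrak g_0)$ consists of a reductive algebraic Lie algebra $\mathfrak g$ over $\Bbbk$ and the fixed subalgebra $\mathfrak g_0=\mathfrak g^\sigma$ of an involutory automorphism $\sigma$ of $\mathfrak g$; $\mathfrak g_1$ denotes the $(-1)$-eigenspace of $\sigma$. The involutions in question are: (1) $\mathfrak g=\mathfrak{gl}(V)$, $V=V_a\oplus V_b$, $\dim V_a=n$, $\dim V_b=m$, and $\sigma$ is conjugation by $A\in\mathrm{GL}(V)$ with $A|_{V_a}=-\mathrm{id}$, $A|_{V_b}=\mathrm{id}$, so that $\mathfrak g_0=\mathfrak{gl}(V_a)\oplus\mathfrak{gl}(V_b)$ and $\mathfrak g_1=\mathrm{Hom}(V_a,V_b)\oplus\mathrm{Hom}(V_b,V_a)$.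 (2) $\mathfrak g=\mathfrak{so}(V)$, $\dim V=2n$, $V=V_+\oplus V_-$ is a direct sum of two isotropic subspaces (each of dimension $n$), and $\sigma$ is conjugation by the linear map $A$ with $A|_{V_+}=\mathrm{id}$, $A|_{V_-}=-\mathrm{id}$, so that $\mathfrak g_0\cong\mathfrak{gl}(V_+)\cong \mathfrak{gl}_n$ and, in a suitable basis, $\mathfrak g_1=\left\{\begin{pmatrix}0 & X \\ Y & 0\end{pmatrix}\mid X,Y\in\mathfrak{gl}_n,\ X=-X^t,\ Y=-Y^t\right\}$. (3) $\mathfrak g$ is the simple Lie algebra of type $E_6$ and $\sigma$ is an involution with $\mathfrak g^\sigma\cong\mathfrak{so}_{10}\oplus\Bbbk$; here $\mathfrak g_1$ is, as an $\mathfrak{so}_{10}$-module, the direct sum of the two different $16$-dimensional half-spinor representations. Reducible means not irreducible in the Zariski topology. *)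

theory Defs
  imports "HOL-Analysis.Analysis" "HOL-Computational_Algebra.Polynomial"
begin

section \<open>Lie algebras\<close>

text \<open>
  A Lie algebra is a subspace \<open>lie_carrier L\<close> of an ambient vector space, the latter being a
  whole type \<open>'g :: ab_group_add\<close> together with the scalar multiplication \<open>lie_scale L\<close>.
\<close>

record ('k, 'g) lie_alg =
  lie_carrier :: "'g set"
  lie_scale :: "'k \<Rightarrow> 'g \<Rightarrow> 'g"
  lie_bracket :: "'g \<Rightarrow> 'g \<Rightarrow> 'g"

definition lie_algebra :: "('k::field, 'g::ab_group_add) lie_alg \<Rightarrow> bool" where
  "lie_algebra L \<longleftrightarrow>
     vector_space (lie_scale L) \<and>
     module.subspace (lie_scale L) (lie_carrier L) \<and>
     (\<forall>x\<in>lie_carrier L. \<forall>y\<in>lie_carrier L. lie_bracket L x y \<in> lie_carrier L) \<and>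
     (\<forall>x\<in>lie_carrier L. \<forall>y\<in>lie_carrier L. \<forall>z\<in>lie_carrier L.
        lie_bracket L (x + y) z = lie_bracket L x z + lie_bracket L y z \<and>
        lie_bracket L z (x + y) = lie_bracket L z x + lie_bracket L z y) \<and>
     (\<forall>c. \<forall>x\<in>lie_carrier L. \<forall>y\<in>lie_carrier L.
        lie_bracket L (lie_scale L c x) y = lie_scale L c (lie_bracket L x y) \<and>
        lie_bracket L x (lie_scale L c y) = lie_scale L c (lie_bracket L x y)) \<and>
     (\<forall>x\<in>lie_carrier L. lie_bracket L x x = 0) \<and>
     (\<forall>x\<in>lie_carrier L. \<forall>y\<in>lie_carrier L. \<forall>z\<in>lie_carrier L.
        lie_bracket L x (lie_bracket L y z) + lie_bracket L y (lie_bracket L z x)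
          + lie_bracket L z (lie_bracket L x y) = 0)"

definition lie_iso ::
    "('g \<Rightarrow> 'h) \<Rightarrow> ('k::field, 'g::ab_group_add) lie_alg \<Rightarrow> ('k, 'h::ab_group_add) lie_alg \<Rightarrow> bool" where
  "lie_iso \<phi> L M \<longleftrightarrow>
     bij_betw \<phi> (lie_carrier L) (lie_carrier M) \<and>
     (\<forall>x\<in>lie_carrier L. \<forall>y\<in>lie_carrier L. \<phi> (x + y) = \<phi> x + \<phi> y) \<and>
     (\<forall>c. \<forall>x\<in>lie_carrier L. \<phi> (lie_scale L c x) = lie_scale M c (\<phi> x)) \<and>
     (\<forall>x\<in>lie_carrier L. \<forall>y\<in>lie_carrier L.
        \<phi> (lie_bracket L x y) = lie_bracket M (\<phi> x) (\<phi> y))"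

definition lie_isomorphic ::
    "('k::field, 'g::ab_group_add) lie_alg \<Rightarrow> ('k, 'h::ab_group_add) lie_alg \<Rightarrow> bool" where
  "lie_isomorphic L M \<longleftrightarrow> (\<exists>\<phi>. lie_iso \<phi> L M)"

definition lie_sum ::
    "('k::field, 'g::ab_group_add) lie_alg \<Rightarrow> ('k, 'h::ab_group_add) lie_alg \<Rightarrow> ('k, 'g \<times> 'h) lie_alg" where
  "lie_sum L M =
     \<lparr>lie_carrier = lie_carrier L \<times> lie_carrier M,
      lie_scale = module_prod.scale (lie_scale L) (lie_scale M),
      lie_bracket = (\<lambda>(x, x') (y, y'). (lie_bracket L x y, lie_bracket M x' y'))\<rparr>"

definition lie_line :: "('k::field, 'k) lie_alg" where
  "lie_line = \<lparr>lie_carrier = UNIV, lie_scale = (*), lie_bracket = (\<lambda>x y. 0)\<rparr>"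


section \<open>Involutions and commuting varieties\<close>

definition lie_involution :: "('k::field, 'g::ab_group_add) lie_alg \<Rightarrow> ('g \<Rightarrow> 'g) \<Rightarrow> bool" where
  "lie_involution L \<sigma> \<longleftrightarrow>
     lie_iso \<sigma> L L \<and> (\<forall>x\<in>lie_carrier L. \<sigma> (\<sigma> x) = x) \<and> (\<exists>x\<in>lie_carrier L. \<sigma> x \<noteq> x)"

definition fixed_subalgebra ::
    "('k::field, 'g::ab_group_add) lie_alg \<Rightarrow> ('g \<Rightarrow> 'g) \<Rightarrow> ('k, 'g) lie_alg" where
  "fixed_subalgebra L \<sigma> = L\<lparr>lie_carrier := {x \<in> lie_carrier L. \<sigma> x = x}\<rparr>"

definition minus_eigenspace ::
    "('k::field, 'g::ab_group_add) lie_alg \<Rightarrow> ('g \<Rightarrow> 'g) \<Rightarrow> 'g set" where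
  "minus_eigenspace L \<sigma> = {x \<in> lie_carrier L. \<sigma> x = - x}"

definition commuting_variety ::
    "('k::field, 'g::ab_group_add) lie_alg \<Rightarrow> ('g \<Rightarrow> 'g) \<Rightarrow> ('g \<times> 'g) set" where
  "commuting_variety L \<sigma> =
     {(x, y). x \<in> minus_eigenspace L \<sigma> \<and> y \<in> minus_eigenspace L \<sigma> \<and> lie_bracket L x y = 0}"


section \<open>The Zariski topology\<close>

text \<open>
  Polynomial functions on a vector space, without choosing coordinates: the algebra of functions
  generated by the constants and the linear functionals.
\<close>

inductive_set polynomial_maps :: "('k::field \<Rightarrow> 'v::ab_group_add \<Rightarrow> 'v) \<Rightarrow> ('v \<Rightarrow> 'k) set"
  for s :: "'k \<Rightarrow> 'v \<Rightarrow> 'v" where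
  const: "(\<lambda>v. c) \<in> polynomial_maps s"
| linear: "Vector_Spaces.linear s (*) f \<Longrightarrow> f \<in> polynomial_maps s"
| add: "p \<in> polynomial_maps s \<Longrightarrow> q \<in> polynomial_maps s \<Longrightarrow> (\<lambda>v. p v + q v) \<in> polynomial_maps s"
| mult: "p \<in> polynomial_maps s \<Longrightarrow> q \<in> polynomial_maps s \<Longrightarrow> (\<lambda>v. p v * q v) \<in> polynomial_maps s"

definition zariski :: "('k::field \<Rightarrow> 'v::ab_group_add \<Rightarrow> 'v) \<Rightarrow> 'v topology" where
  "zariski s = topology (\<lambda>U. \<exists>P\<subseteq>polynomial_maps s. U = {v. \<exists>p\<in>P. p v \<noteq> 0})"

lemma istopology_zariski:
  fixes s :: "'k::field \<Rightarrow> 'v::ab_group_add \<Rightarrow> 'v"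
  shows "istopology (\<lambda>U. \<exists>P\<subseteq>polynomial_maps s. U = {v. \<exists>p\<in>P. p v \<noteq> 0})"
    (is "istopology ?op")
  unfolding istopology_def
proof (intro conjI allI impI)
  fix S T assume "?op S" "?op T"
  then obtain P Q where P: "P \<subseteq> polynomial_maps s" "S = {v. \<exists>p\<in>P. p v \<noteq> 0}"
    and Q: "Q \<subseteq> polynomial_maps s" "T = {v. \<exists>p\<in>Q. p v \<noteq> 0}"
    by blast
  let ?R = "(\<lambda>(p, q) v. p v * q v) ` (P \<times> Q)"
  have "?R \<subseteq> polynomial_maps s"
    using P(1) Q(1) by (auto intro!: polynomial_maps.mult)
  moreover have "S \<inter> T = {v. \<exists>r\<in>?R. r v \<noteq> 0}"
    unfolding P(2) Q(2) by (simp add: set_eq_iff split: prod.splits)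
  ultimately show "?op (S \<inter> T)" by blast
next
  fix \<K> assume "\<forall>K\<in>\<K>. ?op K"
  from bchoice[OF this]
  obtain F where F: "\<forall>K\<in>\<K>. F K \<subseteq> polynomial_maps s \<and> K = {v. \<exists>p\<in>F K. p v \<noteq> 0}" ..
  have F1: "F K \<subseteq> polynomial_maps s" if "K \<in> \<K>" for K
    using bspec[OF F that] by (rule conjunct1)
  have F2: "v \<in> K \<longleftrightarrow> (\<exists>p\<in>F K. p v \<noteq> 0)" if "K \<in> \<K>" for v K
  proof -
    have "K = {v. \<exists>p\<in>F K. p v \<noteq> 0}" using bspec[OF F that] by (rule conjunct2)
    then have "v \<in> K \<longleftrightarrow> v \<in> {v. \<exists>p\<in>F K. p v \<noteq> 0}" by (rule arg_cong)
    then show ?thesis by (simp only: mem_Collect_eq)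
  qed
  have "(\<Union>K\<in>\<K>. F K) \<subseteq> polynomial_maps s" using F1 by (rule UN_least)
  moreover have "\<Union>\<K> = {v. \<exists>p\<in>(\<Union>K\<in>\<K>. F K). p v \<noteq> 0}"
    by (simp add: set_eq_iff F2)
  ultimately show "?op (\<Union>\<K>)" by (intro exI conjI)
qed

lemma openin_zariski:
  "openin (zariski s) U \<longleftrightarrow> (\<exists>P\<subseteq>polynomial_maps s. U = {v. \<exists>p\<in>P. p v \<noteq> 0})"
  unfolding zariski_def by (simp add: topology_inverse'[OF istopology_zariski])

lemma topspace_zariski [simp]: "topspace (zariski s) = UNIV"
proof -
  have "openin (zariski s) UNIV"
    unfolding openin_zariski
    by (rule exI[of _ "{\<lambda>v. 1}"]) (auto intro: polynomial_maps.const)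
  then show ?thesis by (meson openin_subset top.extremum_uniqueI)
qed

lemma closedin_zariski:
  fixes s :: "'k::field \<Rightarrow> 'v::ab_group_add \<Rightarrow> 'v"
  shows "closedin (zariski s) Z \<longleftrightarrow> (\<exists>P\<subseteq>polynomial_maps s. Z = {v. \<forall>p\<in>P. p v = 0})"
proof -
  have "UNIV - Z = {v. \<exists>p\<in>P. p v \<noteq> 0} \<longleftrightarrow> Z = {v. \<forall>p\<in>P. p v = 0}" for P :: "('v \<Rightarrow> 'k) set"
    by auto
  then show ?thesis by (simp add: closedin_def openin_zariski)
qed

definition irreducible_space :: "'a topology \<Rightarrow> bool" where
  "irreducible_space T \<longleftrightarrow>
     topspace T \<noteq> {} \<and>
     (\<forall>A B. closedin T A \<and> closedin T B \<and> A \<union> B = topspace T \<longrightarrow> A = topspace T \<or> B = topspace T)"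

definition zariski_reducible :: "('k::field \<Rightarrow> 'v::ab_group_add \<Rightarrow> 'v) \<Rightarrow> 'v set \<Rightarrow> bool" where
  "zariski_reducible s X \<longleftrightarrow> \<not> irreducible_space (subtopology (zariski s) X)"

definition commuting_variety_reducible ::
    "('k::field, 'g::ab_group_add) lie_alg \<Rightarrow> ('g \<Rightarrow> 'g) \<Rightarrow> bool" where
  "commuting_variety_reducible L \<sigma> \<longleftrightarrow>
     zariski_reducible (module_prod.scale (lie_scale L) (lie_scale L)) (commuting_variety L \<sigma>)"


section \<open>Matrix Lie algebras\<close>

definition matrix_scale :: "'k::field \<Rightarrow> 'k^'n^'n \<Rightarrow> 'k^'n^'n" where
  "matrix_scale c M = (\<chi> i j. c * M $ i $ j)"

definition gl :: "('k::field, 'k^'n::finite^'n) lie_alg" where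
  "gl = \<lparr>lie_carrier = UNIV, lie_scale = matrix_scale, lie_bracket = (\<lambda>M N. M ** N - N ** M)\<rparr>"

text \<open>The orthogonal Lie algebra of the symmetric bilinear form with Gram matrix \<open>B\<close>.\<close>

definition so_form :: "'k::field^'n::finite^'n \<Rightarrow> ('k, 'k^'n^'n) lie_alg" where
  "so_form B = gl\<lparr>lie_carrier := {M. transpose M ** B + B ** M = 0}\<rparr>"

text \<open>
  For the index type \<open>'n + 'm\<close> the space of column vectors is the direct sum of the span of the
  \<open>Inl\<close> basis vectors and the span of the \<open>Inr\<close> basis vectors. The hyperbolic form makes the two
  summands isotropic and dual to each other.
\<close>

definition hyperbolic_form :: "'k::field^('n::finite + 'n)^('n + 'n)" where
  "hyperbolic_form = (\<chi> i j. case (i, j) of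
     (Inl a, Inr b) \<Rightarrow> (if a = b then 1 else 0)
   | (Inr a, Inl b) \<Rightarrow> (if a = b then 1 else 0)
   | _ \<Rightarrow> 0)"

definition so_even :: "('k::field, 'k^('n::finite + 'n)^('n + 'n)) lie_alg" where
  "so_even = so_form hyperbolic_form"

definition two_block_diag :: "'k::field \<Rightarrow> 'k \<Rightarrow> 'k^('n::finite + 'm::finite)^('n + 'm)" where
  "two_block_diag a b = (\<chi> i j. if i = j then (case i of Inl _ \<Rightarrow> a | Inr _ \<Rightarrow> b) else 0)"

definition conjugation :: "'k::field^'n::finite^'n \<Rightarrow> 'k^'n^'n \<Rightarrow> 'k^'n^'n" where
  "conjugation A M = A ** M ** matrix_inv A"

definition sigma_gl :: "'k::field^('n::finite + 'm::finite)^('n + 'm) \<Rightarrow> 'k^('n + 'm)^('n + 'm)" where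
  "sigma_gl = conjugation (two_block_diag (- 1) 1)"

definition sigma_so :: "'k::field^('n::finite + 'n)^('n + 'n) \<Rightarrow> 'k^('n + 'n)^('n + 'n)" where
  "sigma_so = conjugation (two_block_diag 1 (- 1))"


section \<open>The simple Lie algebra of type E6\<close>

definition lie_finite_dim :: "('k::field, 'g::ab_group_add) lie_alg \<Rightarrow> bool" where
  "lie_finite_dim L \<longleftrightarrow> (\<exists>B. finite B \<and> lie_carrier L = module.span (lie_scale L) B)"

definition lie_ideal :: "('k::field, 'g::ab_group_add) lie_alg \<Rightarrow> 'g set \<Rightarrow> bool" where
  "lie_ideal L I \<longleftrightarrow>
     I \<subseteq> lie_carrier L \<and> module.subspace (lie_scale L) I \<and>
     (\<forall>x\<in>lie_carrier L. \<forall>y\<in>I. lie_bracket L x y \<in> I)"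

definition lie_simple :: "('k::field, 'g::ab_group_add) lie_alg \<Rightarrow> bool" where
  "lie_simple L \<longleftrightarrow>
     (\<exists>x\<in>lie_carrier L. \<exists>y\<in>lie_carrier L. lie_bracket L x y \<noteq> 0) \<and>
     (\<forall>I. lie_ideal L I \<longrightarrow> I = {0} \<or> I = lie_carrier L)"

definition lie_subalgebra :: "('k::field, 'g::ab_group_add) lie_alg \<Rightarrow> 'g set \<Rightarrow> bool" where
  "lie_subalgebra L H \<longleftrightarrow>
     H \<subseteq> lie_carrier L \<and> module.subspace (lie_scale L) H \<and>
     (\<forall>x\<in>H. \<forall>y\<in>H. lie_bracket L x y \<in> H)"

text \<open>Over an algebraically closed field, semisimple means diagonalizable.\<close>

definition ad_semisimple :: "('k::field, 'g::ab_group_add) lie_alg \<Rightarrow> 'g \<Rightarrow> bool" where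
  "ad_semisimple L x \<longleftrightarrow>
     lie_carrier L \<subseteq>
       module.span (lie_scale L) {v \<in> lie_carrier L. \<exists>c. lie_bracket L x v = lie_scale L c v}"

definition toral_subalgebra :: "('k::field, 'g::ab_group_add) lie_alg \<Rightarrow> 'g set \<Rightarrow> bool" where
  "toral_subalgebra L H \<longleftrightarrow> lie_subalgebra L H \<and> (\<forall>x\<in>H. ad_semisimple L x)"

definition maximal_toral_subalgebra :: "('k::field, 'g::ab_group_add) lie_alg \<Rightarrow> 'g set \<Rightarrow> bool" where
  "maximal_toral_subalgebra L H \<longleftrightarrow>
     toral_subalgebra L H \<and> (\<forall>H'. toral_subalgebra L H' \<and> H \<subseteq> H' \<longrightarrow> H' = H)"

text \<open>
  An element of the dual of \<open>H\<close> is represented by any linear functional on the ambient space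
  restricting to it; all notions below depend only on the restriction to \<open>H\<close>.
\<close>

definition root_space ::
    "('k::field, 'g::ab_group_add) lie_alg \<Rightarrow> 'g set \<Rightarrow> ('g \<Rightarrow> 'k) \<Rightarrow> 'g set" where
  "root_space L H \<alpha> = {x \<in> lie_carrier L. \<forall>h\<in>H. lie_bracket L h x = lie_scale L (\<alpha> h) x}"

definition is_root ::
    "('k::field, 'g::ab_group_add) lie_alg \<Rightarrow> 'g set \<Rightarrow> ('g \<Rightarrow> 'k) \<Rightarrow> bool" where
  "is_root L H \<alpha> \<longleftrightarrow>
     Vector_Spaces.linear (lie_scale L) (*) \<alpha> \<and> (\<exists>h\<in>H. \<alpha> h \<noteq> 0) \<and> root_space L H \<alpha> \<noteq> {0}"

definition is_coroot ::
    "('k::field, 'g::ab_group_add) lie_alg \<Rightarrow> 'g set \<Rightarrow> ('g \<Rightarrow> 'k) \<Rightarrow> 'g \<Rightarrow> bool" where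
  "is_coroot L H \<alpha> h \<longleftrightarrow>
     h \<in> H \<and>
     h \<in> module.span (lie_scale L)
          {lie_bracket L x y | x y. x \<in> root_space L H \<alpha> \<and> y \<in> root_space L H (\<lambda>t. - \<alpha> t)} \<and>
     \<alpha> h = 2"

definition is_root_base ::
    "('k::field, 'g::ab_group_add) lie_alg \<Rightarrow> 'g set \<Rightarrow> 'i set \<Rightarrow> ('i \<Rightarrow> 'g \<Rightarrow> 'k) \<Rightarrow> bool" where
  "is_root_base L H I \<alpha> \<longleftrightarrow>
     finite I \<and> (\<forall>i\<in>I. is_root L H (\<alpha> i)) \<and>
     (\<forall>c :: 'i \<Rightarrow> 'k. (\<forall>h\<in>H. (\<Sum>i\<in>I. c i * \<alpha> i h) = 0) \<longrightarrow> (\<forall>i\<in>I. c i = 0)) \<and>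
     (\<forall>\<beta>. is_root L H \<beta> \<longrightarrow>
        (\<exists>m :: 'i \<Rightarrow> nat.
           (\<forall>h\<in>H. \<beta> h = (\<Sum>i\<in>I. of_nat (m i) * \<alpha> i h)) \<or>
           (\<forall>h\<in>H. \<beta> h = - (\<Sum>i\<in>I. of_nat (m i) * \<alpha> i h))))"

text \<open>
  The Dynkin diagram in Bourbaki's labelling: the path 1--3--4--5--6 with node 2 attached to node 4.
\<close>

definition E6_cartan_matrix :: "nat \<Rightarrow> nat \<Rightarrow> int" where
  "E6_cartan_matrix i j =
     (if i = j then 2
      else if {i, j} \<in> {{1, 3}, {3, 4}, {4, 5}, {5, 6}, {2, 4}} then - 1
      else 0)"

definition simple_of_type_E6 :: "('k::field, 'g::ab_group_add) lie_alg \<Rightarrow> bool" where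
  "simple_of_type_E6 L \<longleftrightarrow>
     lie_algebra L \<and> lie_finite_dim L \<and> lie_simple L \<and>
     (\<exists>H (\<alpha> :: nat \<Rightarrow> 'g \<Rightarrow> 'k).
        maximal_toral_subalgebra L H \<and> is_root_base L H {1..6} \<alpha> \<and>
        (\<forall>j\<in>{1..6}. \<exists>h. is_coroot L H (\<alpha> j) h \<and>
           (\<forall>i\<in>{1..6}. \<alpha> i h = of_int (E6_cartan_matrix i j))))"

definition so10_plus_line :: "('k::field, ('k^(5 + 5)^(5 + 5)) \<times> 'k) lie_alg" where
  "so10_plus_line = lie_sum so_even lie_line"


section \<open>The matrix pairs are symmetric pairs\<close>

lemma vector_space_matrix_scale: "vector_space (matrix_scale :: 'k::field \<Rightarrow> 'k^'n^'n \<Rightarrow> 'k^'n^'n)"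
  by unfold_locales (simp_all add: matrix_scale_def vec_eq_iff algebra_simps)

lemma lie_algebra_gl: "lie_algebra (gl :: ('k::field, 'k^'n::finite^'n) lie_alg)"
proof -
  interpret vector_space "matrix_scale :: 'k \<Rightarrow> 'k^'n^'n \<Rightarrow> 'k^'n^'n"
    by (rule vector_space_matrix_scale)
  have left: "matrix_scale c M ** N = matrix_scale c (M ** N)"
    and right: "M ** matrix_scale c N = matrix_scale c (M ** N)" for c and M N :: "'k^'n^'n"
    by (simp_all add: matrix_scale_def matrix_matrix_mult_def vec_eq_iff sum_distrib_left mult_ac)
  have al: "(A + B) ** C = A ** C + B ** C" and ar: "C ** (A + B) = C ** A + C ** B"
    and dl: "(A - B) ** C = A ** C - B ** C" and dr: "C ** (A - B) = C ** A - C ** B"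
    for A B C :: "'k^'n^'n"
    by (simp_all add: matrix_matrix_mult_def vec_eq_iff sum.distrib sum_subtractf algebra_simps)
  show ?thesis
    unfolding lie_algebra_def gl_def
    by (simp add: vector_space_axioms left right scale_right_diff_distrib dl dr
        al ar matrix_mul_assoc)
qed

lemma lie_algebra_so_form:
  fixes B :: "'k::field^'n::finite^'n"
  shows "lie_algebra (so_form B)"
proof -
  let ?S = "{M :: 'k^'n^'n. transpose M ** B + B ** M = 0}"
  interpret vector_space "matrix_scale :: 'k \<Rightarrow> 'k^'n^'n \<Rightarrow> 'k^'n^'n"
    by (rule vector_space_matrix_scale)
  have left: "matrix_scale c M ** N = matrix_scale c (M ** N)"
    and right: "M ** matrix_scale c N = matrix_scale c (M ** N)"
    and tr: "transpose (matrix_scale c M) = matrix_scale c (transpose M)"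
    and trp: "transpose (M + N) = transpose M + transpose N"
    and trm: "transpose (M - N) = transpose M - transpose N" for c and M N :: "'k^'n^'n"
    by (simp_all add: matrix_scale_def matrix_matrix_mult_def transpose_def vec_eq_iff
        sum_distrib_left mult_ac)
  have al: "(A + B) ** C = A ** C + B ** C" and ar: "C ** (A + B) = C ** A + C ** B"
    and dl: "(A - B) ** C = A ** C - B ** C" and dr: "C ** (A - B) = C ** A - C ** B"
    and ul: "(- A) ** C = - (A ** C)" and ur: "C ** (- A) = - (C ** A)"
    for A B C :: "'k^'n^'n"
    by (simp_all add: matrix_matrix_mult_def vec_eq_iff sum.distrib sum_subtractf sum_negf algebra_simps)
  have "subspace ?S"
  proof (rule subspaceI)
    show "0 \<in> ?S" by (simp add: transpose_def matrix_matrix_mult_def vec_eq_iff)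
  next
    fix M N assume "M \<in> ?S" "N \<in> ?S"
    then have "(transpose M ** B + B ** M) + (transpose N ** B + B ** N) = 0" by simp
    then show "M + N \<in> ?S"
      by (simp add: trp al ar add_ac)
  next
    fix c M assume "M \<in> ?S"
    then show "matrix_scale c M \<in> ?S"
      by (simp add: tr left right scale_right_distrib[symmetric])
  qed
  moreover have "M ** N - N ** M \<in> ?S" if "M \<in> ?S" "N \<in> ?S" for M N
  proof -
    have M: "transpose M ** B = - (B ** M)" and N: "transpose N ** B = - (B ** N)"
      using that by (simp_all add: eq_neg_iff_add_eq_0)
    have "transpose N ** (transpose M ** B) = B ** N ** M"
      by (simp add: M ur N ul matrix_mul_assoc)
    moreover have "transpose M ** (transpose N ** B) = B ** M ** N"
      by (simp add: N ur M ul matrix_mul_assoc)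
    ultimately show ?thesis
      by (simp add: trm matrix_transpose_mul dl dr matrix_mul_assoc)
  qed
  ultimately show ?thesis
    using lie_algebra_gl[where 'k='k and 'n='n]
    unfolding lie_algebra_def so_form_def gl_def by simp
qed

lemma two_block_diag_mult:
  "(two_block_diag a b ** M) $ i $ j = (case i of Inl _ \<Rightarrow> a | Inr _ \<Rightarrow> b) * M $ i $ j"
  by (cases i) (simp_all add: two_block_diag_def matrix_matrix_mult_def mult_delta_left)

lemma mult_two_block_diag:
  "(M ** two_block_diag a b) $ i $ j = M $ i $ j * (case j of Inl _ \<Rightarrow> a | Inr _ \<Rightarrow> b)"
  by (cases j) (simp_all add: two_block_diag_def matrix_matrix_mult_def mult_delta_right cong: if_cong)

lemma matrix_inv_two_block_diag:
  fixes a b :: "'k::field"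
  assumes "a * a = 1" "b * b = 1"
  shows "matrix_inv (two_block_diag a b :: 'k^('n::finite + 'm::finite)^('n + 'm)) = two_block_diag a b"
proof -
  let ?A = "two_block_diag a b :: 'k^('n + 'm)^('n + 'm)"
  have "(?A ** ?A) $ i $ j = mat 1 $ i $ j" for i j
  proof (cases "i = j")
    case True
    then show ?thesis
      unfolding two_block_diag_mult
      by (simp add: two_block_diag_def mat_def assms split: sum.split)
  next
    case False
    then show ?thesis
      unfolding two_block_diag_mult by (simp add: two_block_diag_def mat_def)
  qed
  then have AA: "?A ** ?A = mat 1" by (simp add: vec_eq_iff)
  then have inv: "?A ** matrix_inv ?A = mat 1 \<and> matrix_inv ?A ** ?A = mat 1"
    unfolding matrix_inv_def
    using someI[of "\<lambda>A'. ?A ** A' = mat 1 \<and> A' ** ?A = mat 1" ?A] by simp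
  have "matrix_inv ?A = matrix_inv ?A ** (?A ** ?A)" by (simp only: AA matrix_mul_rid)
  also have "\<dots> = ?A" using inv by (simp only: matrix_mul_assoc matrix_mul_lid)
  finally show ?thesis .
qed

lemma conjugation_two_block_diag:
  fixes M :: "'k::field^('n::finite + 'm::finite)^('n + 'm)"
  assumes "a * a = 1" "b * b = 1"
  shows "conjugation (two_block_diag a b) M $ i $ j =
    (case i of Inl _ \<Rightarrow> a | Inr _ \<Rightarrow> b) * M $ i $ j * (case j of Inl _ \<Rightarrow> a | Inr _ \<Rightarrow> b)"
  unfolding conjugation_def matrix_inv_two_block_diag[OF assms]
  by (simp only: mult_two_block_diag two_block_diag_mult)

lemma sigma_gl_entry:
  fixes M :: "'k::field^('n::finite + 'm::finite)^('n + 'm)"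
  shows "sigma_gl M $ i $ j = (if isl i = isl j then M $ i $ j else - M $ i $ j)"
  by (simp add: sigma_gl_def conjugation_two_block_diag split: sum.split)

lemma sigma_so_entry:
  fixes M :: "'k::field^('n::finite + 'n)^('n + 'n)"
  shows "sigma_so M $ i $ j = (if isl i = isl j then M $ i $ j else - M $ i $ j)"
  by (simp add: sigma_so_def conjugation_two_block_diag split: sum.split)

lemma sum_UNIV_Plus:
  fixes f :: "'n::finite + 'm::finite \<Rightarrow> 'k::comm_monoid_add"
  shows "(\<Sum>i\<in>UNIV. f i) = (\<Sum>i\<in>UNIV. f (Inl i)) + (\<Sum>i\<in>UNIV. f (Inr i))"
  by (subst UNIV_Plus_UNIV[symmetric], subst sum.Plus) (simp_all add: comp_def)

lemma split_sum_all_UNIV: "(\<forall>i :: 'n + 'm. P i) \<longleftrightarrow> (\<forall>i. P (Inl i)) \<and> (\<forall>i. P (Inr i))"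
  by (metis sum.exhaust)

lemma in_so_even_iff:
  fixes M :: "'k::field^('n::finite + 'n)^('n + 'n)"
  shows "M \<in> lie_carrier so_even \<longleftrightarrow>
    (\<forall>i j. M $ Inl i $ Inl j = - M $ Inr j $ Inr i \<and>
           M $ Inl i $ Inr j = - M $ Inl j $ Inr i \<and>
           M $ Inr i $ Inl j = - M $ Inr j $ Inl i)"
proof -
  have "M \<in> lie_carrier so_even \<longleftrightarrow>
    (\<forall>i j. M $ Inr j $ Inl i + M $ Inr i $ Inl j = 0) \<and>
    (\<forall>i j. M $ Inl j $ Inl i + M $ Inr i $ Inr j = 0) \<and>
    (\<forall>i j. M $ Inr j $ Inr i + M $ Inl i $ Inl j = 0) \<and>
    (\<forall>i j. M $ Inl j $ Inr i + M $ Inl i $ Inr j = 0)"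
    by (simp add: so_even_def so_form_def hyperbolic_form_def vec_eq_iff matrix_matrix_mult_def
        transpose_def sum_UNIV_Plus split_sum_all_UNIV mult_delta_left mult_delta_right all_conj_distrib)
  also have "\<dots> \<longleftrightarrow> (\<forall>i j. M $ Inl i $ Inl j = - M $ Inr j $ Inr i \<and>
           M $ Inl i $ Inr j = - M $ Inl j $ Inr i \<and>
           M $ Inr i $ Inl j = - M $ Inr j $ Inl i)"
    by (simp add: eq_neg_iff_add_eq_0 all_conj_distrib) (metis add.commute)
  finally show ?thesis .
qed

lemma minus_eigenspace_gl:
  "minus_eigenspace gl (sigma_gl :: 'k::field_char_0^('n::finite + 'm::finite)^('n + 'm) \<Rightarrow> _) =
     {M. (\<forall>i j. M $ Inl i $ Inl j = 0) \<and> (\<forall>i j. M $ Inr i $ Inr j = 0)}"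
  by (simp add: minus_eigenspace_def gl_def vec_eq_iff sigma_gl_entry split_sum_all_UNIV
      eq_neg_iff_add_eq_0 all_conj_distrib flip: mult_2)

lemma minus_eigenspace_so:
  "minus_eigenspace so_even (sigma_so :: 'k::field_char_0^('n::finite + 'n)^('n + 'n) \<Rightarrow> _) =
     {M. (\<forall>i j. M $ Inl i $ Inl j = 0) \<and> (\<forall>i j. M $ Inr i $ Inr j = 0) \<and>
         (\<forall>i j. M $ Inl i $ Inr j = - M $ Inl j $ Inr i) \<and>
         (\<forall>i j. M $ Inr i $ Inl j = - M $ Inr j $ Inl i)}"
  unfolding minus_eigenspace_def in_so_even_iff
  by (simp add: vec_eq_iff sigma_so_entry split_sum_all_UNIV
      eq_neg_iff_add_eq_0 all_conj_distrib flip: mult_2) auto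

lemma lie_involution_gl:
  "lie_involution gl (sigma_gl :: 'k::field_char_0^('n::finite + 'm::finite)^('n + 'm) \<Rightarrow> _)"
proof -
  let ?s = "sigma_gl :: 'k^('n + 'm)^('n + 'm) \<Rightarrow> _"
  have inv: "?s (?s M) = M" for M
    by (simp add: vec_eq_iff sigma_gl_entry)
  have mult: "?s (M ** N) = ?s M ** ?s N" for M N
    by (simp add: vec_eq_iff sigma_gl_entry matrix_matrix_mult_def sum_UNIV_Plus
        split_sum_all_UNIV sum_negf)
  let ?E = "(\<chi> i j. if isl i = isl j then 0 else 1) :: 'k^('n + 'm)^('n + 'm)"
  have "?s ?E $ Inl undefined $ Inr undefined \<noteq> ?E $ Inl undefined $ Inr undefined"
    by (simp add: sigma_gl_entry)
  then have "\<exists>M. ?s M \<noteq> M" by metis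
  moreover have "bij ?s" using inv by (metis bij_iff)
  moreover have "?s (M ** N - N ** M) = ?s M ** ?s N - ?s N ** ?s M" for M N
    by (subst (1 2) mult[symmetric]) (simp add: vec_eq_iff sigma_gl_entry)
  ultimately show ?thesis
    unfolding lie_involution_def lie_iso_def gl_def
    by (simp add: inv) (simp add: vec_eq_iff sigma_gl_entry matrix_scale_def)
qed

lemma lie_involution_so:
  assumes "CARD('n::finite) \<ge> 2"
  shows "lie_involution so_even (sigma_so :: 'k::field_char_0^('n + 'n)^('n + 'n) \<Rightarrow> _)"
proof -
  let ?s = "sigma_so :: 'k^('n + 'n)^('n + 'n) \<Rightarrow> _"
  have inv: "?s (?s M) = M" for M
    by (simp add: vec_eq_iff sigma_so_entry)
  have mult: "?s (M ** N) = ?s M ** ?s N" for M N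
    by (simp add: vec_eq_iff sigma_so_entry matrix_matrix_mult_def sum_UNIV_Plus
        split_sum_all_UNIV sum_negf)
  have closed: "?s M \<in> lie_carrier so_even" if "M \<in> lie_carrier so_even" for M
  proof -
    have M: "M $ Inl i $ Inl j = - M $ Inr j $ Inr i" "- M $ Inl i $ Inr j = M $ Inl j $ Inr i"
      "- M $ Inr i $ Inl j = M $ Inr j $ Inl i" for i j
      using that unfolding in_so_even_iff by metis+
    show ?thesis
      unfolding in_so_even_iff by (intro allI conjI; simp add: sigma_so_entry; rule M)
  qed
  obtain a b :: 'n where ab: "a \<noteq> b"
    using assms card_le_Suc0_iff_eq[of "UNIV :: 'n set"] by auto
  define E :: "'k^('n + 'n)^('n + 'n)" where "E = (\<chi> i j.
     if i = Inl a \<and> j = Inr b then 1 else if i = Inl b \<and> j = Inr a then - 1 else 0)"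
  have "E \<in> lie_carrier so_even"
    using ab by (auto simp: in_so_even_iff E_def)
  moreover have "?s E $ Inl a $ Inr b \<noteq> E $ Inl a $ Inr b"
    by (simp add: sigma_so_entry E_def)
  ultimately have "\<exists>M\<in>lie_carrier so_even. ?s M \<noteq> M" by metis
  moreover have "bij_betw ?s (lie_carrier so_even) (lie_carrier so_even)"
    by (rule bij_betw_byWitness[of _ ?s]) (auto simp: inv closed)
  moreover have "?s (M ** N - N ** M) = ?s M ** ?s N - ?s N ** ?s M" for M N
    by (subst (1 2) mult[symmetric]) (simp add: vec_eq_iff sigma_so_entry)
  moreover have "?s (M + N) = ?s M + ?s N" "?s (matrix_scale c M) = matrix_scale c (?s M)" for c M N
    by (simp_all add: vec_eq_iff sigma_so_entry matrix_scale_def)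
  ultimately show ?thesis
    unfolding lie_involution_def lie_iso_def
    by (simp add: inv) (simp add: so_even_def so_form_def gl_def)
qed

lemma fixed_subalgebra_gl:
  "lie_isomorphic
     (fixed_subalgebra gl (sigma_gl :: 'k::field_char_0^('n::finite + 'm::finite)^('n + 'm) \<Rightarrow> _))
     (lie_sum (gl :: ('k, 'k^'n^'n) lie_alg) (gl :: ('k, 'k^'m^'m) lie_alg))"
proof -
  let ?F = "{M :: 'k^('n + 'm)^('n + 'm).
              (\<forall>i j. M $ Inl i $ Inr j = 0) \<and> (\<forall>i j. M $ Inr i $ Inl j = 0)}"
  let ?\<phi> = "\<lambda>M :: 'k^('n + 'm)^('n + 'm).
     ((\<chi> i j. M $ Inl i $ Inl j) :: 'k^'n^'n, (\<chi> i j. M $ Inr i $ Inr j) :: 'k^'m^'m)"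
  let ?\<psi> = "\<lambda>(X :: 'k^'n^'n, Y :: 'k^'m^'m). (\<chi> i j. case (i, j) of
     (Inl a, Inl b) \<Rightarrow> X $ a $ b | (Inr a, Inr b) \<Rightarrow> Y $ a $ b | _ \<Rightarrow> 0) :: 'k^('n + 'm)^('n + 'm)"
  have scale: "module_prod.scale (matrix_scale :: 'k \<Rightarrow> 'k^'n^'n \<Rightarrow> _) (matrix_scale :: 'k \<Rightarrow> 'k^'m^'m \<Rightarrow> _) c p
      = (matrix_scale c (fst p), matrix_scale c (snd p))" for c p
  proof -
    interpret vector_space_pair "matrix_scale :: 'k \<Rightarrow> 'k^'n^'n \<Rightarrow> _" "matrix_scale :: 'k \<Rightarrow> 'k^'m^'m \<Rightarrow> _"
      by (intro vector_space_pair.intro vector_space_matrix_scale)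
    interpret vector_space_prod "matrix_scale :: 'k \<Rightarrow> 'k^'n^'n \<Rightarrow> _" "matrix_scale :: 'k \<Rightarrow> 'k^'m^'m \<Rightarrow> _" ..
    show ?thesis by (rule scale_def)
  qed
  have F: "lie_carrier (fixed_subalgebra gl (sigma_gl :: 'k^('n + 'm)^('n + 'm) \<Rightarrow> _)) = ?F"
    by (simp add: fixed_subalgebra_def gl_def vec_eq_iff sigma_gl_entry split_sum_all_UNIV
        all_conj_distrib)
  have "bij_betw ?\<phi> ?F UNIV"
    by (rule bij_betw_byWitness[of _ ?\<psi>])
      (auto simp: vec_eq_iff split_sum_all_UNIV)
  then have "lie_iso ?\<phi> (fixed_subalgebra gl sigma_gl) (lie_sum gl gl)"
    unfolding lie_iso_def F
    by (auto simp: fixed_subalgebra_def lie_sum_def gl_def scale matrix_scale_def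
        matrix_matrix_mult_def sum_UNIV_Plus vec_eq_iff)
  then show ?thesis unfolding lie_isomorphic_def by blast
qed

lemma fixed_subalgebra_so:
  "lie_isomorphic
     (fixed_subalgebra so_even (sigma_so :: 'k::field_char_0^('n::finite + 'n)^('n + 'n) \<Rightarrow> _))
     (gl :: ('k, 'k^'n^'n) lie_alg)"
proof -
  let ?F = "{M :: 'k^('n + 'n)^('n + 'n).
              (\<forall>i j. M $ Inl i $ Inr j = 0) \<and> (\<forall>i j. M $ Inr i $ Inl j = 0) \<and>
              (\<forall>i j. M $ Inr i $ Inr j = - M $ Inl j $ Inl i)}"
  let ?\<phi> = "\<lambda>M :: 'k^('n + 'n)^('n + 'n). (\<chi> i j. M $ Inl i $ Inl j) :: 'k^'n^'n"
  let ?\<psi> = "\<lambda>X :: 'k^'n^'n. (\<chi> i j. case (i, j) of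
     (Inl a, Inl b) \<Rightarrow> X $ a $ b | (Inr a, Inr b) \<Rightarrow> - X $ b $ a | _ \<Rightarrow> 0) :: 'k^('n + 'n)^('n + 'n)"
  have F: "lie_carrier (fixed_subalgebra so_even (sigma_so :: 'k^('n + 'n)^('n + 'n) \<Rightarrow> _)) = ?F"
    by (auto simp: fixed_subalgebra_def in_so_even_iff vec_eq_iff sigma_so_entry
        split_sum_all_UNIV all_conj_distrib)
  have "bij_betw ?\<phi> ?F UNIV"
    by (rule bij_betw_byWitness[of _ ?\<psi>]) (auto simp: vec_eq_iff split_sum_all_UNIV)
  then have "lie_iso ?\<phi> (fixed_subalgebra so_even sigma_so) gl"
    unfolding lie_iso_def F
    by (auto simp: fixed_subalgebra_def so_even_def so_form_def gl_def matrix_scale_def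
        matrix_matrix_mult_def sum_UNIV_Plus vec_eq_iff)
  then show ?thesis unfolding lie_isomorphic_def by blast
qed

end

theory Submission
  imports Defs
begin


text \<open>
  All three pairs are graded: \<open>\<gg>\<^sub>1 = V\<^sub>+ \<oplus> V\<^sub>-\<close> is the sum of the eigenspaces for \<open>\<plusminus>1\<close> of an element
  \<open>s\<close> of \<open>\<gg>\<close> with \<open>(ad s)\<^sup>3 = ad s\<close>, so that \<open>[V\<^sub>+, V\<^sub>+] = [V\<^sub>-, V\<^sub>-] = 0\<close>. Reducibility comes from two open sets of the
  commuting variety that do not meet. Put \<open>Q\<^sub>x = (ad x)\<^sup>2 : V\<^sub>- \<rightarrow> V\<^sub>+\<close> for \<open>x\<close> in \<open>V\<^sub>+\<close>, and suppose that
  (a) \<open>ad [u, u']\<close> is injective on \<open>V\<^sub>+\<close> for some \<open>u\<close> in \<open>V\<^sub>+\<close>, \<open>u'\<close> in \<open>V\<^sub>-\<close>, and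
  (b) no \<open>Q\<^sub>x\<close> is onto. If \<open>x + x'\<close> commutes with \<open>y + y'\<close> and \<open>ad [x, x']\<close> is injective on \<open>V\<^sub>+\<close>, then \<open>y\<close> lies in the image of
  \<open>Q\<^sub>x\<close>, a proper subspace. On the other hand any \<open>x\<close> and \<open>y\<close> in \<open>V\<^sub>+\<close> commute, so there are also points with \<open>y\<close> outside the
  image of \<open>Q\<^sub>x\<close>. Both conditions are open, and they exclude each other (\<open>commuting_reducible\<close>).

  For \<open>\<gg>\<ll>\<^bsub>n+m\<^esub>\<close> the map \<open>Q\<^sub>x\<close> is \<open>a \<mapsto> - 2 x a x\<close> with \<open>x\<close> not square, and for \<open>\<ss>\<oo>\<^bsub>2n\<^esub>\<close> the same with \<open>x\<close> skew of odd size; in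
  both cases \<open>x\<close> has a kernel on one side, which gives (b), and (a) is checked on an explicit matrix (\<open>reducible_gl\<close>, \<open>reducible_so\<close>).

  For E6 only the root system and the isomorphism type of \<open>\<gg>\<^sub>0\<close> are given, so the structure of \<open>\<gg>\<^sub>1\<close> has to be recovered.
  The Killing form is nondegenerate, because it does not vanish on the neutral element of an sl2-triple of \<open>\<gg>\<^sub>0\<close>. The centre of
  \<open>\<gg>\<^sub>0\<close> acts diagonalizably on \<open>\<gg>\<^sub>1\<close> with two opposite eigenvalues, which provides \<open>s\<close> (\<open>grading_exists\<close>). The diagonal
  matrices of so10 together with \<open>s\<close> span a Cartan subalgebra. Since \<open>V\<^sub>\<plusminus>\<close> are abelian, strings through weights of \<open>V\<^sub>+\<close> have length at
  most 3, which leaves the weights \<open>0\<close>, \<open>\<plusminus>\<epsilon>\<^sub>a\<close> and \<open>1/2 (\<plusminus>1, \<dots>, \<plusminus>1)\<close> (\<open>minuscule_weights\<close>). The first two kinds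
  alone would make \<open>\<gg>\<close> too small: 36 positive roots of E6 are produced by reflections, so that \<open>dim \<gg> \<ge> 72\<close> (\<open>E6_dimension\<close>).
  Simplicity of \<open>\<gg>\<close> then leaves the half-spin weights of one chirality (\<open>\<Phi>_uniform\<close>).

  Two weights \<open>\<mu>\<close>, \<open>\<nu>\<close> of \<open>V\<^sub>+\<close> that differ in four signs are strongly orthogonal, and the sum of their sl2-triples yields
  (a). The vector \<open>x\<^sub>0 = e\<^sub>\<mu> + e\<^sub>\<nu>\<close> has an open so10-orbit. If some \<open>Q\<^sub>x\<close> were onto, then a generic \<open>x\<close> would have both properties:
  \<open>Q\<^sub>x\<close> bijective, and \<open>[\<xi>, x] = x\<close> for some \<open>\<xi>\<close> in so10. But then \<open>tr (ad \<xi>)\<close> on \<open>V\<^sub>+\<close> and on \<open>V\<^sub>-\<close> would differ by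
  \<open>2 dim V\<^sub>+\<close>, while both traces are zero (\<open>Q_onto_no_scaling\<close>).
\<close>


section \<open>Zariski-open conditions\<close>

lemma zariski_reducibleI:
  assumes p: "p \<in> polynomial_maps S" and q: "q \<in> polynomial_maps S"
    and pq: "\<And>v. v \<in> X \<Longrightarrow> p v = 0 \<or> q v = 0"
    and a: "a \<in> X" "p a \<noteq> 0" and b: "b \<in> X" "q b \<noteq> 0"
  shows "zariski_reducible S X"
proof -
  have closed: "closedin (subtopology (zariski S) X) (X \<inter> {v. r v = 0})" if "r \<in> polynomial_maps S" for r
  proof -
    have "closedin (zariski S) {v. r v = 0}"
      unfolding closedin_zariski using that by (intro exI[of _ "{r}"]) auto
    then show ?thesis by (auto simp: closedin_subtopology)
  qed
  have "X \<inter> {v. p v = 0} \<union> X \<inter> {v. q v = 0} = X" using pq by auto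
  moreover have "X \<inter> {v. p v = 0} \<noteq> X" "X \<inter> {v. q v = 0} \<noteq> X" using a b by auto
  ultimately show ?thesis
    using closed[OF p] closed[OF q]
    unfolding zariski_reducible_def irreducible_space_def by (auto simp del: Int_iff)
qed

lemma polynomial_maps_on_line:
  assumes "p \<in> polynomial_maps s"
  shows "\<exists>P. \<forall>t. p (a + s t b) = poly P t"
  using assms
proof induction
  case (const c)
  show ?case by (rule exI[of _ "[:c:]"]) simp
next
  case (linear f)
  then have "f (a + s t b) = poly [:f a, f b:] t" for t
    by (simp add: Vector_Spaces.linear_iff)
  then show ?case by blast
next
  case (add p q)
  then obtain P Q where "\<forall>t. p (a + s t b) = poly P t" "\<forall>t. q (a + s t b) = poly Q t" by blast
  then show ?case by (intro exI[of _ "P + Q"]) simp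
next
  case (mult p q)
  then obtain P Q where "\<forall>t. p (a + s t b) = poly P t" "\<forall>t. q (a + s t b) = poly Q t" by blast
  then show ?case by (intro exI[of _ "P * Q"]) simp
qed

lemma nonvanishing_common_point:
  fixes s :: "'k::field_char_0 \<Rightarrow> 'v::ab_group_add \<Rightarrow> 'v"
  assumes "vector_space s" "p \<in> polynomial_maps s" "q \<in> polynomial_maps s" "p a \<noteq> 0" "q b \<noteq> 0"
  shows "\<exists>t. p (a + s t (b - a)) \<noteq> 0 \<and> q (a + s t (b - a)) \<noteq> 0"
proof -
  interpret vector_space s by fact
  obtain P Q where P: "\<And>t. p (a + s t (b - a)) = poly P t" and Q: "\<And>t. q (a + s t (b - a)) = poly Q t"
    using assms(2,3) polynomial_maps_on_line by metis
  have "poly P 0 \<noteq> 0" "poly Q 1 \<noteq> 0" using assms(4,5) P[of 0] Q[of 1] by auto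
  then have "P * Q \<noteq> 0" by auto
  then have "finite {t. poly (P * Q) t = 0}" by (rule poly_roots_finite)
  then have "\<exists>t. poly (P * Q) t \<noteq> 0" using infinite_UNIV_char_0[where 'a='k]
    by (metis (mono_tags, lifting) UNIV_I finite_subset mem_Collect_eq subsetI)
  then show ?thesis by (auto simp: P Q)
qed

lemma polynomial_maps_sum:
  "(\<And>i. i \<in> I \<Longrightarrow> p i \<in> polynomial_maps s) \<Longrightarrow> (\<lambda>v. \<Sum>i\<in>I. p i v) \<in> polynomial_maps s"
  by (induction I rule: infinite_finite_induct) (auto intro: polynomial_maps.intros)

definition poly_vec :: "('k::field \<Rightarrow> 'v::ab_group_add \<Rightarrow> 'v) \<Rightarrow> ('k \<Rightarrow> 'g::ab_group_add \<Rightarrow> 'g) \<Rightarrow> ('v \<Rightarrow> 'g) \<Rightarrow> bool" where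
  "poly_vec S s w \<longleftrightarrow> (\<forall>\<phi>. Vector_Spaces.linear s (*) \<phi> \<longrightarrow> (\<lambda>v. \<phi> (w v)) \<in> polynomial_maps S)"

lemma poly_vec_const: "poly_vec S s (\<lambda>v. x)"
  by (simp add: poly_vec_def polynomial_maps.const)

lemma poly_vec_linear: "Vector_Spaces.linear S s w \<Longrightarrow> poly_vec S s w"
  unfolding poly_vec_def by (auto intro!: polynomial_maps.linear simp: Vector_Spaces.linear_iff)

lemma poly_vec_diff:
  assumes "poly_vec S s w" "poly_vec S s u"
  shows "poly_vec S s (\<lambda>v. w v - u v)"
  unfolding poly_vec_def
proof (intro allI impI)
  fix \<phi> assume \<phi>: "Vector_Spaces.linear s (*) \<phi>"
  then have eq: "\<phi> (x - y) = \<phi> x + (- 1) * \<phi> y" for x y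
    by (metis Vector_Spaces.linear_def module_hom.diff mult_minus1 uminus_add_conv_diff add.commute)
  show "(\<lambda>v. \<phi> (w v - u v)) \<in> polynomial_maps S"
    unfolding eq using assms \<phi>
    by (intro polynomial_maps.add polynomial_maps.mult polynomial_maps.const) (auto simp: poly_vec_def)
qed

lemma poly_vec_sum:
  assumes "\<And>i. i \<in> I \<Longrightarrow> poly_vec S s (w i)"
  shows "poly_vec S s (\<lambda>v. \<Sum>i\<in>I. w i v)"
  unfolding poly_vec_def
proof (intro allI impI)
  fix \<phi> assume \<phi>: "Vector_Spaces.linear s (*) \<phi>"
  then have eq: "\<phi> (\<Sum>i\<in>I. w i v) = (\<Sum>i\<in>I. \<phi> (w i v))" for v
    by (metis Vector_Spaces.linear_def module_hom.sum)
  show "(\<lambda>v. \<phi> (\<Sum>i\<in>I. w i v)) \<in> polynomial_maps S"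
    unfolding eq by (rule polynomial_maps_sum) (use assms \<phi> in \<open>auto simp: poly_vec_def\<close>)
qed

lemma poly_vec_scale:
  assumes "p \<in> polynomial_maps S" "poly_vec S s w"
  shows "poly_vec S s (\<lambda>v. s (p v) (w v))"
  using assms unfolding poly_vec_def
  by (auto intro!: polynomial_maps.mult simp: Vector_Spaces.linear_iff)

definition (in vector_space) indep_family :: "'i set \<Rightarrow> ('i \<Rightarrow> 'b) \<Rightarrow> bool" where
  "indep_family I u \<longleftrightarrow> (\<forall>c. (\<Sum>i\<in>I. scale (c i) (u i)) = 0 \<longrightarrow> (\<forall>i\<in>I. c i = 0))"

context vector_space begin

lemma indep_familyD: "indep_family I u \<Longrightarrow> (\<Sum>i\<in>I. scale (c i) (u i)) = 0 \<Longrightarrow> i \<in> I \<Longrightarrow> c i = 0"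
  by (auto simp: indep_family_def)

lemma indep_family_imp:
  assumes fin: "finite I" and ind: "indep_family I u"
  shows "inj_on u I" "independent (u ` I)"
proof -
  show inj: "inj_on u I"
  proof (rule inj_onI, rule ccontr)
    fix i j assume ij: "i \<in> I" "j \<in> I" "u i = u j" "i \<noteq> j"
    define c where "c k = (if k = i then 1 else if k = j then -1 else 0 :: 'a)" for k
    have "(\<Sum>k\<in>I. scale (c k) (u k)) = (\<Sum>k\<in>{i,j}. scale (c k) (u k))"
      by (rule sum.mono_neutral_right) (use fin ij in \<open>auto simp: c_def\<close>)
    also have "\<dots> = 0" using ij by (simp add: c_def)
    finally have "c i = 0" using indep_familyD[OF ind _ ij(1)] by blast
    then show False by (simp add: c_def)
  qed
  show "independent (u ` I)"
  proof (rule independent_if_scalars_zero)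
    show "finite (u ` I)" using fin by simp
  next
    fix f x assume "(\<Sum>x\<in>u ` I. scale (f x) x) = 0" and x: "x \<in> u ` I"
    then have "(\<Sum>i\<in>I. scale (f (u i)) (u i)) = 0"
      by (simp add: sum.reindex[OF inj])
    then show "f x = 0" using indep_familyD[OF ind, of "f \<circ> u"] x by auto
  qed
qed

lemma independent_imp_indep_family:
  assumes "finite B" "independent B" shows "indep_family B (\<lambda>b. b)"
  using assms by (auto simp: indep_family_def dependent_finite)

lemma indep_family_reindex:
  assumes "finite I" "inj_on u I" "independent (u ` I)" shows "indep_family I u"
  unfolding indep_family_def
proof (intro allI impI ballI)
  fix c i assume s: "(\<Sum>i\<in>I. scale (c i) (u i)) = 0" and i: "i \<in> I"
  have "(\<Sum>x\<in>u ` I. scale (c (the_inv_into I u x)) x) = 0"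
    using s by (simp add: sum.reindex[OF assms(2)] the_inv_into_f_f[OF assms(2)])
  then have "c (the_inv_into I u (u i)) = 0"
    using independentD[OF assms(3), of "u ` I" "\<lambda>x. c (the_inv_into I u x)"] assms(1) i by auto
  then show "c i = 0" by (simp add: the_inv_into_f_f[OF assms(2) i])
qed

lemma indep_family_card:
  assumes "finite I" "indep_family I u" "u ` I \<subseteq> span C" "finite C"
  shows "card I \<le> card C"
  using indep_family_imp[OF assms(1,2)] independent_span_bound[OF assms(4) _ assms(3)]
  by (simp add: card_image)

lemma independent_max_spans:
  assumes "finite C" "independent B" "B \<subseteq> span C" "card C \<le> card B"
  shows "span B = span C"
proof (rule ccontr)
  assume "span B \<noteq> span C"
  moreover have "span B \<subseteq> span C" by (rule span_minimal) (use assms in auto)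
  ultimately obtain x where x: "x \<in> span C" "x \<notin> span B" by blast
  have fB: "finite B" using independent_span_bound[OF assms(1-3)] by simp
  have "independent (insert x B)" using x assms by (simp add: independent_insertI)
  moreover have "insert x B \<subseteq> span C" using x assms by auto
  ultimately have "card (insert x B) \<le> card C" using independent_span_bound assms(1) by blast
  moreover have "x \<notin> B" using x span_base by blast
  ultimately show False using fB assms(4) by simp
qed

lemma linear_functional_exists:
  assumes "x \<noteq> 0" shows "\<exists>\<phi>. Vector_Spaces.linear scale (*) \<phi> \<and> \<phi> x = 1"
proof -
  interpret vp: vector_space_pair scale "(*) :: 'a \<Rightarrow> 'a \<Rightarrow> 'a"
    by unfold_locales (auto simp: algebra_simps)
  have "independent {x}" using assms by simp
  from vp.linear_independent_extend[OF this, of "\<lambda>_. 1"] show ?thesis by auto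
qed

text \<open>Linear independence of polynomial families is an open condition: one step of Gaussian
  elimination at the given point, with the pivot kept as a factor of the polynomial.\<close>

lemma independence_open:
  fixes w :: "'i \<Rightarrow> 'v::ab_group_add \<Rightarrow> 'b"
  assumes "finite I" "\<And>i. i \<in> I \<Longrightarrow> poly_vec S scale (w i)" "indep_family I (\<lambda>i. w i a)"
  shows "\<exists>p\<in>polynomial_maps S. p a \<noteq> 0 \<and> (\<forall>v. p v \<noteq> 0 \<longrightarrow> indep_family I (\<lambda>i. w i v))"
  using assms
proof (induction I arbitrary: w rule: finite_induct)
  case empty
  then show ?case
    by (intro bexI[of _ "\<lambda>_. 1"]) (auto simp: indep_family_def intro: polynomial_maps.const)
next
  case (insert j I)
  have "w j a \<noteq> 0"
  proof
    assume 0: "w j a = 0"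
    have "(\<Sum>i\<in>insert j I. scale (if i = j then 1 else 0) (w i a)) = 0"
      using 0 by (intro sum.neutral) auto
    from indep_familyD[OF insert.prems(2) this, of j] show False by simp
  qed
  then obtain \<phi> where \<phi>: "Vector_Spaces.linear scale (*) \<phi>" "\<phi> (w j a) = 1"
    using linear_functional_exists by blast
  define w' where "w' i v = scale (\<phi> (w j v)) (w i v) - scale (\<phi> (w i v)) (w j v)" for i v
  interpret \<phi>: Vector_Spaces.linear scale "(*)" \<phi> by fact
  have pol: "(\<lambda>v. \<phi> (w i v)) \<in> polynomial_maps S" if "i \<in> insert j I" for i
    using insert.prems(1)[OF that] \<phi>(1) by (auto simp: poly_vec_def)
  have pv: "poly_vec S scale (w' i)" if "i \<in> I" for i
    unfolding w'_def using that
    by (intro poly_vec_diff poly_vec_scale pol insert.prems) auto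
  have sum_eq: "(\<Sum>i\<in>I. scale (c i) (w' i v)) =
      scale (\<phi> (w j v)) (\<Sum>i\<in>I. scale (c i) (w i v)) - scale (\<Sum>i\<in>I. c i * \<phi> (w i v)) (w j v)" for c v
    by (simp add: w'_def scale_right_diff_distrib sum_subtractf scale_sum_right scale_sum_left mult.commute)
  have "indep_family I (\<lambda>i. w' i a)"
    unfolding indep_family_def
  proof (intro allI impI ballI)
    fix c i assume s: "(\<Sum>i\<in>I. scale (c i) (w' i a)) = 0" and i: "i \<in> I"
    define d where "d k = (if k = j then - (\<Sum>i\<in>I. c i * \<phi> (w i a)) else c k)" for k
    have "(\<Sum>k\<in>I. scale (d k) (w k a)) = (\<Sum>k\<in>I. scale (c k) (w k a))"
      by (rule sum.cong) (use insert.hyps in \<open>auto simp: d_def\<close>)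
    then have "(\<Sum>k\<in>insert j I. scale (d k) (w k a)) = 0"
      using s insert.hyps unfolding sum_eq by (simp add: d_def \<phi>(2))
    then have "d i = 0" by (rule indep_familyD[OF insert.prems(2)]) (use i in simp)
    then show "c i = 0" using i insert.hyps by (auto simp: d_def split: if_splits)
  qed
  from insert.IH[OF pv this] obtain p where
    p: "p \<in> polynomial_maps S" "p a \<noteq> 0" "\<And>v. p v \<noteq> 0 \<Longrightarrow> indep_family I (\<lambda>i. w' i v)" by auto
  show ?case
  proof (intro bexI conjI allI impI)
    show "(\<lambda>v. \<phi> (w j v) * p v) \<in> polynomial_maps S" by (intro polynomial_maps.mult pol p) simp
    show "\<phi> (w j a) * p a \<noteq> 0" using \<phi> p by simp
    fix v assume nz: "\<phi> (w j v) * p v \<noteq> 0"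
    show "indep_family (insert j I) (\<lambda>i. w i v)"
      unfolding indep_family_def
    proof (intro allI impI)
      fix c assume "(\<Sum>i\<in>insert j I. scale (c i) (w i v)) = 0"
      then have s: "(\<Sum>i\<in>I. scale (c i) (w i v)) = - scale (c j) (w j v)"
        using insert.hyps by (simp add: eq_neg_iff_add_eq_0 add.commute)
      from arg_cong[OF this, of \<phi>] have s2: "(\<Sum>i\<in>I. c i * \<phi> (w i v)) = - c j * \<phi> (w j v)"
        by (simp add: \<phi>.sum \<phi>.scale \<phi>.neg)
      have "(\<Sum>i\<in>I. scale (c i) (w' i v)) = 0"
        unfolding sum_eq s s2 by (simp add: mult.commute)
      then have cI: "\<forall>i\<in>I. c i = 0" using p(3)[of v] nz by (auto dest: indep_familyD)
      then have "c j * \<phi> (w j v) = 0" using s2 by simp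
      then show "\<forall>i\<in>insert j I. c i = 0" using cI nz by auto
    qed
  qed
qed

end

definition (in vector_space) lmap :: "('b \<Rightarrow> 'b) \<Rightarrow> bool" where
  "lmap f \<longleftrightarrow> (\<forall>x y. f (x + y) = f x + f y) \<and> (\<forall>c x. f (scale c x) = scale c (f x))"

context vector_space begin

lemma indep_family_insert:
  assumes "finite I" "j \<notin> I"
  shows "indep_family (insert j I) u \<longleftrightarrow> indep_family I u \<and> u j \<notin> span (u ` I)"
proof (intro iffI conjI)
  assume i: "indep_family (insert j I) u"
  from indep_family_imp[OF _ this] assms have inj: "inj_on u (insert j I)" and ind: "independent (u ` insert j I)" by auto
  then have "independent (u ` I)" by (meson image_mono independent_mono subset_insertI)
  then show "indep_family I u" using indep_family_reindex assms inj by (metis inj_on_insert)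
  have "u j \<notin> u ` I" using inj assms by auto
  then show "u j \<notin> span (u ` I)" using ind independent_insert[of "u j" "u ` I"] by (simp split: if_splits)
next
  assume r: "indep_family I u \<and> u j \<notin> span (u ` I)"
  from indep_family_imp[OF assms(1)] r have "inj_on u I" "independent (u ` I)" by auto
  moreover have "u j \<notin> u ` I" using r span_base[of "u j" "u ` I"] by auto
  ultimately show "indep_family (insert j I) u"
    using assms r independent_insertI[of "u j" "u ` I"] by (intro indep_family_reindex) auto
qed

lemma indep_family_image:
  assumes "inj_on f I" "indep_family (f ` I) u" shows "indep_family I (u \<circ> f)"
  unfolding indep_family_def
proof (intro allI impI ballI)
  fix c i assume "(\<Sum>i\<in>I. scale (c i) ((u \<circ> f) i)) = 0" and i: "i \<in> I"
  then have "(\<Sum>x\<in>f ` I. scale (c (the_inv_into I f x)) (u x)) = 0"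
    by (simp add: sum.reindex[OF assms(1)] the_inv_into_f_f[OF assms(1)])
  from indep_familyD[OF assms(2) this, of "f i"] i show "c i = 0"
    by (simp add: the_inv_into_f_f[OF assms(1)])
qed

lemma indep_family_comp:
  assumes "inj_on f I" "indep_family I (u \<circ> f)" shows "indep_family (f ` I) u"
  unfolding indep_family_def
proof (intro allI impI ballI)
  fix c x assume "(\<Sum>x\<in>f ` I. scale (c x) (u x)) = 0" and x: "x \<in> f ` I"
  then have "(\<Sum>i\<in>I. scale (c (f i)) ((u \<circ> f) i)) = 0"
    by (simp add: sum.reindex[OF assms(1)])
  from indep_familyD[OF assms(2) this] x show "c x = 0" by auto
qed

lemma finite_dim_subspace_basis:
  assumes "subspace W" "W \<subseteq> span C" "finite C"
  obtains B where "finite B" "independent B" "span B = W" "card B \<le> card C"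
proof -
  obtain B where B: "B \<subseteq> W" "independent B" "W \<subseteq> span B"
    using maximal_independent_subset[of W] by blast
  then have "span B = W" using assms(1) span_minimal by blast
  moreover have "B \<subseteq> span C" using B assms by auto
  ultimately show ?thesis using that B independent_span_bound[OF assms(3) B(2)] by blast
qed

lemma lmap_iff: "lmap f \<longleftrightarrow> Vector_Spaces.linear scale scale f"
  unfolding lmap_def by (simp add: Vector_Spaces.linear_iff vector_space_axioms)

lemma lin_add: "lmap f \<Longrightarrow> f (x + y) = f x + f y" by (simp add: lmap_def)
lemma lin_scale: "lmap f \<Longrightarrow> f (scale c x) = scale c (f x)" by (simp add: lmap_def)
lemma lin_0: "lmap f \<Longrightarrow> f 0 = 0" by (metis lin_scale scale_zero_left)
lemma lin_neg: "lmap f \<Longrightarrow> f (- x) = - f x"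
  by (metis lin_add lin_0 add.right_inverse add_eq_0_iff)
lemma lin_diff: "lmap f \<Longrightarrow> f (x - y) = f x - f y"
  by (metis lin_add lin_neg diff_conv_add_uminus)
lemma lin_sum: "lmap f \<Longrightarrow> f (sum g A) = (\<Sum>a\<in>A. f (g a))"
  by (induction A rule: infinite_finite_induct) (auto simp: lin_0 lin_add)
lemma lin_comp: "lmap f \<Longrightarrow> lmap g \<Longrightarrow> lmap (\<lambda>x. f (g x))" by (simp add: lmap_def)
lemma lin_plus: "lmap f \<Longrightarrow> lmap g \<Longrightarrow> lmap (\<lambda>x. f x + g x)"
  by (simp add: lmap_def scale_right_distrib add_ac)
lemma lin_minus: "lmap f \<Longrightarrow> lmap g \<Longrightarrow> lmap (\<lambda>x. f x - g x)"
  by (simp add: lmap_def scale_right_diff_distrib algebra_simps)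
lemma lin_smult: "lmap f \<Longrightarrow> lmap (\<lambda>x. scale c (f x))"
  by (simp add: lmap_def scale_right_distrib mult.commute)
lemma lin_id: "lmap (\<lambda>x. x)" by (simp add: lmap_def)

lemma lin_span_image_subset:
  assumes "lmap f" "\<And>x. x \<in> B \<Longrightarrow> f x \<in> W" "subspace W" "v \<in> span B"
  shows "f v \<in> W"
proof -
  have "subspace {x. f x \<in> W}"
    by (rule subspaceI)
      (use assms in \<open>auto simp: lin_0 lin_add lin_scale subspace_0 subspace_add subspace_scale\<close>)
  then have "span B \<subseteq> {x. f x \<in> W}" using assms(2) by (intro span_minimal) auto
  then show ?thesis using assms by auto
qed

lemma lin_eq_on_span:
  assumes "lmap f" "lmap g" "\<And>x. x \<in> B \<Longrightarrow> f x = g x" "v \<in> span B"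
  shows "f v = g v"
  using lin_span_image_subset[OF lin_minus[OF assms(1,2)] _ subspace_single_0 assms(4)] assms(3)
  by auto

lemma injective_endo_surj:
  assumes f: "lmap f" and W: "subspace W" "W \<subseteq> span C" "finite C"
    and fW: "\<And>x. x \<in> W \<Longrightarrow> f x \<in> W" and inj: "\<And>x. x \<in> W \<Longrightarrow> f x = 0 \<Longrightarrow> x = 0"
    and y: "y \<in> W"
  shows "\<exists>x\<in>W. f x = y"
proof -
  obtain B where B: "finite B" "independent B" "span B = W"
    using finite_dim_subspace_basis[OF W] by blast
  have in0: "inj_on f (span B)"
    unfolding B using f fW inj W by (auto intro!: inj_onI)
      (metis eq_iff_diff_eq_0 lin_diff subspace_diff)
  interpret f: Vector_Spaces.linear scale scale f using f by (simp add: lmap_iff)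
  have "independent (f ` B)" using f.independent_injective_image[OF B(2) in0] .
  moreover have "card (f ` B) = card B"
    using in0 by (meson card_image inj_on_subset span_superset)
  moreover have "f ` B \<subseteq> span B" using B fW span_superset by auto
  ultimately have "span (f ` B) = W"
    using independent_max_spans[of B "f ` B"] B by auto
  then have "y \<in> f ` W" using y f.span_image[of B] B by simp
  then show ?thesis by blast
qed

end

section \<open>Finite-dimensional Lie algebras inside a vector space\<close>

text \<open>The bracket is total and bilinear on the ambient space, with values in the algebra \<open>G\<close>: a
  bracket given on \<open>G\<close> only is extended along a linear projection onto \<open>G\<close>.\<close>

locale lie_space = vector_space scale
  for scale :: "'k::{alg_closed_field,field_char_0} \<Rightarrow> 'g::ab_group_add \<Rightarrow> 'g" (infixr "\<odot>" 75) +
  fixes G :: "'g set" and br :: "'g \<Rightarrow> 'g \<Rightarrow> 'g"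
  assumes subspace_G: "subspace G"
    and fin_dim: "\<exists>B. finite B \<and> G = span B"
    and br_in [simp]: "br x y \<in> G"
    and br_add_l: "br (x + y) z = br x z + br y z"
    and br_add_r: "br z (x + y) = br z x + br z y"
    and br_scale_l: "br (c \<odot> x) y = c \<odot> br x y"
    and br_scale_r: "br x (c \<odot> y) = c \<odot> br x y"
    and br_self [simp]: "br x x = 0"
    and jacobi: "br x (br y z) = br (br x y) z + br y (br x z)"
begin

lemma lin_br: "lmap (br x)" by (simp add: lmap_def br_add_r br_scale_r)
lemma lin_br_l: "lmap (\<lambda>x. br x y)" by (simp add: lmap_def br_add_l br_scale_l)

lemmas br_0_r [simp] = lin_0[OF lin_br]
lemmas br_0_l [simp] = lin_0[OF lin_br_l]
lemmas br_neg_r = lin_neg[OF lin_br]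
lemmas br_neg_l = lin_neg[OF lin_br_l]
lemmas br_diff_r = lin_diff[OF lin_br]
lemmas br_diff_l = lin_diff[OF lin_br_l]
lemmas br_sum_r = lin_sum[OF lin_br]
lemmas br_sum_l = lin_sum[OF lin_br_l]

lemmas br_simps = br_add_l br_add_r br_scale_l br_scale_r br_neg_l br_neg_r br_diff_l br_diff_r

lemma br_anti: "br y x = - br x y"
proof -
  have "br (x + y) (x + y) = (br x x + br y x) + (br x y + br y y)" by (simp only: br_add_l br_add_r)
  then have "br y x + br x y = 0" by simp
  then show ?thesis by (simp only: eq_neg_iff_add_eq_0)
qed

lemmas G_closed = subspace_0[OF subspace_G] subspace_add[OF subspace_G] subspace_diff[OF subspace_G]
  subspace_scale[OF subspace_G] subspace_neg[OF subspace_G] subspace_sum[OF subspace_G]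

lemma G_basis:
  obtains B where "finite B" "independent B" "span B = G"
  using fin_dim finite_dim_subspace_basis[OF subspace_G] by (metis order_refl)

lemma subspace_basis:
  assumes "subspace W" "W \<subseteq> G"
  obtains B where "finite B" "independent B" "span B = W"
  using fin_dim finite_dim_subspace_basis[OF assms(1)] assms(2) by metis

definition eig :: "'g \<Rightarrow> 'k \<Rightarrow> 'g set" where
  "eig a c = {x \<in> G. br a x = c \<odot> x}"

lemma subspace_eig: "subspace (eig a c)"
  by (rule subspaceI) (auto simp: eig_def G_closed br_simps scale_right_distrib mult.commute)

lemma poly_vec_br:
  assumes w: "poly_vec S scale w" "\<And>v. w v \<in> G" and u: "poly_vec S scale u" "\<And>v. u v \<in> G"
  shows "poly_vec S scale (\<lambda>v. br (w v) (u v))"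
proof -
  obtain B where B: "finite B" "independent B" "span B = G" by (rule G_basis)
  let ?r = "representation (extend_basis B)"
  have eB: "independent (extend_basis B)" "span (extend_basis B) = UNIV"
    using independent_extend_basis[OF B(2)] span_extend_basis[OF B(2)] by auto
  have rep: "(\<Sum>b\<in>B. ?r x b \<odot> b) = x" if "x \<in> G" for x
  proof -
    have "representation B x = ?r x"
      using representation_extend[OF eB(1), of x B] that B extend_basis_superset[OF B(2)] by simp
    then show ?thesis using sum_representation_eq[OF B(2), of x B] B that by simp
  qed
  have lin: "Vector_Spaces.linear scale (*) (\<lambda>x. ?r x b)" for b
    unfolding Vector_Spaces.linear_iff
    by (simp add: vector_space_axioms representation_add[OF eB(1)] representation_scale[OF eB(1)] eB)
      (unfold_locales, auto simp: algebra_simps)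
  have "br (w v) (u v) = (\<Sum>b\<in>B. \<Sum>c\<in>B. (?r (w v) b * ?r (u v) c) \<odot> br b c)" for v
  proof -
    have "br (w v) (u v) = br (\<Sum>b\<in>B. ?r (w v) b \<odot> b) (\<Sum>c\<in>B. ?r (u v) c \<odot> c)"
      by (simp only: rep[OF w(2)] rep[OF u(2)])
    also have "\<dots> = (\<Sum>b\<in>B. \<Sum>c\<in>B. (?r (w v) b * ?r (u v) c) \<odot> br b c)"
      by (simp add: br_sum_l br_sum_r br_scale_l br_scale_r scale_sum_right)
        (subst sum.swap, simp add: mult.commute)
    finally show ?thesis .
  qed
  moreover have "(\<lambda>v. ?r (w v) b) \<in> polynomial_maps S" "(\<lambda>v. ?r (u v) b) \<in> polynomial_maps S" for b
    using w(1) u(1) lin[of b] by (auto simp: poly_vec_def)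
  ultimately show ?thesis
    by (simp only:) (intro poly_vec_sum poly_vec_scale polynomial_maps.mult poly_vec_const)
qed

end

section \<open>A criterion for commuting varieties of three-graded Lie algebras\<close>

locale three_graded = lie_space scale G br
  for scale :: "'k::{alg_closed_field,field_char_0} \<Rightarrow> 'g::ab_group_add \<Rightarrow> 'g" (infixr "\<odot>" 75)
    and G br +
  fixes s :: 'g assumes s_in: "s \<in> G"
    and cube: "x \<in> G \<Longrightarrow> br s (br s (br s x)) = br s x"
begin

abbreviation "Vp \<equiv> eig s 1"
abbreviation "Vm \<equiv> eig s (- 1)"

lemma VpD: "x \<in> Vp \<Longrightarrow> x \<in> G" "x \<in> Vp \<Longrightarrow> br s x = x" by (auto simp: eig_def)
lemma VmD: "x \<in> Vm \<Longrightarrow> x \<in> G" "x \<in> Vm \<Longrightarrow> br s x = - x" by (auto simp: eig_def)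
lemma VpI: "x \<in> G \<Longrightarrow> br s x = x \<Longrightarrow> x \<in> Vp" by (auto simp: eig_def)
lemma VmI: "x \<in> G \<Longrightarrow> br s x = - x \<Longrightarrow> x \<in> Vm" by (auto simp: eig_def)

lemma no_other_eigenvalue:
  assumes "z \<in> G" "br s z = c \<odot> z" "c ^ 3 \<noteq> c" shows "z = 0"
proof -
  have "br s (br s (br s z)) = br s z" by (rule cube) fact
  then have "(c ^ 3 - c) \<odot> z = 0"
    by (simp add: assms(2) br_scale_r power3_eq_cube scale_left_diff_distrib mult.assoc)
  then show ?thesis using assms(3) by simp
qed

lemma Vp_Vp: assumes "x \<in> Vp" "y \<in> Vp" shows "br x y = 0"
proof (rule no_other_eigenvalue)
  have "br s (br x y) = br x y + br x y"
    using jacobi[of s x y] VpD[OF assms(1)] VpD[OF assms(2)] by simp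
  also have "\<dots> = 2 \<odot> br x y"
    by (simp only: one_add_one[symmetric] scale_left_distrib scale_one)
  finally show "br s (br x y) = 2 \<odot> br x y" .
qed auto

lemma Vm_Vm: assumes "x \<in> Vm" "y \<in> Vm" shows "br x y = 0"
proof (rule no_other_eigenvalue)
  have "br s (br x y) = - (br x y + br x y)"
    using jacobi[of s x y] VmD[OF assms(1)] VmD[OF assms(2)] by (simp add: br_simps)
  also have "\<dots> = (-2) \<odot> br x y"
    by (simp only: scale_minus_left one_add_one[symmetric] scale_left_distrib scale_one)
  finally show "br s (br x y) = (-2) \<odot> br x y" .
qed auto

lemma Vp_Vm: assumes "x \<in> Vp" "y \<in> Vm" shows "br s (br x y) = 0"
  using jacobi[of s x y] VpD[OF assms(1)] VmD[OF assms(2)] by (simp add: br_simps)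

lemma g0_Vp: assumes "br s h = 0" "x \<in> Vp" shows "br h x \<in> Vp"
  using jacobi[of s h x] VpD[OF assms(2)] assms(1) by (intro VpI) auto

lemma g0_Vm: assumes "br s h = 0" "x \<in> Vm" shows "br h x \<in> Vm"
  using jacobi[of s h x] VmD[OF assms(2)] assms(1) by (intro VmI) (auto simp: br_simps)

abbreviation "Q x a \<equiv> br x (br x a)"

lemma lin_Q: "lmap (Q x)" by (rule lin_comp[OF lin_br lin_br])

lemma Q_Vp: assumes x: "x \<in> Vp" and a: "a \<in> Vm" shows "Q x a \<in> Vp"
proof -
  have "br (br x a) x \<in> Vp" by (rule g0_Vp[OF Vp_Vm[OF x a] x])
  then show ?thesis using subspace_neg[OF subspace_eig] unfolding br_anti[of "br x a" x] by fastforce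
qed

text \<open>For \<open>x \<in> V\<^sub>+\<close> one has \<open>(ad x)\<^sup>3 = 0\<close>; expanding \<open>(ad x)\<^sup>2\<close> of \<open>[b, [x, a]]\<close> and of
  \<open>[a, [x, b]]\<close> gives two linear equations whose solution places \<open>[Q\<^sub>x b, [x, a]]\<close> in the image of
  \<open>Q\<^sub>x\<close>.\<close>

lemma Q_br_in_image:
  assumes x: "x \<in> Vp" and a: "a \<in> Vm" and b: "b \<in> Vm"
  shows "\<exists>c\<in>Vm. br (Q x b) (br x a) = Q x c"
proof -
  have x3: "br x (Q x a) = 0" "br x (Q x b) = 0" using Q_Vp[OF x] a b Vp_Vp[OF x] by auto
  define \<alpha> where "\<alpha> = br b (br x a)"
  define \<beta> where "\<beta> = br a (br x b)"
  define P where "P = br (Q x b) (br x a)"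
  define R where "R = br (br x b) (Q x a)"
  have mem: "\<alpha> \<in> Vm" "\<beta> \<in> Vm"
    using subspace_neg[OF subspace_eig g0_Vm[OF Vp_Vm[OF x a] b]] subspace_neg[OF subspace_eig g0_Vm[OF Vp_Vm[OF x b] a]]
    unfolding \<alpha>_def \<beta>_def br_anti[of "br x a" b] br_anti[of "br x b" a] by simp_all
  have e1: "Q x \<alpha> = P + R + R"
    unfolding \<alpha>_def P_def R_def
    by (simp add: jacobi[of x b "br x a"] br_add_r jacobi[of x "br x b" "br x a"]
        jacobi[of x b "Q x a"] x3)
  have e2: "Q x \<beta> = - R - P - P"
    unfolding \<beta>_def P_def R_def
    by (simp add: jacobi[of x a "br x b"] br_add_r jacobi[of x "br x a" "br x b"]
        jacobi[of x a "Q x b"] x3)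
       (simp add: br_anti[of "br x b" "Q x a"] br_anti[of "Q x b" "br x a"])
  have "Q x (- (\<alpha> + \<beta> + \<beta>)) = P + P + P"
    by (simp only: lin_neg[OF lin_Q] lin_add[OF lin_Q] e1 e2) simp
  moreover have "P + P + P = 3 \<odot> P"
    by (simp only: numeral_Bit1 numeral_One scale_left_distrib scale_one)
  ultimately have "Q x ((1/3) \<odot> (- (\<alpha> + \<beta> + \<beta>))) = P" by (simp only: lin_scale[OF lin_Q] scale_scale) simp
  moreover have "(1/3) \<odot> (- (\<alpha> + \<beta> + \<beta>)) \<in> Vm"
    using mem subspace_eig subspace_scale subspace_neg subspace_add by metis
  ultimately show ?thesis unfolding P_def by metis
qed

lemma Q_image_stable:
  assumes x: "x \<in> Vp" and b: "b \<in> Vm" and a: "a \<in> Vm"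
  shows "\<exists>c\<in>Vm. br (br x b) (Q x a) = Q x c"
proof -
  let ?h = "br x b"
  have u: "br ?h x = - Q x b" by (rule br_anti)
  have x3: "br x (Q x b) = 0" using Q_Vp[OF x b] Vp_Vp[OF x] by auto
  obtain c where c: "c \<in> Vm" "br (Q x b) (br x a) = Q x c" using Q_br_in_image[OF x a b] by blast
  have "br x (br (Q x b) a) = br (Q x b) (br x a)" using jacobi[of x "Q x b" a] x3 by simp
  then have "br ?h (Q x a) = - Q x c - Q x c + Q x (br ?h a)"
    by (simp add: jacobi[of ?h x "br x a"] jacobi[of ?h x a] u br_simps c)
  also have "\<dots> = Q x (- c - c + br ?h a)" by (simp add: br_simps)
  finally show ?thesis
    using c g0_Vm[OF Vp_Vm[OF x b] a] subspace_eig subspace_neg subspace_add subspace_diff by meson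
qed

lemma commuting_in_Q_image:
  assumes x: "x \<in> Vp" "x' \<in> Vm" and y: "y \<in> Vp" "y' \<in> Vm" and comm: "br (x + x') (y + y') = 0"
    and inj: "\<And>z. z \<in> Vp \<Longrightarrow> br (br x x') z = 0 \<Longrightarrow> z = 0"
  shows "y \<in> Q x ` Vm"
proof -
  let ?h = "br x x'" and ?W = "Q x ` Vm"
  have "br x y' + br x' y = 0"
    using comm Vp_Vp[OF x(1) y(1)] Vm_Vm[OF x(2) y(2)] by (simp add: br_simps add.commute)
  then have e: "br x' y = - br x y'" by (simp add: eq_neg_iff_add_eq_0 add.commute)
  have "br x (br x' y) = br ?h y + br x' (br x y)" by (rule jacobi)
  then have hy: "br ?h y = Q x (- y')" using Vp_Vp[OF x(1) y(1)] e by (simp add: br_simps)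
  interpret Qx: Vector_Spaces.linear scale scale "Q x" using lin_Q by (simp add: lmap_iff)
  have W: "subspace ?W" using Qx.subspace_image subspace_eig by blast
  have WG: "?W \<subseteq> Vp" using Q_Vp[OF x(1)] by auto
  obtain C where C: "finite C" "G = span C" using fin_dim by blast
  have "\<exists>w\<in>?W. br ?h w = br ?h y"
  proof (rule injective_endo_surj[OF lin_br W, of C])
    show "?W \<subseteq> span C" using WG VpD C by auto
    show "br ?h w \<in> ?W" if "w \<in> ?W" for w using that Q_image_stable[OF x] by auto
    show "w = 0" if "w \<in> ?W" "br ?h w = 0" for w using that inj WG by blast
    show "br ?h y \<in> ?W" using hy y subspace_neg[OF subspace_eig] by blast
  qed (use C in auto)
  then obtain w where w: "w \<in> ?W" "br ?h (w - y) = 0" by (auto simp: br_simps)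
  moreover have "w - y \<in> Vp" using w WG y subspace_diff[OF subspace_eig] by blast
  ultimately show ?thesis using inj by force
qed

definition "comp_p x = (1/2) \<odot> (br s (br s x) + br s (br s (br s x)))"
definition "comp_m x = (1/2) \<odot> (br s (br s x) - br s (br s (br s x)))"

lemma comp_in: "comp_p x \<in> Vp" "comp_m x \<in> Vm"
proof -
  have e: "br s (br s (br s (br s x))) = br s (br s x)" by (rule cube) simp
  have 1: "br s (comp_p x) = comp_p x" by (simp add: comp_p_def br_simps e add.commute)
  have 2: "br s (comp_m x) = - comp_m x" 
    by (simp add: comp_m_def br_simps e flip: scale_minus_right)
  show "comp_p x \<in> Vp" by (rule VpI[OF _ 1]) (simp add: comp_p_def G_closed)
  show "comp_m x \<in> Vm" by (rule VmI[OF _ 2]) (simp add: comp_m_def G_closed)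
qed

lemma lin_comp_p: "lmap comp_p" and lin_comp_m: "lmap comp_m"
  by (simp_all add: lmap_def comp_p_def comp_m_def br_simps scale_right_distrib
      scale_right_diff_distrib mult.commute)

lemma half_double: "(1/2) \<odot> (x + x) = x"
  by (simp flip: scale_left_distrib add: scale_right_distrib)

lemma comp_of_Vp: "x \<in> Vp \<Longrightarrow> comp_p x = x" "x \<in> Vp \<Longrightarrow> comp_m x = 0"
  by (simp_all add: comp_p_def comp_m_def VpD half_double)

lemma comp_of_Vm: assumes "x \<in> Vm" shows "comp_m x = x" "comp_p x = 0"
  using assms by (simp_all add: comp_p_def comp_m_def VmD br_neg_r half_double)

definition "odd_part = {x \<in> G. br s (br s x) = x}"

lemma odd_part_decomp: assumes "x \<in> odd_part" shows "x = comp_p x + comp_m x"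
proof -
  have "comp_p x + comp_m x = (1/2) \<odot> (x + x)"
    using assms by (simp only: odd_part_def comp_p_def comp_m_def mem_Collect_eq flip: scale_right_distrib) simp
  then show ?thesis by (simp only: half_double)
qed

lemma Vpm_odd_part: assumes "x \<in> Vp" "y \<in> Vm" shows "x + y \<in> odd_part"
  using assms VpD VmD by (simp add: odd_part_def G_closed br_simps)

end

context three_graded begin

text \<open>On the open set where \<open>ad [x\<^sub>+, x\<^sub>-]\<close> is injective on \<open>V\<^sub>+\<close>, commuting pairs satisfy
  \<open>y\<^sub>+ \<in> Q\<^bsub>x\<^sub>+\<^esub> V\<^sub>-\<close>. On the open set where \<open>Q\<^bsub>x\<^sub>+\<^esub>\<close> has maximal rank and \<open>y\<^sub>+\<close> enlarges its image this
  fails, and that set meets \<open>V\<^sub>+ \<times> V\<^sub>+\<close>.\<close>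

theorem commuting_reducible:
  assumes u: "u \<in> Vp" "u' \<in> Vm" "\<And>z. z \<in> Vp \<Longrightarrow> br (br u u') z = 0 \<Longrightarrow> z = 0"
    and Q: "\<And>x. x \<in> Vp \<Longrightarrow> \<exists>y\<in>Vp. y \<notin> Q x ` Vm"
  shows "zariski_reducible (module_prod.scale scale scale)
           {(x, y). x \<in> odd_part \<and> y \<in> odd_part \<and> br x y = 0}"
    (is "zariski_reducible ?S ?X")
proof -
  interpret vp: vector_space_pair scale scale ..
  interpret vp: vector_space_prod scale scale ..
  have vS: "vector_space ?S" by (rule vp.p.vector_space_axioms)
  have lin_fst: "Vector_Spaces.linear ?S scale (\<lambda>v. f (fst v))"
    and lin_snd: "Vector_Spaces.linear ?S scale (\<lambda>v. f (snd v))" if "lmap f" for f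
    using that unfolding Vector_Spaces.linear_iff lmap_def
    by (auto simp: vS vector_space_axioms vp.scale_def)
  have pol: "poly_vec ?S scale (\<lambda>v. comp_p (fst v))" "poly_vec ?S scale (\<lambda>v. comp_m (fst v))"
    "poly_vec ?S scale (\<lambda>v. comp_p (snd v))"
    by (intro poly_vec_linear lin_fst lin_snd lin_comp_p lin_comp_m)+
  have inG: "comp_p x \<in> G" "comp_m x \<in> G" for x using comp_in VpD VmD by blast+
  obtain B where B: "finite B" "independent B" "span B = Vp"
    using subspace_basis[OF subspace_eig, of s 1] VpD by blast
  let ?h = "\<lambda>v. br (comp_p (fst v)) (comp_m (fst v))"
  let ?x0 = "(u + u', u + u')"
  have BG: "b \<in> B \<Longrightarrow> b \<in> G" for b using B VpD span_base by blast
  have comp_u: "comp_p (u + u') = u" "comp_m (u + u') = u'"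
    using u by (simp_all add: lin_add[OF lin_comp_p] lin_add[OF lin_comp_m] comp_of_Vp comp_of_Vm)
  have "indep_family B (\<lambda>b. br (?h ?x0) b)"
    unfolding indep_family_def
  proof (intro allI impI ballI)
    fix c b assume s0: "(\<Sum>b\<in>B. c b \<odot> br (?h ?x0) b) = 0" and b: "b \<in> B"
    then have "br (br u u') (\<Sum>b\<in>B. c b \<odot> b) = 0" by (simp add: comp_u br_sum_r br_scale_r)
    moreover have "(\<Sum>b\<in>B. c b \<odot> b) \<in> Vp"
      unfolding B(3)[symmetric] by (intro span_sum span_scale span_base)
    ultimately have "(\<Sum>b\<in>B. c b \<odot> b) = 0" using u by blast
    then show "c b = 0" using independentD[OF B(2,1) order_refl] b by blast
  qed
  moreover have "poly_vec ?S scale (\<lambda>v. br (?h v) b)" if "b \<in> B" for b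
    by (rule poly_vec_br[OF poly_vec_br[OF pol(1) _ pol(2)] _ poly_vec_const]) (use inG BG that in auto)
  ultimately obtain p where
    p: "p \<in> polynomial_maps ?S" "p ?x0 \<noteq> 0" "\<And>v. p v \<noteq> 0 \<Longrightarrow> indep_family B (\<lambda>b. br (?h v) b)"
    using independence_open[OF B(1), of ?S "\<lambda>b v. br (?h v) b" ?x0] by blast
  have p_inj: "z = 0" if "p v \<noteq> 0" "z \<in> Vp" "br (?h v) z = 0" for v z
  proof -
    have z: "(\<Sum>b\<in>B. representation B z b \<odot> b) = z" 
      using sum_representation_eq[of B z B] that B by simp
    have "(\<Sum>b\<in>B. representation B z b \<odot> br (?h v) b) = br (?h v) (\<Sum>b\<in>B. representation B z b \<odot> b)"
      by (simp only: br_sum_r br_scale_r)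
    also have "\<dots> = 0" unfolding z by fact
    finally have "representation B z b = 0" if "b \<in> B" for b
      using indep_familyD[OF p(3)[OF \<open>p v \<noteq> 0\<close>]] that by blast
    then have "(\<Sum>b\<in>B. representation B z b \<odot> b) = 0" by (intro sum.neutral) simp
    then show "z = 0" unfolding z .
  qed
  obtain C where C: "finite C" "G = span C" using fin_dim by blast
  define R where "R A x \<longleftrightarrow> finite A \<and> A \<subseteq> Vm \<and> x \<in> Vp \<and> indep_family A (Q x)" for A x
  have bound: "card A \<le> card C" if "R A x" for A x
    using indep_family_card[of A "Q x" C] that C(1) br_in unfolding C(2)[symmetric]
    by (simp add: R_def image_subset_iff)
  have "R {} 0" by (auto simp: R_def indep_family_def subspace_0[OF subspace_eig])
  then have "\<exists>Ax. R (fst Ax) (snd Ax) \<and> (\<forall>Ax'. R (fst Ax') (snd Ax') \<longrightarrow> card (fst Ax') \<le> card (fst Ax))"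
    by (intro Lattices_Big.ex_has_greatest_nat[where k = "({}, 0)" and b = "Suc (card C)"])
      (use bound in \<open>auto simp: less_Suc_eq_le\<close>)
  then obtain Ax where Ax: "R (fst Ax) (snd Ax)" "\<And>Ax'. R (fst Ax') (snd Ax') \<Longrightarrow> card (fst Ax') \<le> card (fst Ax)"
    by blast
  define A x0 where "A = fst Ax" and "x0 = snd Ax"
  have A: "R A x0" and max: "\<And>A' x'. R A' x' \<Longrightarrow> card A' \<le> card A"
    using Ax(1) Ax(2)[of "(A', x')" for A' x'] by (simp_all add: A_def x0_def)
  have A': "finite A" "A \<subseteq> Vm" "x0 \<in> Vp" "indep_family A (Q x0)" using A by (auto simp: R_def)
  obtain y0 where y0: "y0 \<in> Vp" "y0 \<notin> Q x0 ` Vm" using Q A' by blast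
  let ?I = "insert None (Some ` A)"
  let ?w = "\<lambda>i v. case i of None \<Rightarrow> comp_p (snd v) | Some a \<Rightarrow> Q (comp_p (fst v)) a"
  have w_iff: "indep_family ?I (\<lambda>i. ?w i v) \<longleftrightarrow>
      indep_family A (Q (comp_p (fst v))) \<and> comp_p (snd v) \<notin> span (Q (comp_p (fst v)) ` A)" for v
  proof -
    have "indep_family (Some ` A) (\<lambda>i. ?w i v) \<longleftrightarrow> indep_family A (Q (comp_p (fst v)))"
      using indep_family_image[of Some A "\<lambda>i. ?w i v"] indep_family_comp[of Some A "\<lambda>i. ?w i v"]
      unfolding comp_def by (simp del: br_self) blast
    then show ?thesis using indep_family_insert[of "Some ` A" None "\<lambda>i. ?w i v"] A'(1)
      by (simp add: image_image)
  qed
  have span_Q: "span (Q x ` A) \<subseteq> Q x ` Vm" for x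
  proof -
    interpret Qx: Vector_Spaces.linear scale scale "Q x" using lin_Q by (simp add: lmap_iff)
    show ?thesis unfolding Qx.span_image using span_minimal[OF A'(2) subspace_eig] by (rule image_mono)
  qed
  have "indep_family ?I (\<lambda>i. ?w i (x0, y0))"
  proof -
    have "y0 \<notin> span (Q x0 ` A)" using y0(2) span_Q[of x0] by blast
    then show ?thesis unfolding w_iff using A'(4) comp_of_Vp(1)[OF A'(3)] comp_of_Vp(1)[OF y0(1)] by simp
  qed
  moreover have "poly_vec ?S scale (?w i)" if "i \<in> ?I" for i
  proof (cases i)
    case None then show ?thesis using pol(3) by simp
  next
    case (Some a)
    then have "a \<in> G" using that A' VmD by auto
    then have "poly_vec ?S scale (\<lambda>v. Q (comp_p (fst v)) a)"
      by (intro poly_vec_br[OF pol(1) _ poly_vec_br[OF pol(1) _ poly_vec_const]] inG) auto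
    then show ?thesis using Some by simp
  qed
  ultimately obtain q where
    q: "q \<in> polynomial_maps ?S" "q (x0, y0) \<noteq> 0" "\<And>v. q v \<noteq> 0 \<Longrightarrow> indep_family ?I (\<lambda>i. ?w i v)"
    using independence_open[of ?I ?S ?w "(x0, y0)"] A' by blast
  have q_Q: "comp_p (snd v) \<notin> Q (comp_p (fst v)) ` Vm" if "q v \<noteq> 0" for v
  proof
    let ?x = "comp_p (fst v)"
    assume "comp_p (snd v) \<in> Q ?x ` Vm"
    then obtain a where a: "a \<in> Vm" "comp_p (snd v) = Q ?x a" by blast
    have i: "indep_family A (Q ?x)" "Q ?x a \<notin> span (Q ?x ` A)"
      using q(3)[OF that, unfolded w_iff] unfolding a(2) by auto
    have "a \<notin> A" using i(2) span_base[of "Q ?x a" "Q ?x ` A"] by auto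
    then have "R (insert a A) ?x"
      unfolding R_def using indep_family_insert[of A a "Q ?x"] i A'(1,2) a(1) comp_in(1) \<open>a \<notin> A\<close> by simp
    then have "card (insert a A) \<le> card A" by (rule max)
    then show False using A' \<open>a \<notin> A\<close> by simp
  qed
  show ?thesis
  proof (rule zariski_reducibleI[OF p(1) q(1)])
    fix v assume v: "v \<in> ?X"
    show "p v = 0 \<or> q v = 0"
    proof (rule ccontr)
      assume "\<not> (p v = 0 \<or> q v = 0)"
      moreover obtain x y where xy: "v = (x, y)" by fastforce
      moreover have "br (comp_p x + comp_m x) (comp_p y + comp_m y) = 0"
        using v xy odd_part_decomp by auto
      ultimately show False
        using commuting_in_Q_image[of "comp_p x" "comp_m x" "comp_p y" "comp_m y"]
          p_inj[of v] q_Q[of v] comp_in by auto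
    qed
  next
    show "?x0 \<in> ?X" using Vpm_odd_part u by auto
    show "(x0, y0) \<in> ?X"
      using Vpm_odd_part[of _ 0] A' y0 Vp_Vp subspace_0[OF subspace_eig] by force
  qed (use p q in auto)
qed

end

lemma (in vector_space) projection_exists:
  assumes "independent B"
  shows "\<exists>P. lmap P \<and> (\<forall>x. P x \<in> span B) \<and> (\<forall>x\<in>span B. P x = x)"
proof -
  interpret vp: vector_space_pair scale scale ..
  obtain P where P: "Vector_Spaces.linear scale scale P" "\<forall>x\<in>B. P x = x" "range P = span ((\<lambda>x. x) ` B)"
    using vp.linear_independent_extend_subspace[OF assms, of "\<lambda>x. x"] by blast
  have lP: "lmap P" using P(1) by (simp add: lmap_iff)
  show ?thesis
  proof (intro exI[of _ P] conjI lP allI ballI)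
    show "P x \<in> span B" for x using P(3) by auto
    show "P x = x" if "x \<in> span B" for x
      by (rule lin_eq_on_span[OF lP _ _ that]) (use P(2) in \<open>auto simp: lmap_def\<close>)
  qed
qed

lemma lie_space_of_lie_alg:
  fixes L :: "('k::{alg_closed_field,field_char_0}, 'g::ab_group_add) lie_alg"
  assumes L: "lie_algebra L" and fd: "lie_finite_dim L"
  obtains br where "lie_space (lie_scale L) (lie_carrier L) br"
    "\<And>x y. x \<in> lie_carrier L \<Longrightarrow> y \<in> lie_carrier L \<Longrightarrow> br x y = lie_bracket L x y"
proof -
  interpret vector_space "lie_scale L" using L by (simp add: lie_algebra_def)
  let ?G = "lie_carrier L" and ?b = "lie_bracket L"
  have sub: "subspace ?G" using L by (simp add: lie_algebra_def)
  obtain C where C: "finite C" "?G = span C" using fd by (auto simp: lie_finite_dim_def)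
  obtain B where B: "finite B" "independent B" "span B = ?G" "card B \<le> card C"
    by (rule finite_dim_subspace_basis[OF sub equalityD1[OF C(2)] C(1)])
  obtain P where P: "lmap P" "\<And>x. P x \<in> ?G" "\<And>x. x \<in> ?G \<Longrightarrow> P x = x"
    using projection_exists[OF B(2), unfolded B(3)] by auto
  have in_G: "x \<in> ?G \<Longrightarrow> y \<in> ?G \<Longrightarrow> ?b x y \<in> ?G" for x y using L by (simp add: lie_algebra_def)
  have addl: "x \<in> ?G \<Longrightarrow> y \<in> ?G \<Longrightarrow> z \<in> ?G \<Longrightarrow> ?b (x + y) z = ?b x z + ?b y z" for x y z
    using L unfolding lie_algebra_def by blast
  have addr: "x \<in> ?G \<Longrightarrow> y \<in> ?G \<Longrightarrow> z \<in> ?G \<Longrightarrow> ?b z (x + y) = ?b z x + ?b z y" for x y z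
    using L unfolding lie_algebra_def by blast
  have scl: "x \<in> ?G \<Longrightarrow> y \<in> ?G \<Longrightarrow> ?b (lie_scale L c x) y = lie_scale L c (?b x y)" for c x y
    using L unfolding lie_algebra_def by blast
  have scr: "x \<in> ?G \<Longrightarrow> y \<in> ?G \<Longrightarrow> ?b x (lie_scale L c y) = lie_scale L c (?b x y)" for c x y
    using L unfolding lie_algebra_def by blast
  have self: "x \<in> ?G \<Longrightarrow> ?b x x = 0" for x using L unfolding lie_algebra_def by blast
  have jac: "x \<in> ?G \<Longrightarrow> y \<in> ?G \<Longrightarrow> z \<in> ?G \<Longrightarrow> ?b x (?b y z) + ?b y (?b z x) + ?b z (?b x y) = 0" for x y z
    using L unfolding lie_algebra_def by blast
  have anti: "?b y x = - ?b x y" if "x \<in> ?G" "y \<in> ?G" for x y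
  proof -
    have "x + y \<in> ?G" using that sub subspace_add by blast
    then have "?b (x + y) (x + y) = 0" by (rule self)
    moreover have "?b (x + y) (x + y) = (?b x x + ?b y x) + (?b x y + ?b y y)"
      using that \<open>x + y \<in> ?G\<close> by (simp only: addl addr)
    ultimately have "?b y x + ?b x y = 0" using that by (simp add: self)
    then show ?thesis by (simp only: eq_neg_iff_add_eq_0)
  qed
  have neg: "?b x (- y) = - ?b x y" if "x \<in> ?G" "y \<in> ?G" for x y
    using scr[OF that, of "-1"] by simp
  define br where "br x y = ?b (P x) (P y)" for x y
  have "lie_space (lie_scale L) ?G br"
  proof unfold_locales
    show "\<exists>B. finite B \<and> ?G = span B" using C by blast
    show "br x (br y z) = br (br x y) z + br y (br x z)" for x y z
    proof -
      let ?x = "P x" and ?y = "P y" and ?z = "P z"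
      have "?b ?x (?b ?y ?z) + (?b ?y (?b ?z ?x) + ?b ?z (?b ?x ?y)) = 0"
        using jac P(2) by (simp add: add.assoc)
      moreover have "?b ?y (?b ?z ?x) = - ?b ?y (?b ?x ?z)" "?b ?z (?b ?x ?y) = - ?b (?b ?x ?y) ?z"
        using anti neg P(2) in_G by metis+
      ultimately have "?b ?x (?b ?y ?z) = ?b (?b ?x ?y) ?z + ?b ?y (?b ?x ?z)"
        by (simp add: algebra_simps)
      then show ?thesis by (simp add: br_def P in_G)
    qed
  qed (simp_all add: sub br_def in_G P lin_add[OF P(1)] lin_scale[OF P(1)] addl addr scl scr self)
  then show ?thesis by (rule that) (simp add: br_def P)
qed

lemma three_graded_commuting_variety_reducible:
  fixes L :: "('k::{alg_closed_field,field_char_0}, 'g::ab_group_add) lie_alg"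
  assumes tg: "three_graded (lie_scale L) (lie_carrier L) br s"
    and br: "\<And>x y. x \<in> lie_carrier L \<Longrightarrow> y \<in> lie_carrier L \<Longrightarrow> br x y = lie_bracket L x y"
    and odd: "minus_eigenspace L \<sigma> = three_graded.odd_part (lie_carrier L) br s"
    and u: "u \<in> lie_space.eig (lie_scale L) (lie_carrier L) br s 1"
       "u' \<in> lie_space.eig (lie_scale L) (lie_carrier L) br s (- 1)"
       "\<And>z. z \<in> lie_space.eig (lie_scale L) (lie_carrier L) br s 1 \<Longrightarrow> br (br u u') z = 0 \<Longrightarrow> z = 0"
    and Q: "\<And>x. x \<in> lie_space.eig (lie_scale L) (lie_carrier L) br s 1 \<Longrightarrow>
      \<exists>y\<in>lie_space.eig (lie_scale L) (lie_carrier L) br s 1.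
        y \<notin> (\<lambda>a. br x (br x a)) ` lie_space.eig (lie_scale L) (lie_carrier L) br s (- 1)"
  shows "commuting_variety_reducible L \<sigma>"
proof -
  interpret three_graded "lie_scale L" "lie_carrier L" br s by (rule tg)
  have "commuting_variety L \<sigma> = {(x, y). x \<in> odd_part \<and> y \<in> odd_part \<and> br x y = 0}"
    unfolding commuting_variety_def odd by (auto simp: odd_part_def br)
  then show ?thesis
    unfolding commuting_variety_reducible_def using commuting_reducible[OF u Q] by simp
qed

section \<open>The classical pairs\<close>

lemma matrix_algebra_rules:
  fixes A B C :: "'k::field^'n::finite^'n"
  shows "(A + B) ** C = A ** C + B ** C" "C ** (A + B) = C ** A + C ** B"
    "(A - B) ** C = A ** C - B ** C" "C ** (A - B) = C ** A - C ** B"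
    "(- A) ** C = - (A ** C)" "C ** (- A) = - (C ** A)"
  by (simp_all add: matrix_matrix_mult_def vec_eq_iff sum.distrib sum_subtractf sum_negf algebra_simps)

definition diag_matrix :: "('i \<Rightarrow> 'k) \<Rightarrow> 'k::field^'i::finite^'i" where
  "diag_matrix d = (\<chi> i j. if i = j then d i else 0)"

lemma diag_matrix_commutator:
  "(diag_matrix d ** M - M ** diag_matrix d) $ i $ j = (d i - d j) * M $ i $ j"
  by (simp add: diag_matrix_def matrix_matrix_mult_def mult_delta_left mult_delta_right
      algebra_simps cong: if_cong)

text \<open>\<open>block True\<close> is the space of upper right and \<open>block False\<close> that of lower left blocks.\<close>

definition block :: "bool \<Rightarrow> ('k::field^('n::finite + 'm::finite)^('n + 'm)) set" where
  "block b = {M. \<forall>i j. M $ i $ j \<noteq> 0 \<longrightarrow> isl i = b \<and> isl j = (\<not> b)}"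

lemma block_square_zero: assumes "X \<in> block b" shows "X ** X = 0"
proof -
  have "X $ i $ k * X $ k $ j = 0" for i j k
    using assms unfolding block_def by (cases "X $ i $ k = 0"; cases "X $ k $ j = 0") auto
  then have "(\<Sum>k\<in>UNIV. X $ i $ k * X $ k $ j) = 0" for i j by (intro sum.neutral) blast
  then show ?thesis by (simp add: vec_eq_iff matrix_matrix_mult_def)
qed

lemma block_Q_left_kernel:
  fixes X A :: "'k::field^('n::finite + 'm::finite)^('n + 'm)"
  assumes X: "X \<in> block b" and u: "transpose X *v u = 0"
  shows "transpose (X ** (X ** A - A ** X) - (X ** A - A ** X) ** X) *v u = 0"
proof -
  have "X ** (X ** A - A ** X) - (X ** A - A ** X) ** X = - (X ** (A ** X) + X ** (A ** X))"
    using block_square_zero[OF X]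
    by (simp add: matrix_algebra_rules matrix_mul_assoc) (simp add: matrix_mul_assoc[symmetric])
  also have "\<dots> = X ** (- (A ** X + A ** X))" by (simp only: matrix_algebra_rules)
  finally have eq: "X ** (X ** A - A ** X) - (X ** A - A ** X) ** X = X ** (- (A ** X + A ** X))" .
  have "transpose (X ** W) *v u = transpose W *v (transpose X *v u)" for W
    by (simp only: matrix_transpose_mul matrix_vector_mul_assoc)
  then show ?thesis unfolding eq u by simp
qed

lemma finite_dim_matrix_space:
  assumes "lie_scale L = (matrix_scale :: 'k::field \<Rightarrow> 'k^'n::finite^'n \<Rightarrow> 'k^'n^'n)" "lie_algebra L"
  shows "lie_finite_dim L"
proof -
  interpret vector_space "matrix_scale :: 'k \<Rightarrow> 'k^'n^'n \<Rightarrow> 'k^'n^'n" by (rule vector_space_matrix_scale)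
  let ?E = "\<lambda>(i, j). (\<chi> k l. if k = i \<and> l = j then 1 else 0) :: 'k^'n^'n"
  let ?C = "range ?E"
  have "M \<in> span ?C" for M
  proof -
    have "M = (\<Sum>p\<in>UNIV. matrix_scale (M $ fst p $ snd p) (?E p))"
    proof (simp add: vec_eq_iff, intro allI)
      fix k l
      have "(\<Sum>p\<in>UNIV. matrix_scale (M $ fst p $ snd p) (?E p) $ k $ l)
          = (\<Sum>p\<in>UNIV. if p = (k, l) then M $ k $ l else 0)"
        by (rule sum.cong) (auto simp: matrix_scale_def split: if_splits)
      then show "M $ k $ l = (\<Sum>p\<in>UNIV. matrix_scale (M $ fst p $ snd p) (?E p) $ k $ l)" by simp
    qed
    moreover have "(\<Sum>p\<in>UNIV. matrix_scale (M $ fst p $ snd p) (?E p)) \<in> span ?C"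
      by (intro span_sum span_scale span_base rangeI)
    ultimately show ?thesis by simp
  qed
  then have "lie_carrier L \<subseteq> span ?C" by blast
  moreover have "subspace (lie_carrier L)" using assms by (simp add: lie_algebra_def)
  moreover have "finite ?C" by simp
  ultimately obtain B where "finite B" "independent B" "span B = lie_carrier L" "card B \<le> card ?C"
    using finite_dim_subspace_basis[of "lie_carrier L" ?C] by metis
  then show ?thesis unfolding lie_finite_dim_def assms(1) by metis
qed

lemma matrix_pair_reducible:
  fixes L :: "('k::{alg_closed_field,field_char_0}, 'k^('n::finite + 'm::finite)^('n + 'm)) lie_alg"
    and b :: bool
  defines "s \<equiv> diag_matrix (\<lambda>i. if isl i = b then 1 / 2 else - (1 / 2))"
  assumes L: "lie_algebra L" "lie_scale L = matrix_scale" "lie_bracket L = (\<lambda>M N. M ** N - N ** M)"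
    and s: "s \<in> lie_carrier L"
    and odd: "minus_eigenspace L \<sigma> = {M \<in> lie_carrier L. \<forall>i j. isl i = isl j \<longrightarrow> M $ i $ j = 0}"
    and U: "U \<in> block b \<inter> lie_carrier L" "U' \<in> block (\<not> b) \<inter> lie_carrier L"
    and h: "U ** U' - U' ** U = diag_matrix d"
    and inj: "\<And>Z i j. Z \<in> block b \<inter> lie_carrier L \<Longrightarrow> isl i = b \<Longrightarrow> isl j = (\<not> b) \<Longrightarrow> d i = d j \<Longrightarrow> Z $ i $ j = 0"
    and ker: "\<And>X. X \<in> block b \<inter> lie_carrier L \<Longrightarrow>
        \<exists>u. transpose X *v u = 0 \<and> (\<exists>Y\<in>block b \<inter> lie_carrier L. transpose Y *v u \<noteq> 0)"
  shows "commuting_variety_reducible L \<sigma>"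
proof -
  obtain br where ls: "lie_space (lie_scale L) (lie_carrier L) br"
    and br0: "\<And>x y. x \<in> lie_carrier L \<Longrightarrow> y \<in> lie_carrier L \<Longrightarrow> br x y = lie_bracket L x y"
    using lie_space_of_lie_alg[OF L(1) finite_dim_matrix_space[OF L(2,1)]] by blast
  have br: "br x y = x ** y - y ** x" if "x \<in> lie_carrier L" "y \<in> lie_carrier L" for x y
    using br0[OF that] L(3) by simp
  interpret lie_space "lie_scale L" "lie_carrier L" br by (rule ls)
  have brs: "br s M $ i $ j = (if isl i = isl j then 0 else if isl i = b then M $ i $ j else - M $ i $ j)"
    if "M \<in> lie_carrier L" for M i j
    unfolding br[OF s that] unfolding s_def diag_matrix_commutator by auto
  interpret three_graded "lie_scale L" "lie_carrier L" br s
  proof unfold_locales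
    show "br s (br s (br s x)) = br s x" if "x \<in> lie_carrier L" for x
      using that by (simp add: vec_eq_iff brs)
  qed (rule s)
  have "br s M = M \<longleftrightarrow> M \<in> block b" if "M \<in> lie_carrier L" for M
    unfolding block_def vec_eq_iff brs[OF that] by (auto split: if_splits) 
  then have Vp: "Vp = block b \<inter> lie_carrier L" by (auto simp: eig_def)
  have "br s M = - M \<longleftrightarrow> M \<in> block (\<not> b)" if "M \<in> lie_carrier L" for M
    unfolding block_def vec_eq_iff vector_uminus_component brs[OF that] by (auto split: if_splits)
  then have Vm: "Vm = block (\<not> b) \<inter> lie_carrier L" by (auto simp: eig_def)
  show ?thesis
  proof (rule three_graded_commuting_variety_reducible[OF three_graded_axioms])
    show "minus_eigenspace L \<sigma> = odd_part"
      unfolding odd odd_part_def by (auto simp: vec_eq_iff brs split: if_splits)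
    show "U \<in> Vp" "U' \<in> Vm" unfolding Vp Vm by fact+
  next
    fix Z assume Z: "Z \<in> Vp" "br (br U U') Z = 0"
    have brU: "br U U' = diag_matrix d" using br[of U U'] U h by simp
    then have dg: "diag_matrix d \<in> lie_carrier L" by (metis br_in)
    have "br (diag_matrix d) Z = diag_matrix d ** Z - Z ** diag_matrix d"
      by (rule br[OF dg VpD(1)[OF Z(1)]])
    then have 0: "(d i - d j) * Z $ i $ j = 0" for i j
      using Z(2) unfolding brU diag_matrix_commutator[symmetric] by simp
    show "Z = 0"
    proof (simp add: vec_eq_iff, intro allI)
      fix i j show "Z $ i $ j = 0"
        using 0[of i j] inj[of Z i j] Z(1) unfolding Vp by (auto simp: block_def)
    qed
  next
    fix X assume X: "X \<in> Vp"
    then have "X \<in> block b \<inter> lie_carrier L" unfolding Vp .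
    from ker[OF this] obtain u Y where u: "transpose X *v u = 0" "Y \<in> Vp" "transpose Y *v u \<noteq> 0"
      unfolding Vp by blast
    have "transpose (Q X A) *v u = 0" if "A \<in> Vm" for A
    proof -
      have XA: "X \<in> lie_carrier L" "A \<in> lie_carrier L" using X that by (auto simp: Vp Vm)
      have "Q X A = X ** (X ** A - A ** X) - (X ** A - A ** X) ** X"
        using br[OF XA(1) br_in[of X A]] br[OF XA] by simp
      then show ?thesis using block_Q_left_kernel[of X b u A] X u(1) unfolding Vp by auto
    qed
    then have "Y \<notin> (\<lambda>a. br X (br X a)) ` Vm" using u(3) by force
    then show "\<exists>y\<in>Vp. y \<notin> (\<lambda>a. br X (br X a)) ` Vm" using u(2) by (rule bexI)
  qed (rule br0)
qed

lemma block_left_null: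
  fixes X :: "'k::field^('n::finite + 'm::finite)^('n + 'm)"
  assumes X: "X \<in> block b" and card: "card {i::'n + 'm. isl i = (\<not> b)} < card {i::'n + 'm. isl i = b}"
  shows "\<exists>u. transpose X *v u = 0 \<and> (\<exists>i. isl i = b \<and> u $ i \<noteq> 0)"
proof -
  let ?I = "{i::'n + 'm. isl i = b}" and ?J = "{i::'n + 'm. isl i = (\<not> b)}"
  let ?e = "\<lambda>j. axis j 1 :: 'k^('n + 'm)"
  have row: "X $ i \<in> vec.span (?e ` ?J)" for i
  proof -
    have "X $ i = (\<Sum>j\<in>?J. X $ i $ j *s ?e j)"
    proof (simp add: vec_eq_iff axis_def, intro allI)
      fix k
      have "(\<Sum>j\<in>?J. X $ i $ j * (if k = j then 1 else 0)) = (if k \<in> ?J then X $ i $ k else 0)"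
        by (simp add: mult_delta_right sum.delta' if_distrib cong: if_cong)
      then show "X $ i $ k = (\<Sum>j\<in>?J. X $ i $ j * (if k = j then 1 else 0))"
        using X unfolding block_def by auto
    qed
    also have "\<dots> \<in> vec.span (?e ` ?J)" by (intro vec.span_sum vec.span_scale vec.span_base imageI)
    finally show ?thesis .
  qed
  have "\<not> vec.indep_family ?I (\<lambda>i. X $ i)"
  proof
    assume "vec.indep_family ?I (\<lambda>i. X $ i)"
    from vec.indep_family_card[OF _ this, of "?e ` ?J"] row
    have "card ?I \<le> card (?e ` ?J)" by auto
    also have "\<dots> \<le> card ?J" by (intro card_image_le) simp
    finally show False using card by simp
  qed
  then obtain c i where c: "(\<Sum>i\<in>?I. c i *s X $ i) = 0" "i \<in> ?I" "c i \<noteq> 0"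
    unfolding vec.indep_family_def by blast
  define u where "u = (\<chi> i. if isl i = b then c i else 0)"
  have "(transpose X *v u) $ j = (\<Sum>i\<in>?I. c i *s X $ i) $ j" for j
    by (simp add: matrix_vector_mult_def transpose_def u_def mult_delta_right if_distrib[of "\<lambda>x. _ * x"]
        sum.If_cases mult.commute del: transpose_matrix_vector)
  then have "transpose X *v u = 0" unfolding c(1) by (simp add: vec_eq_iff del: transpose_matrix_vector)
  moreover have "isl i = b \<and> u $ i \<noteq> 0" using c by (simp add: u_def)
  ultimately show ?thesis by blast
qed

definition unit_matrix :: "'i \<Rightarrow> 'j \<Rightarrow> 'k::zero_neq_one^'j::finite^'i::finite" where
  "unit_matrix i j = (\<chi> k l. if k = i \<and> l = j then 1 else 0)"

lemma transpose_unit_matrix_mult: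
  fixes u :: "'k::field^'n::finite"
  shows "(transpose (unit_matrix i j :: 'k^'n^'n) *v u) $ j = u $ i"
  by (simp add: matrix_vector_mult_def transpose_def unit_matrix_def mult_delta_left del: transpose_matrix_vector)

text \<open>The grading is chosen such that \<open>x \<in> V\<^sub>+\<close> is a matrix with more rows than columns, so \<open>x a x\<close> cannot
  run through all such matrices.\<close>

lemma reducible_gl:
  assumes "CARD('n::finite) \<noteq> CARD('m::finite)"
  shows "commuting_variety_reducible
    (gl :: ('k::{alg_closed_field,field_char_0}, 'k^('n + 'm)^('n + 'm)) lie_alg) sigma_gl"
proof -
  let ?L = "gl :: ('k, 'k^('n + 'm)^('n + 'm)) lie_alg"
  define b where "b = (CARD('n) > CARD('m))"
  let ?I = "{i::'n + 'm. isl i = b}" and ?J = "{i::'n + 'm. isl i = (\<not> b)}"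
  have "x \<in> {i::'n + 'm. isl i} \<longleftrightarrow> x \<in> range Inl" "x \<in> {i::'n + 'm. \<not> isl i} \<longleftrightarrow> x \<in> range Inr" for x
    by (cases x; auto)+
  then have "{i::'n + 'm. isl i} = range Inl" "{i::'n + 'm. \<not> isl i} = range Inr" by blast+
  then have "card {i::'n + 'm. isl i} = CARD('n)" "card {i::'n + 'm. \<not> isl i} = CARD('m)"
    by (simp_all add: card_image)
  then have card: "card ?J < card ?I" using assms by (cases b) (auto simp: b_def)
  then obtain \<iota> where \<iota>: "\<iota> ` ?J \<subseteq> ?I" "inj_on \<iota> ?J"
    using card_le_inj[of ?J ?I] by auto
  define j0 :: "'n + 'm" where "j0 = (if b then Inr undefined else Inl undefined)"
  have j0: "j0 \<in> ?J" by (simp add: j0_def)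
  define U :: "'k^('n + 'm)^('n + 'm)" where "U = (\<chi> i j. if j \<in> ?J \<and> i = \<iota> j then 1 else 0)"
  define d where "d i = (if i \<in> \<iota> ` ?J then 1 else 0) - (if i \<in> ?J then 1 else 0 :: 'k)" for i
  have 1: "(U ** transpose U) $ i $ k = (if i = k \<and> i \<in> \<iota> ` ?J then 1 else 0)" for i k
  proof (cases "i = k \<and> i \<in> \<iota> ` ?J")
    case True
    then obtain j where j: "j \<in> ?J" "i = \<iota> j" by blast
    have "l \<in> ?J \<and> \<iota> j = \<iota> l \<longleftrightarrow> l = j" for l
      using inj_on_eq_iff[OF \<iota>(2) _ j(1), of l] j(1) by auto
    then have "U $ \<iota> j $ l = (if l = j then 1 else 0)" for l
      unfolding U_def by (simp only: vec_lambda_beta)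
    moreover have "i = \<iota> j" "k = \<iota> j" using True j by auto
    ultimately have "U $ i $ l * U $ k $ l = (if l = j then 1 else 0)" for l by simp
    then have "(U ** transpose U) $ i $ k = (\<Sum>l\<in>UNIV. if l = j then 1 else 0)"
      by (simp add: matrix_matrix_mult_def transpose_def)
    then show ?thesis unfolding if_P[OF True] by simp
  next
    case False
    then have "(U ** transpose U) $ i $ k = (\<Sum>l\<in>UNIV. 0)"
      unfolding matrix_matrix_mult_def by (auto simp: U_def transpose_def intro!: sum.neutral)
    then show ?thesis using False by simp
  qed
  have 2: "(transpose U ** U) $ j $ l = (if j = l \<and> j \<in> ?J then 1 else 0)" for j l
  proof (cases "j = l \<and> j \<in> ?J")
    case True
    then have "U $ i $ j * U $ i $ l = (if i = \<iota> j then 1 else 0)" for i by (auto simp: U_def)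
    then have "(transpose U ** U) $ j $ l = (\<Sum>i\<in>UNIV. if i = \<iota> j then 1 else 0)"
      by (simp add: matrix_matrix_mult_def transpose_def)
    then show ?thesis unfolding if_P[OF True] by simp
  next
    case False
    then have z: "U $ i $ j * U $ i $ l = 0" for i
      using inj_on_eq_iff[OF \<iota>(2), of j l] by (cases "j \<in> ?J"; cases "l \<in> ?J") (simp_all add: U_def)
    have "(transpose U ** U) $ j $ l = (\<Sum>i\<in>UNIV. U $ i $ j * U $ i $ l)"
      by (simp add: matrix_matrix_mult_def transpose_def)
    also have "\<dots> = 0" by (intro sum.neutral ballI z)
    finally show ?thesis unfolding if_not_P[OF False] .
  qed
  show ?thesis
  proof (rule matrix_pair_reducible[where b = b and U = U and U' = "transpose U" and d = d])
    show "minus_eigenspace ?L sigma_gl = {M \<in> lie_carrier ?L. \<forall>i j. isl i = isl j \<longrightarrow> M $ i $ j = 0}"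
      unfolding minus_eigenspace_gl by (auto simp: gl_def split_sum_all_UNIV)
    show "U \<in> block b \<inter> lie_carrier ?L" "transpose U \<in> block (\<not> b) \<inter> lie_carrier ?L"
      using \<iota>(1) by (auto simp: block_def U_def transpose_def gl_def)
    show "U ** transpose U - transpose U ** U = diag_matrix d"
      by (auto simp: vec_eq_iff 1 2 diag_matrix_def d_def)
    show "Z $ i $ j = 0" if "isl i = b" "isl j = (\<not> b)" "d i = d j" for Z :: "'k^('n + 'm)^('n + 'm)" and i j
      using that \<iota>(1) by (auto simp: d_def split: if_splits)
  next
    fix X assume "X \<in> block b \<inter> lie_carrier ?L"
    then obtain u i where u: "transpose X *v u = 0" "isl i = b" "u $ i \<noteq> 0"
      using block_left_null[OF _ card, of X] by auto
    have "transpose (unit_matrix i j0) *v u \<noteq> 0"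
      using transpose_unit_matrix_mult[of i j0 u] u(3) by (metis zero_index)
    moreover have "unit_matrix i j0 \<in> block b \<inter> lie_carrier ?L"
      using u j0 by (auto simp: block_def unit_matrix_def gl_def)
    ultimately show "\<exists>u. transpose X *v u = 0 \<and> (\<exists>Y\<in>block b \<inter> lie_carrier ?L. transpose Y *v u \<noteq> 0)"
      using u(1) by blast
  qed (simp_all add: lie_algebra_gl, simp_all add: gl_def)
qed

lemma odd_skew_kernel:
  fixes A :: "'k::field_char_0^'r::finite^'r"
  assumes "odd CARD('r)" and A: "transpose A = - A"
  shows "\<exists>u. u \<noteq> 0 \<and> A *v u = 0"
proof -
  have "- A = (\<chi> i. (- 1) *s A $ i)" by (simp add: vec_eq_iff)
  then have "det (- A) = (- 1) ^ CARD('r) * det (\<chi> i. A $ i)"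
    by (simp only: det_rows_mul) simp
  then have "det (- A) = - det A" using assms(1) by simp
  moreover have "det (- A) = det A" using A det_transpose[of A] by simp
  ultimately have "det A = 0" by simp
  then show ?thesis using invertible_det_nz invertible_left_inverse matrix_left_invertible_ker by metis
qed

text \<open>A fixed point free involution of all but one element of a set of odd size, with a sign that it
  reverses: the pattern of a symplectic matrix on the complement of one basis vector.\<close>

lemma odd_pairing:
  assumes "odd CARD('r::finite)"
  obtains \<tau> :: "'r::finite \<Rightarrow> 'r" and g :: "'r::finite \<Rightarrow> int" and r where
    "\<And>i. \<tau> (\<tau> i) = i" "\<And>i. g (\<tau> i) = - g i" "\<And>i. g i * g i = (if i = r then 0 else 1)"
proof -
  obtain p where p: "CARD('r) = 2 * p + 1" using assms by (rule oddE)
  obtain h where h: "bij_betw h (UNIV :: 'r set) {0..<2 * p + 1}"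
    using ex_bij_betw_finite_nat[of "UNIV :: 'r set"] p by auto
  define k where "k = the_inv_into UNIV h"
  have kh: "k (h i) = i" for i using h by (simp add: k_def bij_betw_def the_inv_into_f_f)
  have hk: "h (k n) = n" if "n < 2 * p + 1" for n
    using h that by (simp add: k_def bij_betw_def f_the_inv_into_f)
  have hlt: "h i < 2 * p + 1" for i using h by (auto simp: bij_betw_def)
  define t where "t n = (if n = 2 * p then n else if even n then n + 1 else n - 1)" for n
  define s where "s n = (if n = 2 * p then 0 else if even n then 1 else - 1 :: int)" for n
  have t: "t n < 2 * p + 1" "t (t n) = n" "s (t n) = - s n" if "n < 2 * p + 1" for n
  proof -
    show "t n < 2 * p + 1" using that by (auto simp: t_def elim!: evenE)
    show "t (t n) = n" "s (t n) = - s n" using that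
      by (auto simp: t_def s_def elim!: evenE oddE)
  qed
  show ?thesis
  proof (rule that[of "\<lambda>i. k (t (h i))" "\<lambda>i. s (h i)" "k (2 * p)"])
    show "k (t (h (k (t (h i))))) = i" for i using t[OF hlt[of i]] by (simp add: hk kh)
    show "s (h (k (t (h i)))) = - s (h i)" for i using t[OF hlt[of i]] by (simp add: hk)
    show "s (h i) * s (h i) = (if i = k (2 * p) then 0 else 1)" for i
      using kh[of i] hk[of "2 * p"] by (auto simp: s_def)
  qed
qed

text \<open>A skew matrix of odd size is singular, so \<open>x a x\<close> does not run through all skew matrices.\<close>

lemma reducible_so:
  assumes odd: "odd CARD('r::finite)" and ge: "CARD('r) \<ge> 3"
  shows "commuting_variety_reducible
    (so_even :: ('k::{alg_closed_field,field_char_0}, 'k^('r + 'r)^('r + 'r)) lie_alg) sigma_so"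
proof -
  let ?L = "so_even :: ('k, 'k^('r + 'r)^('r + 'r)) lie_alg"
  obtain \<tau> :: "'r \<Rightarrow> 'r" and g :: "'r \<Rightarrow> int" and r where
    \<tau>: "\<And>i. \<tau> (\<tau> i) = i" and g: "\<And>i. g (\<tau> i) = - g i" "\<And>i. g i * g i = (if i = r then 0 else 1)"
    using odd_pairing[OF odd] by metis
  define \<omega> :: "'r \<Rightarrow> 'r \<Rightarrow> 'k" where "\<omega> i j = (if j = \<tau> i then of_int (g i) else 0)" for i j
  have skew: "\<omega> j i = - \<omega> i j" for i j using \<tau> g(1) by (auto simp: \<omega>_def)
  have sq: "(\<Sum>j\<in>UNIV. \<omega> i j * \<omega> k j) = (if i = k \<and> i \<noteq> r then 1 else 0)" for i k
  proof -
    have "(\<Sum>j\<in>UNIV. \<omega> i j * \<omega> k j) = (\<Sum>j\<in>UNIV. if j = \<tau> i then (if i = k then of_int (g i * g i) else 0) else 0)"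
      using \<tau> by (intro sum.cong) (auto simp: \<omega>_def, metis)
    then show ?thesis by (auto simp: g(2))
  qed
  have sq': "(\<Sum>j\<in>UNIV. \<omega> j i * \<omega> j k) = (if i = k \<and> i \<noteq> r then 1 else 0)" for i k
    using sq[of i k] by (simp add: skew[of i] skew[of k])
  define U :: "'k^('r + 'r)^('r + 'r)" where
    "U = (\<chi> i j. case (i, j) of (Inl a, Inr b) \<Rightarrow> \<omega> a b | _ \<Rightarrow> 0)"
  define d :: "'r + 'r \<Rightarrow> 'k" where
    "d i = (case i of Inl a \<Rightarrow> if a = r then 0 else 1 | Inr a \<Rightarrow> if a = r then 0 else - 1)" for i
  have sc: "lie_scale ?L = matrix_scale" and brk: "lie_bracket ?L = (\<lambda>M N. M ** N - N ** M)"
    by (simp_all add: so_even_def so_form_def gl_def)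
  show ?thesis
  proof (rule matrix_pair_reducible[where b = True and U = U and U' = "transpose U" and d = d])
    show "lie_algebra ?L" unfolding so_even_def by (rule lie_algebra_so_form)
    show "diag_matrix (\<lambda>i. if isl i = True then 1 / 2 else - (1 / 2)) \<in> lie_carrier ?L"
      by (auto simp: in_so_even_iff diag_matrix_def)
    show "minus_eigenspace ?L sigma_so = {M \<in> lie_carrier ?L. \<forall>i j. isl i = isl j \<longrightarrow> M $ i $ j = 0}"
    proof -
      have "sigma_so M = - M \<longleftrightarrow> (\<forall>i j. isl i = isl j \<longrightarrow> M $ i $ j = 0)" for M :: "'k^('r + 'r)^('r + 'r)"
        unfolding vec_eq_iff sigma_so_entry by (auto simp: eq_neg_iff_add_eq_0 simp flip: mult_2)
      then show ?thesis unfolding minus_eigenspace_def by simp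
    qed
    have "U \<in> lie_carrier ?L" "transpose U \<in> lie_carrier ?L"
      unfolding in_so_even_iff U_def transpose_def by (auto intro: skew)
    moreover have "U \<in> block True" "transpose U \<in> block (\<not> True)"
      by (simp_all add: block_def split_sum_all_UNIV U_def transpose_def)
    ultimately show "U \<in> block True \<inter> lie_carrier ?L" "transpose U \<in> block (\<not> True) \<inter> lie_carrier ?L"
      by simp_all
    show "U ** transpose U - transpose U ** U = diag_matrix d"
      by (simp add: vec_eq_iff split_sum_all_UNIV matrix_matrix_mult_def sum_UNIV_Plus U_def
          transpose_def sq sq' diag_matrix_def d_def)
    show "Z $ i $ j = 0" if Z: "Z \<in> block True \<inter> lie_carrier ?L" and ij: "isl i = True" "isl j = (\<not> True)" "d i = d j"
      for Z i j
    proof -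
      obtain a b where ab: "i = Inl a" "j = Inr b" using ij by (cases i; cases j) auto
      then have "a = r" "b = r" using ij(3) by (auto simp: d_def split: if_splits)
      moreover have "Z $ Inl r $ Inr r = - Z $ Inl r $ Inr r" using Z unfolding in_so_even_iff Int_iff by blast
      ultimately show ?thesis using ab by simp
    qed
  next
    fix X assume X: "X \<in> block True \<inter> lie_carrier ?L"
    define A :: "'k^'r^'r" where "A = (\<chi> b a. X $ Inl a $ Inr b)"
    have sk: "X $ Inl i $ Inr j = - X $ Inl j $ Inr i" for i j using X unfolding in_so_even_iff Int_iff by blast
    have "transpose A $ i $ j = (- A) $ i $ j" for i j
      unfolding A_def transpose_def vector_uminus_component vec_lambda_beta by (rule sk)
    then have "transpose A = - A" unfolding vec_eq_iff by blast
    then obtain u0 where u0: "u0 \<noteq> 0" "A *v u0 = 0" using odd_skew_kernel[OF odd] by blast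
    define u :: "'k^('r + 'r)" where "u = (\<chi> i. case i of Inl a \<Rightarrow> u0 $ a | Inr a \<Rightarrow> 0)"
    have A0: "(\<Sum>a\<in>UNIV. X $ Inl a $ Inr b * u0 $ a) = 0" for b
      using u0(2) by (simp add: A_def matrix_vector_mult_def vec_eq_iff)
    have X0: "X $ i $ j = 0" if "\<not> (isl i \<and> \<not> isl j)" for i j using X that by (auto simp: block_def)
    have "(transpose X *v u) $ j = 0" for j
      using A0 X0 by (cases j) (auto simp: matrix_vector_mult_def transpose_def u_def sum_UNIV_Plus
        simp del: transpose_matrix_vector)
    then have Xu: "transpose X *v u = 0" by (simp add: vec_eq_iff del: transpose_matrix_vector)
    obtain a where a: "u0 $ a \<noteq> 0" using u0(1) by (auto simp: vec_eq_iff)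
    have "\<exists>b. b \<noteq> a"
    proof (rule ccontr)
      assume "\<nexists>b. b \<noteq> a"
      then have "(UNIV :: 'r set) = {a}" by auto
      then have "CARD('r) = 1" by (metis card_1_singleton_iff One_nat_def)
      then show False using ge by simp
    qed
    then obtain b where b: "b \<noteq> a" by blast
    define Y :: "'k^('r + 'r)^('r + 'r)" where
      "Y = unit_matrix (Inl a) (Inr b) - unit_matrix (Inl b) (Inr a)"
    have "(transpose Y *v u) $ Inr b = u0 $ a"
      using b by (simp add: Y_def matrix_vector_mult_def transpose_def unit_matrix_def sum_UNIV_Plus u_def
        mult_delta_left del: transpose_matrix_vector)
    then have "transpose Y *v u \<noteq> 0" using a by (metis zero_index)
    moreover have "Y \<in> block True \<inter> lie_carrier ?L"
      using b by (auto simp: Y_def block_def unit_matrix_def in_so_even_iff split: if_splits)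
    ultimately show "\<exists>u. transpose X *v u = 0 \<and> (\<exists>Y\<in>block True \<inter> lie_carrier ?L. transpose Y *v u \<noteq> 0)"
      using Xu by blast
  qed (fact sc brk)+
qed

section \<open>Traces\<close>

definition (in vector_space) trace_on :: "'b set \<Rightarrow> ('b \<Rightarrow> 'b) \<Rightarrow> 'a" where
  "trace_on B f = (\<Sum>b\<in>B. representation B (f b) b)"

context vector_space begin

lemma representation_lmap:
  assumes B: "finite B" "independent B" "span B = W" and f: "lmap f" and x: "x \<in> W"
    and D: "finite D" "independent D" "\<And>b. b \<in> B \<Longrightarrow> f b \<in> span D"
  shows "representation D (f x) d = (\<Sum>b\<in>B. representation B x b * representation D (f b) d)"
proof -
  have "f x = f (\<Sum>b\<in>B. scale (representation B x b) b)"
    using sum_representation_eq[of B x B] B x by simp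
  also have "\<dots> = (\<Sum>b\<in>B. scale (representation B x b) (f b))"
    by (simp add: lin_sum[OF f] lin_scale[OF f])
  finally have fx: "f x = (\<Sum>b\<in>B. scale (representation B x b) (f b))" .
  have "representation D (f x) = (\<lambda>d. \<Sum>b\<in>B. representation D (scale (representation B x b) (f b)) d)"
    unfolding fx by (rule representation_sum[OF D(2)]) (use D(3) span_scale in blast)
  then show ?thesis using D by (simp add: representation_scale)
qed

lemma trace_on_cyclic:
  assumes B: "finite B" "independent B" and C: "finite C" "independent C"
    and f: "lmap f" "\<And>b. b \<in> B \<Longrightarrow> f b \<in> span C" and g: "lmap g" "\<And>c. c \<in> C \<Longrightarrow> g c \<in> span B"
  shows "trace_on B (\<lambda>x. g (f x)) = trace_on C (\<lambda>x. f (g x))"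
proof -
  have "trace_on B (\<lambda>x. g (f x)) = (\<Sum>b\<in>B. \<Sum>c\<in>C. representation C (f b) c * representation B (g c) b)"
    unfolding trace_on_def
    by (rule sum.cong[OF refl], rule representation_lmap[OF C refl g(1) f(2) B g(2)])
  also have "\<dots> = (\<Sum>c\<in>C. \<Sum>b\<in>B. representation C (f b) c * representation B (g c) b)"
    by (rule sum.swap)
  also have "\<dots> = (\<Sum>c\<in>C. \<Sum>b\<in>B. representation B (g c) b * representation C (f b) c)"
    by (simp only: mult.commute)
  also have "\<dots> = trace_on C (\<lambda>x. f (g x))"
    unfolding trace_on_def
    by (rule sum.cong[OF refl], rule representation_lmap[OF B refl f(1) g(2) C f(2), symmetric])
  finally show ?thesis .
qed

lemma trace_on_basis_change:
  assumes "finite B" "independent B" "finite C" "independent C" "span B = span C"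
    and "lmap f" "\<And>x. x \<in> span B \<Longrightarrow> f x \<in> span B"
  shows "trace_on B f = trace_on C f"
  using trace_on_cyclic[OF assms(1-4), of "\<lambda>x. x" f] assms lin_id span_base by auto

lemma trace_on_add:
  assumes "independent B" "\<And>b. b \<in> B \<Longrightarrow> f b \<in> span B" "\<And>b. b \<in> B \<Longrightarrow> g b \<in> span B"
  shows "trace_on B (\<lambda>x. f x + g x) = trace_on B f + trace_on B g"
  unfolding trace_on_def using assms by (simp add: representation_add sum.distrib)

lemma trace_on_scale:
  assumes "independent B" "\<And>b. b \<in> B \<Longrightarrow> f b \<in> span B"
  shows "trace_on B (\<lambda>x. scale c (f x)) = c * trace_on B f"
  unfolding trace_on_def using assms by (simp add: representation_scale sum_distrib_left)

lemma trace_on_diagonal: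
  assumes "independent B" "\<And>b. b \<in> B \<Longrightarrow> f b = scale (d b) b"
  shows "trace_on B f = (\<Sum>b\<in>B. d b)"
  unfolding trace_on_def using assms
  by (intro sum.cong) (simp_all add: representation_scale span_base representation_basis)

end

context lie_space begin

definition endo :: "('g \<Rightarrow> 'g) \<Rightarrow> bool" where
  "endo f \<longleftrightarrow> lmap f \<and> (\<forall>x. f x \<in> G)"

end

context lie_space begin

lemma endo_lmap: "endo f \<Longrightarrow> lmap f" and endo_in: "endo f \<Longrightarrow> f x \<in> G" by (auto simp: endo_def)
lemma endo_br: "endo (br x)" by (simp add: endo_def lin_br)
lemma endo_comp: "endo f \<Longrightarrow> endo g \<Longrightarrow> endo (\<lambda>x. f (g x))" by (simp add: endo_def lin_comp)
lemma endo_diff: "endo f \<Longrightarrow> endo g \<Longrightarrow> endo (\<lambda>x. f x - g x)"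
  by (simp add: endo_def lin_minus G_closed)
lemma endo_add: "endo f \<Longrightarrow> endo g \<Longrightarrow> endo (\<lambda>x. f x + g x)"
  by (simp add: endo_def lin_plus G_closed)
lemma endo_smult: "endo f \<Longrightarrow> endo (\<lambda>x. c \<odot> f x)"
  by (simp add: endo_def lin_smult G_closed)

definition "GB = (SOME B. finite B \<and> independent B \<and> span B = G)"

lemma GB: "finite GB" "independent GB" "span GB = G"
proof -
  obtain B where "finite B" "independent B" "span B = G" by (rule G_basis)
  then have "\<exists>B. finite B \<and> independent B \<and> span B = G" by blast
  from someI_ex[OF this] show "finite GB" "independent GB" "span GB = G" unfolding GB_def by auto
qed

lemma GB_in: "b \<in> GB \<Longrightarrow> b \<in> G" using span_base[of b GB] GB by auto

definition "tr f = trace_on GB f"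

lemma tr_basis:
  assumes "finite B" "independent B" "span B = G" "endo f"
  shows "tr f = trace_on B f"
  unfolding tr_def using assms endo_lmap endo_in GB by (intro trace_on_basis_change) auto

lemma tr_cong: "(\<And>x. x \<in> G \<Longrightarrow> f x = g x) \<Longrightarrow> tr f = tr g"
  unfolding tr_def trace_on_def by (intro sum.cong refl) (simp add: GB_in)

lemma tr_comm: "endo f \<Longrightarrow> endo g \<Longrightarrow> tr (\<lambda>x. f (g x)) = tr (\<lambda>x. g (f x))"
  unfolding tr_def by (intro trace_on_cyclic) (auto simp: GB endo_lmap endo_in)

lemma tr_add: "endo f \<Longrightarrow> endo g \<Longrightarrow> tr (\<lambda>x. f x + g x) = tr f + tr g"
  unfolding tr_def by (intro trace_on_add) (auto simp: GB endo_in)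

lemma tr_scale: "endo f \<Longrightarrow> tr (\<lambda>x. c \<odot> f x) = c * tr f"
  unfolding tr_def by (intro trace_on_scale) (auto simp: GB endo_in)

lemma tr_diff: assumes "endo f" "endo g" shows "tr (\<lambda>x. f x - g x) = tr f - tr g"
proof -
  have "tr (\<lambda>x. f x + (-1) \<odot> g x) = tr f + (-1) * tr g"
    using tr_add[OF assms(1) endo_smult[OF assms(2)], of "-1"] tr_scale[OF assms(2), of "-1"] by simp
  then show ?thesis by simp
qed

lemma nilpotent_on_basis:
  assumes f: "endo f" and nil: "\<And>x. x \<in> G \<Longrightarrow> \<exists>n. (f ^^ n) x = 0"
  shows "\<exists>n. \<forall>x\<in>G. (f ^^ n) x = 0"
proof -
  have lf: "lmap (f ^^ n)" for n
    by (induction n) (use endo_lmap[OF f] in \<open>auto simp: lmap_def\<close>)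
  have f0: "(f ^^ n) 0 = 0" for n using lin_0[OF lf] .
  have mono: "(f ^^ (m + n)) x = 0" if "(f ^^ n) x = 0" for m n x
    using that by (simp add: funpow_add f0)
  obtain n where n: "\<And>x. x \<in> G \<Longrightarrow> (f ^^ n x) x = 0" using nil by metis
  define N where "N = sum n GB"
  have "(f ^^ N) b = 0" if "b \<in> GB" for b
  proof -
    have "n b \<le> N" unfolding N_def using GB(1) that by (rule member_le_sum[rotated 2]) auto
    then show ?thesis using mono[OF n[OF GB_in[OF that]], of "N - n b"] by simp
  qed
  then have "(f ^^ N) x \<in> {0}" if "x \<in> G" for x
    using lin_span_image_subset[OF lf[of N], of GB "{0}" x] that GB by auto
  then show ?thesis by blast
qed

lemma tr_nilpotent:
  assumes f: "endo f" and nil: "\<And>x. x \<in> G \<Longrightarrow> \<exists>n. (f ^^ n) x = 0"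
  shows "tr f = 0"
proof -
  have lf: "lmap (f ^^ n)" for n
    by (induction n) (use endo_lmap[OF f] in \<open>auto simp: lmap_def\<close>)
  define K where "K n = {x \<in> G. (f ^^ n) x = 0}" for n
  have subK: "subspace (K n)" for n
    by (rule subspaceI) (auto simp: K_def G_closed lin_0[OF lf] lin_add[OF lf] lin_scale[OF lf])
  have fK: "f x \<in> K n" if "x \<in> K (Suc n)" for x n
    using that endo_in[OF f] by (auto simp: K_def funpow_swap1)
  have KK: "K n \<subseteq> K (Suc n)" for n
    using lin_0[OF endo_lmap[OF f]] by (auto simp: K_def)
  define adapted where "adapted B W \<longleftrightarrow> (finite B \<and> independent B \<and> span B = W) \<and> (\<forall>b\<in>B. representation B (f b) b = 0)" for B W
  have "\<exists>B. adapted B (K n)" for n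
  proof (induction n)
    case 0
    have "K 0 = {0}" by (auto simp: K_def G_closed)
    then show ?case by (intro exI[of _ "{}"]) (simp add: adapted_def independent_empty)
  next
    case (Suc n)
    then obtain B where ad: "adapted B (K n)" ..
    have B: "finite B" "independent B" "span B = K n"
      using ad[unfolded adapted_def, THEN conjunct1] by - (elim conjE, assumption)+
    have B4: "representation B (f b) b = 0" if "b \<in> B" for b
      using ad[unfolded adapted_def, THEN conjunct2] that by (rule bspec)
    have "B \<subseteq> K (Suc n)" using span_superset[of B] B(3) KK[of n] by simp
    then obtain B' where B': "B \<subseteq> B'" "B' \<subseteq> K (Suc n)" "independent B'" "K (Suc n) \<subseteq> span B'"
      using maximal_independent_subset_extend[of B "K (Suc n)"] B(2) by auto
    have "B' \<subseteq> span GB" using B'(2) GB(3) by (auto simp: K_def)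
    then have fin: "finite B'" using independent_span_bound[OF GB(1) B'(3)] by simp
    have sp: "span B' = K (Suc n)" using B'(2,4) span_minimal[OF B'(2) subK] by simp
    have "representation B' (f b) b = 0" if b: "b \<in> B'" for b
    proof -
      have "f b \<in> span B" unfolding B(3) by (rule fK) (use b B'(2) in auto)
      then have eq: "representation B' (f b) = representation B (f b)"
        by (rule representation_extend[OF B'(3) _ B'(1)])
      show ?thesis
      proof (cases "b \<in> B")
        case True then show ?thesis using eq B4 by simp
      next
        case False then show ?thesis using eq representation_ne_zero[of B "f b" b] by auto
      qed
    qed
    then have "adapted B' (K (Suc n))" unfolding adapted_def using fin B'(3) sp by (intro conjI ballI)
    then show ?case ..
  qed
  note flag = this
  obtain n where "\<forall>x\<in>G. (f ^^ n) x = 0" using nilpotent_on_basis[OF f nil] ..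
  then have "K n = G" by (auto simp: K_def)
  then obtain B where ad: "adapted B G" using flag[of n] by (elim exE) simp
  have B: "finite B" "independent B" "span B = G"
    using ad[unfolded adapted_def, THEN conjunct1] by - (elim conjE, assumption)+
  then show ?thesis using ad[unfolded adapted_def, THEN conjunct2] using tr_basis[OF B(1-3) f] by (simp add: trace_on_def)
qed

lemma tr_commuting_nilpotent:
  assumes f: "endo f" and g: "endo g" and nil: "\<And>x. x \<in> G \<Longrightarrow> \<exists>n. (f ^^ n) x = 0"
    and comm: "\<And>x. x \<in> G \<Longrightarrow> f (g x) = g (f x)"
  shows "tr (\<lambda>x. f (g x)) = 0"
proof (rule tr_nilpotent[OF endo_comp[OF f g]])
  fix x assume x: "x \<in> G"
  have g0: "(g ^^ n) 0 = 0" for n by (induction n) (auto simp: lin_0[OF endo_lmap[OF g]])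
  have fG: "(f ^^ n) x \<in> G" if "x \<in> G" for n x using that by (induction n) (auto simp: endo_in[OF f])
  have gG: "(g ^^ n) x \<in> G" if "x \<in> G" for n x using that by (induction n) (auto simp: endo_in[OF g])
  have fg: "f ((g ^^ n) x) = (g ^^ n) (f x)" if "x \<in> G" for n x
    by (induction n) (auto simp: comm gG that)
  have pow: "((\<lambda>x. f (g x)) ^^ n) x = (g ^^ n) ((f ^^ n) x)" for n
  proof (induction n)
    case (Suc n)
    have "f (g ((g ^^ n) ((f ^^ n) x))) = f ((g ^^ Suc n) ((f ^^ n) x))" by simp
    also have "\<dots> = (g ^^ Suc n) (f ((f ^^ n) x))" by (rule fg) (rule fG[OF x])
    finally show ?case using Suc by simp
  qed simp
  obtain n where "(f ^^ n) x = 0" using nil[OF x] by blast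
  then have "((\<lambda>x. f (g x)) ^^ n) x = 0" unfolding pow by (simp add: g0)
  then show "\<exists>n. ((\<lambda>x. f (g x)) ^^ n) x = 0" by blast
qed

section \<open>Generalized eigenspaces and the semisimple part\<close>

definition "gen f c = {x \<in> G. \<exists>n. ((\<lambda>x. f x - c \<odot> x) ^^ n) x = 0}"

lemma lmap_shift: "lmap f \<Longrightarrow> lmap (\<lambda>x. f x - c \<odot> x)"
  by (intro lin_minus lin_smult lin_id)

lemma lmap_funpow: "lmap f \<Longrightarrow> lmap (f ^^ n)"
  by (induction n) (auto simp: lmap_def)

lemma subspace_gen: assumes "lmap f" shows "subspace (gen f c)"
proof -
  let ?s = "\<lambda>x. f x - c \<odot> x"
  have l: "lmap (?s ^^ n)" for n by (intro lmap_funpow lmap_shift assms)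
  show ?thesis
  proof (rule subspaceI)
    fix x y assume "x \<in> gen f c" "y \<in> gen f c"
    then obtain m n where mn: "(?s ^^ m) x = 0" "(?s ^^ n) y = 0" and G: "x \<in> G" "y \<in> G" by (auto simp: gen_def)
    have "(?s ^^ (n + m)) x = 0" unfolding funpow_add o_apply mn by (rule lin_0[OF l])
    moreover have "(?s ^^ (m + n)) y = 0" unfolding funpow_add o_apply mn by (rule lin_0[OF l])
    ultimately have "(?s ^^ (m + n)) (x + y) = 0" using lin_add[OF l, of "m + n"] by (simp add: add.commute)
    then show "x + y \<in> gen f c" using G by (auto simp: gen_def G_closed)
  next
    fix a x assume "x \<in> gen f c"
    then obtain n where "(?s ^^ n) x = 0" "x \<in> G" by (auto simp: gen_def)
    then have "(?s ^^ n) (a \<odot> x) = 0" using lin_scale[OF l] by simp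
    then show "a \<odot> x \<in> gen f c" using \<open>x \<in> G\<close> by (auto simp: gen_def G_closed)
  next
    show "0 \<in> gen f c" using lin_0[OF l] by (auto simp: gen_def G_closed)
  qed
qed

lemma gen_shiftI:
  assumes "x \<in> G" "f x - c \<odot> x \<in> gen f c" shows "x \<in> gen f c"
proof -
  obtain n where "((\<lambda>x. f x - c \<odot> x) ^^ n) (f x - c \<odot> x) = 0" using assms(2) by (auto simp: gen_def)
  then have "((\<lambda>x. f x - c \<odot> x) ^^ Suc n) x = 0" by (simp only: funpow_Suc_right o_apply)
  then show ?thesis using assms(1) unfolding gen_def by blast
qed

lemma gen_induct [consumes 2, case_names zero step]:
  assumes "x \<in> gen f c" "endo f" "P 0"
    and "\<And>x. x \<in> G \<Longrightarrow> f x - c \<odot> x \<in> gen f c \<Longrightarrow> P (f x - c \<odot> x) \<Longrightarrow> P x"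
  shows "P x"
proof -
  let ?s = "\<lambda>x. f x - c \<odot> x"
  obtain n where "(?s ^^ n) x = 0" "x \<in> G" using assms(1) by (auto simp: gen_def)
  then show ?thesis
  proof (induction n arbitrary: x)
    case 0 then show ?case using assms(3) by simp
  next
    case (Suc n)
    have G: "?s x \<in> G" using Suc.prems(2) endo_in[OF assms(2)] by (simp add: G_closed)
    moreover have "(?s ^^ n) (?s x) = 0" using Suc.prems(1) by (simp only: funpow_Suc_right o_apply)
    ultimately show ?case using assms(4)[OF Suc.prems(2)] Suc.IH[of "?s x"] by (auto simp: gen_def)
  qed
qed

lemma eigenvector_in_gen: "x \<in> G \<Longrightarrow> f x = c \<odot> x \<Longrightarrow> x \<in> gen f c"
  by (auto simp: gen_def intro!: exI[of _ 1])

lemma gen_stable: assumes "x \<in> gen f c" "endo f" shows "f x \<in> gen f c" "f x - c \<odot> x \<in> gen f c"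
proof -
  obtain n where n: "((\<lambda>x. f x - c \<odot> x) ^^ n) x = 0" "x \<in> G" using assms(1) by (auto simp: gen_def)
  have l: "lmap (\<lambda>x. f x - c \<odot> x)" using assms(2) endo_lmap lmap_shift by blast
  have "((\<lambda>x. f x - c \<odot> x) ^^ n) (f x - c \<odot> x) = (\<lambda>x. f x - c \<odot> x) (((\<lambda>x. f x - c \<odot> x) ^^ n) x)"
    by (rule funpow_swap1[symmetric])
  also have "\<dots> = 0" unfolding n using lin_0[OF l] by simp
  finally show 1: "f x - c \<odot> x \<in> gen f c" using n(2) endo_in[OF assms(2)] by (auto simp: gen_def G_closed)
  have "f x = (f x - c \<odot> x) + c \<odot> x" by simp
  also have "\<dots> \<in> gen f c"
    using 1 assms subspace_gen[OF endo_lmap[OF assms(2)]] by (meson subspace_add subspace_scale)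
  finally show "f x \<in> gen f c" .
qed

text \<open>A nonzero generalized eigenspace contains an eigenvector.\<close>

lemma gen_eigenvector:
  assumes "x \<in> gen f c" "x \<noteq> 0" "endo f"
  shows "\<exists>y\<in>G. y \<noteq> 0 \<and> f y = c \<odot> y"
proof -
  have "x \<noteq> 0 \<longrightarrow> (\<exists>y\<in>G. y \<noteq> 0 \<and> f y = c \<odot> y)"
    using assms(1,3)
  proof (induction rule: gen_induct)
    case (step x)
    then show ?case by (cases "f x - c \<odot> x = 0") auto
  qed simp
  then show ?thesis using assms(2) by blast
qed

lemma gen_disjoint:
  assumes f: "endo f" and x: "x \<in> gen f c" "x \<in> gen f d" and cd: "c \<noteq> d"
  shows "x = 0"
proof -
  have "x \<in> gen f d \<longrightarrow> x = 0" using x(1) f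
  proof (induction rule: gen_induct)
    case (step x)
    show ?case
    proof
      assume xd: "x \<in> gen f d"
      have "f x - c \<odot> x \<in> gen f d"
        using gen_stable(1)[OF xd f] xd subspace_gen[OF endo_lmap[OF f]] by (meson subspace_diff subspace_scale)
      then have fx: "f x = c \<odot> x" using step by simp
      have "x \<noteq> 0 \<longrightarrow> False" using xd f fx
      proof (induction rule: gen_induct)
        case (step x)
        have e: "f x - d \<odot> x = (c - d) \<odot> x" using step(4) by (simp add: scale_left_diff_distrib)
        have "f (f x - d \<odot> x) = c \<odot> (f x - d \<odot> x)"
          unfolding e using step(4) lin_scale[OF endo_lmap[OF f]] by (simp add: mult.commute)
        then have "f x - d \<odot> x = 0" using step(3) by blast
        then show ?case unfolding e using cd by simp
      qed simp
      then show "x = 0" by blast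
    qed
  qed simp
  then show ?thesis using x(2) by blast
qed

lemma gen_independent:
  assumes f: "endo f" and F: "finite F" and v: "\<And>c. c \<in> F \<Longrightarrow> v c \<in> gen f c" "(\<Sum>c\<in>F. v c) = 0" and d: "d \<in> F"
  shows "v d = 0"
  using F v d
proof (induction F arbitrary: v d rule: finite_induct)
  case (insert c F)
  let ?s = "\<lambda>x. f x - c \<odot> x"
  obtain n where n: "(?s ^^ n) (v c) = 0" using insert.prems(1)[of c] by (auto simp: gen_def)
  have ls: "lmap (?s ^^ n)" by (intro lmap_funpow lmap_shift endo_lmap f)
  have st: "(?s ^^ n) x \<in> gen f a" if "x \<in> gen f a" for a x n
  proof (induction n)
    case (Suc n)
    then show ?case
      using gen_stable(1)[OF Suc f] subspace_gen[OF endo_lmap[OF f], of a] 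
      by (simp add: subspace_diff subspace_scale)
  qed (use that in simp)
  have vF: "v a = 0" if a: "a \<in> F" for a
  proof -
    have "(\<Sum>a\<in>F. (?s ^^ n) (v a)) = (?s ^^ n) (\<Sum>a\<in>insert c F. v a)"
      unfolding lin_sum[OF ls] using insert.hyps n by simp
    also have "\<dots> = 0" unfolding insert.prems(2) by (rule lin_0[OF ls])
    finally have "(?s ^^ n) (v a) = 0"
      using insert.IH[of "\<lambda>a. (?s ^^ n) (v a)" a] st insert.prems(1) a by simp
    then have "v a \<in> gen f c" using insert.prems(1)[of a] a by (auto simp: gen_def)
    then show ?thesis using gen_disjoint[OF f, of "v a" a c] insert.prems(1)[of a] a insert.hyps by auto
  qed
  then have "v c = 0" using insert.prems(2) insert.hyps by simp
  then show ?case using vF insert.prems(3) by auto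
qed simp

end

context lie_space begin

text \<open>Every vector is annihilated by a nonzero polynomial in \<open>f\<close>, which splits into linear
  factors; these are removed one at a time.\<close>

lemma shift_preimage_in_span_gen:
  assumes f: "endo f" and v: "v \<in> G" "f v - c \<odot> v \<in> span (\<Union>d. gen f d)"
  shows "v \<in> span (\<Union>d. gen f d)"
proof -
  let ?S = "span (\<Union>d. gen f d)"
  note lf = endo_lmap[OF f]
  have genS: "x \<in> gen f d \<Longrightarrow> x \<in> ?S" for x d by (rule span_base) blast
  define T where "T = {u. \<exists>w\<in>?S. u - (f w - c \<odot> w) \<in> gen f c}"
  have subT: "subspace T"
  proof (rule subspaceI)
    have "0 - (f 0 - c \<odot> 0) \<in> gen f c" using lin_0[OF lf] subspace_0[OF subspace_gen[OF lf]] by simp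
    then show "0 \<in> T" unfolding T_def using span_zero by blast
  next
    fix x y assume "x \<in> T" "y \<in> T"
    then obtain w w' where w: "w \<in> ?S" "w' \<in> ?S"
      and m: "x - (f w - c \<odot> w) \<in> gen f c" "y - (f w' - c \<odot> w') \<in> gen f c"
      unfolding T_def by blast
    have "(x + y) - (f (w + w') - c \<odot> (w + w')) = (x - (f w - c \<odot> w)) + (y - (f w' - c \<odot> w'))"
      by (simp add: lin_add[OF lf] scale_right_distrib)
    then have "(x + y) - (f (w + w') - c \<odot> (w + w')) \<in> gen f c"
      by (simp only: subspace_add[OF subspace_gen[OF lf] m])
    then show "x + y \<in> T" unfolding T_def using span_add[OF w] by blast
  next
    fix a x assume "x \<in> T"
    then obtain w where w: "w \<in> ?S" and m: "x - (f w - c \<odot> w) \<in> gen f c"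
      unfolding T_def by blast
    have "a \<odot> x - (f (a \<odot> w) - c \<odot> (a \<odot> w)) = a \<odot> (x - (f w - c \<odot> w))"
      by (simp add: lin_scale[OF lf] scale_right_diff_distrib mult.commute)
    then have "a \<odot> x - (f (a \<odot> w) - c \<odot> (a \<odot> w)) \<in> gen f c"
      by (simp only: subspace_scale[OF subspace_gen[OF lf] m])
    then show "a \<odot> x \<in> T" unfolding T_def using span_scale[OF w] by blast
  qed
  have "u \<in> T" if u: "u \<in> gen f d" for u d
  proof (cases "d = c")
    case True
    then have "u - (f 0 - c \<odot> 0) \<in> gen f c" using u lin_0[OF lf] by simp
    then show ?thesis unfolding T_def using span_zero by blast
  next
    case False
    have "\<exists>w\<in>gen f d. u = f w - c \<odot> w"
      using u f
    proof (induction rule: gen_induct)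
      case zero
      show ?case using lin_0[OF lf] subspace_0[OF subspace_gen[OF lf]] by (intro bexI[of _ 0]) auto
    next
      case (step u)
      then obtain w where w: "w \<in> gen f d" "f u - d \<odot> u = f w - c \<odot> w" by blast
      have ug: "u \<in> gen f d" using step(1,2) by (rule gen_shiftI)
      let ?w = "(1 / (d - c)) \<odot> (u - w)"
      have "f u - c \<odot> u = (d - c) \<odot> u + (f w - c \<odot> w)"
        unfolding w(2)[symmetric] by (simp add: scale_left_diff_distrib)
      then have "f (u - w) - c \<odot> (u - w) = (d - c) \<odot> u"
        by (simp add: lin_diff[OF lf] scale_right_diff_distrib algebra_simps)
      moreover have "f ?w - c \<odot> ?w = (1 / (d - c)) \<odot> (f (u - w) - c \<odot> (u - w))"
        by (subst lin_scale[OF lf]) (simp only: scale_left_commute[of c] scale_right_diff_distrib)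
      ultimately have "f ?w - c \<odot> ?w = u" using False by simp
      moreover have "?w \<in> gen f d"
        by (intro subspace_scale[OF subspace_gen[OF lf]] subspace_diff[OF subspace_gen[OF lf]] ug w)
      ultimately show ?case by metis
    qed
    then obtain w where w: "w \<in> gen f d" "u = f w - c \<odot> w" by blast
    then have "u - (f w - c \<odot> w) \<in> gen f c" using subspace_0[OF subspace_gen[OF lf]] by simp
    then show ?thesis unfolding T_def using genS[OF w(1)] by blast
  qed
  then have "?S \<subseteq> T" by (intro span_minimal[OF _ subT]) blast
  then obtain w where w: "w \<in> ?S" and m: "f v - c \<odot> v - (f w - c \<odot> w) \<in> gen f c"
    using v(2) unfolding T_def by blast
  have "gen f d \<subseteq> G" for d by (auto simp: gen_def)
  then have "?S \<subseteq> G" by (intro span_minimal subspace_G) blast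
  then have "v - w \<in> G" using w v(1) by (intro G_closed) auto
  moreover have "f (v - w) - c \<odot> (v - w) \<in> gen f c"
    using m by (simp add: lin_diff[OF lf] scale_right_diff_distrib algebra_simps)
  ultimately have "v - w \<in> gen f c" by (rule gen_shiftI)
  then have "(v - w) + w \<in> ?S" using genS w span_add by blast
  then show ?thesis by simp
qed

lemma span_gen:
  assumes f: "endo f" shows "span (\<Union>c. gen f c) = G"
proof
  have "gen f d \<subseteq> G" for d by (auto simp: gen_def)
  then show "span (\<Union>c. gen f c) \<subseteq> G" by (intro span_minimal subspace_G) blast
  let ?S = "span (\<Union>d. gen f d)"
  note lf = endo_lmap[OF f]
  define ev where "ev N p v = (\<Sum>i<N. coeff p i \<odot> (f ^^ i) v)" for N p v
  have ev_red: "ev (Suc N) ([:- c, 1:] * q) v = ev N q (f v - c \<odot> v)" if "degree q < N" for N c q v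
  proof -
    have lp: "lmap (f ^^ i)" for i by (rule lmap_funpow[OF lf])
    have "ev (Suc N) ([:- c, 1:] * q) v = (\<Sum>i<Suc N. coeff (pCons 0 q) i \<odot> (f ^^ i) v) - c \<odot> (\<Sum>i<Suc N. coeff q i \<odot> (f ^^ i) v)"
      unfolding ev_def scale_sum_right sum_subtractf[symmetric]
      by (rule sum.cong) (simp_all add: scale_left_diff_distrib scale_left_distrib)
    also have "(\<Sum>i<Suc N. coeff (pCons 0 q) i \<odot> (f ^^ i) v) = (\<Sum>i<N. coeff q i \<odot> (f ^^ i) (f v))"
      unfolding sum.lessThan_Suc_shift by (simp add: funpow_swap1)
    also have "(\<Sum>i<Suc N. coeff q i \<odot> (f ^^ i) v) = (\<Sum>i<N. coeff q i \<odot> (f ^^ i) v)"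
      using that by (simp add: coeff_eq_0)
    finally show ?thesis
      unfolding ev_def scale_sum_right sum_subtractf[symmetric]
      by (simp add: lin_diff[OF lp] lin_scale[OF lp] scale_right_diff_distrib mult.commute)
  qed
  have main: "v \<in> ?S" if "degree p < N" "p \<noteq> 0" "ev N p v = 0" "v \<in> G" for N p v
    using that
  proof (induction N arbitrary: p v)
    case (Suc N)
    show ?case
    proof (cases "degree p = 0")
      case True
      have "ev (Suc N) p v = coeff p 0 \<odot> v"
        unfolding ev_def sum.lessThan_Suc_shift using True by (simp add: coeff_eq_0)
      moreover have "coeff p 0 \<noteq> 0" using True Suc.prems(2) leading_coeff_0_iff by metis
      ultimately have "v = 0" using Suc.prems(3) by simp
      then show ?thesis by (simp add: span_zero)
    next
      case False
      then obtain c where "poly p c = 0" using alg_closed_imp_poly_has_root[of p] by blast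
      then obtain q where q: "p = [:- c, 1:] * q" by (auto simp: poly_eq_0_iff_dvd dvd_def)
      then have "q \<noteq> 0" using Suc.prems(2) by auto
      then have "degree p = Suc (degree q)" unfolding q by (subst degree_mult_eq) auto
      then have dq: "degree q < N" using Suc.prems(1) by simp
      have "ev N q (f v - c \<odot> v) = 0" using ev_red[OF dq] Suc.prems(3) unfolding q by simp
      moreover have "f v - c \<odot> v \<in> G" using Suc.prems(4) endo_in[OF f] by (simp add: G_closed)
      ultimately have "f v - c \<odot> v \<in> ?S" using Suc.IH[OF dq \<open>q \<noteq> 0\<close>] by blast
      then show ?thesis by (rule shift_preimage_in_span_gen[OF f Suc.prems(4)])
    qed
  qed simp
  show "G \<subseteq> ?S"
  proof
    fix v assume v: "v \<in> G"
    define N where "N = Suc (card GB)"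
    have fG: "(f ^^ i) v \<in> span GB" for i
      unfolding GB(3) using v by (induction i) (auto simp: endo_in[OF f])
    have "\<not> indep_family {..<N} (\<lambda>i. (f ^^ i) v)"
    proof
      assume "indep_family {..<N} (\<lambda>i. (f ^^ i) v)"
      from indep_family_card[OF _ this, of GB] fG GB(1) have "N \<le> card GB" by auto
      then show False by (simp add: N_def)
    qed
    then obtain c i where c: "(\<Sum>i<N. c i \<odot> (f ^^ i) v) = 0" "i < N" "c i \<noteq> 0"
      unfolding indep_family_def by blast
    define p where "p = (\<Sum>i<N. monom (c i) i)"
    have cp: "coeff p j = (if j < N then c j else 0)" for j
      by (simp add: p_def coeff_sum)
    have "ev N p v = 0" unfolding ev_def using c(1) by (simp add: cp)
    moreover have "p \<noteq> 0" using c(2,3) cp[of i] by auto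
    moreover have "degree p < N"
    proof -
      have "coeff p (degree p) \<noteq> 0" using \<open>p \<noteq> 0\<close> by simp
      then show ?thesis unfolding cp by (simp split: if_splits)
    qed
    ultimately show "v \<in> ?S" using main v by blast
  qed
qed

lemma endo_eq_on_gen:
  assumes f: "endo f" and g: "lmap g" "lmap h" "\<And>c x. x \<in> gen f c \<Longrightarrow> g x = h x" and x: "x \<in> G"
  shows "g x = h x"
  by (rule lin_eq_on_span[OF g(1,2), of "\<Union>c. gen f c"]) (use g(3) x span_gen[OF f] in auto)

lemma semisimple_part:
  assumes f: "endo f"
  shows "\<exists>S. endo S \<and> (\<forall>c. \<forall>x\<in>gen f c. S x = c \<odot> x)"
proof -
  let ?E = "\<Union>c. gen f c"
  note lf = endo_lmap[OF f]
  obtain B where B: "B \<subseteq> ?E" "independent B" "?E \<subseteq> span B"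
    using maximal_independent_subset[of ?E] by blast
  have spB: "span B = G"
    using span_minimal[OF B(3) subspace_span] span_mono[OF B(1)] span_gen[OF f] by auto
  have BG: "B \<subseteq> G" using span_superset[of B] unfolding spB .
  have finB: "finite B" using independent_span_bound[OF GB(1) B(2)] BG GB(3) by simp
  have "\<forall>b\<in>B. \<exists>c. b \<in> gen f c" using B(1) by blast
  then obtain ev where ev: "\<forall>b\<in>B. b \<in> gen f (ev b)" by (rule bchoice[THEN exE])
  interpret vp: vector_space_pair scale scale ..
  obtain S where S: "Vector_Spaces.linear scale scale S" "\<forall>b\<in>B. S b = ev b \<odot> b"
    "range S = span ((\<lambda>b. ev b \<odot> b) ` B)"
    using vp.linear_independent_extend_subspace[OF B(2), of "\<lambda>b. ev b \<odot> b"] by blast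
  have lS: "lmap S" using S(1) by (simp add: lmap_iff)
  have "span ((\<lambda>b. ev b \<odot> b) ` B) \<subseteq> G"
    using BG by (intro span_minimal subspace_G) (auto simp: G_closed)
  then have "endo S" using lS S(3) by (auto simp: endo_def)
  moreover have "S x = c \<odot> x" if x: "x \<in> gen f c" for c x
  proof -
    let ?r = "representation B x"
    have xG: "x \<in> span B" using x spB by (auto simp: gen_def)
    have x_eq: "(\<Sum>b\<in>B. ?r b \<odot> b) = x"
      using sum_representation_eq[OF B(2) xG finB] by simp
    define u where "u d = (\<Sum>b\<in>{b\<in>B. ev b = d}. ?r b \<odot> b)" for d
    define F where "F = insert c (ev ` B)"
    have F: "finite F" "ev ` B \<subseteq> F" "c \<in> F" using finB by (auto simp: F_def)
    have u_gen: "u d \<in> gen f d" for d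
      unfolding u_def using ev by (intro subspace_sum[OF subspace_gen[OF lf]] subspace_scale[OF subspace_gen[OF lf]]) auto
    have sum_u: "(\<Sum>d\<in>F. u d) = x"
      unfolding u_def using sum.group[OF finB F(1,2), of "\<lambda>b. ?r b \<odot> b"] x_eq by simp
    have ud: "u d = (if d = c then x else 0)" if "d \<in> F" for d
    proof -
      have "u d - (if d = c then x else 0) = 0"
      proof (rule gen_independent[OF f F(1) _ _ that, where v = "\<lambda>d. u d - (if d = c then x else 0)"])
        show "u d - (if d = c then x else 0) \<in> gen f d" for d
          using u_gen x subspace_gen[OF lf] by (auto intro: subspace_diff)
        show "(\<Sum>d\<in>F. u d - (if d = c then x else 0)) = 0"
          using F by (simp add: sum_subtractf sum_u)
      qed
      then show ?thesis by simp
    qed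
    have "S x = (\<Sum>b\<in>B. ?r b \<odot> S b)" by (subst x_eq[symmetric]) (simp add: lin_sum[OF lS] lin_scale[OF lS])
    also have "\<dots> = (\<Sum>b\<in>B. ev b \<odot> ?r b \<odot> b)" using S(2) by (intro sum.cong) (simp_all add: mult.commute)
    also have "\<dots> = (\<Sum>d\<in>F. \<Sum>b\<in>{b\<in>B. ev b = d}. ev b \<odot> ?r b \<odot> b)"
      using sum.group[OF finB F(1,2), of "\<lambda>b. ev b \<odot> ?r b \<odot> b"] by simp
    also have "\<dots> = (\<Sum>d\<in>F. d \<odot> u d)"
      unfolding u_def scale_sum_right by (intro sum.cong refl) auto
    also have "\<dots> = (\<Sum>d\<in>F. if d = c then c \<odot> x else 0)"
      by (intro sum.cong refl) (use ud in auto)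
    also have "\<dots> = c \<odot> x" using F by simp
    finally show ?thesis .
  qed
  ultimately show ?thesis by blast
qed

lemma nilpotent_part:
  assumes f: "endo f" and S: "endo S" "\<And>c x. x \<in> gen f c \<Longrightarrow> S x = c \<odot> x" and x: "x \<in> G"
  shows "\<exists>n. ((\<lambda>x. f x - S x) ^^ n) x = 0"
proof -
  let ?N = "\<lambda>x. f x - S x"
  have eN: "endo ?N" using f S(1) by (rule endo_diff)
  have "x \<in> gen ?N 0" if "x \<in> gen f c" for x c
    using that f
  proof (induction rule: gen_induct)
    case zero show ?case by (rule subspace_0[OF subspace_gen[OF endo_lmap[OF eN]]])
  next
    case (step x)
    have "S x = c \<odot> x" by (rule S(2)[OF gen_shiftI[OF step(1,2)]])
    then have "?N x - 0 \<odot> x \<in> gen ?N 0" using step(3) by simp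
    then show ?case by (rule gen_shiftI[OF step(1)])
  qed
  then have "span (\<Union>c. gen f c) \<subseteq> gen ?N 0"
    by (intro span_minimal subspace_gen endo_lmap eN) blast
  then have "x \<in> gen ?N 0" using x span_gen[OF f] by blast
  then show ?thesis by (simp add: gen_def)
qed

definition "derivation D \<longleftrightarrow> endo D \<and> (\<forall>x\<in>G. \<forall>y\<in>G. D (br x y) = br (D x) y + br x (D y))"

lemma derivD: "derivation D \<Longrightarrow> x \<in> G \<Longrightarrow> y \<in> G \<Longrightarrow> D (br x y) = br (D x) y + br x (D y)"
  and deriv_endo: "derivation D \<Longrightarrow> endo D"
  by (auto simp: derivation_def)

lemma deriv_br: "derivation (br a)" unfolding derivation_def using endo_br jacobi by blast

lemma deriv_diff:
  assumes "derivation D" "derivation E" shows "derivation (\<lambda>x. D x - E x)"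
  using assms by (auto simp: derivation_def endo_diff br_simps)

lemma gen_br:
  assumes D: "derivation D" and x: "x \<in> gen D c" and y: "y \<in> gen D d"
  shows "br x y \<in> gen D (c + d)"
proof -
  note sub = subspace_gen[OF endo_lmap[OF deriv_endo[OF D]], of "c + d"]
  have "\<forall>y\<in>gen D d. br x y \<in> gen D (c + d)" using x deriv_endo[OF D]
  proof (induction rule: gen_induct)
    case zero show ?case using subspace_0[OF sub] by simp
  next
    case (step x)
    show ?case
    proof
      fix y assume "y \<in> gen D d"
      then show "br x y \<in> gen D (c + d)" using deriv_endo[OF D]
      proof (induction rule: gen_induct)
        case zero show ?case using subspace_0[OF sub] by simp
      next
        case y: (step y)
        have yg: "y \<in> gen D d" by (rule gen_shiftI[OF y(1,2)])
        have "D (br x y) - (c + d) \<odot> br x y = br (D x - c \<odot> x) y + br x (D y - d \<odot> y)"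
          unfolding derivD[OF D step(1) y(1)] by (simp add: br_simps scale_left_distrib)
        also have "\<dots> \<in> gen D (c + d)" using step(3) yg y(3) by (intro subspace_add[OF sub]) blast+
        finally show ?case by (rule gen_shiftI[OF br_in])
      qed
    qed
  qed
  then show ?thesis using y by blast
qed

lemma deriv_semisimple_part:
  assumes D: "derivation D" and S: "endo S" "\<And>c x. x \<in> gen D c \<Longrightarrow> S x = c \<odot> x"
  shows "derivation S"
  unfolding derivation_def
proof (intro conjI S(1) ballI)
  fix x y assume x: "x \<in> G" and y: "y \<in> G"
  note eD = deriv_endo[OF D] and lS = endo_lmap[OF S(1)]
  have 1: "S (br x y) = br (S x) y + br x (S y)" if y: "y \<in> gen D d" and x: "x \<in> G" for x y d
  proof (rule endo_eq_on_gen[OF eD _ _ _ x, where g = "\<lambda>x. S (br x y)" and h = "\<lambda>x. br (S x) y + br x (S y)"])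
    show "lmap (\<lambda>x. S (br x y))" using lS by (simp add: lmap_def br_simps)
    show "lmap (\<lambda>x. br (S x) y + br x (S y))"
      using lS by (simp add: lmap_def br_simps scale_right_distrib add_ac)
    fix c x assume x: "x \<in> gen D c"
    show "S (br x y) = br (S x) y + br x (S y)"
      using S(2)[OF gen_br[OF D x y]] S(2)[OF x] S(2)[OF y] by (simp add: br_simps scale_left_distrib)
  qed
  show "S (br x y) = br (S x) y + br x (S y)"
  proof (rule endo_eq_on_gen[OF eD _ _ _ y, where g = "\<lambda>y. S (br x y)" and h = "\<lambda>y. br (S x) y + br x (S y)"])
    show "lmap (\<lambda>y. S (br x y))" using lS by (simp add: lmap_def br_simps)
    show "lmap (\<lambda>y. br (S x) y + br x (S y))"
      using lS by (simp add: lmap_def br_simps scale_right_distrib add_ac)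
  qed (rule 1[OF _ x])
qed

section \<open>The Killing form\<close>

definition "kf x y = tr (\<lambda>v. br x (br y v))"

lemma endo_br2: "endo (\<lambda>v. br x (br y v))" by (rule endo_comp[OF endo_br endo_br])

lemma kf_sym: "kf x y = kf y x" unfolding kf_def by (rule tr_comm[OF endo_br endo_br])

lemma kf_add_l: "kf (x + y) z = kf x z + kf y z"
  unfolding kf_def br_add_l by (rule tr_add[OF endo_br2 endo_br2])
lemma kf_scale_l: "kf (c \<odot> x) z = c * kf x z"
  unfolding kf_def br_scale_l by (rule tr_scale[OF endo_br2])
lemma kf_add_r: "kf z (x + y) = kf z x + kf z y" by (simp add: kf_sym[of z] kf_add_l)
lemma kf_scale_r: "kf z (c \<odot> x) = c * kf z x" by (simp add: kf_sym[of z] kf_scale_l)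
lemma kf_0_l [simp]: "kf 0 z = 0" using kf_scale_l[of 0 0 z] by simp
lemma kf_0_r [simp]: "kf z 0 = 0" by (simp add: kf_sym[of z])
lemma kf_neg_l: "kf (- x) z = - kf x z" using kf_scale_l[of "-1" x z] by simp
lemma kf_neg_r: "kf z (- x) = - kf z x" by (simp add: kf_sym[of z] kf_neg_l)
lemma kf_diff_l: "kf (x - y) z = kf x z - kf y z"
  using kf_add_l[of x "- y" z] by (simp add: kf_neg_l)
lemma kf_diff_r: "kf z (x - y) = kf z x - kf z y" by (simp add: kf_sym[of z] kf_diff_l)
lemma kf_sum_l: "kf (sum f A) z = (\<Sum>a\<in>A. kf (f a) z)"
  by (induction A rule: infinite_finite_induct) (auto simp: kf_add_l)

lemma kf_invariant: "kf (br x y) z = kf x (br y z)"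
proof -
  have "kf (br x y) z = tr (\<lambda>v. br x (br y (br z v)) - br y (br x (br z v)))"
    unfolding kf_def by (rule tr_cong) (simp add: jacobi[of x y])
  also have "\<dots> = tr (\<lambda>v. br x (br y (br z v))) - tr (\<lambda>v. br y (br x (br z v)))"
    by (rule tr_diff[OF endo_comp[OF endo_br endo_br2] endo_comp[OF endo_br endo_br2]])
  also have "tr (\<lambda>v. br y (br x (br z v))) = tr (\<lambda>v. br x (br z (br y v)))"
    by (rule tr_comm[OF endo_br endo_br2])
  also have "tr (\<lambda>v. br x (br y (br z v))) - tr (\<lambda>v. br x (br z (br y v))) =
      tr (\<lambda>v. br x (br y (br z v)) - br x (br z (br y v)))"
    by (rule tr_diff[OF endo_comp[OF endo_br endo_br2] endo_comp[OF endo_br endo_br2], symmetric])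
  also have "\<dots> = kf x (br y z)"
    unfolding kf_def by (rule tr_cong) (simp add: jacobi[of y z] br_simps)
  finally show ?thesis .
qed

lemma kf_invariant': "kf (br y x) z = - kf x (br y z)"
  using kf_invariant[of x y z] kf_neg_l[of "br x y" z] br_anti[where x = x and y = y] by simp

definition "kf_nondegenerate \<longleftrightarrow> (\<forall>x\<in>G. (\<forall>y\<in>G. kf x y = 0) \<longrightarrow> x = 0)"

lemma kf_nondegenerateD:
  "kf_nondegenerate \<Longrightarrow> x \<in> G \<Longrightarrow> (\<And>y. y \<in> G \<Longrightarrow> kf x y = 0) \<Longrightarrow> x = 0"
  by (auto simp: kf_nondegenerate_def)

text \<open>\<open>\<kappa>(E x, y) = tr ([E, ad x] ad y) = tr (E ad [x, y])\<close>.\<close>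

lemma deriv_zero:
  assumes nd: "kf_nondegenerate" and E: "derivation E"
    and t: "\<And>y. y \<in> G \<Longrightarrow> tr (\<lambda>v. E (br y v)) = 0" and x: "x \<in> G"
  shows "E x = 0"
proof (rule kf_nondegenerateD[OF nd])
  note eE = deriv_endo[OF E]
  show "E x \<in> G" by (rule endo_in[OF eE])
  fix y assume y: "y \<in> G"
  have "kf (E x) y = tr (\<lambda>v. E (br x (br y v)) - br x (E (br y v)))"
    unfolding kf_def by (rule tr_cong) (simp add: derivD[OF E x])
  also have "\<dots> = tr (\<lambda>v. E (br x (br y v))) - tr (\<lambda>v. br x (E (br y v)))"
    by (rule tr_diff[OF endo_comp[OF eE endo_br2] endo_comp[OF endo_br endo_comp[OF eE endo_br]]])
  also have "tr (\<lambda>v. br x (E (br y v))) = tr (\<lambda>v. E (br y (br x v)))"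
    by (rule tr_comm[OF endo_br endo_comp[OF eE endo_br]])
  also have "tr (\<lambda>v. E (br x (br y v))) - tr (\<lambda>v. E (br y (br x v))) =
      tr (\<lambda>v. E (br x (br y v)) - E (br y (br x v)))"
    by (rule tr_diff[OF endo_comp[OF eE endo_br2] endo_comp[OF eE endo_br2], symmetric])
  also have "\<dots> = tr (\<lambda>v. E (br (br x y) v))"
    by (rule tr_cong) (simp add: jacobi[of x y] lin_diff[OF endo_lmap[OF eE], symmetric])
  finally show "kf (E x) y = 0" using t[OF br_in] by simp
qed

lemma deriv_inner:
  assumes nd: "kf_nondegenerate" and D: "derivation D"
  shows "\<exists>d\<in>G. \<forall>x\<in>G. D x = br d x"
proof -
  note eD = deriv_endo[OF D]
  define \<theta> where "\<theta> d = (\<Sum>b\<in>GB. kf d b \<odot> b)" for d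
  have l\<theta>: "lmap \<theta>"
    by (simp add: lmap_def \<theta>_def kf_add_l kf_scale_l scale_left_distrib sum.distrib scale_sum_right)
  have on_G: "kf d y = \<phi> y" if "\<And>b. b \<in> GB \<Longrightarrow> kf d b = \<phi> b" "\<And>x y. \<phi> (x + y) = \<phi> x + \<phi> y"
    "\<And>c x. \<phi> (c \<odot> x) = c * \<phi> x" "y \<in> G" for d \<phi> y
  proof -
    have "\<phi> 0 = 0" using that(3)[of 0 0] by simp
    then have "subspace {y. kf d y = \<phi> y}"
      by (intro subspaceI) (auto simp: kf_add_r kf_scale_r that(2,3))
    then have "span GB \<subseteq> {y. kf d y = \<phi> y}" using that(1) by (intro span_minimal) auto
    then show ?thesis using that(4) GB(3) by auto
  qed
  have indep: "\<forall>b\<in>GB. c b = e b" if "(\<Sum>b\<in>GB. c b \<odot> b) = (\<Sum>b\<in>GB. e b \<odot> b)" for c e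
  proof -
    have "(\<Sum>b\<in>GB. (c b - e b) \<odot> b) = 0"
      using that by (simp add: scale_left_diff_distrib sum_subtractf)
    then have "\<forall>b\<in>GB. c b - e b = 0"
      using independentD[OF GB(2,1) order_refl, of "\<lambda>b. c b - e b"] by blast
    then show ?thesis by simp
  qed
  have sumG: "(\<Sum>b\<in>GB. c b \<odot> b) \<in> G" for c
    by (intro G_closed(6) G_closed(4) GB_in)
  have "\<exists>d\<in>G. \<theta> d = (\<Sum>b\<in>GB. tr (\<lambda>v. D (br b v)) \<odot> b)"
  proof (rule injective_endo_surj[OF l\<theta> subspace_G _ GB(1)])
    show "G \<subseteq> span GB" using GB(3) by simp
    show "\<theta> d \<in> G" for d unfolding \<theta>_def by (rule sumG)
    show "d = 0" if "d \<in> G" "\<theta> d = 0" for d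
    proof (rule kf_nondegenerateD[OF nd that(1)])
      have "\<forall>b\<in>GB. kf d b = 0" using that(2) indep[of "kf d" "\<lambda>_. 0"] by (simp add: \<theta>_def)
      then show "kf d y = 0" if "y \<in> G" for y using on_G[of d "\<lambda>_. 0"] that by auto
    qed
  qed (rule sumG)
  then obtain d where d: "d \<in> G" and \<theta>d: "\<theta> d = (\<Sum>b\<in>GB. tr (\<lambda>v. D (br b v)) \<odot> b)" ..
  have d2: "\<forall>b\<in>GB. kf d b = tr (\<lambda>v. D (br b v))"
    using \<theta>d unfolding \<theta>_def by (rule indep)
  have d': "kf d y = tr (\<lambda>v. D (br y v))" if "y \<in> G" for y
  proof (rule on_G[OF _ _ _ that])
    show "kf d b = tr (\<lambda>v. D (br b v))" if "b \<in> GB" for b using d2 that by (rule bspec)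
    show "tr (\<lambda>v. D (br (x + y) v)) = tr (\<lambda>v. D (br x v)) + tr (\<lambda>v. D (br y v))" for x y
      unfolding br_add_l lin_add[OF endo_lmap[OF eD]] by (intro tr_add endo_comp[OF eD endo_br])
    show "tr (\<lambda>v. D (br (c \<odot> x) v)) = c * tr (\<lambda>v. D (br x v))" for c x
      unfolding br_scale_l lin_scale[OF endo_lmap[OF eD]] by (intro tr_scale endo_comp[OF eD endo_br])
  qed
  have dE: "derivation (\<lambda>x. D x - br d x)" by (rule deriv_diff[OF D deriv_br])
  have "D x - br d x = 0" if "x \<in> G" for x
  proof (rule deriv_zero[OF nd dE _ that])
    fix y assume y: "y \<in> G"
    have "tr (\<lambda>v. D (br y v) - br d (br y v)) = tr (\<lambda>v. D (br y v)) - tr (\<lambda>v. br d (br y v))"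
      by (rule tr_diff[OF endo_comp[OF eD endo_br] endo_br2])
    then show "tr (\<lambda>v. D (br y v) - br d (br y v)) = 0" using d'[OF y] by (simp add: kf_def)
  qed
  then show ?thesis using d by auto
qed

end

context lie_space begin

section \<open>Diagonalizable operators and representations of sl2\<close>

lemma no_infinite_eigenvector_sequence:
  assumes f: "endo f" and v: "\<And>k::nat. v k \<in> G" "\<And>k. v k \<noteq> 0" "\<And>k. f (v k) = \<mu> k \<odot> v k" and inj: "inj \<mu>"
  shows False
proof -
  define N where "N = Suc (card GB)"
  have "indep_family {..<N} v"
    unfolding indep_family_def
  proof (intro allI impI ballI)
    fix c i assume s: "(\<Sum>i<N. c i \<odot> v i) = 0" and i: "i \<in> {..<N}"
    let ?u = "\<lambda>d. c (inv \<mu> d) \<odot> v (inv \<mu> d)"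
    have "?u (\<mu> i) = 0"
    proof (rule gen_independent[OF f, of "\<mu> ` {..<N}" ?u])
      show "?u d \<in> gen f d" if "d \<in> \<mu> ` {..<N}" for d
      proof -
        obtain k where "d = \<mu> k" using \<open>d \<in> \<mu> ` {..<N}\<close> by auto
        then show ?thesis using v inj
          by (auto simp: inv_f_f lin_scale[OF endo_lmap[OF f]] mult.commute G_closed intro!: eigenvector_in_gen)
      qed
      show "(\<Sum>d\<in>\<mu> ` {..<N}. ?u d) = 0"
        using s by (subst sum.reindex) (auto intro: inj_on_subset[OF inj] simp: inv_f_f[OF inj])
    qed (use i in auto)
    then show "c i = 0" using v(2) inj by (simp add: inv_f_f)
  qed
  from indep_family_card[OF _ this, of GB] v(1) GB have "N \<le> card GB" by auto
  then show False by (simp add: N_def)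
qed

lemma sl2_highest:
  assumes sl2: "br e f = h" "br h e = 2 \<odot> e" "br h f = (-2) \<odot> f"
    and w: "w \<in> G" "w \<noteq> 0" "br e w = 0" "br h w = m \<odot> w"
  shows "\<exists>N::nat. m = of_nat N \<and> (\<forall>j\<le>N. (br f ^^ j) w \<noteq> 0)"
proof -
  let ?v = "\<lambda>j. (br f ^^ j) w"
  have hv: "br h (?v j) = (m - 2 * of_nat j) \<odot> ?v j" for j
  proof (induction j)
    case (Suc j)
    have "br h (?v (Suc j)) = br (br h f) (?v j) + br f (br h (?v j))" by (simp add: jacobi[of h f])
    also have "\<dots> = (m - 2 * of_nat (Suc j)) \<odot> ?v (Suc j)"
      unfolding sl2 Suc by (simp add: br_simps scale_left_diff_distrib scale_left_distrib algebra_simps)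
    finally show ?case .
  qed (use w in simp)
  have ev: "br e (?v (Suc j)) = (of_nat (Suc j) * (m - of_nat j)) \<odot> ?v j" for j
  proof (induction j)
    case 0
    show ?case using w by (simp add: jacobi[of e f] sl2)
  next
    case (Suc j)
    have "br e (?v (Suc (Suc j))) = br h (?v (Suc j)) + br f (br e (?v (Suc j)))"
      by (simp add: jacobi[of e f] sl2)
    also have "\<dots> = (m - 2 * of_nat (Suc j)) \<odot> ?v (Suc j) + (of_nat (Suc j) * (m - of_nat j)) \<odot> ?v (Suc j)"
      unfolding hv Suc by (simp add: br_scale_r)
    also have "\<dots> = (of_nat (Suc (Suc j)) * (m - of_nat (Suc j))) \<odot> ?v (Suc j)"
      by (simp only: scale_left_distrib[symmetric]) (rule arg_cong[where f = "\<lambda>c. c \<odot> ?v (Suc j)"], simp add: algebra_simps)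
    finally show ?case .
  qed
  have vG: "?v j \<in> G" for j using w(1) by (cases j) auto
  have "\<exists>j. ?v j = 0"
  proof (rule ccontr)
    assume "\<nexists>j. ?v j = 0"
    then show False
      by (intro no_infinite_eigenvector_sequence[OF endo_br[of h], of ?v "\<lambda>j. m - 2 * of_nat j"] vG hv)
        (auto simp: inj_def)
  qed
  then obtain M where M: "?v M = 0" "\<And>j. j < M \<Longrightarrow> ?v j \<noteq> 0"
    using LeastI_ex[of "\<lambda>j. ?v j = 0"] not_less_Least[of _ "\<lambda>j. ?v j = 0"] by metis
  then obtain N where N: "M = Suc N" using w(2) by (cases M) auto
  have "of_nat (Suc N) * (m - of_nat N) = 0" using ev[of N] M(1) M(2)[of N] N by auto
  then have "m = of_nat N" using of_nat_eq_0_iff[of "Suc N", where 'a = 'k] by (simp del: of_nat_Suc of_nat_eq_0_iff)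
  then show ?thesis using M(2) N by (metis less_Suc_eq_le)
qed

lemma sl2_eigenvector:
  assumes sl2: "br e f = h" "br h e = 2 \<odot> e" "br h f = (-2) \<odot> f"
    and v: "v \<in> G" "v \<noteq> 0" "br h v = c \<odot> v"
  shows "\<exists>N p::nat. c = of_nat N - 2 * of_nat p \<and> (\<forall>j\<le>N. (br f ^^ j) ((br e ^^ p) v) \<noteq> 0)"
proof -
  let ?v = "\<lambda>j. (br e ^^ j) v"
  have hv: "br h (?v j) = (c + 2 * of_nat j) \<odot> ?v j" for j
  proof (induction j)
    case (Suc j)
    have "br h (?v (Suc j)) = br (br h e) (?v j) + br e (br h (?v j))" by (simp add: jacobi[of h e])
    also have "\<dots> = (c + 2 * of_nat (Suc j)) \<odot> ?v (Suc j)"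
      unfolding sl2 Suc by (simp add: br_simps scale_left_distrib algebra_simps)
    finally show ?case .
  qed (use v in simp)
  have vG: "?v j \<in> G" for j using v(1) by (cases j) auto
  have "\<exists>j. ?v j = 0"
  proof (rule ccontr)
    assume "\<nexists>j. ?v j = 0"
    then show False
      by (intro no_infinite_eigenvector_sequence[OF endo_br[of h], of ?v "\<lambda>j. c + 2 * of_nat j"] vG hv)
        (auto simp: inj_def)
  qed
  then obtain M where M: "?v M = 0" "\<And>j. j < M \<Longrightarrow> ?v j \<noteq> 0"
    using LeastI_ex[of "\<lambda>j. ?v j = 0"] not_less_Least[of _ "\<lambda>j. ?v j = 0"] by metis
  then obtain p where p: "M = Suc p" using v(2) by (cases M) auto
  have "\<exists>N::nat. c + 2 * of_nat p = of_nat N \<and> (\<forall>j\<le>N. (br f ^^ j) (?v p) \<noteq> 0)"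
    by (rule sl2_highest[OF sl2 vG _ _ hv]) (use M p in auto)
  then show ?thesis by (metis add_diff_cancel_right')
qed

lemma sl2_integral:
  assumes sl2: "br e f = h" "br h e = 2 \<odot> e" "br h f = (-2) \<odot> f"
    and v: "v \<in> G" "v \<noteq> 0" "br h v = c \<odot> v"
  shows "\<exists>n::int. c = of_int n"
  using sl2_eigenvector[OF assms] by (metis of_int_diff of_int_mult of_int_numeral of_int_of_nat_eq)

lemma gen_basis:
  assumes f: "endo f"
  shows "\<exists>B. finite B \<and> independent B \<and> span B = G \<and> (\<forall>b\<in>B. \<exists>c. b \<in> gen f c)"
proof -
  let ?E = "\<Union>c. gen f c"
  obtain B where B: "B \<subseteq> ?E" "independent B" "?E \<subseteq> span B"
    using maximal_independent_subset[of ?E] by blast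
  have spB: "span B = G"
    using span_minimal[OF B(3) subspace_span] span_mono[OF B(1)] span_gen[OF f] by auto
  have BG: "B \<subseteq> G" using span_superset[of B] unfolding spB .
  have finB: "finite B" using independent_span_bound[OF GB(1) B(2)] BG GB(3) by simp
  have "\<forall>b\<in>B. \<exists>c. b \<in> gen f c" using B(1) by blast
  then show ?thesis using finB B(2) spB by blast
qed

text \<open>The neutral element of an sl2-triple has integral eigenvalues, so \<open>\<kappa>(h, h)\<close> is a positive
  integer.\<close>

lemma kf_sl2_nonzero:
  assumes sl2: "br e f = h" "br h e = 2 \<odot> e" "br h f = (-2) \<odot> f" and e: "e \<in> G" "e \<noteq> 0"
  shows "kf h h \<noteq> 0"
proof -
  obtain S where S: "endo S" "\<And>c x. x \<in> gen (br h) c \<Longrightarrow> S x = c \<odot> x"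
    using semisimple_part[OF endo_br[of h]] by auto
  let ?N = "\<lambda>x. br h x - S x"
  have eN: "endo ?N" by (rule endo_diff[OF endo_br S(1)])
  note lS = endo_lmap[OF S(1)]
  have nil: "\<exists>n. (?N ^^ n) x = 0" if "x \<in> G" for x by (rule nilpotent_part[OF endo_br S that])
  have hS: "br h (S x) = S (br h x)" if x: "x \<in> G" for x
  proof (rule endo_eq_on_gen[OF endo_br lin_comp[OF lin_br lS] lin_comp[OF lS lin_br] _ x])
    show "br h (S x) = S (br h x)" if "x \<in> gen (br h) c" for c x
      using S(2)[OF that] S(2)[OF gen_stable(1)[OF that endo_br]] by (simp add: br_scale_r)
  qed
  have "kf h h = tr (\<lambda>v. S (S v) + (?N (S v) + ?N (br h v)))"
    unfolding kf_def
    by (rule tr_cong) (simp add: hS lin_diff[OF lS])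
  also have "\<dots> = tr (\<lambda>v. S (S v)) + (tr (\<lambda>v. ?N (S v)) + tr (\<lambda>v. ?N (br h v)))"
    unfolding tr_add[OF endo_comp[OF S(1) S(1)] endo_add[OF endo_comp[OF eN S(1)] endo_comp[OF eN endo_br]]]
      tr_add[OF endo_comp[OF eN S(1)] endo_comp[OF eN endo_br]] ..
  also have "tr (\<lambda>v. ?N (S v)) = 0"
    by (rule tr_commuting_nilpotent[OF eN S(1) nil]) (simp_all add: hS lin_diff[OF lS])
  also have "tr (\<lambda>v. ?N (br h v)) = 0"
    by (rule tr_commuting_nilpotent[OF eN endo_br nil]) (simp_all add: hS br_simps)
  finally have k: "kf h h = tr (\<lambda>v. S (S v))" by simp
  obtain B where B: "finite B" "independent B" "span B = G" "\<And>b. b \<in> B \<Longrightarrow> \<exists>c. b \<in> gen (br h) c"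
    using gen_basis[OF endo_br[of h]] by (elim exE conjE) (rule that, auto)
  have "\<forall>b\<in>B. \<exists>n::int. b \<in> gen (br h) (of_int n)"
  proof
    fix b assume b: "b \<in> B"
    then obtain c where c: "b \<in> gen (br h) c" using B(4) by blast
    have "b \<noteq> 0" using B(2) b dependent_zero by blast
    from gen_eigenvector[OF c this endo_br] obtain y where "y \<in> G" "y \<noteq> 0" "br h y = c \<odot> y" by blast
    from sl2_integral[OF sl2 this] c show "\<exists>n::int. b \<in> gen (br h) (of_int n)" by auto
  qed
  then obtain n :: "'g \<Rightarrow> int" where n: "\<forall>b\<in>B. b \<in> gen (br h) (of_int (n b))" by (rule bchoice[THEN exE])
  have Sb: "S b = of_int (n b) \<odot> b" if "b \<in> B" for b using S(2) n that by blast
  have "tr (\<lambda>v. S (S v)) = trace_on B (\<lambda>v. S (S v))"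
    by (rule tr_basis[OF B(1-3) endo_comp[OF S(1) S(1)]])
  also have "\<dots> = (\<Sum>b\<in>B. of_int (n b * n b))"
    by (rule trace_on_diagonal[OF B(2)]) (simp add: Sb lin_scale[OF lS])
  also have "\<dots> = of_int (\<Sum>b\<in>B. n b * n b)" by simp
  finally have k2: "kf h h = of_int (\<Sum>b\<in>B. n b * n b)" unfolding k .
  show ?thesis
  proof
    assume "kf h h = 0"
    then have "(\<Sum>b\<in>B. n b * n b) = 0" unfolding k2 by (simp only: of_int_eq_0_iff)
    then have "\<forall>b\<in>B. n b * n b = 0" by (subst (asm) sum_nonneg_eq_0_iff) (auto simp: B(1))
    then have "S b = 0" if "b \<in> B" for b using Sb[OF that] that by simp
    then have "S e = 0"
      using lin_eq_on_span[OF lS, of "\<lambda>_. 0" B e] e B(3) by (auto simp: lmap_def)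
    moreover have "S e = 2 \<odot> e" by (rule S(2)[OF eigenvector_in_gen[where f = "br h", OF e(1) sl2(2)]])
    ultimately show False using e(2) by simp
  qed
qed

definition "simple \<longleftrightarrow> (\<forall>I. subspace I \<and> I \<subseteq> G \<and> (\<forall>x\<in>G. \<forall>y\<in>I. br x y \<in> I) \<longrightarrow> I = {0} \<or> I = G)"

lemma simple_nondegenerate:
  assumes s: "simple" and h: "h \<in> G" "kf h h \<noteq> 0"
  shows "kf_nondegenerate"
proof -
  let ?R = "{x \<in> G. \<forall>y\<in>G. kf x y = 0}"
  have "subspace ?R" by (rule subspaceI) (auto simp: G_closed kf_add_l kf_scale_l)
  moreover have "\<forall>x\<in>G. \<forall>y\<in>?R. br x y \<in> ?R" by (auto simp: kf_invariant')
  moreover have "?R \<subseteq> G" by blast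
  ultimately have "?R = {0} \<or> ?R = G" using s unfolding simple_def by blast
  moreover have "?R \<noteq> G" using h by blast
  ultimately show ?thesis unfolding kf_nondegenerate_def by blast
qed

lemma center_trivial:
  assumes nd: "kf_nondegenerate" and x: "x \<in> G" "\<And>y. y \<in> G \<Longrightarrow> br x y = 0"
  shows "x = 0"
proof (rule kf_nondegenerateD[OF nd x(1)])
  fix y
  have "kf x y = tr (\<lambda>v. 0)" unfolding kf_def by (rule tr_cong) (simp add: x(2))
  also have "\<dots> = 0" using tr_scale[of "\<lambda>v. br x v" 0] endo_br by simp
  finally show "kf x y = 0" .
qed

text \<open>The nilpotent part of such an \<open>ad a\<close> is a derivation that kills the even part. Its trace
  form with the even part vanishes because commuting nilpotents have trace zero, that with the odd
  part for reasons of parity.\<close>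

lemma diagonalizable_of_even_part:
  assumes nd: "kf_nondegenerate"
    and \<theta>: "endo \<theta>" "\<And>x. x \<in> G \<Longrightarrow> \<theta> (\<theta> x) = x" "\<And>x y. x \<in> G \<Longrightarrow> y \<in> G \<Longrightarrow> \<theta> (br x y) = br (\<theta> x) (\<theta> y)"
    and a: "a \<in> G" "\<theta> a = a"
    and diag: "{x \<in> G. \<theta> x = x} \<subseteq> span {x \<in> G. \<exists>c. br a x = c \<odot> x}"
    and x: "x \<in> gen (br a) c"
  shows "br a x = c \<odot> x"
proof -
  obtain S where S: "endo S" "\<And>c x. x \<in> gen (br a) c \<Longrightarrow> S x = c \<odot> x"
    using semisimple_part[OF endo_br[of a]] by auto
  let ?N = "\<lambda>x. br a x - S x"
  have eN: "endo ?N" by (rule endo_diff[OF endo_br S(1)])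
  note lS = endo_lmap[OF S(1)] and lN = endo_lmap[OF eN] and l\<theta> = endo_lmap[OF \<theta>(1)]
  have dN: "derivation ?N" by (rule deriv_diff[OF deriv_br deriv_semisimple_part[OF deriv_br S]])
  have nil: "\<exists>n. (?N ^^ n) x = 0" if "x \<in> G" for x by (rule nilpotent_part[OF endo_br S that])
  have \<theta>a: "\<theta> (br a x) = br a (\<theta> x)" if "x \<in> G" for x using \<theta>(3)[OF a(1) that] a(2) by simp
  have \<theta>gen: "\<theta> x \<in> gen (br a) c" if "x \<in> gen (br a) c" for x c
    using that endo_br[of a]
  proof (induction rule: gen_induct)
    case zero show ?case using lin_0[OF l\<theta>] subspace_0[OF subspace_gen[OF lin_br]] by simp
  next
    case (step x)
    have "br a (\<theta> x) - c \<odot> \<theta> x = \<theta> (br a x - c \<odot> x)"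
      by (simp add: \<theta>a[OF step(1)] lin_diff[OF l\<theta>] lin_scale[OF l\<theta>])
    also have "\<dots> \<in> gen (br a) c" by (rule step(3))
    finally show ?case by (rule gen_shiftI[OF endo_in[OF \<theta>(1)]])
  qed
  have \<theta>S: "\<theta> (S x) = S (\<theta> x)" if "x \<in> G" for x
  proof (rule endo_eq_on_gen[OF endo_br[of a] lin_comp[OF l\<theta> lS] lin_comp[OF lS l\<theta>] _ that])
    show "\<theta> (S x) = S (\<theta> x)" if "x \<in> gen (br a) c" for c x
      using S(2)[OF that] S(2)[OF \<theta>gen[OF that]] by (simp add: lin_scale[OF l\<theta>])
  qed
  have N0: "?N x = 0" if "x \<in> G" "\<theta> x = x" for x
  proof -
    have "?N y = 0" if "y \<in> {x \<in> G. \<exists>c. br a x = c \<odot> x}" for y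
    proof -
      have "y \<in> G" "\<exists>d. br a y = d \<odot> y" using that by auto
      then obtain d where d: "br a y = d \<odot> y" "y \<in> G" by blast
      then show ?thesis using S(2)[OF eigenvector_in_gen[where f = "br a", OF d(2,1)]] by simp
    qed
    then show ?thesis
      using lin_eq_on_span[OF lN, of "\<lambda>_. 0" "{x \<in> G. \<exists>c. br a x = c \<odot> x}" x] diag that by (auto simp: lmap_def)
  qed
  have even: "tr (\<lambda>v. ?N (br y v)) = 0" if y: "y \<in> G" "\<theta> y = y" for y
    by (rule tr_commuting_nilpotent[OF eN endo_br nil]) (use derivD[OF dN y(1)] N0[OF y] in simp_all)
  have odd: "tr (\<lambda>v. ?N (br y v)) = 0" if y: "y \<in> G" "\<theta> y = - y" for y
  proof -
    have e1: "endo (\<lambda>v. ?N (br y v))" by (rule endo_comp[OF eN endo_br])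
    have "tr (\<lambda>v. ?N (br y v)) = tr (\<lambda>v. \<theta> (\<theta> (?N (br y v))))"
      by (rule tr_cong) (simp add: \<theta>(2) endo_in[OF eN])
    also have "\<dots> = tr (\<lambda>v. \<theta> (?N (br y (\<theta> v))))"
      by (rule tr_comm[OF \<theta>(1) endo_comp[OF \<theta>(1) e1]])
    also have "\<dots> = tr (\<lambda>v. (-1) \<odot> ?N (br y v))"
    proof (rule tr_cong)
      fix v assume v: "v \<in> G"
      have "\<theta> (?N (br y (\<theta> v))) = ?N (\<theta> (br y (\<theta> v)))"
        by (simp add: lin_diff[OF l\<theta>] \<theta>a \<theta>S)
      also have "\<theta> (br y (\<theta> v)) = - br y v"
        using \<theta>(3)[OF y(1) endo_in[OF \<theta>(1), of v]] \<theta>(2)[OF v] y(2) by (simp add: br_simps)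
      finally show "\<theta> (?N (br y (\<theta> v))) = (-1) \<odot> ?N (br y v)"
        by (simp only: lin_neg[OF lN] scale_minus_left scale_one)
    qed
    also have "\<dots> = - tr (\<lambda>v. ?N (br y v))" using tr_scale[OF e1, of "-1"] by simp
    finally show ?thesis by simp
  qed
  have "?N x = 0"
  proof (rule deriv_zero[OF nd dN])
    show "x \<in> G" using x by (simp add: gen_def)
    fix y assume y: "y \<in> G"
    let ?p = "(1/2) \<odot> (y + \<theta> y)" and ?m = "(1/2) \<odot> (y - \<theta> y)"
    have pm: "?p \<in> G" "?m \<in> G" using y endo_in[OF \<theta>(1)] by (auto intro!: G_closed)
    have pm2: "\<theta> ?p = ?p" "\<theta> ?m = - ?m"
      using \<theta>(2)[OF y] by (simp_all add: lin_scale[OF l\<theta>] lin_add[OF l\<theta>] lin_diff[OF l\<theta>] add.commute flip: scale_minus_right)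
    have "?p + ?m = (1/2) \<odot> (y + y)" by (simp only: scale_right_distrib[symmetric]) simp
    then have y_eq: "?p + ?m = y" by (simp flip: scale_left_distrib add: scale_right_distrib)
    have "tr (\<lambda>v. ?N (br y v)) = tr (\<lambda>v. ?N (br ?p v) + ?N (br ?m v))"
    proof (rule tr_cong)
      fix v
      have "br y v = br (?p + ?m) v" by (simp only: y_eq)
      then have "br y v = br ?p v + br ?m v" by (simp only: br_add_l)
      then have "?N (br y v) = ?N (br ?p v + br ?m v)" by (rule arg_cong)
      then show "?N (br y v) = ?N (br ?p v) + ?N (br ?m v)" unfolding lin_add[OF lN] .
    qed
    also have "\<dots> = tr (\<lambda>v. ?N (br ?p v)) + tr (\<lambda>v. ?N (br ?m v))"
      by (rule tr_add[OF endo_comp[OF eN endo_br] endo_comp[OF eN endo_br]])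
    finally show "tr (\<lambda>v. ?N (br y v)) = 0" using even[OF pm(1)] odd[OF pm(2)] pm2 by simp
  qed
  then show ?thesis using S(2)[OF x] by simp
qed

lemma span_Union_subspaces:
  assumes "\<And>c. subspace (V c)" "x \<in> span (\<Union>c. V c)"
  shows "\<exists>D xs. finite D \<and> (\<forall>c. xs c \<in> V c) \<and> x = (\<Sum>c\<in>D. xs c)"
  using assms(2)
proof (induction rule: span_induct_alt)
  case base
  show ?case using subspace_0[OF assms(1)] by (intro exI[of _ "{}"] exI[of _ "\<lambda>_. 0"]) simp
next
  case (step a v y)
  then obtain c D xs where c: "v \<in> V c" and D: "finite D" "\<forall>c. xs c \<in> V c" "y = (\<Sum>c\<in>D. xs c)" by auto
  define xs' where "xs' d = (if d \<in> D then xs d else 0) + (if d = c then a \<odot> v else 0)" for d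
  have "xs' d \<in> V d" for d unfolding xs'_def
    using D(2) c subspace_0[OF assms(1)] by (intro subspace_add[OF assms(1)]) (auto intro: subspace_scale[OF assms(1)])
  moreover have "(\<Sum>d\<in>insert c D. if d \<in> D then xs d else 0) = (\<Sum>d\<in>D. xs d)"
    using D(1) by (intro sum.mono_neutral_cong_right) auto
  then have "(\<Sum>d\<in>insert c D. xs' d) = (\<Sum>d\<in>D. xs d) + a \<odot> v"
    unfolding xs'_def sum.distrib using D(1) by simp
  then have "a \<odot> v + y = (\<Sum>d\<in>insert c D. xs' d)" using D(3) by (simp add: add.commute)
  moreover have "finite (insert c D)" using D(1) by simp
  ultimately show ?case by blast
qed

lemma eigencomponents_in_stable:
  assumes f: "endo f" and W: "subspace W" "\<And>x. x \<in> W \<Longrightarrow> f x \<in> W" and D: "finite D"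
    and xs: "\<And>c. c \<in> D \<Longrightarrow> f (xs c) = c \<odot> xs c" "(\<Sum>c\<in>D. xs c) \<in> W" and c: "c \<in> D"
  shows "xs c \<in> W"
  using D xs c
proof (induction D arbitrary: xs c rule: finite_induct)
  case (insert d D)
  note lf = endo_lmap[OF f]
  let ?x = "\<Sum>c\<in>insert d D. xs c"
  have "f ?x - d \<odot> ?x = (\<Sum>c\<in>insert d D. (c - d) \<odot> xs c)"
    unfolding lin_sum[OF lf] scale_sum_right sum_subtractf[symmetric]
    by (intro sum.cong refl) (simp add: insert.prems(1) scale_left_diff_distrib)
  also have "\<dots> = (\<Sum>c\<in>D. (c - d) \<odot> xs c)" using insert.hyps by simp
  finally have "(\<Sum>c\<in>D. (c - d) \<odot> xs c) \<in> W"
    using subspace_diff[OF W(1) W(2)[OF insert.prems(2)] subspace_scale[OF W(1) insert.prems(2)]] by metis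
  then have "(c - d) \<odot> xs c \<in> W" if "c \<in> D" for c
    using insert.IH[of "\<lambda>c. (c - d) \<odot> xs c" c] insert.prems(1) that
    by (simp add: lin_scale[OF lf] mult.commute)
  then have "(1 / (c - d)) \<odot> (c - d) \<odot> xs c \<in> W" if "c \<in> D" for c
    using that by (blast intro: subspace_scale[OF W(1)])
  moreover have "c - d \<noteq> 0" if "c \<in> D" for c using that insert.hyps by auto
  ultimately have inD: "xs c \<in> W" if "c \<in> D" for c using that by fastforce
  have "xs d = ?x - (\<Sum>c\<in>D. xs c)" using insert.hyps by simp
  also have "\<dots> \<in> W" by (intro subspace_diff[OF W(1) insert.prems(2)] subspace_sum[OF W(1)] inD)
  finally show ?case using inD insert.prems(3) by auto
qed simp

lemma simultaneous_eigenvectors: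
  assumes "finite F" "F \<subseteq> G" "\<And>s t. s \<in> F \<Longrightarrow> t \<in> F \<Longrightarrow> br s t = 0"
    "\<And>t. t \<in> F \<Longrightarrow> G \<subseteq> span (\<Union>c. eig t c)"
  shows "G \<subseteq> span {x \<in> G. \<forall>t\<in>F. \<exists>c. br t x = c \<odot> x}"
  using assms
proof (induction F rule: finite_induct)
  case empty then show ?case using span_superset by simp
next
  case (insert t F)
  let ?E = "{x \<in> G. \<forall>t\<in>insert t F. \<exists>c. br t x = c \<odot> x}"
  have "{x \<in> G. \<forall>t\<in>F. \<exists>c. br t x = c \<odot> x} \<subseteq> span ?E"
  proof
    fix x assume "x \<in> {x \<in> G. \<forall>t\<in>F. \<exists>c. br t x = c \<odot> x}"
    then have xG: "x \<in> G" and "\<forall>s\<in>F. \<exists>c. br s x = c \<odot> x" by auto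
    then obtain ev where ev: "\<forall>s\<in>F. br s x = ev s \<odot> x" using bchoice[of F "\<lambda>s c. br s x = c \<odot> x"] by blast
    define W where "W = {y \<in> G. \<forall>s\<in>F. br s y = ev s \<odot> y}"
    have W: "subspace W" by (rule subspaceI) (auto simp: W_def G_closed br_simps scale_right_distrib mult.commute)
    have stable: "br t y \<in> W" if "y \<in> W" for y
    proof -
      have "br s (br t y) = ev s \<odot> br t y" if s: "s \<in> F" for s
        using jacobi[of s t y] insert.prems(2)[of s t] s \<open>y \<in> W\<close> by (simp add: W_def br_simps)
      then show ?thesis by (simp add: W_def)
    qed
    have "x \<in> span (\<Union>c. eig t c)" using insert.prems(3)[of t] xG by auto
    then obtain D xs where D: "finite D" "\<forall>c. xs c \<in> eig t c" "x = (\<Sum>c\<in>D. xs c)"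
      using span_Union_subspaces[of "eig t" x] subspace_eig by blast
    have "xs c \<in> W" if "c \<in> D" for c
      by (rule eigencomponents_in_stable[OF endo_br[of t] W stable D(1) _ _ that])
        (use D ev xG in \<open>auto simp: eig_def W_def\<close>)
    then have "xs c \<in> ?E" if "c \<in> D" for c using that D(2) by (auto simp: W_def eig_def)
    then show "x \<in> span ?E" unfolding D(3) by (intro span_sum span_base)
  qed
  then have "span {x \<in> G. \<forall>t\<in>F. \<exists>c. br t x = c \<odot> x} \<subseteq> span ?E" by (rule span_minimal) simp
  then show ?case using insert.IH insert.prems by blast
qed

end

section \<open>Weight spaces of a toral subalgebra\<close>

context lie_space begin

definition "wt T \<alpha> = {x \<in> G. \<forall>t\<in>T. br t x = \<alpha> t \<odot> x}"

lemma wtD: "x \<in> wt T \<alpha> \<Longrightarrow> x \<in> G" "x \<in> wt T \<alpha> \<Longrightarrow> t \<in> T \<Longrightarrow> br t x = \<alpha> t \<odot> x"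
  by (auto simp: wt_def)

lemma wtI: "x \<in> G \<Longrightarrow> (\<And>t. t \<in> T \<Longrightarrow> br t x = \<alpha> t \<odot> x) \<Longrightarrow> x \<in> wt T \<alpha>"
  by (auto simp: wt_def)

lemma subspace_wt: "subspace (wt T \<alpha>)"
  by (rule subspaceI) (auto simp: wt_def G_closed br_simps scale_right_distrib mult.commute)

lemma wt_cong: "(\<And>t. t \<in> T \<Longrightarrow> \<alpha> t = \<beta> t) \<Longrightarrow> wt T \<alpha> = wt T \<beta>"
  by (auto simp: wt_def)

lemma wt_br:
  assumes "x \<in> wt T \<alpha>" "y \<in> wt T \<beta>" shows "br x y \<in> wt T (\<lambda>t. \<alpha> t + \<beta> t)"
  by (rule wtI) (auto simp: jacobi[of _ x y] wtD[OF assms(1)] wtD[OF assms(2)] br_simps scale_left_distrib)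

lemma wt_br_pow:
  assumes e: "e \<in> wt T \<alpha>" and v: "v \<in> wt T \<beta>"
  shows "(br e ^^ k) v \<in> wt T (\<lambda>t. \<beta> t + of_nat k * \<alpha> t)"
proof (induction k)
  case (Suc k)
  have "br e ((br e ^^ k) v) \<in> wt T (\<lambda>t. \<alpha> t + (\<beta> t + of_nat k * \<alpha> t))" by (rule wt_br[OF e Suc])
  also have "\<dots> = wt T (\<lambda>t. \<beta> t + of_nat (Suc k) * \<alpha> t)" by (rule wt_cong) (simp add: algebra_simps)
  finally show ?case by simp
qed (use v in simp)

lemma wt_kf_zero:
  assumes x: "x \<in> wt T \<alpha>" and y: "y \<in> wt T \<beta>" and t: "t \<in> T" "\<alpha> t + \<beta> t \<noteq> 0"
  shows "kf x y = 0"
proof -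
  have "kf (br x t) y = kf x (br t y)" by (rule kf_invariant)
  moreover have "br x t = - (\<alpha> t \<odot> x)" using br_anti[where x = t and y = x] wtD(2)[OF x t(1)] by simp
  moreover have "br t y = \<beta> t \<odot> y" by (rule wtD(2)[OF y t(1)])
  ultimately have "- (\<alpha> t * kf x y) = \<beta> t * kf x y" by (simp only: kf_neg_l kf_scale_l kf_scale_r)
  then have "(\<alpha> t + \<beta> t) * kf x y = 0" by (simp add: distrib_right eq_neg_iff_add_eq_0 neg_eq_iff_add_eq_0)
  then show ?thesis using t(2) by simp
qed

lemma wt_independent:
  assumes "finite I" "\<And>i. i \<in> I \<Longrightarrow> v i \<in> wt T (\<beta> i)" "\<And>i. i \<in> I \<Longrightarrow> v i \<noteq> 0"
    "\<And>i j. i \<in> I \<Longrightarrow> j \<in> I \<Longrightarrow> i \<noteq> j \<Longrightarrow> \<exists>t\<in>T. \<beta> i t \<noteq> \<beta> j t"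
  shows "indep_family I v"
  using assms
proof (induction I rule: finite_induct)
  case empty show ?case by (simp add: indep_family_def)
next
  case (insert j I)
  have ind: "indep_family I v" using insert by auto
  show ?case
    unfolding indep_family_def
  proof (intro allI impI)
    fix c assume s: "(\<Sum>i\<in>insert j I. c i \<odot> v i) = 0"
    have cI: "c k = 0" if k: "k \<in> I" for k
    proof -
      obtain t where t: "t \<in> T" "\<beta> j t \<noteq> \<beta> k t" using insert.prems(3)[of j k] k insert.hyps by auto
      have "(\<Sum>i\<in>insert j I. (c i * (\<beta> i t - \<beta> j t)) \<odot> v i) =
          br t (\<Sum>i\<in>insert j I. c i \<odot> v i) - \<beta> j t \<odot> (\<Sum>i\<in>insert j I. c i \<odot> v i)"
        unfolding br_sum_r scale_sum_right sum_subtractf[symmetric]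
        by (intro sum.cong refl)
          (simp add: br_scale_r wtD(2)[OF insert.prems(1) t(1)] right_diff_distrib scale_left_diff_distrib mult.commute)
      also have "\<dots> = 0" unfolding s by simp
      finally have "(\<Sum>i\<in>I. (c i * (\<beta> i t - \<beta> j t)) \<odot> v i) = 0" using insert.hyps by simp
      from indep_familyD[OF ind this k] show ?thesis using t(2) by simp
    qed
    then have "c j \<odot> v j = 0" using s insert.hyps by simp
    then have "c j = 0" using insert.prems(2)[of j] by simp
    then show "\<forall>i\<in>insert j I. c i = 0" using cI by blast
  qed
qed

lemma toral_abelian:
  assumes T: "subspace T" "T \<subseteq> G" "\<And>x y. x \<in> T \<Longrightarrow> y \<in> T \<Longrightarrow> br x y \<in> T"
    and diag: "\<And>t. t \<in> T \<Longrightarrow> G \<subseteq> span (\<Union>c. eig t c)" and x: "x \<in> T" and y: "y \<in> T"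
  shows "br x y = 0"
proof -
  have diag2: "br a z = 0" if a: "a \<in> T" and z: "z \<in> G" "br a (br a z) = 0" for a z
  proof -
    obtain D xs where D: "finite D" "\<forall>c. xs c \<in> eig a c" "z = (\<Sum>c\<in>D. xs c)"
      using span_Union_subspaces[of "eig a" z] subspace_eig diag[OF a] z(1) by blast
    let ?W = "{v \<in> G. br a (br a v) = 0}"
    have W: "subspace ?W" by (rule subspaceI) (auto simp: G_closed br_simps)
    have "c \<odot> xs c = 0" if c: "c \<in> D" for c
    proof -
      have "xs c \<in> ?W"
        by (rule eigencomponents_in_stable[OF endo_br[of a] W _ D(1) _ _ c]) (use D z in \<open>auto simp: eig_def\<close>)
      then show ?thesis using D(2) by (auto simp: eig_def br_simps)
    qed
    then have "(\<Sum>c\<in>D. br a (xs c)) = 0" using D(2) by (intro sum.neutral) (auto simp: eig_def)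
    then show ?thesis unfolding D(3) br_sum_r .
  qed
  obtain D ys where D: "finite D" "\<forall>c. ys c \<in> eig x c" "y = (\<Sum>c\<in>D. ys c)"
    using span_Union_subspaces[of "eig x" y] subspace_eig diag[OF x] y T(2) by blast
  have "br x (ys c) = 0" if c: "c \<in> D" for c
  proof -
    have e: "br x (ys c) = c \<odot> ys c" using D(2) by (auto simp: eig_def)
    have "ys c \<in> T"
      by (rule eigencomponents_in_stable[OF endo_br[of x] T(1) T(3)[OF x] D(1) _ _ c]) (use D y in \<open>auto simp: eig_def\<close>)
    moreover have "br (ys c) (br (ys c) x) = 0"
      using br_anti[where x = x and y = "ys c"] e by (simp add: br_simps)
    ultimately have "br (ys c) x = 0" using diag2[of "ys c" x] x T(2) by auto
    then show ?thesis using br_anti[where x = "ys c" and y = x] by simp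
  qed
  then show ?thesis unfolding D(3) br_sum_r by (intro sum.neutral) blast
qed

lemma toral_span_wt:
  assumes T: "subspace T" "T \<subseteq> G" and ab: "\<And>x y. x \<in> T \<Longrightarrow> y \<in> T \<Longrightarrow> br x y = 0"
    and F: "finite F" "F \<subseteq> T" "T \<subseteq> span F" and diag: "\<And>t. t \<in> F \<Longrightarrow> G \<subseteq> span (\<Union>c. eig t c)"
  shows "G \<subseteq> span (\<Union>\<alpha>. wt T \<alpha>)"
proof -
  have "{x \<in> G. \<forall>t\<in>F. \<exists>c. br t x = c \<odot> x} \<subseteq> (\<Union>\<alpha>. wt T \<alpha>)"
  proof
    fix x assume x: "x \<in> {x \<in> G. \<forall>t\<in>F. \<exists>c. br t x = c \<odot> x}"
    have "subspace {t. \<exists>c. br t x = c \<odot> x}"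
    proof (rule subspaceI)
      show "0 \<in> {t. \<exists>c. br t x = c \<odot> x}" by (auto intro: exI[of _ 0])
      show "a + b \<in> {t. \<exists>c. br t x = c \<odot> x}" if "a \<in> {t. \<exists>c. br t x = c \<odot> x}" "b \<in> {t. \<exists>c. br t x = c \<odot> x}" for a b
        using that by (auto simp: br_add_l simp flip: scale_left_distrib)
      show "r \<odot> a \<in> {t. \<exists>c. br t x = c \<odot> x}" if "a \<in> {t. \<exists>c. br t x = c \<odot> x}" for r a
        using that by (auto simp: br_scale_l)
    qed
    then have "span F \<subseteq> {t. \<exists>c. br t x = c \<odot> x}" by (intro span_minimal) (use x in auto)
    then have "\<forall>t\<in>T. \<exists>c. br t x = c \<odot> x" using F(3) by blast
    then obtain \<alpha> where "\<forall>t\<in>T. br t x = \<alpha> t \<odot> x" by (rule bchoice[THEN exE])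
    then have "x \<in> wt T \<alpha>" using x by (auto simp: wt_def)
    then show "x \<in> (\<Union>\<alpha>. wt T \<alpha>)" by blast
  qed
  then have "span {x \<in> G. \<forall>t\<in>F. \<exists>c. br t x = c \<odot> x} \<subseteq> span (\<Union>\<alpha>. wt T \<alpha>)" by (rule span_mono)
  moreover have "G \<subseteq> span {x \<in> G. \<forall>t\<in>F. \<exists>c. br t x = c \<odot> x}"
  proof (rule simultaneous_eigenvectors[OF F(1)])
    show "F \<subseteq> G" using F(2) T(2) by blast
    show "br s t = 0" if "s \<in> F" "t \<in> F" for s t using that F(2) by (intro ab) auto
  qed (rule diag)
  ultimately show ?thesis by blast
qed

lemma kf_zero_on_span:
  assumes "\<And>y. y \<in> A \<Longrightarrow> kf x y = 0" "y \<in> span A" shows "kf x y = 0"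
proof -
  have "subspace {y. kf x y = 0}" by (rule subspaceI) (auto simp: kf_add_r kf_scale_r)
  then have "span A \<subseteq> {y. kf x y = 0}" using assms(1) by (intro span_minimal) auto
  then show ?thesis using assms(2) by auto
qed

definition "adnil n \<longleftrightarrow> (\<forall>v\<in>G. \<exists>k. (br n ^^ k) v = 0)"

definition "toral T \<longleftrightarrow> subspace T \<and> T \<subseteq> G \<and> (\<forall>x\<in>T. \<forall>y\<in>T. br x y \<in> T) \<and> (\<forall>t\<in>T. G \<subseteq> span (\<Union>c. eig t c))"

text \<open>Jordan decomposition inside the centralizer of a maximal toral \<open>T\<close>: derivations being inner,
  the semisimple part of \<open>ad x\<close> is \<open>ad s\<close>, and \<open>s\<close> lies in \<open>T\<close> by maximality.\<close>

lemma centralizer_jordan: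
  assumes nd: "kf_nondegenerate" and T: "toral T" and max: "\<And>T'. toral T' \<Longrightarrow> T \<subseteq> T' \<Longrightarrow> T' = T"
    and x: "x \<in> G" "\<And>t. t \<in> T \<Longrightarrow> br t x = 0"
  shows "\<exists>s\<in>T. adnil (x - s)"
proof -
  have T': "subspace T" "T \<subseteq> G" "\<And>x y. x \<in> T \<Longrightarrow> y \<in> T \<Longrightarrow> br x y \<in> T" "\<And>t. t \<in> T \<Longrightarrow> G \<subseteq> span (\<Union>c. eig t c)"
    using T unfolding toral_def by auto
  have ab: "br t t' = 0" if "t \<in> T" "t' \<in> T" for t t' by (rule toral_abelian[OF T' that])
  obtain S where S: "endo S" "\<And>c v. v \<in> gen (br x) c \<Longrightarrow> S v = c \<odot> v"
    using semisimple_part[OF endo_br[of x]] by auto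
  obtain s where s: "s \<in> G" "\<forall>v\<in>G. S v = br s v"
    using deriv_inner[OF nd deriv_semisimple_part[OF deriv_br S]] by blast
  have st: "br t s = 0" if t: "t \<in> T" for t
  proof -
    have "br x t = 0 \<odot> t" using x(2)[OF t] br_anti[where x = t and y = x] by simp
    then have "S t = 0" using S(2)[OF eigenvector_in_gen[where f = "br x"], of t 0] t T'(2) by auto
    then show ?thesis using s(2) t T'(2) br_anti[where x = s and y = t] by auto
  qed
  have diag_s: "G \<subseteq> span (\<Union>c. eig s c)"
  proof -
    have "gen (br x) c \<subseteq> eig s c" for c using S(2) s(2) by (auto simp: eig_def gen_def)
    then have "(\<Union>c. gen (br x) c) \<subseteq> (\<Union>c. eig s c)" by blast
    from span_mono[OF this] show ?thesis unfolding span_gen[OF endo_br] .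
  qed
  let ?T = "{t + c \<odot> s | t c. t \<in> T}"
  have "toral ?T"
    unfolding toral_def
  proof (intro conjI ballI)
    have "span {s} = {c \<odot> s | c. True}" unfolding span_singleton by auto
    then have "?T = {x + y | x y. x \<in> T \<and> y \<in> span {s}}" by auto
    then show "subspace ?T" using subspace_sums[OF T'(1) subspace_span] by simp
    show "?T \<subseteq> G" using T'(2) s(1) by (auto intro!: G_closed)
    show "br a b \<in> ?T" if ab': "a \<in> ?T" "b \<in> ?T" for a b
    proof -
      obtain t c where a: "a = t + c \<odot> s" "t \<in> T" using ab' by blast
      obtain t' c' where b: "b = t' + c' \<odot> s" "t' \<in> T" using ab' by blast
      have "br a b = 0" unfolding a b
        using ab[OF a(2) b(2)] st[OF a(2)] st[OF b(2)] br_anti[where x = t' and y = s] by (simp add: br_simps)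
      then have "br a b = 0 + 0 \<odot> s" by simp
      then show ?thesis using subspace_0[OF T'(1)] by blast
    qed
    fix a assume "a \<in> ?T"
    then obtain t c where a: "a = t + c \<odot> s" "t \<in> T" by blast
    have "G \<subseteq> span {v \<in> G. \<forall>u\<in>{t, s}. \<exists>c. br u v = c \<odot> v}"
    proof (rule simultaneous_eigenvectors)
      show "br u v = 0" if "u \<in> {t, s}" "v \<in> {t, s}" for u v
        using that st[OF a(2)] br_anti[where x = t and y = s] by auto
      show "G \<subseteq> span (\<Union>c. eig u c)" if "u \<in> {t, s}" for u
        using that T'(4)[OF a(2)] diag_s by (elim insertE) simp_all
      show "{t, s} \<subseteq> G" using a(2) T'(2) s(1) by auto
    qed simp
    also have "\<dots> \<subseteq> span (\<Union>c. eig a c)"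
    proof (rule span_mono, rule subsetI)
      fix v assume "v \<in> {v \<in> G. \<forall>u\<in>{t, s}. \<exists>c. br u v = c \<odot> v}"
      then obtain p q where "v \<in> G" "br t v = p \<odot> v" "br s v = q \<odot> v" by auto
      then have "v \<in> eig a (p + c * q)" by (simp add: eig_def a(1) br_simps scale_left_distrib)
      then show "v \<in> (\<Union>c. eig a c)" by blast
    qed
    finally show "G \<subseteq> span (\<Union>c. eig a c)" .
  qed
  moreover have "t \<in> ?T" if "t \<in> T" for t
  proof -
    have "t = t + 0 \<odot> s" by simp
    then show ?thesis using that by blast
  qed
  ultimately have "?T = T" by (intro max) auto
  moreover have "s = 0 + 1 \<odot> s" by simp
  then have "s \<in> ?T" using subspace_0[OF T'(1)] by blast
  ultimately have sT: "s \<in> T" by simp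
  have "adnil (x - s)"
    unfolding adnil_def
  proof
    fix v assume v: "v \<in> G"
    let ?N = "\<lambda>v. br x v - S v"
    have "(br (x - s) ^^ k) v = (?N ^^ k) v \<and> (?N ^^ k) v \<in> G" for k
    proof (induction k)
      case (Suc k)
      then show ?case using s(2) endo_in[OF S(1)] by (simp add: br_simps G_closed)
    qed (use v in simp)
    moreover obtain k where "(?N ^^ k) v = 0" using nilpotent_part[OF endo_br S v] by blast
    ultimately have "(br (x - s) ^^ k) v = 0" by simp
    then show "\<exists>k. (br (x - s) ^^ k) v = 0" by blast
  qed
  then show ?thesis using sT by blast
qed

lemma kf_adnil:
  assumes "adnil n" "br n y = 0" shows "kf n y = 0"
  unfolding kf_def
  by (rule tr_commuting_nilpotent[OF endo_br endo_br]) (use assms in \<open>auto simp: adnil_def jacobi[of n y]\<close>)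

text \<open>Nilpotent elements of the centralizer are closed under addition, since the semisimple part of
  a sum is orthogonal to \<open>T\<close>; polarizing \<open>\<kappa>(n, n) = 0\<close> they are orthogonal to each other. No appeal
  to Engel's theorem is needed.\<close>

lemma maximal_toral_self_centralizing:
  assumes nd: "kf_nondegenerate" and T: "toral T" and max: "\<And>T'. toral T' \<Longrightarrow> T \<subseteq> T' \<Longrightarrow> T' = T"
    and span_wt: "G \<subseteq> span (\<Union>\<alpha>. wt T \<alpha>)"
    and x: "x \<in> G" "\<And>t. t \<in> T \<Longrightarrow> br t x = 0"
  shows "x \<in> T"
proof -
  have T': "subspace T" "T \<subseteq> G" "\<And>x y. x \<in> T \<Longrightarrow> y \<in> T \<Longrightarrow> br x y \<in> T" "\<And>t. t \<in> T \<Longrightarrow> G \<subseteq> span (\<Union>c. eig t c)"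
    using T unfolding toral_def by auto
  have ab: "br t t' = 0" if "t \<in> T" "t' \<in> T" for t t' by (rule toral_abelian[OF T' that])
  define C where "C = {x \<in> G. \<forall>t\<in>T. br t x = 0}"
  have subC: "subspace C" by (rule subspaceI) (auto simp: C_def G_closed br_simps)
  have TC: "T \<subseteq> C" using T'(2) ab by (auto simp: C_def)
  have C0: "C = wt T (\<lambda>_. 0)" by (auto simp: C_def wt_def)
  have jordan: "\<exists>s\<in>T. adnil (y - s)" if "y \<in> C" for y
    by (rule centralizer_jordan[OF nd T max]) (use that in \<open>auto simp: C_def\<close>)
  have nil_T: "kf n t = 0" if "n \<in> C" "adnil n" "t \<in> T" for n t
  proof (rule kf_adnil[OF that(2)])
    show "br n t = 0" using that(1,3) br_anti[where x = t and y = n] by (simp add: C_def)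
  qed
  have perp: "n = 0" if n: "n \<in> C" "\<And>y. y \<in> C \<Longrightarrow> kf n y = 0" for n
  proof (rule kf_nondegenerateD[OF nd])
    show "n \<in> G" using n(1) by (simp add: C_def)
    fix y assume "y \<in> G"
    then have "y \<in> span (\<Union>\<alpha>. wt T \<alpha>)" using span_wt by blast
    moreover have "kf n z = 0" if z: "z \<in> (\<Union>\<alpha>. wt T \<alpha>)" for z
    proof -
      obtain \<alpha> where \<alpha>: "z \<in> wt T \<alpha>" using z by blast
      show ?thesis
      proof (cases "\<exists>t\<in>T. \<alpha> t \<noteq> 0")
        case True
        then obtain t where "t \<in> T" "0 + \<alpha> t \<noteq> 0" by auto
        then show ?thesis by (rule wt_kf_zero[OF n(1)[unfolded C0] \<alpha>])
      next
        case False
        then have "z \<in> C" unfolding C0 using \<alpha> wt_cong[of T \<alpha> "\<lambda>_. 0"] by auto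
        then show ?thesis by (rule n(2))
      qed
    qed
    ultimately show "kf n y = 0" using kf_zero_on_span by blast
  qed
  have T_nd: "t = 0" if t: "t \<in> T" "\<And>t'. t' \<in> T \<Longrightarrow> kf t t' = 0" for t
  proof (rule perp)
    show "t \<in> C" using t(1) TC by blast
    fix y assume y: "y \<in> C"
    then obtain s where s: "s \<in> T" "adnil (y - s)" using jordan by blast
    have "kf (y - s) t = 0" by (rule nil_T[OF subspace_diff[OF subC y] s(2) t(1)]) (use s TC in auto)
    then show "kf t y = 0" using t(2)[OF s(1)] by (simp add: kf_diff_l kf_sym[of t])
  qed
  have nil_sum: "adnil (n + m)" if n: "n \<in> C" "adnil n" and m: "m \<in> C" "adnil m" for n m
  proof -
    have nm: "n + m \<in> C" by (rule subspace_add[OF subC n(1) m(1)])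
    then obtain s where s: "s \<in> T" "adnil (n + m - s)" using jordan by blast
    have "n + m - s \<in> C" by (rule subspace_diff[OF subC nm]) (use s TC in auto)
    then have "kf s t = 0" if "t \<in> T" for t
      using nil_T[OF _ s(2) that] nil_T[OF n that] nil_T[OF m that] by (simp add: kf_add_l kf_diff_l)
    then have "s = 0" using T_nd s(1) by blast
    then show ?thesis using s(2) by simp
  qed
  have nil0: "n = 0" if n: "n \<in> C" "adnil n" for n
  proof (rule perp[OF n(1)])
    have sq: "kf m m = 0" if "adnil m" for m by (rule kf_adnil[OF that br_self])
    fix y assume y: "y \<in> C"
    then obtain s where s: "s \<in> T" "adnil (y - s)" using jordan by blast
    let ?m = "y - s"
    have m: "?m \<in> C" by (rule subspace_diff[OF subC y]) (use s TC in auto)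
    have "kf (n + ?m) (n + ?m) = 0" by (rule sq[OF nil_sum[OF n m s(2)]])
    then have "kf n ?m + kf n ?m = 0"
      using sq[OF n(2)] sq[OF s(2)] kf_sym[of ?m n] by (simp only: kf_add_l kf_add_r) simp
    then have "kf n ?m = 0" by (simp flip: mult_2)
    then show "kf n y = 0" using nil_T[OF n s(1)] by (simp add: kf_diff_r)
  qed
  have xC: "x \<in> C" using x by (simp add: C_def)
  then obtain s where s: "s \<in> T" "adnil (x - s)" using jordan by blast
  have "x - s = 0" by (rule nil0[OF subspace_diff[OF subC xC] s(2)]) (use s TC in auto)
  then show ?thesis using s(1) by simp
qed

end

locale cartan_space = lie_space scale G br
  for scale :: "'k::{alg_closed_field,field_char_0} \<Rightarrow> 'g::ab_group_add \<Rightarrow> 'g" (infixr "\<odot>" 75)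
    and G br +
  fixes T :: "'g set"
  assumes nd: "kf_nondegenerate"
    and subspace_T: "subspace T" and T_G: "T \<subseteq> G"
    and T_abelian: "s \<in> T \<Longrightarrow> t \<in> T \<Longrightarrow> br s t = 0"
    and span_wt: "G \<subseteq> span (\<Union>\<alpha>. wt T \<alpha>)"
    and self_centralizing: "x \<in> G \<Longrightarrow> (\<And>t. t \<in> T \<Longrightarrow> br t x = 0) \<Longrightarrow> x \<in> T"
begin

lemma T_wt: "t \<in> T \<Longrightarrow> t \<in> wt T (\<lambda>_. 0)"
  using T_G T_abelian by (auto simp: wt_def)

lemma wt_zero: "x \<in> wt T \<alpha> \<Longrightarrow> (\<And>t. t \<in> T \<Longrightarrow> \<alpha> t = 0) \<Longrightarrow> x \<in> T"
  by (intro self_centralizing) (auto simp: wt_def)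

lemma wt_pair:
  assumes x: "x \<in> wt T \<alpha>" "x \<noteq> 0"
  shows "\<exists>y\<in>wt T (\<lambda>t. - \<alpha> t). kf x y = 1"
proof -
  have "\<exists>y\<in>\<Union>\<beta>. wt T \<beta>. kf x y \<noteq> 0"
  proof (rule ccontr)
    assume a: "\<not> ?thesis"
    have "kf x y = 0" if "y \<in> G" for y
      by (rule kf_zero_on_span[of "\<Union>\<beta>. wt T \<beta>"]) (use a span_wt that in auto)
    then show False using kf_nondegenerateD[OF nd wtD(1)[OF x(1)]] x(2) by blast
  qed
  then obtain y \<beta> where y: "y \<in> wt T \<beta>" "kf x y \<noteq> 0" by blast
  have "\<beta> t = - \<alpha> t" if "t \<in> T" for t
    using wt_kf_zero[OF x(1) y(1) that] y(2) by (auto simp: eq_neg_iff_add_eq_0 add.commute)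
  then have "y \<in> wt T (\<lambda>t. - \<alpha> t)" using y(1) wt_cong[of T \<beta> "\<lambda>t. - \<alpha> t"] by auto
  then have "(1 / kf x y) \<odot> y \<in> wt T (\<lambda>t. - \<alpha> t)" by (rule subspace_scale[OF subspace_wt])
  moreover have "kf x ((1 / kf x y) \<odot> y) = 1" using y(2) by (simp add: kf_scale_r)
  ultimately show ?thesis by blast
qed

lemma kf_T_nondegenerate:
  assumes t: "t \<in> T" "\<And>t'. t' \<in> T \<Longrightarrow> kf t t' = 0" shows "t = 0"
proof (rule ccontr)
  assume "t \<noteq> 0"
  from wt_pair[OF T_wt[OF t(1)] this] obtain y where y: "y \<in> wt T (\<lambda>_. - 0)" "kf t y = 1" by auto
  then have "y \<in> T" using wt_zero by auto
  then show False using t(2) y(2) by auto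
qed

lemma br_opposite:
  assumes x: "x \<in> wt T \<alpha>" and y: "y \<in> wt T (\<lambda>t. - \<alpha> t)"
  shows "br x y \<in> T" "t \<in> T \<Longrightarrow> kf (br x y) t = \<alpha> t * kf x y"
proof -
  show "br x y \<in> T" using wt_br[OF x y] by (rule wt_zero) simp
  assume t: "t \<in> T"
  have "br y t = \<alpha> t \<odot> y"
    using wtD(2)[OF y t] br_anti[where x = t and y = y] by simp
  then show "kf (br x y) t = \<alpha> t * kf x y" by (simp add: kf_invariant kf_scale_r)
qed

lemma wt_sequence_terminates:
  assumes v: "\<And>k::nat. v k \<in> wt T (\<lambda>t. \<beta> t + of_nat k * \<alpha> t)" and t: "t \<in> T" "\<alpha> t \<noteq> 0"
  shows "\<exists>k. v k = 0"
proof (rule ccontr)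
  assume nz: "\<nexists>k. v k = 0"
  show False
  proof (rule no_infinite_eigenvector_sequence[OF endo_br[of t], of v "\<lambda>k. \<beta> t + of_nat k * \<alpha> t"])
    show "v k \<in> G" "br t (v k) = (\<beta> t + of_nat k * \<alpha> t) \<odot> v k" for k using wtD[OF v] t by auto
  qed (use nz t in \<open>auto simp: inj_def\<close>)
qed

lemma root_nonisotropic:
  assumes x: "x \<in> wt T \<alpha>" and y: "y \<in> wt T (\<lambda>t. - \<alpha> t)" and xy: "kf x y = 1" and t: "t \<in> T" "\<alpha> t \<noteq> 0"
  shows "\<alpha> (br x y) \<noteq> 0"
proof
  let ?h = "br x y"
  assume 0: "\<alpha> ?h = 0"
  have hT: "?h \<in> T" by (rule br_opposite(1)[OF x y])
  have "\<beta> ?h = 0" if z: "z \<in> wt T \<beta>" "z \<noteq> 0" for z \<beta>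
  proof -
    let ?z = "\<lambda>k. (br x ^^ k) z"
    obtain K where K: "?z K = 0" using wt_sequence_terminates[OF wt_br_pow[OF x z(1)] t] by blast
    define M where "M = (LEAST k. ?z k = 0)"
    have M: "?z M = 0" "\<And>j. j < M \<Longrightarrow> ?z j \<noteq> 0"
      unfolding M_def using LeastI[of "\<lambda>k. ?z k = 0", OF K] not_less_Least[of _ "\<lambda>k. ?z k = 0"] by auto
    obtain p where p: "M = Suc p" using M(1) z(2) by (cases M) auto
    define v where "v = ?z p"
    have v: "v \<noteq> 0" "br x v = 0" using M p by (auto simp: v_def)
    have vw: "v \<in> wt T (\<lambda>t. \<beta> t + of_nat p * \<alpha> t)" unfolding v_def by (rule wt_br_pow[OF x z(1)])
    let ?v = "\<lambda>k. (br y ^^ k) v"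
    have vk: "?v k \<in> wt T (\<lambda>t. (\<beta> t + of_nat p * \<alpha> t) + of_nat k * - \<alpha> t)" for k
      by (rule wt_br_pow[OF y vw])
    then have hv: "br ?h (?v k) = \<beta> ?h \<odot> ?v k" for k using wtD(2)[OF vk hT] 0 by simp
    have xv: "br x (?v (Suc k)) = (of_nat (Suc k) * \<beta> ?h) \<odot> ?v k" for k
    proof (induction k)
      case 0
      show ?case using hv[of 0] v(2) by (simp add: jacobi[of x y v])
    next
      case (Suc k)
      have "br x (?v (Suc (Suc k))) = br ?h (?v (Suc k)) + br y (br x (?v (Suc k)))"
        by (simp add: jacobi[of x y])
      also have "\<dots> = \<beta> ?h \<odot> ?v (Suc k) + (of_nat (Suc k) * \<beta> ?h) \<odot> ?v (Suc k)"
        unfolding hv Suc by (simp add: br_scale_r)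
      also have "\<dots> = (of_nat (Suc (Suc k)) * \<beta> ?h) \<odot> ?v (Suc k)"
        by (simp only: scale_left_distrib[symmetric]) (simp add: algebra_simps)
      finally show ?case .
    qed
    obtain K' where K': "?v K' = 0" 
      using wt_sequence_terminates[where \<alpha> = "\<lambda>t. - \<alpha> t", OF vk t(1)] t(2) by auto
    define M' where "M' = (LEAST k. ?v k = 0)"
    have M': "?v M' = 0" "\<And>j. j < M' \<Longrightarrow> ?v j \<noteq> 0"
      unfolding M'_def using LeastI[of "\<lambda>k. ?v k = 0", OF K'] not_less_Least[of _ "\<lambda>k. ?v k = 0"] by auto
    obtain q where q: "M' = Suc q" using M'(1) v(1) by (cases M') auto
    have "(of_nat (Suc q) * \<beta> ?h) \<odot> ?v q = 0" using xv[of q] M'(1) q by simp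
    moreover have "?v q \<noteq> 0" using M'(2) q by simp
    ultimately show "\<beta> ?h = 0" using of_nat_eq_0_iff[of "Suc q", where 'a = 'k] by (simp del: of_nat_Suc of_nat_eq_0_iff)
  qed
  then have "br ?h z = 0" if "z \<in> (\<Union>\<beta>. wt T \<beta>)" for z
    using that wtD(2)[OF _ hT] by (cases "z = 0") auto
  then have hz: "br ?h z = 0" if "z \<in> G" for z
    using lin_eq_on_span[OF lin_br[of ?h], of "\<lambda>_. 0" "\<Union>\<beta>. wt T \<beta>" z] span_wt that by (auto simp: lmap_def)
  have "?h = 0" by (rule center_trivial[OF nd br_in hz])
  then show False using br_opposite(2)[OF x y t(1)] xy t(2) by simp
qed

lemma root_sl2:
  assumes x: "x \<in> wt T \<alpha>" "x \<noteq> 0" and t: "t \<in> T" "\<alpha> t \<noteq> 0"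
  shows "\<exists>f\<in>wt T (\<lambda>t. - \<alpha> t). \<exists>h\<in>T. br x f = h \<and> \<alpha> h = 2 \<and> br h x = 2 \<odot> x \<and> br h f = (-2) \<odot> f \<and>
    (\<exists>c. c \<noteq> 0 \<and> (\<forall>t\<in>T. kf h t = c * \<alpha> t))"
proof -
  obtain y where y: "y \<in> wt T (\<lambda>t. - \<alpha> t)" "kf x y = 1" using wt_pair[OF x] by blast
  let ?a = "\<alpha> (br x y)"
  have a: "?a \<noteq> 0" by (rule root_nonisotropic[OF x(1) y t])
  let ?f = "(2 / ?a) \<odot> y"
  let ?h = "(2 / ?a) \<odot> br x y"
  have hT: "br x y \<in> T" by (rule br_opposite(1)[OF x(1) y(1)])
  have f: "?f \<in> wt T (\<lambda>t. - \<alpha> t)" by (rule subspace_scale[OF subspace_wt y(1)])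
  have h: "?h \<in> T" by (rule subspace_scale[OF subspace_T hT])
  have hx: "br ?h x = 2 \<odot> x" using wtD(2)[OF x(1) hT] a by (simp add: br_scale_l)
  have "br ?h x = \<alpha> ?h \<odot> x" by (rule wtD(2)[OF x(1) h])
  then have ah: "\<alpha> ?h = 2" using hx x(2) by simp
  have hf: "br ?h ?f = (-2) \<odot> ?f" using wtD(2)[OF f h] ah by simp
  have "kf ?h t = (2 / ?a) * \<alpha> t" if "t \<in> T" for t
    using br_opposite(2)[OF x(1) y(1) that] y(2) by (simp add: kf_scale_l)
  moreover have "2 / ?a \<noteq> 0" using a by simp
  moreover have "br x ?f = ?h" by (rule br_scale_r)
  ultimately show ?thesis using f h hx hf ah by blast
qed

lemma wt_reflection:
  assumes e: "e \<in> wt T \<alpha>" and f: "f \<in> wt T (\<lambda>t. - \<alpha> t)" and h: "h \<in> T"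
    and sl2: "br e f = h" "br h e = 2 \<odot> e" "br h f = (-2) \<odot> f"
    and u: "u \<in> wt T \<gamma>" "u \<noteq> 0"
  shows "\<exists>n::int. \<gamma> h = of_int n \<and> (\<exists>v\<in>wt T (\<lambda>t. \<gamma> t - of_int n * \<alpha> t). v \<noteq> 0)"
proof -
  have hu: "br h u = \<gamma> h \<odot> u" by (rule wtD(2)[OF u(1) h])
  obtain N p :: nat where N: "\<gamma> h = of_nat N - 2 * of_nat p" "\<And>j. j \<le> N \<Longrightarrow> (br f ^^ j) ((br e ^^ p) u) \<noteq> 0"
    using sl2_eigenvector[OF sl2 wtD(1)[OF u(1)] u(2) hu] by blast
  let ?n = "int N - 2 * int p"
  have n: "\<gamma> h = of_int ?n" using N(1) by simp
  show ?thesis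
  proof (cases "p \<le> N")
    case True
    let ?v = "(br f ^^ (N - p)) ((br e ^^ p) u)"
    have "?v \<in> wt T (\<lambda>t. (\<gamma> t + of_nat p * \<alpha> t) + of_nat (N - p) * - \<alpha> t)"
      by (intro wt_br_pow f e u)
    also have "\<dots> = wt T (\<lambda>t. \<gamma> t - of_int ?n * \<alpha> t)"
      by (rule wt_cong) (use True in \<open>simp add: of_nat_diff algebra_simps\<close>)
    finally show ?thesis using n N(2)[of "N - p"] by (intro exI[of _ ?n]) auto
  next
    case False
    have sl2': "br f e = - h" "br (- h) f = 2 \<odot> f" "br (- h) e = (-2) \<odot> e"
      using sl2 br_anti[where x = e and y = f] by (simp_all add: br_neg_l)
    have "br (- h) u = (- \<gamma> h) \<odot> u" by (simp add: br_neg_l hu)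
    then obtain N' p' :: nat where N': "- \<gamma> h = of_nat N' - 2 * of_nat p'" "\<And>j. j \<le> N' \<Longrightarrow> (br e ^^ j) ((br f ^^ p') u) \<noteq> 0"
      using sl2_eigenvector[OF sl2' wtD(1)[OF u(1)] u(2)] by blast
    have "of_int (int N' - 2 * int p') = (of_int (- ?n) :: 'k)" using N'(1) n by simp
    then have n': "int N' - 2 * int p' = - ?n" by (simp only: of_int_eq_iff)
    then have le: "p' \<le> N'" using False by linarith
    let ?v = "(br e ^^ (N' - p')) ((br f ^^ p') u)"
    have "?v \<in> wt T (\<lambda>t. (\<gamma> t + of_nat p' * - \<alpha> t) + of_nat (N' - p') * \<alpha> t)"
      by (intro wt_br_pow f e u)
    also have "\<dots> = wt T (\<lambda>t. \<gamma> t - of_int ?n * \<alpha> t)"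
    proof (rule wt_cong)
      fix t
      have "of_int ?n = (2 * of_nat p' - of_nat N' :: 'k)"
        using arg_cong[OF n', of "\<lambda>z. - of_int z :: 'k"] by simp
      moreover have "of_nat (N' - p') = (of_nat N' - of_nat p' :: 'k)" using le by (rule of_nat_diff)
      ultimately show "\<gamma> t + of_nat p' * - \<alpha> t + of_nat (N' - p') * \<alpha> t = \<gamma> t - of_int ?n * \<alpha> t"
        by (simp only:) (simp add: algebra_simps)
    qed
    finally show ?thesis using n N'(2)[of "N' - p'"] le by (intro exI[of _ ?n]) auto
  qed
qed

end

section \<open>The roots of E6\<close>

definition E6_positive_roots :: "int list list" where
  "E6_positive_roots = [[1, 0, 0, 0, 0, 0], [0, 1, 0, 0, 0, 0], [0, 0, 1, 0, 0, 0], [0, 0, 0, 1, 0, 0],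
    [0, 0, 0, 0, 1, 0], [0, 0, 0, 0, 0, 1], [1, 0, 1, 0, 0, 0], [0, 1, 0, 1, 0, 0],
    [0, 0, 1, 1, 0, 0], [0, 0, 0, 1, 1, 0], [0, 0, 0, 0, 1, 1], [1, 0, 1, 1, 0, 0],
    [0, 1, 1, 1, 0, 0], [0, 1, 0, 1, 1, 0], [0, 0, 1, 1, 1, 0], [0, 0, 0, 1, 1, 1],
    [1, 1, 1, 1, 0, 0], [1, 0, 1, 1, 1, 0], [0, 1, 1, 1, 1, 0], [0, 1, 0, 1, 1, 1],
    [0, 0, 1, 1, 1, 1], [1, 1, 1, 1, 1, 0], [1, 0, 1, 1, 1, 1], [0, 1, 1, 2, 1, 0],
    [0, 1, 1, 1, 1, 1], [1, 1, 1, 2, 1, 0], [1, 1, 1, 1, 1, 1], [0, 1, 1, 2, 1, 1],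
    [1, 1, 2, 2, 1, 0], [1, 1, 1, 2, 1, 1], [0, 1, 1, 2, 2, 1], [1, 1, 2, 2, 1, 1],
    [1, 1, 1, 2, 2, 1], [1, 1, 2, 2, 2, 1], [1, 1, 2, 3, 2, 1], [1, 2, 2, 3, 2, 1]]"

context cartan_space begin

lemma coroot_triple:
  assumes x: "x \<in> wt T \<alpha>" "x \<noteq> 0" and h: "h \<in> T" "\<alpha> h = 2"
    "h \<in> span {br x y | x y. x \<in> wt T \<alpha> \<and> y \<in> wt T (\<lambda>t. - \<alpha> t)}"
  shows "\<exists>f\<in>wt T (\<lambda>t. - \<alpha> t). br x f = h \<and> br h x = 2 \<odot> x \<and> br h f = (-2) \<odot> f"
proof -
  have nz: "\<alpha> h \<noteq> 0" using h(2) by simp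
  obtain f h' where f: "f \<in> wt T (\<lambda>t. - \<alpha> t)" and h': "h' \<in> T" "\<alpha> h' = 2"
    and fh: "br x f = h'" "br h' x = 2 \<odot> x" "br h' f = (-2) \<odot> f"
    and ex: "\<exists>c. c \<noteq> 0 \<and> (\<forall>t\<in>T. kf h' t = c * \<alpha> t)"
    using root_sl2[OF x h(1) nz] by blast
  obtain c where c: "c \<noteq> 0" "\<forall>t\<in>T. kf h' t = c * \<alpha> t" using ex by blast
  let ?P = "{z. \<exists>d. \<forall>t\<in>T. kf z t = d * \<alpha> t}"
  have "subspace ?P"
  proof (rule subspaceI)
    show "0 \<in> ?P" by (auto intro!: exI[of _ 0])
    show "a + b \<in> ?P" if ab: "a \<in> ?P" "b \<in> ?P" for a b
    proof -
      obtain p q where "\<forall>t\<in>T. kf a t = p * \<alpha> t" "\<forall>t\<in>T. kf b t = q * \<alpha> t" using ab by auto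
      then have "\<forall>t\<in>T. kf (a + b) t = (p + q) * \<alpha> t" by (simp add: kf_add_l distrib_right)
      then show ?thesis by blast
    qed
    show "r \<odot> a \<in> ?P" if a: "a \<in> ?P" for r a
    proof -
      obtain p where "\<forall>t\<in>T. kf a t = p * \<alpha> t" using a by auto
      then have "\<forall>t\<in>T. kf (r \<odot> a) t = (r * p) * \<alpha> t" by (simp add: kf_scale_l)
      then show ?thesis by blast
    qed
  qed
  moreover have "br x y \<in> ?P" if "x \<in> wt T \<alpha>" "y \<in> wt T (\<lambda>t. - \<alpha> t)" for x y
    using br_opposite(2)[OF that] by (auto simp: mult.commute intro!: exI[of _ "kf x y"])
  ultimately have "span {br x y | x y. x \<in> wt T \<alpha> \<and> y \<in> wt T (\<lambda>t. - \<alpha> t)} \<subseteq> ?P"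
    by (intro span_minimal) auto
  then obtain d where d: "\<forall>t\<in>T. kf h t = d * \<alpha> t" using h(3) by blast
  have "c \<odot> h - d \<odot> h' = 0"
  proof (rule kf_T_nondegenerate)
    show "c \<odot> h - d \<odot> h' \<in> T" using h(1) h'(1) subspace_T by (simp add: subspace_diff subspace_scale)
    show "kf (c \<odot> h - d \<odot> h') t = 0" if "t \<in> T" for t
      using c(2) d that by (simp add: kf_diff_l kf_scale_l)
  qed
  then have eq: "c \<odot> h = d \<odot> h'" by simp
  have hx: "br h x = 2 \<odot> x" using wtD(2)[OF x(1) h(1)] h(2) by simp
  have "br (c \<odot> h) x = br (d \<odot> h') x" by (simp only: eq)
  then have "(c * 2) \<odot> x = (d * 2) \<odot> x" unfolding br_scale_l hx fh(2) by simp
  then have "c = d" using x(2) by simp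
  then have "h = h'" using eq c(1) by simp
  then show ?thesis using f fh by blast
qed

definition "root_combination \<alpha> xs t = (\<Sum>i<length xs. of_int (xs ! i) * \<alpha> (Suc i) t)"

definition "is_weight \<beta> \<longleftrightarrow> (\<exists>v\<in>wt T \<beta>. v \<noteq> 0)"

text \<open>The reflections in the simple roots produce all 36 positive roots from the simple ones, each
  by raising the height.\<close>

lemma E6_root_count:
  fixes \<alpha> :: "nat \<Rightarrow> 'g \<Rightarrow> 'k"
  assumes nz: "\<And>i. i \<in> {1..6} \<Longrightarrow> is_weight (\<alpha> i)"
    and indep: "\<And>c :: nat \<Rightarrow> 'k. \<forall>t\<in>T. (\<Sum>i\<in>{1..6}. c i * \<alpha> i t) = 0 \<Longrightarrow> \<forall>i\<in>{1..6}. c i = 0"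
    and cor: "\<And>j. j \<in> {1..6} \<Longrightarrow> \<exists>h\<in>T. \<alpha> j h = 2 \<and>
      h \<in> span {br x y | x y. x \<in> wt T (\<alpha> j) \<and> y \<in> wt T (\<lambda>t. - \<alpha> j t)} \<and>
      (\<forall>i\<in>{1..6}. \<alpha> i h = of_int (E6_cartan_matrix i j))"
    and C: "finite C" "G \<subseteq> span C"
  shows "72 \<le> card C"
proof -
  let ?r = "root_combination \<alpha>"
  let ?g = "\<lambda>xs. is_weight (?r xs)"
  have r6: "?r [a,b,c,d,e,f] t = of_int a * \<alpha> 1 t + of_int b * \<alpha> 2 t + of_int c * \<alpha> 3 t
      + of_int d * \<alpha> 4 t + of_int e * \<alpha> 5 t + of_int f * \<alpha> 6 t" for a b c d e f t
    by (simp add: root_combination_def eval_nat_numeral lessThan_Suc algebra_simps)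
  have step: "\<exists>n::int. of_int n = (of_int a * \<alpha> 1 h + of_int b * \<alpha> 2 h + of_int c * \<alpha> 3 h
      + of_int d * \<alpha> 4 h + of_int e * \<alpha> 5 h + of_int f * \<alpha> 6 h) \<and>
      is_weight (\<lambda>t. ?r [a,b,c,d,e,f] t - of_int n * \<alpha> j t)"
    if g: "?g [a,b,c,d,e,f]" and j: "j \<in> {1..6}" and h: "h \<in> T" "\<alpha> j h = 2"
      "h \<in> span {br x y | x y. x \<in> wt T (\<alpha> j) \<and> y \<in> wt T (\<lambda>t. - \<alpha> j t)}" for a b c d e f j h
  proof -
    obtain x where x: "x \<in> wt T (\<alpha> j)" "x \<noteq> 0" using nz[OF j] by (auto simp: is_weight_def)
    obtain f' where f': "f' \<in> wt T (\<lambda>t. - \<alpha> j t)" "br x f' = h" "br h x = 2 \<odot> x" "br h f' = (-2) \<odot> f'"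
      using coroot_triple[OF x h] by blast
    obtain u where u: "u \<in> wt T (?r [a,b,c,d,e,f])" "u \<noteq> 0" using g by (auto simp: is_weight_def)
    obtain n :: int where "?r [a,b,c,d,e,f] h = of_int n"
      "\<exists>v\<in>wt T (\<lambda>t. ?r [a,b,c,d,e,f] t - of_int n * \<alpha> j t). v \<noteq> 0"
      using wt_reflection[OF x(1) f'(1) h(1) f'(2-4) u] by blast
    then show ?thesis unfolding is_weight_def r6 by (intro exI[of _ n]) simp
  qed
  have step': "?g ys" if g: "?g [a,b,c,d,e,f]" and j: "j \<in> {1..6}"
    and ys: "\<And>t. ?r ys t = ?r [a,b,c,d,e,f] t - of_int (a * E6_cartan_matrix 1 j + b * E6_cartan_matrix 2 j
      + c * E6_cartan_matrix 3 j + d * E6_cartan_matrix 4 j + e * E6_cartan_matrix 5 j + f * E6_cartan_matrix 6 j) * \<alpha> j t"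
    for a b c d e f j ys
  proof -
    obtain h where h: "h \<in> T" "\<alpha> j h = 2"
      "h \<in> span {br x y | x y. x \<in> wt T (\<alpha> j) \<and> y \<in> wt T (\<lambda>t. - \<alpha> j t)}"
      and A: "\<forall>i\<in>{1..6}. \<alpha> i h = of_int (E6_cartan_matrix i j)" using cor[OF j] by blast
    have Ai: "\<alpha> i h = of_int (E6_cartan_matrix i j)" if "i \<in> {1..6}" for i using A that by (rule bspec)
    obtain n :: int where n: "of_int n = (of_int a * \<alpha> 1 h + of_int b * \<alpha> 2 h + of_int c * \<alpha> 3 h
      + of_int d * \<alpha> 4 h + of_int e * \<alpha> 5 h + of_int f * \<alpha> 6 h)"
      and w: "is_weight (\<lambda>t. ?r [a,b,c,d,e,f] t - of_int n * \<alpha> j t)"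
      using step[OF g j h] by blast
    let ?m = "a * E6_cartan_matrix 1 j + b * E6_cartan_matrix 2 j
      + c * E6_cartan_matrix 3 j + d * E6_cartan_matrix 4 j + e * E6_cartan_matrix 5 j + f * E6_cartan_matrix 6 j"
    have "(of_int n :: 'k) = of_int ?m"
      unfolding n by (simp add: Ai)
    then have "n = ?m" by (simp only: of_int_eq_iff)
    then show ?thesis using w unfolding ys by simp
  qed
  have A: "E6_cartan_matrix i j = (if i = j then 2 else if (i, j) \<in> {(1,3),(3,1),(3,4),(4,3),(4,5),(5,4),(5,6),(6,5),(2,4),(4,2)} then - 1 else 0)" for i j
    unfolding E6_cartan_matrix_def by (auto simp: doubleton_eq_iff)
  have R1: "?g [c - a, b, c, d, e, f]" if "?g [a,b,c,d,e,f]" for a b c d e f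
    by (rule step'[OF that, of 1]) (simp_all add: r6 A algebra_simps)
  have R2: "?g [a, d - b, c, d, e, f]" if "?g [a,b,c,d,e,f]" for a b c d e f
    by (rule step'[OF that, of 2]) (simp_all add: r6 A algebra_simps)
  have R3: "?g [a, b, a + d - c, d, e, f]" if "?g [a,b,c,d,e,f]" for a b c d e f
    by (rule step'[OF that, of 3]) (simp_all add: r6 A algebra_simps)
  have R4: "?g [a, b, c, b + c + e - d, e, f]" if "?g [a,b,c,d,e,f]" for a b c d e f
    by (rule step'[OF that, of 4]) (simp_all add: r6 A algebra_simps)
  have R5: "?g [a, b, c, d, d + f - e, f]" if "?g [a,b,c,d,e,f]" for a b c d e f
    by (rule step'[OF that, of 5]) (simp_all add: r6 A algebra_simps)
  have R6: "?g [a, b, c, d, e, e - f]" if "?g [a,b,c,d,e,f]" for a b c d e f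
    by (rule step'[OF that, of 6]) (simp_all add: r6 A algebra_simps)
  have s: "?g [a,b,c,d,e,f]" if "i \<in> {1..6}" "\<And>t. ?r [a,b,c,d,e,f] t = \<alpha> i t" for a b c d e f i
  proof -
    have "?r [a,b,c,d,e,f] = \<alpha> i" using that(2) by (rule ext)
    then show ?thesis using nz[OF that(1)] by simp
  qed
  have r1: "?g [1,0,0,0,0,0]" by (rule s[of 1]) (simp_all add: r6)
  have r2: "?g [0,1,0,0,0,0]" by (rule s[of 2]) (simp_all add: r6)
  have r3: "?g [0,0,1,0,0,0]" by (rule s[of 3]) (simp_all add: r6)
  have r4: "?g [0,0,0,1,0,0]" by (rule s[of 4]) (simp_all add: r6)
  have r5: "?g [0,0,0,0,1,0]" by (rule s[of 5]) (simp_all add: r6)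
  have r6': "?g [0,0,0,0,0,1]" by (rule s[of 6]) (simp_all add: r6)
  have r7: "?g [1, 0, 1, 0, 0, 0]" using R3[OF r1] by simp
  have r8: "?g [0, 1, 0, 1, 0, 0]" using R4[OF r2] by simp
  have r9: "?g [0, 0, 1, 1, 0, 0]" using R4[OF r3] by simp
  have r10: "?g [0, 0, 0, 1, 1, 0]" using R5[OF r4] by simp
  have r11: "?g [0, 0, 0, 0, 1, 1]" using R6[OF r5] by simp
  have r12: "?g [1, 0, 1, 1, 0, 0]" using R4[OF r7] by simp
  have r13: "?g [0, 1, 1, 1, 0, 0]" using R3[OF r8] by simp
  have r14: "?g [0, 1, 0, 1, 1, 0]" using R5[OF r8] by simp
  have r15: "?g [0, 0, 1, 1, 1, 0]" using R5[OF r9] by simp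
  have r16: "?g [0, 0, 0, 1, 1, 1]" using R6[OF r10] by simp
  have r17: "?g [1, 1, 1, 1, 0, 0]" using R2[OF r12] by simp
  have r18: "?g [1, 0, 1, 1, 1, 0]" using R5[OF r12] by simp
  have r19: "?g [0, 1, 1, 1, 1, 0]" using R5[OF r13] by simp
  have r20: "?g [0, 1, 0, 1, 1, 1]" using R6[OF r14] by simp
  have r21: "?g [0, 0, 1, 1, 1, 1]" using R6[OF r15] by simp
  have r22: "?g [1, 1, 1, 1, 1, 0]" using R5[OF r17] by simp
  have r23: "?g [1, 0, 1, 1, 1, 1]" using R6[OF r18] by simp
  have r24: "?g [0, 1, 1, 2, 1, 0]" using R4[OF r19] by simp
  have r25: "?g [0, 1, 1, 1, 1, 1]" using R6[OF r19] by simp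
  have r26: "?g [1, 1, 1, 2, 1, 0]" using R4[OF r22] by simp
  have r27: "?g [1, 1, 1, 1, 1, 1]" using R6[OF r22] by simp
  have r28: "?g [0, 1, 1, 2, 1, 1]" using R6[OF r24] by simp
  have r29: "?g [1, 1, 2, 2, 1, 0]" using R3[OF r26] by simp
  have r30: "?g [1, 1, 1, 2, 1, 1]" using R6[OF r26] by simp
  have r31: "?g [0, 1, 1, 2, 2, 1]" using R5[OF r28] by simp
  have r32: "?g [1, 1, 2, 2, 1, 1]" using R6[OF r29] by simp
  have r33: "?g [1, 1, 1, 2, 2, 1]" using R5[OF r30] by simp
  have r34: "?g [1, 1, 2, 2, 2, 1]" using R5[OF r32] by simp
  have r35: "?g [1, 1, 2, 3, 2, 1]" using R4[OF r34] by simp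
  have r36: "?g [1, 2, 2, 3, 2, 1]" using R2[OF r35] by simp
  let ?P = "set E6_positive_roots" and ?N = "map uminus ` set E6_positive_roots"
  have pos: "?g xs" if "xs \<in> ?P" for xs
    using that unfolding E6_positive_roots_def
    by (simp only: set_simps insert_iff empty_iff simp_thms) (elim disjE; simp only: r1 r2 r3 r4 r5 r6' r7 r8 r9 r10 r11 r12 r13 r14 r15 r16 r17 r18 r19 r20 r21 r22 r23 r24 r25 r26 r27 r28 r29 r30 r31 r32 r33 r34 r35 r36)
  have len: "length xs = 6" "sum_list xs > 0" if "xs \<in> ?P" for xs
    using that unfolding E6_positive_roots_def by auto
  have neg: "?g xs" if "xs \<in> ?N" for xs
  proof -
    obtain ys where ys: "ys \<in> ?P" "xs = map uminus ys" using \<open>xs \<in> ?N\<close> by auto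
    obtain v where v: "v \<in> wt T (?r ys)" "v \<noteq> 0" using pos[OF ys(1)] by (auto simp: is_weight_def)
    obtain w where w: "w \<in> wt T (\<lambda>t. - ?r ys t)" "kf v w = 1" using wt_pair[OF v] by blast
    have "(\<lambda>t. - ?r ys t) = ?r xs" by (rule ext) (simp add: root_combination_def ys(2) sum_negf)
    moreover have "w \<noteq> 0" using w(2) by auto
    ultimately show ?thesis using w(1) by (auto simp: is_weight_def)
  qed
  have neg_len: "length xs = 6" "sum_list xs < 0" if "xs \<in> ?N" for xs
  proof -
    obtain ys where ys: "ys \<in> ?P" "xs = map uminus ys" using \<open>xs \<in> ?N\<close> by auto
    have "sum_list (map uminus ys) = - sum_list ys" by (induction ys) auto
    then show "length xs = 6" "sum_list xs < 0" using len[OF ys(1)] ys(2) by auto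
  qed
  have "inj (map uminus :: int list \<Rightarrow> int list)" by (simp add: inj_on_def)
  then have "card ?N = card ?P" by (intro card_image) (auto intro: inj_on_subset)
  moreover have "card ?P = 36"
  proof -
    have "distinct E6_positive_roots" by (simp add: E6_positive_roots_def)
    then show ?thesis by (simp add: distinct_card) (simp add: E6_positive_roots_def)
  qed
  moreover have "?P \<inter> ?N = {}" using len(2) neg_len(2) by fastforce
  ultimately have card: "card (?P \<union> ?N) = 72" by (simp add: card_Un_disjoint)
  have "\<forall>xs\<in>?P \<union> ?N. \<exists>v. v \<in> wt T (?r xs) \<and> v \<noteq> 0"
  proof
    fix xs assume "xs \<in> ?P \<union> ?N"
    then have "?g xs" by (rule UnE) (rule pos, assumption, rule neg)
    then show "\<exists>v. v \<in> wt T (?r xs) \<and> v \<noteq> 0" unfolding is_weight_def by (simp only: Bex_def)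
  qed
  then obtain v where v: "\<forall>xs\<in>?P \<union> ?N. v xs \<in> wt T (?r xs) \<and> v xs \<noteq> 0" by (rule bchoice[THEN exE])
  have ind: "indep_family (?P \<union> ?N) v"
  proof (rule wt_independent[where T = T and \<beta> = ?r])
    fix xs ys assume xy: "xs \<in> ?P \<union> ?N" "ys \<in> ?P \<union> ?N" "xs \<noteq> ys"
    have l: "length xs = 6" "length ys = 6" using xy len neg_len by auto
    show "\<exists>t\<in>T. ?r xs t \<noteq> ?r ys t"
    proof (rule ccontr)
      assume "\<not> (\<exists>t\<in>T. ?r xs t \<noteq> ?r ys t)"
      then have eq: "?r xs t = ?r ys t" if "t \<in> T" for t using that by blast
      let ?c = "\<lambda>i. of_int (xs ! (i - 1) - ys ! (i - 1)) :: 'k"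
      have s6: "(\<Sum>i\<in>{1..6}. F i) = (\<Sum>i<6. F (Suc i))" for F :: "nat \<Rightarrow> 'k"
        by (rule sum.reindex_bij_witness[of _ "Suc" "\<lambda>i. i - 1"]) auto
      have "\<forall>t\<in>T. (\<Sum>i\<in>{1..6}. ?c i * \<alpha> i t) = 0"
      proof
        fix t assume t: "t \<in> T"
        have "?c (Suc k) * \<alpha> (Suc k) t = of_int (xs ! k) * \<alpha> (Suc k) t - of_int (ys ! k) * \<alpha> (Suc k) t" for k
          by (simp add: algebra_simps)
        then have "(\<Sum>i\<in>{1..6}. ?c i * \<alpha> i t) = ?r xs t - ?r ys t"
          unfolding s6 root_combination_def l sum_subtractf[symmetric] by (rule sum.cong[OF refl])
        then show "(\<Sum>i\<in>{1..6}. ?c i * \<alpha> i t) = 0" using eq[OF t] by simp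
      qed
      from indep[OF this] have c0: "?c i = 0" if "i \<in> {1..6}" for i using that by blast
      have "xs ! k = ys ! k" if "k < 6" for k using c0[of "Suc k"] that by simp
      then have "xs = ys" using l by (intro nth_equalityI) auto
      then show False using xy(3) by simp
    qed
  qed (use v in auto)
  show ?thesis
  proof -
    have "v ` (?P \<union> ?N) \<subseteq> span C"
      using v C(2) by (auto simp: wt_def)
    from indep_family_card[OF _ ind this C(1)] show ?thesis unfolding card by simp
  qed
qed

end

text \<open>The rank is not counted: 72 nonzero, pairwise distinct root spaces suffice.\<close>

lemma (in lie_space) E6_dimension:
  fixes L :: "('k, 'g) lie_alg"
  assumes L: "lie_scale L = scale" "lie_carrier L = G"
    "\<And>x y. x \<in> G \<Longrightarrow> y \<in> G \<Longrightarrow> br x y = lie_bracket L x y"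
    and nd: "kf_nondegenerate" and E6: "simple_of_type_E6 L" and C: "finite C" "G \<subseteq> span C"
  shows "72 \<le> card C"
proof -
  obtain H and \<alpha> :: "nat \<Rightarrow> 'g \<Rightarrow> 'k" where H: "maximal_toral_subalgebra L H" and base: "is_root_base L H {1..6} \<alpha>"
    and cor: "\<forall>j\<in>{1..6}. \<exists>h. is_coroot L H (\<alpha> j) h \<and> (\<forall>i\<in>{1..6}. \<alpha> i h = of_int (E6_cartan_matrix i j))"
    using E6 unfolding simple_of_type_E6_def by blast
  have eig_eq: "{v \<in> G. \<exists>c. lie_bracket L x v = c \<odot> v} = (\<Union>c. eig x c)" if "x \<in> G" for x
    using L(3) that by (auto simp: eig_def)
  have toral_iff: "toral_subalgebra L T \<longleftrightarrow> toral T" for T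
    unfolding toral_subalgebra_def lie_subalgebra_def ad_semisimple_def toral_def L(1,2)
    using eig_eq L(3) by (smt (verit, best) subset_iff)
  have tor: "toral H" and max: "\<And>T'. toral T' \<Longrightarrow> H \<subseteq> T' \<Longrightarrow> T' = H"
    using H unfolding maximal_toral_subalgebra_def toral_iff by blast+
  have T: "subspace H" "H \<subseteq> G" "\<And>x y. x \<in> H \<Longrightarrow> y \<in> H \<Longrightarrow> br x y \<in> H" "\<And>t. t \<in> H \<Longrightarrow> G \<subseteq> span (\<Union>c. eig t c)"
    using tor unfolding toral_def by auto
  have ab: "br s t = 0" if "s \<in> H" "t \<in> H" for s t by (rule toral_abelian[OF T that])
  obtain F where F: "finite F" "independent F" "span F = H" by (rule subspace_basis[OF T(1,2)])
  have FH: "F \<subseteq> H" using span_superset[of F] F(3) by simp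
  have sw: "G \<subseteq> span (\<Union>\<alpha>. wt H \<alpha>)"
    by (rule toral_span_wt[OF T(1,2) ab F(1) FH]) (use F(3) FH T(4) in auto)
  interpret H: cartan_space scale G br H
  proof unfold_locales
    show "x \<in> H" if "x \<in> G" "\<And>t. t \<in> H \<Longrightarrow> br t x = 0" for x
      by (rule maximal_toral_self_centralizing[OF nd tor max sw that])
  qed (fact nd T(1,2) ab sw)+
  have rs: "root_space L H \<beta> = wt H \<beta>" for \<beta>
  proof -
    have "lie_bracket L t x = br t x" if "t \<in> H" "x \<in> G" for t x using L(3)[of t x] that T(2) by auto
    then have "(\<forall>t\<in>H. lie_bracket L t x = \<beta> t \<odot> x) \<longleftrightarrow> (\<forall>t\<in>H. br t x = \<beta> t \<odot> x)" if "x \<in> G" for x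
      using that by (intro ball_cong) simp_all
    then show ?thesis unfolding root_space_def wt_def L(1,2) by blast
  qed
  show ?thesis
  proof (rule H.E6_root_count[OF _ _ _ C, of \<alpha>])
    fix i :: nat assume "i \<in> {1..6}"
    then have "is_root L H (\<alpha> i)" using base[unfolded is_root_base_def] by (elim conjE) (rule bspec)
    then have "wt H (\<alpha> i) \<noteq> {0}" unfolding is_root_def rs by (elim conjE)
    moreover have "0 \<in> wt H (\<alpha> i)" by (rule subspace_0[OF subspace_wt])
    ultimately show "H.is_weight (\<alpha> i)" unfolding H.is_weight_def by blast
  next
    fix c :: "nat \<Rightarrow> 'k" assume "\<forall>t\<in>H. (\<Sum>i\<in>{1..6}. c i * \<alpha> i t) = 0"
    then show "\<forall>i\<in>{1..6}. c i = 0" using base[unfolded is_root_base_def, THEN conjunct2, THEN conjunct2, THEN conjunct1] by (elim allE impE)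
  next
    fix j :: nat assume "j \<in> {1..6}"
    then obtain h where h: "is_coroot L H (\<alpha> j) h" "\<forall>i\<in>{1..6}. \<alpha> i h = of_int (E6_cartan_matrix i j)"
      using cor by blast
    have "{lie_bracket L x y | x y. x \<in> wt H (\<alpha> j) \<and> y \<in> wt H (\<lambda>t. - \<alpha> j t)} =
        {br x y | x y. x \<in> wt H (\<alpha> j) \<and> y \<in> wt H (\<lambda>t. - \<alpha> j t)}"
      using L(3) wtD(1) by (metis (no_types, lifting))
    then have "h \<in> H" "\<alpha> j h = 2" "h \<in> span {br x y | x y. x \<in> wt H (\<alpha> j) \<and> y \<in> wt H (\<lambda>t. - \<alpha> j t)}"
      using h(1) unfolding is_coroot_def rs L(1) by auto
    then show "\<exists>h\<in>H. \<alpha> j h = 2 \<and> h \<in> span {br x y | x y. x \<in> wt H (\<alpha> j) \<and> y \<in> wt H (\<lambda>t. - \<alpha> j t)} \<and>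
        (\<forall>i\<in>{1..6}. \<alpha> i h = of_int (E6_cartan_matrix i j))"
      using h(2) by blast
  qed
qed

lemma (in vector_space) lin_zero_on_span:
  assumes "lmap f" "v \<in> span B" "\<And>x. x \<in> B \<Longrightarrow> f x = 0" shows "f v = 0"
  using lin_span_image_subset[OF assms(1) _ subspace_single_0 assms(2)] assms(3) by auto

section \<open>Involutions with fixed subalgebra so10 plus a line\<close>

fun bar :: "'a + 'a \<Rightarrow> 'a + 'a" where
  "bar (Inl a) = Inr a" | "bar (Inr a) = Inl a"

lemma bar_bar [simp]: "bar (bar i) = i" by (cases i) auto
lemma bar_neq [simp]: "bar i \<noteq> i" "i \<noteq> bar i" by (cases i; auto)+

text \<open>The pairing of two weights of the vector representation.\<close>

definition vpair :: "'a + 'a \<Rightarrow> 'a + 'a \<Rightarrow> 'k::ring_1" where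
  "vpair i k = (if k = i then 1 else if k = bar i then - 1 else 0)"

lemma vpair_simps [simp]: "vpair i i = 1" "vpair i (bar i) = - 1" "vpair (bar i) i = - 1"
  "k \<noteq> i \<Longrightarrow> k \<noteq> bar i \<Longrightarrow> vpair i k = 0"
  by (auto simp: vpair_def)

text \<open>\<open>X i j\<close> stands for the matrix \<open>E\<^bsub>i j\<^esub> - E\<^bsub>bar j bar i\<^esub>\<close> of so10, \<open>\<theta>\<close> for the involution and \<open>z\<close> for a
  central element of its fixed subalgebra.\<close>

locale so10_even = lie_space scale G br
  for scale :: "'k::{alg_closed_field,field_char_0} \<Rightarrow> 'g::ab_group_add \<Rightarrow> 'g" (infixr "\<odot>" 75)
    and G br +
  fixes X :: "5 + 5 \<Rightarrow> 5 + 5 \<Rightarrow> 'g" and z :: 'g and \<theta> :: "'g \<Rightarrow> 'g"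
  assumes \<theta>_endo: "endo \<theta>"
    and \<theta>_inv: "x \<in> G \<Longrightarrow> \<theta> (\<theta> x) = x"
    and \<theta>_br: "x \<in> G \<Longrightarrow> y \<in> G \<Longrightarrow> \<theta> (br x y) = br (\<theta> x) (\<theta> y)"
    and X_G: "X i j \<in> G" and \<theta>_X: "\<theta> (X i j) = X i j"
    and z_G: "z \<in> G" and \<theta>_z: "\<theta> z = z" and z_nz: "z \<noteq> 0"
    and X_bar: "X (bar j) (bar i) = - X i j"
    and X_nz: "i \<noteq> j \<Longrightarrow> j \<noteq> bar i \<Longrightarrow> X i j \<noteq> 0"
    and X_diag: "br (X i i) (X k l) = (vpair i k - vpair i l) \<odot> X k l"
    and X_opp: "i \<noteq> j \<Longrightarrow> j \<noteq> bar i \<Longrightarrow> br (X i j) (X j i) = X i i - X j j"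
    and z_X: "br z (X i j) = 0"
    and even_span: "x \<in> G \<Longrightarrow> \<theta> x = x \<Longrightarrow> x \<in> span (insert z (range (\<lambda>(i, j). X i j)))"
    and simple: "simple"
    and dim_bound: "kf_nondegenerate \<Longrightarrow> finite C \<Longrightarrow> G \<subseteq> span C \<Longrightarrow> 72 \<le> card C"
begin

abbreviation "H a \<equiv> X (Inl a) (Inl a)"

lemma double_zero: "x + x = (0::'g) \<Longrightarrow> x = 0"
proof -
  assume "x + x = 0"
  moreover have "x + x = 2 \<odot> x" by (simp only: one_add_one[symmetric] scale_left_distrib scale_one)
  ultimately show ?thesis by simp
qed

lemma X_anti_zero: "X i (bar i) = 0"
proof -
  have "X i (bar i) = - X i (bar i)" using X_bar[of "bar i" i] by simp
  then have "X i (bar i) + X i (bar i) = 0" by (simp only: eq_neg_iff_add_eq_0)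
  then show ?thesis by (rule double_zero)
qed

lemma X_sl2:
  assumes "i \<noteq> j" "j \<noteq> bar i"
  shows "br (X i j) (X j i) = X i i - X j j" "br (X i i - X j j) (X i j) = 2 \<odot> X i j"
    "br (X i i - X j j) (X j i) = (-2) \<odot> X j i"
proof -
  have "i \<noteq> bar j" using assms(2) by auto
  then show "br (X i i - X j j) (X i j) = 2 \<odot> X i j" "br (X i i - X j j) (X j i) = (-2) \<odot> X j i"
    using assms scale_left_distrib[of 1 1 "X i j"] scale_left_distrib[of 1 1 "X j i"]
    by (simp_all add: br_diff_l X_diag)
qed (rule X_opp[OF assms])

lemma nd: "kf_nondegenerate"
proof -
  let ?i = "Inl 0 :: 5 + 5" and ?j = "Inl 1 :: 5 + 5"
  have ij: "?i \<noteq> ?j" "?j \<noteq> bar ?i" by simp_all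
  have "kf (X ?i ?i - X ?j ?j) (X ?i ?i - X ?j ?j) \<noteq> 0"
    by (rule kf_sl2_nonzero[OF X_sl2[OF ij] X_G X_nz[OF ij]])
  then show ?thesis by (rule simple_nondegenerate[OF simple G_closed(3)[OF X_G X_G]])
qed

lemmas l\<theta> = endo_lmap[OF \<theta>_endo]

lemma \<theta>_parts:
  assumes x: "x \<in> G"
  obtains e u where "e \<in> G" "\<theta> e = e" "u \<in> G" "\<theta> u = - u" "x = e + u"
proof (rule that)
  let ?e = "(1/2) \<odot> (x + \<theta> x)" and ?u = "(1/2) \<odot> (x - \<theta> x)"
  show "?e \<in> G" "?u \<in> G" using x endo_in[OF \<theta>_endo] by (auto intro!: G_closed)
  show "\<theta> ?e = ?e" "\<theta> ?u = - ?u"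
    using \<theta>_inv[OF x] by (simp_all add: lin_scale[OF l\<theta>] lin_add[OF l\<theta>] lin_diff[OF l\<theta>] add.commute flip: scale_minus_right)
  have "?e + ?u = (1/2) \<odot> (x + x)" by (simp only: scale_right_distrib[symmetric]) simp
  also have "\<dots> = x" by (simp flip: scale_left_distrib add: scale_right_distrib)
  finally show "x = ?e + ?u" by simp
qed

lemma \<theta>_both_zero:
  assumes "\<theta> x = x" "\<theta> x = - x" shows "x = 0"
proof -
  have "x = - x" using assms by simp
  then have "x + x = 0" by (simp only: eq_neg_iff_add_eq_0)
  then show ?thesis by (rule double_zero)
qed

lemma z_even: "x \<in> G \<Longrightarrow> \<theta> x = x \<Longrightarrow> br z x = 0"
  by (rule lin_zero_on_span[OF lin_br even_span]) (use z_X in auto)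

lemma diagonalizable:
  assumes t: "t = z \<or> (\<exists>i. t = X i i)"
  shows "G \<subseteq> span (\<Union>c. eig t c)"
proof -
  have tG: "t \<in> G" "\<theta> t = t" using t z_G \<theta>_z X_G \<theta>_X by auto
  have Xt: "\<exists>c. br t (X i j) = c \<odot> X i j" for i j
    using t z_X X_diag by (metis scale_zero_left)
  have zt: "br t z = 0 \<odot> z"
    using t z_X br_anti[where x = z and y = t] by auto
  have "insert z (range (\<lambda>(i, j). X i j)) \<subseteq> {x \<in> G. \<exists>c. br t x = c \<odot> x}"
    using Xt zt X_G z_G by auto
  from span_mono[OF this] have sp: "{x \<in> G. \<theta> x = x} \<subseteq> span {x \<in> G. \<exists>c. br t x = c \<odot> x}"
    using even_span by blast
  have "gen (br t) c \<subseteq> eig t c" for c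
    using diagonalizable_of_even_part[OF nd \<theta>_endo \<theta>_inv \<theta>_br tG sp] by (auto simp: eig_def gen_def)
  then have "(\<Union>c. gen (br t) c) \<subseteq> (\<Union>c. eig t c)" by blast
  from span_mono[OF this] show ?thesis unfolding span_gen[OF endo_br] .
qed

text \<open>A splitting of the odd part into commuting pieces stable under the even part is trivial: \<open>U\<close>
  and \<open>[U, U]\<close> span an ideal.\<close>

lemma odd_part_indecomposable:
  assumes U: "subspace U" "\<And>u. u \<in> U \<Longrightarrow> u \<in> G \<and> \<theta> u = - u"
    and W: "\<And>w. w \<in> W \<Longrightarrow> w \<in> G \<and> \<theta> w = - w"
    and UW: "\<And>x. x \<in> G \<Longrightarrow> \<theta> x = - x \<Longrightarrow> \<exists>u\<in>U. \<exists>w\<in>W. x = u + w"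
    and stU: "\<And>e u. e \<in> G \<Longrightarrow> \<theta> e = e \<Longrightarrow> u \<in> U \<Longrightarrow> br e u \<in> U"
    and comm: "\<And>u w. u \<in> U \<Longrightarrow> w \<in> W \<Longrightarrow> br u w = 0"
    and Unz: "u0 \<in> U" "u0 \<noteq> 0" and w: "w \<in> W"
  shows "w = 0"
proof -
  let ?B = "{br u v | u v. u \<in> U \<and> v \<in> U}"
  let ?I = "{x + y | x y. x \<in> U \<and> y \<in> span ?B}"
  have evB: "y \<in> G \<and> \<theta> y = y" if "y \<in> span ?B" for y
  proof -
    have "subspace {y \<in> G. \<theta> y = y}"
      by (rule subspaceI) (auto simp: G_closed lin_0[OF l\<theta>] lin_add[OF l\<theta>] lin_scale[OF l\<theta>])
    moreover have "?B \<subseteq> {y \<in> G. \<theta> y = y}" using U(2) \<theta>_br by (auto simp: br_simps)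
    ultimately have "span ?B \<subseteq> {y \<in> G. \<theta> y = y}" by (intro span_minimal)
    then show ?thesis using that by auto
  qed
  have comm': "br w u = 0" if "u \<in> U" "w \<in> W" for u w
    using comm[OF that] br_anti[where x = u and y = w] by simp
  have WB: "br w y = 0" if "w \<in> W" "y \<in> span ?B" for w y
  proof -
    have "br w b = 0" if b: "b \<in> ?B" for b
    proof -
      obtain u v where "b = br u v" "u \<in> U" "v \<in> U" using b by blast
      then show ?thesis using comm'[OF _ \<open>w \<in> W\<close>] by (simp add: jacobi[of w u v])
    qed
    then show ?thesis by (rule lin_zero_on_span[OF lin_br \<open>y \<in> span ?B\<close>])
  qed
  have UB: "br u y \<in> U" if u: "u \<in> U" and y: "y \<in> span ?B" for u y
  proof -
    have "br y u \<in> U" using stU evB[OF y] u by blast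
    then show ?thesis using subspace_neg[OF U(1)] br_anti[where x = y and y = u] by simp
  qed
  have EB: "br e y \<in> span ?B" if e: "e \<in> G" "\<theta> e = e" and y: "y \<in> span ?B" for e y
  proof (rule lin_span_image_subset[OF lin_br _ subspace_span y])
    fix b assume "b \<in> ?B"
    then obtain u v where b: "b = br u v" "u \<in> U" "v \<in> U" by blast
    have "br (br e u) v \<in> ?B" "br u (br e v) \<in> ?B" using stU[OF e] b by blast+
    then show "br e b \<in> span ?B" unfolding b(1) jacobi[of e u v] by (intro span_add span_base)
  qed
  have sub: "subspace ?I" by (rule subspace_sums[OF U(1) subspace_span])
  moreover have "?I \<subseteq> G" using U(2) evB by (auto intro!: G_closed)
  moreover have "\<forall>x\<in>G. \<forall>i\<in>?I. br x i \<in> ?I"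
  proof (intro ballI)
    fix x i assume x: "x \<in> G" and "i \<in> ?I"
    then obtain v y where i: "i = v + y" "v \<in> U" "y \<in> span ?B" by blast
    obtain e q where eo: "e \<in> G" "\<theta> e = e" "q \<in> G" "\<theta> q = - q" "x = e + q" by (rule \<theta>_parts[OF x])
    obtain u w where uw: "u \<in> U" "w \<in> W" "q = u + w" using UW[OF eo(3,4)] by blast
    have "br x i = (br e v + br u y) + (br e y + br u v)"
      unfolding eo(5) uw(3) i(1) using comm'[OF i(2) uw(2)] WB[OF uw(2) i(3)] by (simp add: br_simps)
    moreover have "br e v + br u y \<in> U" using stU[OF eo(1,2) i(2)] UB[OF uw(1) i(3)] by (rule subspace_add[OF U(1)])
    moreover have "br u v \<in> span ?B" by (rule span_base) (use uw(1) i(2) in blast)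
    then have "br e y + br u v \<in> span ?B" using EB[OF eo(1,2) i(3)] by (intro span_add)
    ultimately show "br x i \<in> ?I" by blast
  qed
  ultimately have "?I = {0} \<or> ?I = G" using simple unfolding simple_def by blast
  moreover have "u0 = u0 + 0" by simp
  then have mem: "u0 \<in> ?I" using Unz(1) span_zero by blast
  have "?I \<noteq> {0}"
  proof
    assume "?I = {0}"
    from mem[unfolded this] show False using Unz(2) by simp
  qed
  ultimately have IG: "?I = G" by blast
  have WU: "w \<in> U" if w: "w \<in> W" for w
  proof -
    obtain u y where uy: "w = u + y" "u \<in> U" "y \<in> span ?B" using IG W[OF w] by blast
    have "y = w - u" using uy(1) by simp
    then have "\<theta> y = - y" using W[OF w] U(2)[OF uy(2)] by (simp add: lin_diff[OF l\<theta>])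
    then have "y = 0" using evB[OF uy(3)] \<theta>_both_zero by blast
    then show ?thesis using uy by simp
  qed
  show "w = 0"
  proof (rule center_trivial[OF nd])
    show "w \<in> G" using W[OF w] by blast
    fix x assume "x \<in> G"
    then obtain v y where "x = v + y" "v \<in> U" "y \<in> span ?B" using IG by blast
    then show "br w x = 0" using comm'[OF _ w] WB[OF w] by (simp add: br_add_r)
  qed
qed

lemma z_eigenvalues:
  obtains \<rho> where "\<rho> \<noteq> 0" "\<And>x. x \<in> G \<Longrightarrow> \<theta> x = - x \<Longrightarrow> \<exists>u\<in>eig z \<rho>. \<exists>w\<in>eig z (- \<rho>). x = u + w"
    "\<And>x c. c \<noteq> 0 \<Longrightarrow> x \<in> eig z c \<Longrightarrow> \<theta> x = - x"
proof -
  have odd: "\<theta> x = - x" if c: "c \<noteq> 0" and x: "x \<in> eig z c" for x c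
  proof -
    have xG: "x \<in> G" and zx: "br z x = c \<odot> x" using x by (auto simp: eig_def)
    obtain e u where eu: "e \<in> G" "\<theta> e = e" "u \<in> G" "\<theta> u = - u" "x = e + u" by (rule \<theta>_parts[OF xG])
    have "br z x = br z u" unfolding eu(5) using z_even[OF eu(1,2)] by (simp add: br_add_r)
    moreover have "\<theta> (br z u) = - br z u" using \<theta>_br[OF z_G eu(3)] \<theta>_z eu(4) by (simp add: br_simps)
    ultimately have "\<theta> (c \<odot> x) = - (c \<odot> x)" using zx by simp
    then have "c \<odot> (\<theta> x + x) = 0" by (simp add: lin_scale[OF l\<theta>] scale_right_distrib)
    then show ?thesis using c by (simp add: eq_neg_iff_add_eq_0)
  qed
  have "\<exists>\<rho> v. \<rho> \<noteq> 0 \<and> v \<in> eig z \<rho> \<and> v \<noteq> 0"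
  proof (rule ccontr)
    assume a: "\<not> ?thesis"
    have "br z x = 0" if "x \<in> (\<Union>c. eig z c)" for x
    proof -
      obtain c where x: "x \<in> eig z c" using \<open>x \<in> (\<Union>c. eig z c)\<close> by auto
      then have "c = 0 \<or> x = 0" using a by blast
      then show ?thesis using x by (auto simp: eig_def)
    qed
    note eig0 = this
    have "br z x = 0" if "x \<in> G" for x
      by (rule lin_zero_on_span[OF lin_br, of x "\<Union>c. eig z c"]) (use diagonalizable[of z] that eig0 in auto)
    then have "z = 0" by (rule center_trivial[OF nd z_G])
    then show False using z_nz by simp
  qed
  then obtain \<rho> v where \<rho>: "\<rho> \<noteq> 0" "v \<in> eig z \<rho>" "v \<noteq> 0" by blast
  let ?U = "{x + y | x y. x \<in> eig z \<rho> \<and> y \<in> eig z (- \<rho>)}"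
  let ?R = "{x \<in> G. \<theta> x = - x} \<inter> (\<Union>c\<in>UNIV - {\<rho>, - \<rho>}. eig z c)"
  let ?W = "span ?R"
  have oddU: "u \<in> G \<and> \<theta> u = - u" if u: "u \<in> ?U" for u
  proof -
    obtain x y where xy: "u = x + y" "x \<in> eig z \<rho>" "y \<in> eig z (- \<rho>)" using u by blast
    have "x \<in> G" "y \<in> G" using xy by (auto simp: eig_def)
    moreover have "\<theta> x = - x" "\<theta> y = - y" using odd[OF \<rho>(1) xy(2)] odd[OF _ xy(3)] \<rho>(1) by auto
    ultimately show ?thesis unfolding xy(1) by (simp add: G_closed lin_add[OF l\<theta>])
  qed
  have br_eig: "br x y \<in> eig z (c + d)" if "x \<in> eig z c" "y \<in> eig z d" for x y c d
    using that by (auto simp: eig_def jacobi[of z x y] br_simps scale_left_distrib)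
  have subU: "subspace ?U" by (rule subspace_sums[OF subspace_eig subspace_eig])
  have zero_odd: "br p r = 0" if p: "p \<in> eig z d" "d \<noteq> 0" and r: "r \<in> eig z c" "\<theta> r = - r" and cd: "d + c \<noteq> 0" for p r c d
  proof -
    have "\<theta> (br p r) = br p r"
      using \<theta>_br[of p r] odd[OF p(2,1)] r p(1) by (simp add: br_simps eig_def)
    then have "br z (br p r) = 0" by (rule z_even[OF br_in])
    moreover have "br z (br p r) = (d + c) \<odot> br p r" using br_eig[OF p(1) r(1)] by (simp add: eig_def)
    ultimately show ?thesis using cd by simp
  qed
  have commUR: "br u r = 0" if u: "u \<in> ?U" and r: "r \<in> ?R" for u r
  proof -
    obtain x y where xy: "u = x + y" "x \<in> eig z \<rho>" "y \<in> eig z (- \<rho>)" using u by blast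
    obtain c where c: "c \<noteq> \<rho>" "c \<noteq> - \<rho>" "r \<in> eig z c" "\<theta> r = - r" using r by auto
    have "\<rho> + c \<noteq> 0" "- \<rho> + c \<noteq> 0" using c(1,2) by (auto simp: add_eq_0_iff)
    then show ?thesis
      unfolding xy(1) using zero_odd[OF xy(2) \<rho>(1) c(3,4)] zero_odd[OF xy(3) _ c(3,4)] \<rho>(1) by (simp add: br_add_l)
  qed
  have commUW: "br u w = 0" if u: "u \<in> ?U" and w: "w \<in> ?W" for u w
    by (rule lin_zero_on_span[OF lin_br w]) (rule commUR[OF u])
  have oddW: "w \<in> G \<and> \<theta> w = - w" if w: "w \<in> ?W" for w
  proof -
    have "subspace {x \<in> G. \<theta> x = - x}"
      by (rule subspaceI) (auto simp: G_closed lin_0[OF l\<theta>] lin_add[OF l\<theta>] lin_scale[OF l\<theta>])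
    then have "?W \<subseteq> {x \<in> G. \<theta> x = - x}" by (intro span_minimal) auto
    then show ?thesis using w by blast
  qed
  have stU: "br e u \<in> ?U" if e: "e \<in> G" "\<theta> e = e" and u: "u \<in> ?U" for e u
  proof -
    obtain x y where xy: "u = x + y" "x \<in> eig z \<rho>" "y \<in> eig z (- \<rho>)" using u by blast
    have "e \<in> eig z 0" using e z_even[OF e] by (simp add: eig_def)
    then have "br e x \<in> eig z \<rho>" "br e y \<in> eig z (- \<rho>)" using br_eig[of e 0] xy by force+
    then show ?thesis unfolding xy(1) br_add_r by blast
  qed
  have decomp: "\<exists>u\<in>?U. \<exists>w\<in>?W. x = u + w" if x: "x \<in> G" "\<theta> x = - x" for x
  proof -
    let ?S = "{u + w | u w. u \<in> ?U \<and> w \<in> ?W}"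
    let ?\<pi> = "\<lambda>x. (1/2) \<odot> (x - \<theta> x)"
    have subS: "subspace ?S" by (rule subspace_sums[OF subU subspace_span])
    have l\<pi>: "lmap ?\<pi>" by (intro lin_smult lin_minus lin_id l\<theta>)
    have "?\<pi> v \<in> ?S" if "v \<in> (\<Union>c. eig z c)" for v
    proof -
      obtain c where v: "v \<in> eig z c" using \<open>v \<in> (\<Union>c. eig z c)\<close> by auto
      have vG: "v \<in> G" using v by (simp add: eig_def)
      have "br z (\<theta> v) = c \<odot> \<theta> v" using \<theta>_br[OF z_G vG] \<theta>_z v by (simp add: eig_def lin_scale[OF l\<theta>])
      then have "\<theta> v \<in> eig z c" using endo_in[OF \<theta>_endo] by (simp add: eig_def)
      then have pv: "?\<pi> v \<in> eig z c" using v by (intro subspace_scale subspace_diff subspace_eig)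
      have po: "\<theta> (?\<pi> v) = - ?\<pi> v"
        using \<theta>_inv[OF vG] by (simp add: lin_scale[OF l\<theta>] lin_diff[OF l\<theta>] flip: scale_minus_right)
      consider "c = \<rho>" | "c = - \<rho>" | "c \<notin> {\<rho>, - \<rho>}" by blast
      then show ?thesis
      proof cases
        case 1
        have "?\<pi> v = (?\<pi> v + 0) + 0" by simp
        then show ?thesis using pv 1 subspace_0[OF subspace_eig] span_zero[of ?R] by blast
      next
        case 2
        have "?\<pi> v = (0 + ?\<pi> v) + 0" by simp
        then show ?thesis using pv 2 subspace_0[OF subspace_eig] span_zero[of ?R] by blast
      next
        case 3
        then have "?\<pi> v \<in> ?R" using pv po by (auto simp: eig_def)
        then have "?\<pi> v \<in> ?W" by (rule span_base)
        moreover have "?\<pi> v = 0 + ?\<pi> v" by simp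
        ultimately show ?thesis using subspace_0[OF subU] by blast
      qed
    qed
    note \<pi>S = this
    have "x \<in> span (\<Union>c. eig z c)" using diagonalizable[of z] x(1) by auto
    from lin_span_image_subset[OF l\<pi> \<pi>S subS this] have "?\<pi> x \<in> ?S" .
    moreover have "?\<pi> x = x" using x(2) by (simp flip: scale_left_distrib add: scale_right_distrib)
    ultimately show ?thesis by auto
  qed
  have W0: "w = 0" if "w \<in> ?W" for w
  proof (rule odd_part_indecomposable[of ?U ?W v, OF subU oddU oddW decomp stU commUW _ \<rho>(3) that])
    have "v = v + 0" by simp
    then show "v \<in> ?U" using \<rho>(2) subspace_0[OF subspace_eig] by blast
  qed
  show ?thesis
  proof (rule that[OF \<rho>(1) _ odd])
    fix x assume "x \<in> G" "\<theta> x = - x"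
    then obtain u w where uw: "u \<in> ?U" "w \<in> ?W" "x = u + w" using decomp by blast
    then show "\<exists>u\<in>eig z \<rho>. \<exists>w\<in>eig z (- \<rho>). x = u + w" using W0[OF uw(2)] by auto
  qed
qed

end

text \<open>After rescaling, the central element induces the grading.\<close>

locale so10_graded = so10_even scale G br X s \<theta> + three_graded scale G br s
  for scale :: "'k::{alg_closed_field,field_char_0} \<Rightarrow> 'g::ab_group_add \<Rightarrow> 'g" (infixr "\<odot>" 75)
    and G br X s \<theta> +
  assumes odd_part_eq: "odd_part = {x \<in> G. \<theta> x = - x}"

lemma (in so10_even) grading_exists: "\<exists>s. so10_graded scale G br X s \<theta>"
proof -
  obtain \<rho> where \<rho>: "\<rho> \<noteq> 0" "\<And>x. x \<in> G \<Longrightarrow> \<theta> x = - x \<Longrightarrow> \<exists>u\<in>eig z \<rho>. \<exists>w\<in>eig z (- \<rho>). x = u + w"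
    "\<And>x c. c \<noteq> 0 \<Longrightarrow> x \<in> eig z c \<Longrightarrow> \<theta> x = - x"
    using z_eigenvalues by blast
  define s where "s = (1 / \<rho>) \<odot> z"
  have sG: "s \<in> G" using z_G by (simp add: s_def G_closed)
  have s_even: "br s x = 0" if "x \<in> G" "\<theta> x = x" for x using z_even[OF that] by (simp add: s_def br_scale_l)
  have s_odd: "\<exists>u w. u \<in> G \<and> w \<in> G \<and> br s u = u \<and> br s w = - w \<and> x = u + w" if "x \<in> G" "\<theta> x = - x" for x
  proof -
    obtain u w where uw: "u \<in> eig z \<rho>" "w \<in> eig z (- \<rho>)" "x = u + w" using \<rho>(2)[OF \<open>x \<in> G\<close> \<open>\<theta> x = - x\<close>] by blast
    then have "u \<in> G" "w \<in> G" "br s u = u" "br s w = - w"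
      using \<rho>(1) by (simp_all add: s_def br_scale_l eig_def)
    then show ?thesis using uw(3) by blast
  qed
  have ss: "br s (br s x) = x" if "x \<in> G" "\<theta> x = - x" for x
    using s_odd[OF that] by (auto simp: br_simps)
  have tg: "three_graded scale G br s"
  proof unfold_locales
    show "br s (br s (br s x)) = br s x" if "x \<in> G" for x
    proof -
      obtain e u where eu: "e \<in> G" "\<theta> e = e" "u \<in> G" "\<theta> u = - u" "x = e + u" by (rule \<theta>_parts[OF \<open>x \<in> G\<close>])
      show ?thesis unfolding eu(5) by (simp add: br_add_r s_even[OF eu(1,2)] ss[OF eu(3,4)])
    qed
  qed (rule sG)
  interpret tg: three_graded scale G br s by (rule tg)
  have odd: "tg.odd_part = {x \<in> G. \<theta> x = - x}"
  proof
    show "{x \<in> G. \<theta> x = - x} \<subseteq> tg.odd_part" using ss by (auto simp: tg.odd_part_def)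
    show "tg.odd_part \<subseteq> {x \<in> G. \<theta> x = - x}"
    proof
      fix x assume x: "x \<in> tg.odd_part"
      then have xG: "x \<in> G" by (simp add: tg.odd_part_def)
      obtain e u where eu: "e \<in> G" "\<theta> e = e" "u \<in> G" "\<theta> u = - u" "x = e + u" by (rule \<theta>_parts[OF xG])
      have "br s (br s x) = u" unfolding eu(5) by (simp add: br_add_r s_even[OF eu(1,2)] ss[OF eu(3,4)])
      then have "x = u" using x by (simp add: tg.odd_part_def)
      then show "x \<in> {x \<in> G. \<theta> x = - x}" using eu by simp
    qed
  qed
  have "so10_even scale G br X s \<theta>"
  proof unfold_locales
    show "\<theta> s = s" by (simp add: s_def lin_scale[OF l\<theta>] \<theta>_z)
    show "s \<noteq> 0" using z_nz \<rho>(1) by (simp add: s_def)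
    show "br s (X i j) = 0" for i j by (rule s_even[OF X_G \<theta>_X])
    show "x \<in> span (insert s (range (\<lambda>(i, j). X i j)))" if "x \<in> G" "\<theta> x = x" for x
    proof -
      let ?A = "insert s (range (\<lambda>(i, j). X i j))"
      have "\<rho> \<odot> s \<in> span ?A" by (intro span_scale span_base) simp
      then have "z \<in> span ?A" using \<rho>(1) by (simp add: s_def)
      moreover have "range (\<lambda>(i, j). X i j) \<subseteq> span ?A" using span_superset[of ?A] by simp
      ultimately have "span (insert z (range (\<lambda>(i, j). X i j))) \<subseteq> span ?A" by (intro span_minimal) auto
      then show ?thesis using even_span[OF that] by blast
    qed
  qed (fact \<theta>_endo \<theta>_inv \<theta>_br X_G \<theta>_X sG X_bar X_nz X_diag X_opp simple dim_bound)+
  then show ?thesis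
    using tg odd by (intro exI[of _ s] so10_graded.intro so10_graded_axioms.intro) auto
qed

section \<open>Minuscule weights of so10\<close>

definition ip :: "(5 \<Rightarrow> 'k::comm_ring_1) \<Rightarrow> (5 \<Rightarrow> 'k) \<Rightarrow> 'k" where
  "ip \<mu> \<gamma> = (\<Sum>a\<in>UNIV. \<mu> a * \<gamma> a)"

lemma ip_diff_local:
  assumes "\<And>c. c \<notin> S \<Longrightarrow> \<gamma> c = \<mu> c"
  shows "ip \<mu> \<mu> - ip \<mu> \<gamma> = (\<Sum>c\<in>S. \<mu> c * (\<mu> c - \<gamma> c))"
proof -
  have "ip \<mu> \<mu> - ip \<mu> \<gamma> = (\<Sum>c\<in>UNIV. \<mu> c * (\<mu> c - \<gamma> c))"
    unfolding ip_def sum_subtractf[symmetric] by (simp add: right_diff_distrib)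
  also have "\<dots> = (\<Sum>c\<in>S. \<mu> c * (\<mu> c - \<gamma> c))"
    using assms by (intro sum.mono_neutral_right) auto
  finally show ?thesis .
qed

lemma ex_other_index: "\<exists>b::5. b \<notin> {x, y, z}"
proof (rule ccontr)
  assume "\<not> (\<exists>b::5. b \<notin> {x, y, z})"
  then have "UNIV = set [x, y, z]" by auto
  then have "card (UNIV :: 5 set) \<le> length [x, y, z]" using card_length[of "[x, y, z]"] by (simp only:)
  then show False by simp
qed

text \<open>The conditions express that the \<open>\<mu>\<close> are weights of an abelian nilradical: \<open>c\<close> is the
  contribution of the grading element to inner products. They force \<open>|\<mu>|\<^sup>2 - \<langle>\<mu>, w \<mu>\<rangle>\<close> to be \<open>0\<close>,
  \<open>D\<close> or \<open>2 D\<close> for every \<open>w\<close> in the Weyl group. Applied to the reflections and to the even sign changes this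
  bounds \<open>(\<mu> a \<plusminus> \<mu> b)\<^sup>2\<close> and their sums, and only few shapes remain.\<close>

lemma minuscule_weights:
  fixes \<Phi> :: "(5 \<Rightarrow> 'k::field_char_0) set" and c :: 'k
  assumes nz: "\<And>\<mu>. \<mu> \<in> \<Phi> \<Longrightarrow> ip \<mu> \<mu> + c \<noteq> 0"
    and N: "\<And>\<mu> \<gamma>. \<mu> \<in> \<Phi> \<Longrightarrow> \<gamma> \<in> \<Phi> \<Longrightarrow> \<exists>N\<le>2. 2 * (ip \<mu> \<gamma> + c) = of_nat N * (ip \<mu> \<mu> + c)"
    and minus: "\<And>\<mu> a b. \<mu> \<in> \<Phi> \<Longrightarrow> a \<noteq> b \<Longrightarrow> (\<exists>n::int. \<mu> a - \<mu> b = of_int n) \<and> \<mu>(a := \<mu> b, b := \<mu> a) \<in> \<Phi>"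
    and plus: "\<And>\<mu> a b. \<mu> \<in> \<Phi> \<Longrightarrow> a \<noteq> b \<Longrightarrow> (\<exists>n::int. \<mu> a + \<mu> b = of_int n) \<and> \<mu>(a := - \<mu> b, b := - \<mu> a) \<in> \<Phi>"
    and int_minus: "\<And>\<mu> a b. \<mu> \<in> \<Phi> \<Longrightarrow> a \<noteq> b \<Longrightarrow> \<exists>n::int. 2 * (\<mu> a - \<mu> b) = of_int n * (ip \<mu> \<mu> + c)"
    and int_plus: "\<And>\<mu> a b. \<mu> \<in> \<Phi> \<Longrightarrow> a \<noteq> b \<Longrightarrow> \<exists>n::int. 2 * (\<mu> a + \<mu> b) = of_int n * (ip \<mu> \<mu> + c)"
    and \<mu>: "\<mu> \<in> \<Phi>"
  shows "(\<forall>a. \<mu> a = 0) \<or> (\<exists>a. (\<mu> a = 1 \<or> \<mu> a = - 1) \<and> (\<forall>b. b \<noteq> a \<longrightarrow> \<mu> b = 0)) \<or>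
    ((\<forall>a. \<mu> a = 1 / 2 \<or> \<mu> a = - (1 / 2)) \<and> c = 3 / 4)"
proof -
  define D where "D = (ip \<mu> \<mu> + c) / 2"
  have D0: "D \<noteq> 0" using nz[OF \<mu>] by (simp add: D_def)
  have Dc: "ip \<mu> \<mu> + c = 2 * D" by (simp add: D_def)
  have D_multiples: "(of_nat i * D = of_nat j * D) = (i = j)" for i j :: nat using D0 by simp
  have dist: "ip \<mu> \<mu> - ip \<mu> \<gamma> \<in> {0, D, 2 * D}" if g: "\<gamma> \<in> \<Phi>" for \<gamma>
  proof -
    obtain N where N: "N \<le> 2" "2 * (ip \<mu> \<gamma> + c) = of_nat N * (ip \<mu> \<mu> + c)" using N[OF \<mu> g] by blast
    have "2 * (ip \<mu> \<mu> - ip \<mu> \<gamma>) = 2 * (ip \<mu> \<mu> + c) - 2 * (ip \<mu> \<gamma> + c)" by (simp add: algebra_simps)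
    also have "\<dots> = 2 * ((2 - of_nat N) * D)" unfolding N(2) Dc by (simp add: algebra_simps)
    finally have e: "ip \<mu> \<mu> - ip \<mu> \<gamma> = (2 - of_nat N) * D" by (subst (asm) mult_left_cancel) simp_all
    have "N = 0 \<or> N = 1 \<or> N = 2" using N(1) by auto
    then show ?thesis unfolding e by auto
  qed
  have flip: "\<gamma>(a := - \<gamma> a, b := - \<gamma> b) \<in> \<Phi>" if g: "\<gamma> \<in> \<Phi>" and ab: "a \<noteq> b" for \<gamma> a b
  proof -
    let ?\<gamma> = "\<gamma>(a := \<gamma> b, b := \<gamma> a)"
    have "?\<gamma> \<in> \<Phi>" using minus[OF g ab] by blast
    then have "?\<gamma>(a := - ?\<gamma> b, b := - ?\<gamma> a) \<in> \<Phi>" using plus[OF _ ab] by blast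
    moreover have "?\<gamma>(a := - ?\<gamma> b, b := - ?\<gamma> a) = \<gamma>(a := - \<gamma> a, b := - \<gamma> b)" using ab by (auto simp: fun_eq_iff)
    ultimately show ?thesis by simp
  qed
  have sq_minus: "(\<mu> a - \<mu> b)^2 \<in> {0, D, 2 * D}" if ab: "a \<noteq> b" for a b
  proof -
    let ?\<gamma> = "\<mu>(a := \<mu> b, b := \<mu> a)"
    have "ip \<mu> \<mu> - ip \<mu> ?\<gamma> = (\<Sum>c\<in>{a, b}. \<mu> c * (\<mu> c - ?\<gamma> c))" by (rule ip_diff_local) auto
    also have "\<dots> = (\<mu> a - \<mu> b)^2" using ab by (simp add: power2_eq_square algebra_simps)
    finally show ?thesis using dist[of ?\<gamma>] minus[OF \<mu> ab] by simp
  qed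
  have sq_plus: "(\<mu> a + \<mu> b)^2 \<in> {0, D, 2 * D}" if ab: "a \<noteq> b" for a b
  proof -
    let ?\<gamma> = "\<mu>(a := - \<mu> b, b := - \<mu> a)"
    have "ip \<mu> \<mu> - ip \<mu> ?\<gamma> = (\<Sum>c\<in>{a, b}. \<mu> c * (\<mu> c - ?\<gamma> c))" by (rule ip_diff_local) auto
    also have "\<dots> = (\<mu> a + \<mu> b)^2" using ab by (simp add: power2_eq_square algebra_simps)
    finally show ?thesis using dist[of ?\<gamma>] plus[OF \<mu> ab] by simp
  qed
  have sq_both: "(\<mu> a - \<mu> b)^2 + (\<mu> a + \<mu> b)^2 \<in> {0, D, 2 * D}" if ab: "a \<noteq> b" for a b
  proof -
    let ?\<gamma> = "\<mu>(a := - \<mu> a, b := - \<mu> b)"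
    have "ip \<mu> \<mu> - ip \<mu> ?\<gamma> = (\<Sum>c\<in>{a, b}. \<mu> c * (\<mu> c - ?\<gamma> c))" by (rule ip_diff_local) auto
    also have "\<dots> = (\<mu> a - \<mu> b)^2 + (\<mu> a + \<mu> b)^2" using ab by (simp add: power2_eq_square algebra_simps)
    finally show ?thesis using dist[OF flip[OF \<mu> ab]] by simp
  qed
  have four: "2 * (\<mu> a)^2 + 2 * (\<mu> b)^2 + 2 * (\<mu> c)^2 + 2 * (\<mu> d)^2 \<in> {0, D, 2 * D}"
    if ab: "a \<noteq> b" and cd: "c \<noteq> d" and ne: "a \<noteq> c" "a \<noteq> d" "b \<noteq> c" "b \<noteq> d" for a b c d
  proof -
    let ?\<gamma> = "\<mu>(a := - \<mu> a, b := - \<mu> b)"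
    let ?\<delta> = "?\<gamma>(c := - ?\<gamma> c, d := - ?\<gamma> d)"
    have "ip \<mu> \<mu> - ip \<mu> ?\<delta> = (\<Sum>e\<in>{a, b, c, d}. \<mu> e * (\<mu> e - ?\<delta> e))" by (rule ip_diff_local) auto
    also have "\<dots> = 2 * (\<mu> a)^2 + 2 * (\<mu> b)^2 + 2 * (\<mu> c)^2 + 2 * (\<mu> d)^2"
      using ab cd ne by (simp add: power2_eq_square algebra_simps)
    finally show ?thesis using dist[OF flip[OF flip[OF \<mu> ab] cd]] by simp
  qed
  have both: "(\<mu> a - \<mu> b)^2 = D \<and> (\<mu> a + \<mu> b)^2 = D" if ab: "a \<noteq> b" and "\<mu> a - \<mu> b \<noteq> 0" "\<mu> a + \<mu> b \<noteq> 0" for a b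
  proof -
    have "(\<mu> a - \<mu> b)^2 \<in> {D, 2 * D}" "(\<mu> a + \<mu> b)^2 \<in> {D, 2 * D}" using sq_minus[OF ab] sq_plus[OF ab] that by auto
    then consider "(\<mu> a - \<mu> b)^2 = D" "(\<mu> a + \<mu> b)^2 = D"
      | "(\<mu> a - \<mu> b)^2 + (\<mu> a + \<mu> b)^2 = of_nat 3 * D" | "(\<mu> a - \<mu> b)^2 + (\<mu> a + \<mu> b)^2 = of_nat 4 * D" by auto
    then show ?thesis
    proof cases
      case 2
      then have "of_nat 3 * D \<in> {of_nat 0 * D, of_nat 1 * D, of_nat 2 * D}" using sq_both[OF ab] by simp
      then show ?thesis unfolding insert_iff D_multiples by simp
    next
      case 3
      then have "of_nat 4 * D \<in> {of_nat 0 * D, of_nat 1 * D, of_nat 2 * D}" using sq_both[OF ab] by simp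
      then show ?thesis unfolding insert_iff D_multiples by simp
    qed simp
  qed
  have A: "\<mu> a = 0 \<or> \<mu> b = 0 \<or> (\<mu> a)^2 = (\<mu> b)^2" if ab: "a \<noteq> b" for a b
  proof (cases "\<mu> a - \<mu> b = 0 \<or> \<mu> a + \<mu> b = 0")
    case True
    then have "(\<mu> a - \<mu> b) * (\<mu> a + \<mu> b) = 0" by simp
    then show ?thesis by (simp add: power2_eq_square algebra_simps)
  next
    case False
    then have "(\<mu> a + \<mu> b)^2 - (\<mu> a - \<mu> b)^2 = 0" using both[OF ab] by simp
    moreover have "(\<mu> a + \<mu> b)^2 - (\<mu> a - \<mu> b)^2 = 4 * (\<mu> a * \<mu> b)" by (simp add: power2_eq_square algebra_simps)
    ultimately have "4 * (\<mu> a * \<mu> b) = 0" by (simp only:)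
    then show ?thesis by auto
  qed
  have B: "(\<mu> a)^2 = D" if "a \<noteq> b" "\<mu> a \<noteq> 0" "\<mu> b = 0" for a b
    using both[OF that(1)] that by simp
  have C: "\<mu> e \<noteq> 0" if ab: "a \<noteq> b" and ne: "e \<noteq> a" "e \<noteq> b" and nz: "\<mu> a \<noteq> 0" "\<mu> b \<noteq> 0" for a b e
  proof
    assume e: "\<mu> e = 0"
    have D: "(\<mu> a)^2 = D" "(\<mu> b)^2 = D" using B[of a e] B[of b e] ne nz e by auto
    have "(\<mu> a - \<mu> b)^2 + (\<mu> a + \<mu> b)^2 = 2 * (\<mu> a)^2 + 2 * (\<mu> b)^2" by (simp add: power2_eq_square algebra_simps)
    also have "\<dots> = of_nat 4 * D" unfolding D by simp
    finally have "of_nat 4 * D \<in> {of_nat 0 * D, of_nat 1 * D, of_nat 2 * D}" using sq_both[OF ab] by simp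
    then show False unfolding insert_iff D_multiples by simp
  qed
  have unit: "n = 1 \<or> n = - 1" if "n = k * n^2" "n \<noteq> 0" for n k :: int
  proof -
    have "n * 1 = n * (k * n)" using that(1) by (simp add: power2_eq_square mult.left_commute)
    then have "k * n = 1" using that(2) by (metis mult_cancel_left)
    then show ?thesis by (auto simp: zmult_eq_1_iff)
  qed
  show ?thesis
  proof (cases "\<exists>a b. a \<noteq> b \<and> \<mu> a \<noteq> 0 \<and> \<mu> b \<noteq> 0")
    case True
    then obtain a b where ab: "a \<noteq> b" "\<mu> a \<noteq> 0" "\<mu> b \<noteq> 0" by blast
    have all: "\<mu> e \<noteq> 0" for e using C[OF ab(1) _ _ ab(2,3), of e] ab by blast
    have sq: "(\<mu> e)^2 = (\<mu> f)^2" for e f using A[of e f] all by (cases "e = f") auto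
    have val: "\<mu> x = 1 / 2 \<or> \<mu> x = - (1 / 2)" and D1: "D = 1" for x
    proof -
      obtain y where y: "y \<notin> {x}" using ex_other_index[of x x x] by blast
      obtain u where u: "u \<notin> {x, y}" using ex_other_index[of x y y] by blast
      obtain v where v: "v \<notin> {x, y, u}" using ex_other_index[of x y u] by blast
      have xy: "x \<noteq> y" using y by simp
      have "2 * (\<mu> x)^2 + 2 * (\<mu> y)^2 + 2 * (\<mu> u)^2 + 2 * (\<mu> v)^2 \<in> {0, D, 2 * D}"
        by (rule four) (use y u v in auto)
      moreover have "2 * (\<mu> x)^2 + 2 * (\<mu> y)^2 + 2 * (\<mu> u)^2 + 2 * (\<mu> v)^2 = 8 * (\<mu> x)^2"
        unfolding sq[of y x] sq[of u x] sq[of v x] by simp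
      ultimately have 8: "8 * (\<mu> x)^2 \<in> {0, D, 2 * D}" by (simp only:)
      have "(\<mu> x - \<mu> y)^2 + (\<mu> x + \<mu> y)^2 = 4 * (\<mu> x)^2"
        using sq[of x y] by (simp add: power2_eq_square algebra_simps)
      moreover have "\<mu> x - \<mu> y = 0 \<or> \<mu> x + \<mu> y = 0" using sq[of x y] by (auto simp: power2_eq_iff add_eq_0_iff)
      ultimately have 4: "4 * (\<mu> x)^2 \<in> {0, D, 2 * D}" using sq_minus[OF xy] sq_plus[OF xy] by auto
      have D4: "4 * (\<mu> x)^2 = D"
      proof (rule ccontr)
        assume n: "4 * (\<mu> x)^2 \<noteq> D"
        have "4 * (\<mu> x)^2 \<noteq> 0" using all[of x] by simp
        then have "4 * (\<mu> x)^2 = 2 * D" using 4 n by simp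
        moreover have "8 * (\<mu> x)^2 = 2 * (4 * (\<mu> x)^2)" by simp
        ultimately have e: "8 * (\<mu> x)^2 = of_nat 4 * D" by (simp only:) simp
        have "of_nat 4 * D \<in> {of_nat 0 * D, of_nat 1 * D, of_nat 2 * D}" using 8 unfolding e by simp
        then show False unfolding insert_iff D_multiples by simp
      qed
      have "\<exists>n k::int. 2 * \<mu> x = of_int n \<and> 2 * (2 * \<mu> x) = of_int k * (2 * D)"
        using \<open>\<mu> x - \<mu> y = 0 \<or> \<mu> x + \<mu> y = 0\<close>
      proof
        assume "\<mu> x - \<mu> y = 0"
        then have "\<mu> x + \<mu> y = 2 * \<mu> x" by simp
        moreover have "\<exists>n::int. \<mu> x + \<mu> y = of_int n" "\<exists>k::int. 2 * (\<mu> x + \<mu> y) = of_int k * (2 * D)"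
          using plus[OF \<mu> xy] int_plus[OF \<mu> xy] unfolding Dc by blast+
        ultimately show ?thesis by (simp only:) blast
      next
        assume "\<mu> x + \<mu> y = 0"
        then have "\<mu> x - \<mu> y = 2 * \<mu> x" by (simp add: add_eq_0_iff)
        moreover have "\<exists>n::int. \<mu> x - \<mu> y = of_int n" "\<exists>k::int. 2 * (\<mu> x - \<mu> y) = of_int k * (2 * D)"
          using minus[OF \<mu> xy] int_minus[OF \<mu> xy] unfolding Dc by blast+
        ultimately show ?thesis by (simp only:) blast
      qed
      then obtain n k :: int where nk: "2 * \<mu> x = of_int n" "2 * (2 * \<mu> x) = of_int k * (2 * D)" by blast
      have "D = (2 * \<mu> x)^2" using D4 by (simp add: power2_eq_square)
      then have Dn: "D = of_int (n^2)" unfolding nk(1) by simp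
      have "of_int n = (of_int (k * n^2) :: 'k)" using nk(2) unfolding nk(1) Dn by simp
      then have "n = k * n^2" by (simp only: of_int_eq_iff)
      moreover have "n \<noteq> 0" using nk(1) all[of x] by auto
      ultimately have n1: "n = 1 \<or> n = - 1" by (rule unit)
      then show "D = 1" unfolding Dn by auto
      have "\<mu> x = of_int n / 2" using nk(1) by (simp add: field_simps)
      show "\<mu> x = 1 / 2 \<or> \<mu> x = - (1 / 2)" unfolding \<open>\<mu> x = of_int n / 2\<close> using n1 by auto
    qed
    have "\<mu> e * \<mu> e = 1 / 4" for e by (rule disjE[OF val[of e]]) (erule ssubst, simp)+
    then have "ip \<mu> \<mu> = (\<Sum>e\<in>(UNIV :: 5 set). 1 / 4)" unfolding ip_def by (intro sum.cong refl)
    then have ipv: "ip \<mu> \<mu> = 5 / 4" by simp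
    have "5 / 4 + c = 2" using Dc unfolding ipv D1 by simp
    then have "c = 2 - 5 / 4" by (simp only: eq_diff_eq add.commute)
    then have "c = 3 / 4" by simp
    then show ?thesis using val by blast
  next
    case False
    show ?thesis
    proof (cases "\<forall>a. \<mu> a = 0")
      case nonzero: False
      then obtain a where a: "\<mu> a \<noteq> 0" by blast
      have zero: "\<mu> b = 0" if "b \<noteq> a" for b using False a that by blast
      obtain b where b: "b \<noteq> a" using ex_other_index[of a a a] by blast
      then have ab: "a \<noteq> b" by simp
      have D: "(\<mu> a)^2 = D" by (rule B[OF ab a zero[OF b]])
      obtain n :: int where n: "\<mu> a = of_int n" using plus[OF \<mu> ab] zero[OF b] by auto
      obtain k :: int where k: "2 * \<mu> a = of_int k * (2 * D)" using int_plus[OF \<mu> ab] zero[OF b] unfolding Dc by auto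
      have "of_int n = (of_int (k * n^2) :: 'k)" using k unfolding D[symmetric] n by simp
      then have "n = k * n^2" by (simp only: of_int_eq_iff)
      moreover have "n \<noteq> 0" using n a by auto
      ultimately have "n = 1 \<or> n = - 1" by (rule unit)
      then have "\<mu> a = 1 \<or> \<mu> a = - 1" unfolding n by auto
      then show ?thesis using zero by blast
    qed simp
  qed
qed

section \<open>The weights of the odd part\<close>

definition ev :: "(5 \<Rightarrow> 'k::ab_group_add) \<Rightarrow> 5 + 5 \<Rightarrow> 'k" where
  "ev f i = (case i of Inl a \<Rightarrow> f a | Inr a \<Rightarrow> - f a)"

lemma sum_vpair: "(\<Sum>a\<in>UNIV. f a * vpair (Inl a) i) = (ev f i :: 'k::comm_ring_1)"
proof (cases i)
  case (Inl b)
  have "(\<Sum>a\<in>UNIV. f a * vpair (Inl a) i) = (\<Sum>a\<in>UNIV. if a = b then f a else 0)"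
    by (rule sum.cong) (auto simp: Inl vpair_def)
  then show ?thesis by (simp add: Inl ev_def)
next
  case (Inr b)
  have "(\<Sum>a\<in>UNIV. f a * vpair (Inl a) i) = (\<Sum>a\<in>UNIV. if a = b then - f a else 0)"
    by (rule sum.cong) (auto simp: Inr vpair_def)
  then show ?thesis by (simp add: Inr ev_def)
qed

context so10_graded begin

definition rt :: "5 + 5 \<Rightarrow> 5 + 5 \<Rightarrow> 5 \<Rightarrow> 'k" where
  "rt i j a = vpair (Inl a) i - vpair (Inl a) j"

lemma ip_rt: "ip \<mu> (rt i j) = ev \<mu> i - ev \<mu> j"
  unfolding ip_def rt_def sum_vpair[symmetric] sum_subtractf[symmetric] by (simp add: right_diff_distrib)

lemma X_Inr: "X (Inr a) (Inr a) = - H a" using X_bar[of "Inl a" "Inl a"] by simp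

lemma Vp_odd: "x \<in> Vp \<Longrightarrow> \<theta> x = - x" and Vm_odd: "x \<in> Vm \<Longrightarrow> \<theta> x = - x"
  using Vpm_odd_part[of x 0] Vpm_odd_part[of 0 x] odd_part_eq subspace_0[OF subspace_eig] by auto

lemma s_zero_even: assumes x: "x \<in> G" "br s x = 0" shows "\<theta> x = x"
proof -
  obtain e u where eu: "e \<in> G" "\<theta> e = e" "u \<in> G" "\<theta> u = - u" "x = e + u" by (rule \<theta>_parts[OF x(1)])
  have "br s u = 0" using x(2) z_even[OF eu(1,2)] unfolding eu(5) by (simp add: br_add_r)
  moreover have "u \<in> odd_part" using eu unfolding odd_part_eq by blast
  then have "br s (br s u) = u" by (simp add: odd_part_def)
  ultimately have "u = 0" by simp
  then show ?thesis using eu by simp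
qed

definition "comb c0 c = c0 \<odot> s + (\<Sum>a\<in>UNIV. c a \<odot> H a)"

definition "T = span (insert s (range H))"

lemma T_gens: "s \<in> T" "H a \<in> T" unfolding T_def by (rule span_base, simp)+

lemma T_sub: "subspace T" by (simp add: T_def)

lemma T_in_G: "T \<subseteq> G" unfolding T_def by (rule span_minimal[OF _ subspace_G]) (use s_in X_G in auto)

lemma X_diag_T: "X i i \<in> T"
  using T_gens subspace_neg[OF T_sub] X_Inr by (cases i) auto

lemma T_comb: assumes "t \<in> T" shows "\<exists>c0 c. t = comb c0 c"
proof -
  have "subspace {t. \<exists>c0 c. t = comb c0 c}"
  proof (rule subspaceI)
    have "0 = comb 0 (\<lambda>_. 0)" by (simp add: comb_def)
    then show "0 \<in> {t. \<exists>c0 c. t = comb c0 c}" by blast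
  next
    fix x y assume "x \<in> {t. \<exists>c0 c. t = comb c0 c}" "y \<in> {t. \<exists>c0 c. t = comb c0 c}"
    then obtain c0 c d0 d where xy: "x = comb c0 c" "y = comb d0 d" by blast
    have "x + y = comb (c0 + d0) (\<lambda>a. c a + d a)"
      unfolding xy by (simp add: comb_def scale_left_distrib sum.distrib add_ac)
    then show "x + y \<in> {t. \<exists>c0 c. t = comb c0 c}" by blast
  next
    fix r x assume "x \<in> {t. \<exists>c0 c. t = comb c0 c}"
    then obtain c0 c where x: "x = comb c0 c" by blast
    have "r \<odot> x = comb (r * c0) (\<lambda>a. r * c a)"
      unfolding x by (simp add: comb_def scale_right_distrib scale_sum_right)
    then show "r \<odot> x \<in> {t. \<exists>c0 c. t = comb c0 c}" by blast
  qed
  moreover have "insert s (range H) \<subseteq> {t. \<exists>c0 c. t = comb c0 c}"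
  proof -
    have "s = comb 1 (\<lambda>_. 0)" by (simp add: comb_def)
    moreover have "H a = comb 0 (\<lambda>b. if b = a then 1 else 0)" for a
    proof -
      have "(\<Sum>b\<in>UNIV. (if b = a then 1 else 0) \<odot> H b) = (\<Sum>b\<in>UNIV. if b = a then H b else 0)"
        by (rule sum.cong) auto
      then show ?thesis by (simp add: comb_def)
    qed
    ultimately show ?thesis by blast
  qed
  ultimately have "T \<subseteq> {t. \<exists>c0 c. t = comb c0 c}" unfolding T_def by (intro span_minimal)
  then show ?thesis using assms by blast
qed

definition "W \<epsilon> \<mu> = {x \<in> G. br s x = \<epsilon> \<odot> x \<and> (\<forall>a. br (H a) x = \<mu> a \<odot> x)}"

lemma WD: "x \<in> W \<epsilon> \<mu> \<Longrightarrow> x \<in> G" "x \<in> W \<epsilon> \<mu> \<Longrightarrow> br s x = \<epsilon> \<odot> x" "x \<in> W \<epsilon> \<mu> \<Longrightarrow> br (H a) x = \<mu> a \<odot> x"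
  by (auto simp: W_def)

lemma WI: "x \<in> G \<Longrightarrow> br s x = \<epsilon> \<odot> x \<Longrightarrow> (\<And>a. br (H a) x = \<mu> a \<odot> x) \<Longrightarrow> x \<in> W \<epsilon> \<mu>"
  by (auto simp: W_def)

lemma subspace_W: "subspace (W \<epsilon> \<mu>)"
  by (rule subspaceI) (auto simp: W_def G_closed br_simps scale_right_distrib mult.commute)

lemma W_br: assumes "x \<in> W \<epsilon> \<mu>" "y \<in> W \<delta> \<gamma>" shows "br x y \<in> W (\<epsilon> + \<delta>) (\<lambda>a. \<mu> a + \<gamma> a)"
  by (rule WI) (simp_all add: jacobi[of _ x y] WD[OF assms(1)] WD[OF assms(2)] br_simps scale_left_distrib)

lemma X_W: "X i j \<in> W 0 (rt i j)"
  by (rule WI) (simp_all add: X_G z_X X_diag rt_def)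

lemma W_comb: "x \<in> W \<epsilon> \<mu> \<Longrightarrow> br (comb c0 c) x = (c0 * \<epsilon> + ip c \<mu>) \<odot> x"
  by (simp add: comb_def br_add_l br_sum_l br_scale_l WD ip_def scale_left_distrib scale_sum_left)

lemma W_X: assumes x: "x \<in> W \<epsilon> \<mu>" shows "br (X i i) x = ev \<mu> i \<odot> x"
proof (cases i)
  case (Inl a) then show ?thesis using WD(3)[OF x, of a] by (simp add: ev_def)
next
  case (Inr a) then show ?thesis using WD(3)[OF x, of a] by (simp add: ev_def X_Inr br_neg_l)
qed

lemma W_Vp: "W 1 \<mu> \<subseteq> Vp" and W_Vm: "W (- 1) \<mu> \<subseteq> Vm"
  by (auto simp: W_def eig_def)

lemma W_commute:
  assumes "x \<in> W \<epsilon> \<mu>" "y \<in> W \<epsilon> \<gamma>" "\<epsilon> = 1 \<or> \<epsilon> = - 1" shows "br x y = 0"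
  using assms(3)
proof
  assume "\<epsilon> = 1" then show ?thesis using assms W_Vp by (intro Vp_Vp) auto
next
  assume "\<epsilon> = - 1" then show ?thesis using assms W_Vm by (intro Vm_Vm) auto
qed

definition "fn \<epsilon> \<mu> t = (let p = SOME p. t = comb (fst p) (snd p) in fst p * \<epsilon> + ip (snd p) \<mu>)"

lemma W_wt: assumes x: "x \<in> W \<epsilon> \<mu>" shows "x \<in> wt T (fn \<epsilon> \<mu>)"
proof (rule wtI)
  show "x \<in> G" using WD[OF x] by simp
  fix t assume "t \<in> T"
  then have "\<exists>p. t = comb (fst p) (snd p)" using T_comb[of t] by auto
  then have "t = comb (fst (SOME p. t = comb (fst p) (snd p))) (snd (SOME p. t = comb (fst p) (snd p)))"
    by (rule someI_ex)
  then have "br t x = br (comb (fst (SOME p. t = comb (fst p) (snd p))) (snd (SOME p. t = comb (fst p) (snd p)))) x"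
    by (rule arg_cong)
  then show "br t x = fn \<epsilon> \<mu> t \<odot> x" unfolding W_comb[OF x] fn_def Let_def .
qed

lemma fn_eval:
  assumes x: "x \<in> W \<epsilon> \<mu>" "x \<noteq> 0" and t: "t \<in> T" "br t x = c \<odot> x" shows "fn \<epsilon> \<mu> t = c"
proof -
  have "fn \<epsilon> \<mu> t \<odot> x = c \<odot> x" using wtD(2)[OF W_wt[OF x(1)] t(1)] t(2) by (rule trans[OF sym])
  then show ?thesis using x(2) by (simp only: scale_cancel_right) blast
qed

lemma wt_W: "y \<in> wt T \<alpha> \<Longrightarrow> y \<in> W (\<alpha> s) (\<lambda>a. \<alpha> (H a))"
  using T_gens by (intro WI) (auto simp: wtD)

text \<open>A regular element of \<open>T\<close> shows that \<open>T\<close> is its own centralizer.\<close>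

lemma T_self_centralizing:
  assumes x: "x \<in> G" "\<And>t. t \<in> T \<Longrightarrow> br t x = 0" shows "x \<in> T"
proof -
  obtain h :: "5 \<Rightarrow> nat" where h: "inj h" using finite_imp_inj_to_nat_seg[of "UNIV :: 5 set"] by auto
  define r :: "5 \<Rightarrow> 'k" where "r a = of_nat (Suc (h a))" for a
  have r_inj: "r a = r b \<longleftrightarrow> a = b" for a b using h by (auto simp: r_def inj_eq simp del: of_nat_Suc)
  have r_neg: "r a \<noteq> - r b" for a b
  proof
    assume "r a = - r b"
    then have "of_nat (Suc (h a) + Suc (h b)) = (0::'k)" by (simp only: r_def of_nat_add) (simp add: add_eq_0_iff)
    then show False by (simp only: of_nat_eq_0_iff)
  qed
  have r_neg': "- r a \<noteq> r b" for a b using r_neg[of b a] by auto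
  have ev_r: "ev r i \<noteq> ev r j" if "i \<noteq> j" for i j
    using that r_inj r_neg r_neg' by (cases i; cases j) (auto simp: ev_def)
  let ?t = "comb 0 r"
  have tT: "?t \<in> T" unfolding comb_def
    by (intro subspace_add[OF T_sub] subspace_sum[OF T_sub] subspace_scale[OF T_sub] T_gens)
  define V where "V c = (if c = 0 then T else eig ?t c)" for c
  have subV: "subspace (V c)" for c by (simp add: V_def T_sub subspace_eig)
  have "X i j \<in> (\<Union>c. V c)" for i j
  proof (cases "i = j")
    case True
    then have "X i j \<in> V 0" using X_diag_T by (simp add: V_def)
    then show ?thesis by blast
  next
    case False
    have "br ?t (X i j) = (ev r i - ev r j) \<odot> X i j" using W_comb[OF X_W] by (simp add: ip_rt)
    then have "X i j \<in> V (ev r i - ev r j)" using ev_r[OF False] X_G by (simp add: V_def eig_def)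
    then show ?thesis by blast
  qed
  moreover have "s \<in> V 0" using T_gens by (simp add: V_def)
  ultimately have "insert s (range (\<lambda>(i, j). X i j)) \<subseteq> (\<Union>c. V c)" by auto
  from span_mono[OF this] have "x \<in> span (\<Union>c. V c)"
    using even_span[OF x(1) s_zero_even[OF x(1) x(2)[OF T_gens(1)]]] by blast
  then obtain D xs where D: "finite D" "\<forall>c. xs c \<in> V c" "x = (\<Sum>c\<in>D. xs c)"
    using span_Union_subspaces[of V x] subV by blast
  have T0: "br ?t t = 0" if "t \<in> T" for t
  proof -
    obtain d0 d where t: "t = comb d0 d" using T_comb[OF \<open>t \<in> T\<close>] by blast
    have "br (H a) (H b) = 0" for a b by (simp add: X_diag)
    moreover have "br (H a) s = 0" for a using z_X[of "Inl a" "Inl a"] br_anti[where x = s and y = "H a"] by simp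
    ultimately show ?thesis unfolding t comb_def by (simp add: br_simps br_sum_l br_sum_r)
  qed
  have "\<And>c. c \<in> D \<Longrightarrow> c \<odot> xs c \<in> gen (br ?t) c"
  proof (rule eigenvector_in_gen)
    fix c
    have "xs c \<in> V c" using D(2) by blast
    then show "c \<odot> xs c \<in> G" "br ?t (c \<odot> xs c) = c \<odot> c \<odot> xs c"
      using T0 T_in_G by (cases "c = 0"; auto simp: V_def eig_def br_scale_r G_closed)+
  qed
  moreover have "(\<Sum>c\<in>D. c \<odot> xs c) = 0"
  proof -
    have "br ?t (xs c) = c \<odot> xs c" for c
    proof -
      have "xs c \<in> V c" using D(2) by blast
      then show ?thesis using T0 by (cases "c = 0") (auto simp: V_def eig_def)
    qed
    then have "(\<Sum>c\<in>D. c \<odot> xs c) = br ?t x" unfolding D(3) br_sum_r by simp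
    then show ?thesis using x(2)[OF tT] by simp
  qed
  ultimately have "c \<odot> xs c = 0" if "c \<in> D" for c
    using gen_independent[OF endo_br[of ?t] D(1), of "\<lambda>c. c \<odot> xs c" c] that by blast
  then have "xs c = 0 \<or> c = 0" if "c \<in> D" for c using that by auto
  then have "xs c \<in> T" if "c \<in> D" for c
    using that spec[OF D(2), of c] subspace_0[OF T_sub] by (cases "c = 0") (force simp: V_def)+
  then show ?thesis unfolding D(3) by (intro subspace_sum[OF T_sub])
qed

lemma T_commutes: assumes "x \<in> T" "y \<in> T" shows "br x y = 0"
proof -
  obtain c0 c where x: "x = comb c0 c" using T_comb[OF assms(1)] by blast
  obtain d0 d where y: "y = comb d0 d" using T_comb[OF assms(2)] by blast
  have "br (H a) (H b) = 0" for a b by (simp add: X_diag)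
  moreover have "br (H a) s = 0" for a using z_X[of "Inl a" "Inl a"] br_anti[where x = s and y = "H a"] by simp
  ultimately show ?thesis unfolding x y comb_def by (simp add: br_simps br_sum_l br_sum_r z_X)
qed

lemma cartan: "cartan_space scale G br T"
proof unfold_locales
  show "G \<subseteq> span (\<Union>\<alpha>. wt T \<alpha>)"
  proof (rule toral_span_wt[OF T_sub T_in_G T_commutes, of "insert s (range H)"])
    show "T \<subseteq> span (insert s (range H))" by (simp add: T_def)
    show "G \<subseteq> span (\<Union>c. eig t c)" if "t \<in> insert s (range H)" for t
      by (rule diagonalizable) (use that in auto)
  qed (use T_gens in auto)
qed (fact nd T_sub T_in_G T_commutes T_self_centralizing)+

sublocale cs: cartan_space scale G br T by (rule cartan)

lemma kf_H_s: "kf (H a) s = 0" and kf_H: "a \<noteq> b \<Longrightarrow> kf (H a) (H b) = 0" "kf (H a) (H a) = kf (H b) (H b)"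
proof -
  have root: "kf (X i i - X j j) t = kf (X i j) (br (X j i) t)" if "i \<noteq> j" "j \<noteq> bar i" for i j t
    using kf_invariant[of "X i j" "X j i" t] X_opp[OF that] by simp
  have brk: "br (X j i) (X k k) = - (vpair k j - vpair k i) \<odot> X j i" for i j k
    using br_anti[where x = "X k k" and y = "X j i"] X_diag[of k j i] by (simp add: scale_left_diff_distrib)
  have m: "kf (H a - H b) (H c) = - (vpair (Inl c) (Inl b) - vpair (Inl c) (Inl a)) * kf (X (Inl a) (Inl b)) (X (Inl b) (Inl a))"
    if "a \<noteq> b" for a b c
    using root[of "Inl a" "Inl b" "H c"] that by (simp add: brk kf_scale_r kf_neg_r)
  have p: "kf (H a + H b) (H c) = - (vpair (Inl c) (Inr b) - vpair (Inl c) (Inl a)) * kf (X (Inl a) (Inr b)) (X (Inr b) (Inl a))"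
    if "a \<noteq> b" for a b c
    using root[of "Inl a" "Inr b" "H c"] that by (simp add: brk kf_scale_r kf_neg_r X_Inr)
  have X_s: "br (X j i) s = 0" for i j using z_X[of j i] br_anti[where x = s and y = "X j i"] by simp
  have ms: "kf (H a - H b) s = 0" if "a \<noteq> b" for a b
    using root[of "Inl a" "Inl b" s] that X_s by simp
  have ps: "kf (H a + H b) s = 0" if "a \<noteq> b" for a b
    using root[of "Inl a" "Inr b" s] that X_s by (simp add: X_Inr)
  have half: "x = 0" if "x - y = 0" "x + y = 0" for x y :: 'k
  proof -
    have "x + x = (x - y) + (x + y)" by simp
    then have "x + x = 0" using that by simp
    then show ?thesis by simp
  qed
  show "kf (H a) s = 0" for a
  proof -
    obtain b where b: "b \<noteq> a" using ex_other_index[of a a a] by blast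
    show ?thesis by (rule half[of _ "kf (H b) s"]) (use ms[of a b] ps[of a b] b in \<open>auto simp: kf_diff_l kf_add_l\<close>)
  qed
  show "kf (H a) (H b) = 0" if ab: "a \<noteq> b" for a b
  proof -
    obtain c where c: "c \<notin> {a, b}" using ex_other_index[of a b b] by blast
    then have ac: "a \<noteq> c" by auto
    have "kf (H a - H c) (H b) = 0" "kf (H a + H c) (H b) = 0"
      unfolding m[OF ac] p[OF ac] using ab c by (simp_all add: vpair_def)
    then show ?thesis unfolding kf_diff_l kf_add_l by (rule half)
  qed
  show "kf (H a) (H a) = kf (H b) (H b)" for a b
  proof (cases "a = b")
    case False
    have "kf (H a + H b) (H a) = kf (H a + H b) (H b)"
      unfolding p[OF False] using False by (simp add: vpair_def)
    then show ?thesis using \<open>\<And>b a. a \<noteq> b \<Longrightarrow> kf (H a) (H b) = 0\<close>[of a b] False kf_sym[of "H a" "H b"] by (simp add: kf_add_l)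
  qed simp
qed

definition "cc = kf (H 0) (H 0) / kf s s"

lemma kf_norms: "kf (H 0) (H 0) \<noteq> 0" "kf s s \<noteq> 0"
proof -
  have perp: "t = 0" if "t \<in> T" "kf t s = 0" "\<And>a. kf t (H a) = 0" for t
  proof (rule cs.kf_T_nondegenerate[OF that(1)])
    fix t' assume "t' \<in> T"
    then obtain d0 d where t': "t' = comb d0 d" using T_comb by blast
    have "kf t t' = kf t' t" by (rule kf_sym)
    also have "\<dots> = 0" unfolding t' comb_def kf_add_l kf_scale_l kf_sum_l
      using that(2,3) by (simp add: kf_sym[of s t] kf_sym[of "H _" t])
    finally show "kf t t' = 0" .
  qed
  have "H 0 \<noteq> 0"
  proof
    assume 0: "H 0 = 0"
    have "br (H 0) (X (Inl 0) (Inl 1)) = X (Inl 0) (Inl 1)" by (simp add: X_diag vpair_def)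
    then show False using 0 X_nz[of "Inl 0" "Inl 1"] by simp
  qed
  moreover have "H 0 = 0" if "kf (H 0) (H 0) = 0"
  proof (rule perp[OF T_gens(2) kf_H_s])
    show "kf (H 0) (H a) = 0" for a using that kf_H(1)[of 0 a] by (cases "a = 0") auto
  qed
  ultimately show "kf (H 0) (H 0) \<noteq> 0" by blast
  have "s = 0" if "kf s s = 0"
    by (rule perp[OF T_gens(1) that]) (use kf_H_s kf_sym in simp)
  then show "kf s s \<noteq> 0" using z_nz by blast
qed

text \<open>sl2-triples through the odd weight vectors; \<open>h\<close> acts on a weight \<open>(\<delta>, \<gamma>)\<close> by a multiple of
  the inner product with \<open>(\<epsilon>, \<mu>)\<close>.\<close>

lemma odd_triple:
  assumes v: "v \<in> W \<epsilon> \<mu>" "v \<noteq> 0" and \<epsilon>: "\<epsilon> = 1 \<or> \<epsilon> = - 1"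
  shows "\<exists>f h q. f \<in> W (- \<epsilon>) (\<lambda>a. - \<mu> a) \<and> br v f = h \<and> br h v = 2 \<odot> v \<and> br h f = (-2) \<odot> f \<and>
    h \<in> T \<and> q * (ip \<mu> \<mu> + cc) = 2 \<and> (\<forall>\<delta> \<gamma> u. u \<in> W \<delta> \<gamma> \<longrightarrow> br h u = (q * (ip \<mu> \<gamma> + \<epsilon> * \<delta> * cc)) \<odot> u)"
proof -
  have fs: "fn \<epsilon> \<mu> s = \<epsilon>" by (rule fn_eval[OF v T_gens(1) WD(2)[OF v(1)]])
  have fH: "fn \<epsilon> \<mu> (H a) = \<mu> a" for a by (rule fn_eval[OF v T_gens(2) WD(3)[OF v(1)]])
  have nz: "fn \<epsilon> \<mu> s \<noteq> 0" using fs \<epsilon> by auto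
  obtain f h where f: "f \<in> wt T (\<lambda>t. - fn \<epsilon> \<mu> t)" and h: "h \<in> T" "br v f = h" "br h v = 2 \<odot> v" "br h f = (-2) \<odot> f"
    and c: "\<exists>c. c \<noteq> 0 \<and> (\<forall>t\<in>T. kf h t = c * fn \<epsilon> \<mu> t)"
    using cs.root_sl2[OF W_wt[OF v(1)] v(2) T_gens(1) nz] by blast
  obtain c where c: "c \<noteq> 0" "\<forall>t\<in>T. kf h t = c * fn \<epsilon> \<mu> t" using c by blast
  have fW: "f \<in> W (- \<epsilon>) (\<lambda>a. - \<mu> a)" using wt_W[OF f] by (simp add: fs fH)
  obtain d0 d where hd: "h = comb d0 d" using T_comb[OF h(1)] by blast
  let ?K = "kf (H 0) (H 0)" and ?M = "kf s s"
  have sum1: "(\<Sum>b\<in>UNIV. d b * kf (H b) (H a)) = d a * ?K" for a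
  proof -
    have "(\<Sum>b\<in>UNIV. d b * kf (H b) (H a)) = (\<Sum>b\<in>UNIV. if b = a then d b * ?K else 0)"
      by (rule sum.cong) (use kf_H(1) kf_H(2)[of a 0] in auto)
    then show ?thesis by simp
  qed
  have "kf h (H a) = d a * ?K" for a
    unfolding hd comb_def by (simp add: kf_add_l kf_scale_l kf_sum_l sum1 kf_sym[of s] kf_H_s)
  then have da: "d a = c * \<mu> a / ?K" for a
    using c(2)[rule_format, OF T_gens(2)[of a]] unfolding \<open>\<And>a. kf h (H a) = d a * ?K\<close> fH
    using kf_norms(1) by (simp add: nonzero_eq_divide_eq)
  have "kf h s = d0 * ?M"
    unfolding hd comb_def by (simp add: kf_add_l kf_scale_l kf_sum_l kf_H_s)
  then have d0: "d0 = c * \<epsilon> / ?M" using c(2)[rule_format, OF T_gens(1)] unfolding fs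
    using kf_norms(2) by (simp add: nonzero_eq_divide_eq)
  have act: "br h u = (c / ?K * (ip \<mu> \<gamma> + \<epsilon> * \<delta> * cc)) \<odot> u" if u: "u \<in> W \<delta> \<gamma>" for u \<delta> \<gamma>
  proof -
    have "ip d \<gamma> = c / ?K * ip \<mu> \<gamma>" unfolding ip_def sum_distrib_left by (intro sum.cong refl) (simp add: da)
    moreover have "d0 * \<delta> = c / ?K * (\<epsilon> * \<delta> * cc)" using kf_norms by (simp add: d0 cc_def)
    ultimately have "d0 * \<delta> + ip d \<gamma> = c / ?K * (ip \<mu> \<gamma> + \<epsilon> * \<delta> * cc)" by (simp add: distrib_left)
    then show ?thesis using W_comb[OF u, of d0 d] unfolding hd by simp
  qed
  have "\<epsilon> * \<epsilon> = 1" using \<epsilon> by auto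
  then have "br h v = (c / ?K * (ip \<mu> \<mu> + cc)) \<odot> v" using act[OF v(1)] by simp
  then have "c / ?K * (ip \<mu> \<mu> + cc) = 2" using h(3) v(2) by simp
  then show ?thesis using fW h act by blast
qed

text \<open>\<open>u\<close> is a highest weight vector for the triple through \<open>v\<close>, and three applications of \<open>f\<close> lead out of the
  grading, so its highest weight is at most 2.\<close>

lemma W_pairing_values:
  assumes v: "v \<in> W \<epsilon> \<mu>" "v \<noteq> 0" and u: "u \<in> W \<epsilon> \<gamma>" "u \<noteq> 0" and \<epsilon>: "\<epsilon> = 1 \<or> \<epsilon> = - 1"
  shows "ip \<mu> \<mu> + cc \<noteq> 0" "\<exists>N\<le>2. 2 * (ip \<mu> \<gamma> + cc) = of_nat N * (ip \<mu> \<mu> + cc)"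
proof -
  obtain f h q where f: "f \<in> W (- \<epsilon>) (\<lambda>a. - \<mu> a)" "br v f = h" "br h v = 2 \<odot> v" "br h f = (-2) \<odot> f"
    and q: "q * (ip \<mu> \<mu> + cc) = 2" and act: "\<And>\<delta> \<gamma> u. u \<in> W \<delta> \<gamma> \<Longrightarrow> br h u = (q * (ip \<mu> \<gamma> + \<epsilon> * \<delta> * cc)) \<odot> u"
    using odd_triple[OF v \<epsilon>] by blast
  show nz: "ip \<mu> \<mu> + cc \<noteq> 0" using q by auto
  have "\<epsilon> * \<epsilon> = 1" using \<epsilon> by auto
  then have hu: "br h u = (q * (ip \<mu> \<gamma> + cc)) \<odot> u" using act[OF u(1)] by simp
  obtain N :: nat where N: "q * (ip \<mu> \<gamma> + cc) = of_nat N" "\<forall>j\<le>N. (br f ^^ j) u \<noteq> 0"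
    using sl2_highest[OF f(2-4) WD(1)[OF u(1)] u(2) W_commute[OF v(1) u(1) \<epsilon>] hu] by blast
  have "br f (br f u) \<in> W (- \<epsilon> + (- \<epsilon> + \<epsilon>)) (\<lambda>a. - \<mu> a + (- \<mu> a + \<gamma> a))" by (intro W_br f u)
  then have "br f (br f (br f u)) = 0" using W_commute[OF f(1)] \<epsilon> by auto
  then have "(br f ^^ 3) u = 0" by (simp add: eval_nat_numeral)
  then have "N \<le> 2" using N(2) by (metis not_less_eq_eq numeral_2_eq_2 numeral_3_eq_3)
  moreover have "2 * (ip \<mu> \<gamma> + cc) = of_nat N * (ip \<mu> \<mu> + cc)"
    unfolding N(1)[symmetric] q[symmetric] by simp
  ultimately show "\<exists>N\<le>2. 2 * (ip \<mu> \<gamma> + cc) = of_nat N * (ip \<mu> \<mu> + cc)" by blast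
qed

text \<open>Modulo \<open>v\<close>, every \<open>u\<close> of the same weight can be made orthogonal to the opposite vector \<open>f\<close>; then
  \<open>[f, u] = 0\<close>, and \<open>u\<close> is killed by \<open>h = [v, f]\<close>, which acts on it by 2.\<close>

lemma W_one_dim:
  assumes v: "v \<in> W \<epsilon> \<mu>" "v \<noteq> 0" and u: "u \<in> W \<epsilon> \<mu>" and \<epsilon>: "\<epsilon> = 1 \<or> \<epsilon> = - 1"
  shows "\<exists>r. u = r \<odot> v"
proof -
  obtain f h q where f: "f \<in> W (- \<epsilon>) (\<lambda>a. - \<mu> a)" "br v f = h" "br h v = 2 \<odot> v" "br h f = (-2) \<odot> f" "h \<in> T"
    and q: "q * (ip \<mu> \<mu> + cc) = 2" and act: "\<And>\<delta> \<gamma> u. u \<in> W \<delta> \<gamma> \<Longrightarrow> br h u = (q * (ip \<mu> \<gamma> + \<epsilon> * \<delta> * cc)) \<odot> u"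
    using odd_triple[OF v \<epsilon>] by blast
  have ee: "\<epsilon> * \<epsilon> = 1" using \<epsilon> by auto
  have fs: "fn \<epsilon> \<mu> s = \<epsilon>" by (rule fn_eval[OF v T_gens(1) WD(2)[OF v(1)]])
  have fwt: "f \<in> wt T (\<lambda>t. - fn \<epsilon> \<mu> t)"
  proof (rule wtI[OF WD(1)[OF f(1)]])
    fix t assume t: "t \<in> T"
    obtain d0 d where td: "t = comb d0 d" using T_comb[OF t] by blast
    have "br t v = (d0 * \<epsilon> + ip d \<mu>) \<odot> v" unfolding td by (rule W_comb[OF v(1)])
    then have "fn \<epsilon> \<mu> t = d0 * \<epsilon> + ip d \<mu>" by (rule fn_eval[OF v t])
    moreover have "ip d (\<lambda>a. - \<mu> a) = - ip d \<mu>" by (simp add: ip_def sum_negf)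
    ultimately show "br t f = - fn \<epsilon> \<mu> t \<odot> f" unfolding td using W_comb[OF f(1), of d0 d] by simp
  qed
  have kvf: "kf v f \<noteq> 0"
  proof
    assume "kf v f = 0"
    then have "h = 0" unfolding f(2)[symmetric]
      using cs.kf_T_nondegenerate[OF cs.br_opposite(1)[OF W_wt[OF v(1)] fwt]] cs.br_opposite(2)[OF W_wt[OF v(1)] fwt] by simp
    then show False using f(3) v(2) by simp
  qed
  define r where "r = kf u f / kf v f"
  let ?u = "u - r \<odot> v"
  have uW: "?u \<in> W \<epsilon> \<mu>" by (intro subspace_diff[OF subspace_W u] subspace_scale[OF subspace_W] v)
  have k0: "kf ?u f = 0" using kvf by (simp add: r_def kf_diff_l kf_scale_l)
  have "br ?u f = 0"
    using cs.kf_T_nondegenerate[OF cs.br_opposite(1)[OF W_wt[OF uW] fwt]] cs.br_opposite(2)[OF W_wt[OF uW] fwt] k0 by simp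
  then have fu: "br f ?u = 0" using br_anti[where x = ?u and y = f] by simp
  have "br h ?u = 0"
    using jacobi[of v f ?u] fu W_commute[OF v(1) uW \<epsilon>] f(2) by simp
  moreover have "br h ?u = (q * (ip \<mu> \<mu> + cc)) \<odot> ?u" using act[OF uW] ee by simp
  ultimately have "?u = 0" unfolding q by simp
  then show ?thesis by (intro exI[of _ r]) simp
qed

lemma W_reflection:
  assumes u: "u \<in> W \<epsilon> \<mu>" "u \<noteq> 0" and ij: "i \<noteq> j" "j \<noteq> bar i"
  shows "\<exists>n::int. ev \<mu> i - ev \<mu> j = of_int n \<and> (\<exists>v\<in>W \<epsilon> (\<lambda>a. \<mu> a - of_int n * rt i j a). v \<noteq> 0)"
proof -
  have eX: "X i j \<in> wt T (fn 0 (rt i j))" by (rule W_wt[OF X_W])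
  have Xnz: "X i j \<noteq> 0" by (rule X_nz[OF ij])
  have fX: "X j i \<in> wt T (\<lambda>t. - fn 0 (rt i j) t)"
  proof (rule wtI[OF X_G])
    fix t assume t: "t \<in> T"
    obtain d0 d where td: "t = comb d0 d" using T_comb[OF t] by blast
    have "br t (X i j) = ip d (rt i j) \<odot> X i j" unfolding td using W_comb[OF X_W, of d0 d] by simp
    then have "fn 0 (rt i j) t = ip d (rt i j)" by (rule fn_eval[OF X_W Xnz t])
    moreover have "br t (X j i) = ip d (rt j i) \<odot> X j i" unfolding td using W_comb[OF X_W, of d0 d] by simp
    moreover have "ip d (rt j i) = - ip d (rt i j)" by (simp add: ip_rt)
    ultimately show "br t (X j i) = - fn 0 (rt i j) t \<odot> X j i" by simp
  qed
  let ?h = "X i i - X j j"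
  have hT: "?h \<in> T" by (intro subspace_diff[OF T_sub] X_diag_T)
  have "br ?h u = (ev \<mu> i - ev \<mu> j) \<odot> u" by (simp add: br_diff_l W_X[OF u(1)] scale_left_diff_distrib)
  then have fh: "fn \<epsilon> \<mu> ?h = ev \<mu> i - ev \<mu> j" by (rule fn_eval[OF u hT])
  obtain n :: int and v where n: "fn \<epsilon> \<mu> ?h = of_int n" and v: "v \<in> wt T (\<lambda>t. fn \<epsilon> \<mu> t - of_int n * fn 0 (rt i j) t)" "v \<noteq> 0"
    using cs.wt_reflection[OF eX fX hT X_sl2[OF ij] W_wt[OF u(1)] u(2)] by blast
  have "fn \<epsilon> \<mu> s = \<epsilon>" "fn \<epsilon> \<mu> (H a) = \<mu> a" for a
    by (rule fn_eval[OF u T_gens(1) WD(2)[OF u(1)]], rule fn_eval[OF u T_gens(2) WD(3)[OF u(1)]])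
  moreover have "fn 0 (rt i j) s = 0" "fn 0 (rt i j) (H a) = rt i j a" for a
    by (rule fn_eval[OF X_W Xnz T_gens(1) WD(2)[OF X_W]], rule fn_eval[OF X_W Xnz T_gens(2) WD(3)[OF X_W]])
  ultimately have "v \<in> W \<epsilon> (\<lambda>a. \<mu> a - of_int n * rt i j a)" using wt_W[OF v(1)] by simp
  then show ?thesis using n fh v(2) by auto
qed

lemma W_root_integral:
  assumes v: "v \<in> W \<epsilon> \<mu>" "v \<noteq> 0" and \<epsilon>: "\<epsilon> = 1 \<or> \<epsilon> = - 1" and ij: "i \<noteq> j" "j \<noteq> bar i"
  shows "\<exists>n::int. 2 * (ev \<mu> i - ev \<mu> j) = of_int n * (ip \<mu> \<mu> + cc)"
proof -
  obtain f h q where f: "br v f = h" "br h v = 2 \<odot> v" "br h f = (-2) \<odot> f"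
    and q: "q * (ip \<mu> \<mu> + cc) = 2" and act: "\<And>\<delta> \<gamma> u. u \<in> W \<delta> \<gamma> \<Longrightarrow> br h u = (q * (ip \<mu> \<gamma> + \<epsilon> * \<delta> * cc)) \<odot> u"
    using odd_triple[OF v \<epsilon>] by blast
  have "br h (X i j) = (q * (ev \<mu> i - ev \<mu> j)) \<odot> X i j" using act[OF X_W] by (simp add: ip_rt)
  from sl2_integral[OF f X_G X_nz[OF ij] this] obtain n :: int where "q * (ev \<mu> i - ev \<mu> j) = of_int n" by blast
  then have "2 * (ev \<mu> i - ev \<mu> j) = of_int n * (ip \<mu> \<mu> + cc)" unfolding q[symmetric] by (simp add: ac_simps)
  then show ?thesis by blast
qed

definition "\<Phi> = {\<mu>. \<exists>v\<in>W 1 \<mu>. v \<noteq> 0}"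

lemma \<Phi>_neg: "v \<in> W (- 1) \<mu> \<Longrightarrow> v \<noteq> 0 \<Longrightarrow> (\<lambda>a. - \<mu> a) \<in> \<Phi>"
  and \<Phi>_neg': "v \<in> W 1 \<mu> \<Longrightarrow> v \<noteq> 0 \<Longrightarrow> \<exists>f\<in>W (- 1) (\<lambda>a. - \<mu> a). f \<noteq> 0"
proof -
  have "\<exists>f\<in>W (- \<epsilon>) (\<lambda>a. - \<mu> a). f \<noteq> 0" if v: "v \<in> W \<epsilon> \<mu>" "v \<noteq> 0" and \<epsilon>: "\<epsilon> = 1 \<or> \<epsilon> = - 1" for v \<epsilon> \<mu>
  proof -
    obtain f h where f: "f \<in> W (- \<epsilon>) (\<lambda>a. - \<mu> a)" "br v f = h" "br h v = 2 \<odot> v" using odd_triple[OF v \<epsilon>] by blast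
    have "f \<noteq> 0"
    proof
      assume "f = 0"
      then show False using f(2,3) v(2) by auto
    qed
    then show ?thesis using f(1) by blast
  qed
  from this[of v "- 1" \<mu>] this[of v 1 \<mu>]
  show "v \<in> W (- 1) \<mu> \<Longrightarrow> v \<noteq> 0 \<Longrightarrow> (\<lambda>a. - \<mu> a) \<in> \<Phi>"
    "v \<in> W 1 \<mu> \<Longrightarrow> v \<noteq> 0 \<Longrightarrow> \<exists>f\<in>W (- 1) (\<lambda>a. - \<mu> a). f \<noteq> 0" by (auto simp: \<Phi>_def)
qed

lemma \<Phi>_shape:
  assumes "\<mu> \<in> \<Phi>"
  shows "(\<forall>a. \<mu> a = 0) \<or> (\<exists>a. (\<mu> a = 1 \<or> \<mu> a = - 1) \<and> (\<forall>b. b \<noteq> a \<longrightarrow> \<mu> b = 0)) \<or>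
    ((\<forall>a. \<mu> a = 1 / 2 \<or> \<mu> a = - (1 / 2)) \<and> cc = 3 / 4)"
proof (rule minuscule_weights[OF _ _ _ _ _ _ assms])
  fix \<mu> \<gamma> assume "\<mu> \<in> \<Phi>"
  then obtain v where v: "v \<in> W 1 \<mu>" "v \<noteq> 0" by (auto simp: \<Phi>_def)
  show "ip \<mu> \<mu> + cc \<noteq> 0" by (rule W_pairing_values(1)[OF v v]) simp
  show "\<exists>N\<le>2. 2 * (ip \<mu> \<gamma> + cc) = of_nat N * (ip \<mu> \<mu> + cc)" if "\<gamma> \<in> \<Phi>"
  proof -
    obtain u where u: "u \<in> W 1 \<gamma>" "u \<noteq> 0" using \<open>\<gamma> \<in> \<Phi>\<close> by (auto simp: \<Phi>_def)
    show ?thesis by (rule W_pairing_values(2)[OF v u]) simp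
  qed
  fix a b :: 5 assume ab: "a \<noteq> b"
  have ij: "Inl a \<noteq> (Inl b :: 5 + 5)" "(Inl b :: 5 + 5) \<noteq> bar (Inl a)" "Inl a \<noteq> (Inr b :: 5 + 5)" "(Inr b :: 5 + 5) \<noteq> bar (Inl a)"
    using ab by auto
  show "\<exists>n::int. 2 * (\<mu> a - \<mu> b) = of_int n * (ip \<mu> \<mu> + cc)"
    using W_root_integral[OF v _ ij(1,2)] by (simp add: ev_def)
  show "\<exists>n::int. 2 * (\<mu> a + \<mu> b) = of_int n * (ip \<mu> \<mu> + cc)"
    using W_root_integral[OF v _ ij(3,4)] by (simp add: ev_def)
  obtain n :: int where n: "\<mu> a - \<mu> b = of_int n" "\<exists>v\<in>W 1 (\<lambda>c. \<mu> c - of_int n * rt (Inl a) (Inl b) c). v \<noteq> 0"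
    using W_reflection[OF v ij(1,2)] by (auto simp: ev_def)
  have "(\<lambda>c. \<mu> c - of_int n * rt (Inl a) (Inl b) c) = \<mu>(a := \<mu> b, b := \<mu> a)"
    unfolding n(1)[symmetric] using ab by (auto simp: fun_eq_iff rt_def vpair_def)
  then show "(\<exists>n::int. \<mu> a - \<mu> b = of_int n) \<and> \<mu>(a := \<mu> b, b := \<mu> a) \<in> \<Phi>"
    using n unfolding \<Phi>_def by auto
  obtain m :: int where m: "\<mu> a + \<mu> b = of_int m" "\<exists>v\<in>W 1 (\<lambda>c. \<mu> c - of_int m * rt (Inl a) (Inr b) c). v \<noteq> 0"
    using W_reflection[OF v ij(3,4)] by (auto simp: ev_def)
  have "(\<lambda>c. \<mu> c - of_int m * rt (Inl a) (Inr b) c) = \<mu>(a := - \<mu> b, b := - \<mu> a)"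
    unfolding m(1)[symmetric] using ab by (auto simp: fun_eq_iff rt_def vpair_def)
  then show "(\<exists>n::int. \<mu> a + \<mu> b = of_int n) \<and> \<mu>(a := - \<mu> b, b := - \<mu> a) \<in> \<Phi>"
    using m unfolding \<Phi>_def by auto
qed

lemma \<Phi>_flip:
  assumes "\<mu> \<in> \<Phi>" "a \<noteq> b" shows "\<mu>(a := - \<mu> a, b := - \<mu> b) \<in> \<Phi>"
proof -
  have refl: "(\<lambda>c. \<mu> c - (ev \<mu> i - ev \<mu> j) * rt i j c) \<in> \<Phi>" if "\<mu> \<in> \<Phi>" "i \<noteq> j" "j \<noteq> bar i" for \<mu> i j
  proof -
    obtain v where v: "v \<in> W 1 \<mu>" "v \<noteq> 0" using \<open>\<mu> \<in> \<Phi>\<close> by (auto simp: \<Phi>_def)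
    show ?thesis using W_reflection[OF v \<open>i \<noteq> j\<close> \<open>j \<noteq> bar i\<close>] unfolding \<Phi>_def by auto
  qed
  let ?\<gamma> = "\<mu>(a := \<mu> b, b := \<mu> a)"
  have "(\<lambda>c. \<mu> c - (ev \<mu> (Inl a) - ev \<mu> (Inl b)) * rt (Inl a) (Inl b) c) = ?\<gamma>"
    using assms(2) by (auto simp: fun_eq_iff rt_def vpair_def ev_def)
  then have g: "?\<gamma> \<in> \<Phi>" using refl[OF assms(1), of "Inl a" "Inl b"] assms(2) by simp
  have "(\<lambda>c. ?\<gamma> c - (ev ?\<gamma> (Inl a) - ev ?\<gamma> (Inr b)) * rt (Inl a) (Inr b) c) = \<mu>(a := - \<mu> a, b := - \<mu> b)"
    using assms(2) by (auto simp: fun_eq_iff rt_def vpair_def ev_def)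
  then show ?thesis using refl[OF g, of "Inl a" "Inr b"] assms(2) by simp
qed

lemma Vp_span: "Vp \<subseteq> span (\<Union>\<mu>\<in>\<Phi>. W 1 \<mu>)"
  and Vm_span: "Vm \<subseteq> span (\<Union>\<mu>\<in>\<Phi>. W (- 1) (\<lambda>a. - \<mu> a))"
proof -
  have scl: "comp_p y \<in> wt T \<alpha>" "comp_m y \<in> wt T \<alpha>" if y: "y \<in> wt T \<alpha>" for y \<alpha>
    unfolding comp_p_def comp_m_def using wtD(2)[OF y T_gens(1)] y
    by (auto simp: br_scale_r intro!: subspace_scale[OF subspace_wt] subspace_add[OF subspace_wt] subspace_diff[OF subspace_wt])
  have p: "comp_p y \<in> span (\<Union>\<mu>\<in>\<Phi>. W 1 \<mu>)" if y: "y \<in> wt T \<alpha>" for y \<alpha>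
  proof (cases "comp_p y = 0")
    case False
    have "comp_p y \<in> W 1 (\<lambda>a. \<alpha> (H a))"
      using wt_W[OF scl(1)[OF y]] comp_in(1)[of y] by (auto simp: W_def eig_def)
    then have "comp_p y \<in> (\<Union>\<mu>\<in>\<Phi>. W 1 \<mu>)" using False by (auto simp: \<Phi>_def)
    then show ?thesis by (rule span_base)
  qed (simp add: span_zero)
  have m: "comp_m y \<in> span (\<Union>\<mu>\<in>\<Phi>. W (- 1) (\<lambda>a. - \<mu> a))" if y: "y \<in> wt T \<alpha>" for y \<alpha>
  proof (cases "comp_m y = 0")
    case False
    have w: "comp_m y \<in> W (- 1) (\<lambda>a. \<alpha> (H a))"
      using wt_W[OF scl(2)[OF y]] comp_in(2)[of y] by (auto simp: W_def eig_def)
    have "(\<lambda>a. - \<alpha> (H a)) \<in> \<Phi>" by (rule \<Phi>_neg[OF w False])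
    moreover have "comp_m y \<in> W (- 1) (\<lambda>a. - (- \<alpha> (H a)))" using w by simp
    ultimately have "comp_m y \<in> (\<Union>\<mu>\<in>\<Phi>. W (- 1) (\<lambda>a. - \<mu> a))" by blast
    then show ?thesis by (rule span_base)
  qed (simp add: span_zero)
  show "Vp \<subseteq> span (\<Union>\<mu>\<in>\<Phi>. W 1 \<mu>)"
  proof
    fix x assume x: "x \<in> Vp"
    have "x \<in> span (\<Union>\<alpha>. wt T \<alpha>)" using cs.span_wt VpD(1)[OF x] by blast
    then have "comp_p x \<in> span (\<Union>\<mu>\<in>\<Phi>. W 1 \<mu>)"
      by (rule lin_span_image_subset[OF lin_comp_p _ subspace_span, rotated]) (use p in blast)
    then show "x \<in> span (\<Union>\<mu>\<in>\<Phi>. W 1 \<mu>)" using comp_of_Vp(1)[OF x] by simp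
  qed
  show "Vm \<subseteq> span (\<Union>\<mu>\<in>\<Phi>. W (- 1) (\<lambda>a. - \<mu> a))"
  proof
    fix x assume x: "x \<in> Vm"
    have "x \<in> span (\<Union>\<alpha>. wt T \<alpha>)" using cs.span_wt VmD(1)[OF x] by blast
    then have "comp_m x \<in> span (\<Union>\<mu>\<in>\<Phi>. W (- 1) (\<lambda>a. - \<mu> a))"
      by (rule lin_span_image_subset[OF lin_comp_m _ subspace_span, rotated]) (use m in blast)
    then show "x \<in> span (\<Union>\<mu>\<in>\<Phi>. W (- 1) (\<lambda>a. - \<mu> a))" using comp_of_Vm(1)[OF x] by simp
  qed
qed

end

section \<open>The odd part is a sum of two half-spin modules\<close>

definition half :: "(5 \<Rightarrow> 'k::field_char_0) \<Rightarrow> bool" where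
  "half \<mu> \<longleftrightarrow> (\<forall>a. \<mu> a = 1 / 2 \<or> \<mu> a = - (1 / 2))"

definition flip2 :: "(5 \<Rightarrow> 'k::field_char_0) \<Rightarrow> 5 \<Rightarrow> 5 \<Rightarrow> 5 \<Rightarrow> 'k" where
  "flip2 \<mu> x y c = (if c = x \<or> c = y then - \<mu> c else \<mu> c)"

definition chi :: "(5 \<Rightarrow> 'k::field_char_0) \<Rightarrow> 'k" where
  "chi \<mu> = (\<Prod>a\<in>UNIV. 2 * \<mu> a)"

lemma halfD: "half \<mu> \<Longrightarrow> \<mu> a = 1 / 2 \<or> \<mu> a = - (1 / 2)"
  by (simp add: half_def)

lemma half_nz: assumes "half \<mu>" shows "\<mu> a \<noteq> 0" "- \<mu> a \<noteq> \<mu> a" "\<mu> a \<noteq> - \<mu> a"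
  by (rule disjE[OF halfD[OF assms, of a]]; erule ssubst; simp)+

lemma half_eq_or_neg: assumes "half \<mu>" "half \<gamma>" shows "\<gamma> a = \<mu> a \<or> \<gamma> a = - \<mu> a"
  by (rule disjE[OF halfD[OF assms(1), of a]]; rule disjE[OF halfD[OF assms(2), of a]]; simp only:) simp_all

lemma chi_signs:
  assumes "\<And>c. \<gamma> c = (if c \<in> D then - \<mu> c else \<mu> c)" shows "chi \<gamma> = (- 1) ^ card D * chi \<mu>"
proof -
  have "chi \<gamma> = (\<Prod>c\<in>UNIV. (if c \<in> D then - 1 else 1) * (2 * \<mu> c))"
    unfolding chi_def by (rule prod.cong) (auto simp: assms)
  also have "\<dots> = (\<Prod>c\<in>UNIV. if c \<in> D then - 1 else 1) * chi \<mu>" by (simp add: prod.distrib chi_def)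
  also have "(\<Prod>c\<in>UNIV. if c \<in> D then - 1 else (1::'a)) = (\<Prod>c\<in>D. - 1)"
    by (rule prod.mono_neutral_cong_right) auto
  finally show ?thesis by simp
qed

lemma chi_flip2: "x \<noteq> y \<Longrightarrow> chi (flip2 \<mu> x y) = chi \<mu>"
  using chi_signs[of "flip2 \<mu> x y" "{x, y}" \<mu>] by (simp add: flip2_def)

text \<open>Two half-spin weights of the same chirality differ in 0, 2 or 4 signs. With \<open>\<nu>\<close> the weight
  differing from \<open>\<mu>\<close> in all signs but one, every other weight is two sign changes away from \<open>\<mu>\<close> or \<open>\<nu>\<close>.\<close>

lemma two_flips:
  fixes \<mu> \<gamma> :: "5 \<Rightarrow> 'k::field_char_0"
  assumes h: "half \<mu>" "half \<gamma>" and c: "chi \<gamma> = chi \<mu>" and n: "\<gamma> \<noteq> \<mu>" "\<gamma> \<noteq> \<nu>"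
    and nu: "\<And>c. \<nu> c = (if c = p then \<mu> c else - \<mu> c)"
  shows "\<exists>x y. x \<noteq> y \<and> x \<noteq> p \<and> (\<gamma> = flip2 \<mu> x y \<or> \<gamma> = flip2 \<nu> x y)"
proof -
  define D where "D = {c. \<gamma> c \<noteq> \<mu> c}"
  have g: "\<gamma> c = (if c \<in> D then - \<mu> c else \<mu> c)" for c using half_eq_or_neg[OF h, of c] by (auto simp: D_def)
  have "chi \<mu> \<noteq> 0" using half_nz(1)[OF h(1)] by (simp add: chi_def)
  moreover have "chi \<mu> = (- 1) ^ card D * chi \<mu>" using chi_signs[of \<gamma> D \<mu>, OF g] c by simp
  ultimately have "(- 1 :: 'k) ^ card D = 1" by simp
  then have ev: "even (card D)" by (cases "even (card D)") auto
  have "card D + card (- D) = card (D \<union> - D)" by (rule card_Un_disjoint[symmetric]) auto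
  also have "D \<union> - D = UNIV" by blast
  finally have c5: "card D + card (- D) = 5" by simp
  have "card D \<noteq> 0"
  proof
    assume "card D = 0"
    then have "\<gamma> = \<mu>" using g by (auto simp: fun_eq_iff)
    then show False using n by simp
  qed
  then have "card D = 2 \<or> card (- D) = 1"
  proof -
    obtain k where "card D = 2 * k" using ev by (rule evenE)
    then show ?thesis using c5 \<open>card D \<noteq> 0\<close> by arith
  qed
  then show ?thesis
  proof
    assume "card D = 2"
    then obtain x y where D: "D = {x, y}" "x \<noteq> y" by (auto simp: card_2_iff)
    have e: "\<gamma> = flip2 \<mu> x y" "\<gamma> = flip2 \<mu> y x" using g D by (auto simp: fun_eq_iff flip2_def)
    show ?thesis
    proof (cases "x = p")
      case True
      then show ?thesis using e(2) D(2) by - (rule exI[of _ y], rule exI[of _ x], auto)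
    next
      case False
      then show ?thesis using e(1) D(2) by - (rule exI[of _ x], rule exI[of _ y], auto)
    qed
  next
    assume "card (- D) = 1"
    then obtain k where k: "- D = {k}" by (auto simp: card_1_singleton_iff)
    then have inD: "c \<in> D \<longleftrightarrow> c \<noteq> k" for c by blast
    have "k \<noteq> p"
    proof
      assume "k = p"
      then have "\<gamma> = \<nu>" using g nu inD by (auto simp: fun_eq_iff)
      then show False using n by simp
    qed
    moreover have "\<gamma> = flip2 \<nu> k p" using g nu inD \<open>k \<noteq> p\<close> by (auto simp: fun_eq_iff flip2_def)
    ultimately show ?thesis by blast
  qed
qed

context so10_graded begin

lemma rt_support:
  fixes i j :: "5 + 5"
  assumes "i \<noteq> j" "j \<noteq> bar i"
  obtains a b where "a \<noteq> b" "\<And>c. (rt i j c :: 'k) \<noteq> 0 \<longleftrightarrow> c = a \<or> c = b" "\<And>c. rt i j c \<in> {0, 1, - 1 :: 'k}"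
proof -
  define ix :: "5 + 5 \<Rightarrow> 5" where "ix i = (case i of Inl a \<Rightarrow> a | Inr a \<Rightarrow> a)" for i
  have "ix i \<noteq> ix j" using assms by (cases i; cases j) (auto simp: ix_def)
  moreover have "(rt i j c :: 'k) \<noteq> 0 \<longleftrightarrow> c = ix i \<or> c = ix j" "rt i j c \<in> {0, 1, - 1 :: 'k}" for c
    using assms by (cases i; cases j; auto simp: ix_def rt_def vpair_def)+
  ultimately show ?thesis by (rule that)
qed

lemma s_W: "s \<in> W 0 (\<lambda>_. 0)"
  by (rule WI) (use s_in T_commutes[OF T_gens(1) T_gens(1)] T_commutes[OF T_gens(2) T_gens(1)] in auto)

lemma W_kf_zero:
  assumes x: "x \<in> W \<epsilon> \<delta>" and y: "y \<in> W \<epsilon>' \<gamma>" and a: "\<delta> a + \<gamma> a \<noteq> 0" shows "kf x y = 0"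
proof -
  have "kf (br (H a) x) y = - kf x (br (H a) y)" by (rule kf_invariant')
  then have "(\<delta> a + \<gamma> a) * kf x y = 0"
    by (simp add: WD[OF x] WD[OF y] kf_scale_l kf_scale_r distrib_right)
  then show ?thesis using a by simp
qed

lemma kf_even_odd: assumes "br s x = 0" "y \<in> Vp \<or> y \<in> Vm" shows "kf x y = 0"
  using kf_invariant'[of s x y] assms VpD(2)[of y] VmD(2)[of y] by (auto simp: kf_neg_r)

lemma even_or_odd_span:
  assumes "x \<in> G"
  obtains e p m where "e \<in> span (insert s (range (\<lambda>(i, j). X i j)))" "p \<in> Vp" "m \<in> Vm" "x = e + p + m"
proof -
  obtain e u where eu: "e \<in> G" "\<theta> e = e" "u \<in> G" "\<theta> u = - u" "x = e + u" by (rule \<theta>_parts[OF assms])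
  have "u \<in> odd_part" using eu unfolding odd_part_eq by blast
  then have "u = comp_p u + comp_m u" by (rule odd_part_decomp)
  then show ?thesis using that[OF even_span[OF eu(1,2)] comp_in] eu(5) by (simp add: add.assoc)
qed

text \<open>An even vector of any other weight would be orthogonal to everything.\<close>

lemma even_weight:
  assumes x: "x \<in> W 0 \<delta>" "x \<noteq> 0" and \<delta>: "\<delta> a \<noteq> 0"
  shows "\<exists>i j. i \<noteq> j \<and> j \<noteq> bar i \<and> \<delta> = rt i j"
proof (rule ccontr)
  assume no: "\<nexists>i j. i \<noteq> j \<and> j \<noteq> bar i \<and> \<delta> = rt i j"
  have sx: "br s x = 0" using WD(2)[OF x(1)] by simp
  have X0: "kf x (X i j) = 0" for i j
  proof (cases "j = bar i")
    case False
    show ?thesis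
    proof (cases "i = j")
      case True
      then have "rt i j = (\<lambda>_. 0)" by (simp add: rt_def fun_eq_iff)
      then show ?thesis using \<delta> by (intro W_kf_zero[OF x(1) X_W[of i j], of a]) simp
    next
      case ij: False
      have ji: "j \<noteq> i" "i \<noteq> bar j" using False ij by auto
      have "\<delta> \<noteq> rt j i" using no ji by blast
      then obtain c where "\<delta> c \<noteq> rt j i c" by blast
      then have "\<delta> c + rt i j c \<noteq> 0" by (auto simp: rt_def algebra_simps)
      then show ?thesis by (rule W_kf_zero[OF x(1) X_W])
    qed
  qed (simp add: X_anti_zero)
  have s0: "kf x s = 0" by (rule W_kf_zero[OF x(1) s_W, of a]) (simp add: \<delta>)
  have "x = 0"
  proof (rule kf_nondegenerateD[OF nd WD(1)[OF x(1)]])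
    fix y assume "y \<in> G"
    then obtain e p m where y: "e \<in> span (insert s (range (\<lambda>(i, j). X i j)))" "p \<in> Vp" "m \<in> Vm" "y = e + p + m"
      by (rule even_or_odd_span)
    have "kf x e = 0" by (rule kf_zero_on_span[OF _ y(1)]) (use X0 s0 in auto)
    then show "kf x y = 0" unfolding y(4) kf_add_r using kf_even_odd[OF sx] y(2,3) by simp
  qed
  then show False using x(2) by simp
qed

text \<open>If the weights of the odd part were \<open>0\<close> and \<open>\<plusminus>\<epsilon>\<^sub>a\<close> only, the Lie algebra would have dimension at
  most \<open>46 + 22 < 72\<close>.\<close>

lemma half_weight_exists: "\<exists>\<mu>\<in>\<Phi>. half \<mu> \<and> cc = 3 / 4"
proof (rule ccontr)
  assume no: "\<not> ?thesis"
  define e1 :: "5 \<times> bool \<Rightarrow> 5 \<Rightarrow> 'k" where "e1 = (\<lambda>(a, b) c. if c = a then (if b then 1 else - 1) else 0)"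
  let ?S = "insert (\<lambda>_. 0) (range e1)"
  have sub: "\<Phi> \<subseteq> ?S"
  proof
    fix \<mu> assume m: "\<mu> \<in> \<Phi>"
    then have "\<not> ((\<forall>a. \<mu> a = 1 / 2 \<or> \<mu> a = - (1 / 2)) \<and> cc = 3 / 4)" using no unfolding half_def by blast
    with \<Phi>_shape[OF m] consider "\<forall>a. \<mu> a = 0" | a where "\<mu> a = 1 \<or> \<mu> a = - 1" "\<forall>b. b \<noteq> a \<longrightarrow> \<mu> b = 0" by blast
    then show "\<mu> \<in> ?S"
    proof cases
      case 1
      then have "\<mu> = (\<lambda>_. 0)" by (rule_tac ext) simp
      then show ?thesis by simp
    next
      case (2 a)
      then have "\<mu> = e1 (a, \<mu> a = 1)" by (auto simp: fun_eq_iff e1_def)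
      then show ?thesis by blast
    qed
  qed
  have finS: "finite ?S" by simp
  have "card ?S \<le> Suc (card (range e1))" by (rule card_insert_le_m1) auto
  also have "card (range e1) \<le> card (UNIV :: (5 \<times> bool) set)" by (rule card_image_le) simp
  also have "card (UNIV :: (5 \<times> bool) set) = 10" by (simp add: card_cartesian_product flip: UNIV_Times_UNIV)
  finally have "card ?S \<le> 11" by simp
  then have fin: "finite \<Phi>" and c11: "card \<Phi> \<le> 11"
    using finite_subset[OF sub finS] card_mono[OF finS sub] by auto
  obtain h :: "5 \<Rightarrow> nat" where h: "inj h" using finite_imp_inj_to_nat_seg[of "UNIV :: 5 set"] by auto
  define P where "P = {(a, b). h a < h b}"
  define P' where "P' = {(a, b). h b < h a}"
  have "card P' = card (prod.swap ` P)" by (rule arg_cong[where f = card]) (auto simp: P_def P'_def image_iff)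
  then have PP: "card P' = card P" by (simp add: card_image)
  have "card P + card P' + card (range (\<lambda>a::5. (a, a))) = card (P \<union> P' \<union> range (\<lambda>a. (a, a)))"
    by (subst card_Un_disjoint, simp, simp, force simp: P_def P'_def, subst card_Un_disjoint) (auto simp: P_def P'_def)
  also have "\<dots> \<le> card (UNIV :: (5 \<times> 5) set)" by (rule card_mono) auto
  also have "\<dots> = 25" by (simp add: card_cartesian_product flip: UNIV_Times_UNIV)
  also have "card (range (\<lambda>a::5. (a, a))) = 5" by (simp add: card_image inj_on_def)
  finally have cP: "card P \<le> 10" using PP by simp
  have "\<exists>v. v \<in> W 1 \<mu> \<and> v \<noteq> 0" if "\<mu> \<in> \<Phi>" for \<mu> using that by (auto simp: \<Phi>_def)
  then obtain e where e: "\<And>\<mu>. \<mu> \<in> \<Phi> \<Longrightarrow> e \<mu> \<in> W 1 \<mu> \<and> e \<mu> \<noteq> 0" by metis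
  have "\<exists>v. v \<in> W (- 1) (\<lambda>a. - \<mu> a) \<and> v \<noteq> 0" if "\<mu> \<in> \<Phi>" for \<mu>
    using e[OF that] \<Phi>_neg'[of "e \<mu>" \<mu>] by blast
  then obtain f where f: "\<And>\<mu>. \<mu> \<in> \<Phi> \<Longrightarrow> f \<mu> \<in> W (- 1) (\<lambda>a. - \<mu> a) \<and> f \<mu> \<noteq> 0" by metis
  define A1 where "A1 = (\<lambda>(a, b). X (Inl a) (Inl b)) ` UNIV"
  define A2 where "A2 = (\<lambda>(a, b). X (Inl a) (Inr b)) ` P"
  define A3 where "A3 = (\<lambda>(a, b). X (Inr a) (Inl b)) ` P"
  define C where "C = {s} \<union> A1 \<union> A2 \<union> A3 \<union> e ` \<Phi> \<union> f ` \<Phi>"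
  have finC: "finite C" using fin by (simp add: C_def A1_def A2_def A3_def)
  have "card A1 \<le> 25" unfolding A1_def
    by (rule order_trans[OF card_image_le]) (simp_all add: card_cartesian_product flip: UNIV_Times_UNIV)
  moreover have "card A2 \<le> 10" "card A3 \<le> 10" unfolding A2_def A3_def
    by (rule order_trans[OF card_image_le cP], simp)+
  moreover have "card (e ` \<Phi>) \<le> 11" "card (f ` \<Phi>) \<le> 11" using card_image_le[OF fin] c11 order_trans by blast+
  moreover have "card C \<le> card {s} + card A1 + card A2 + card A3 + card (e ` \<Phi>) + card (f ` \<Phi>)"
    unfolding C_def by (meson card_Un_le add_mono order_trans order_refl)
  ultimately have cC: "card C < 72" by simp
  have sp: "x \<in> C \<Longrightarrow> x \<in> span C" for x by (rule span_base)
  have Xs: "X i j \<in> span C" for i j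
  proof -
    have ll: "X (Inl a) (Inl b) \<in> span C" for a b by (rule sp) (auto simp: C_def A1_def)
    have lr: "X (Inl a) (Inr b) \<in> span C" if "h a < h b" for a b by (rule sp) (use that in \<open>auto simp: C_def A2_def P_def\<close>)
    have rl: "X (Inr a) (Inl b) \<in> span C" if "h a < h b" for a b by (rule sp) (use that in \<open>auto simp: C_def A3_def P_def\<close>)
    have tri: "h a < h b \<or> h b < h a \<or> a = b" for a b using inj_eq[OF h, of a b] by arith
    show ?thesis
    proof (cases i; cases j)
      fix a b assume ij: "i = Inl a" "j = Inr b"
      have "X i j = - X (Inl b) (Inr a)" using X_bar[of "Inr a" "Inl b"] ij by simp
      then show ?thesis using tri[of a b] lr[of a b] span_neg[OF lr[of b a]] X_anti_zero[of "Inl a"] ij span_zero by auto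
    next
      fix a b assume ij: "i = Inr a" "j = Inl b"
      have "X i j = - X (Inr b) (Inl a)" using X_bar[of "Inl a" "Inr b"] ij by simp
      then show ?thesis using tri[of a b] rl[of a b] span_neg[OF rl[of b a]] X_anti_zero[of "Inr a"] ij span_zero by auto
    next
      fix a b assume ij: "i = Inr a" "j = Inr b"
      have "X i j = - X (Inl b) (Inl a)" using X_bar[of "Inl a" "Inl b"] ij by simp
      then show ?thesis using span_neg[OF ll[of b a]] by simp
    qed (use ll in simp)
  qed
  have evC: "span (insert s (range (\<lambda>(i, j). X i j))) \<subseteq> span C"
    by (rule span_minimal) (use Xs sp[of s] in \<open>auto simp: C_def\<close>)
  have "W 1 \<mu> \<subseteq> span C" if m: "\<mu> \<in> \<Phi>" for \<mu>
  proof
    fix x assume "x \<in> W 1 \<mu>"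
    then obtain r where "x = r \<odot> e \<mu>" using W_one_dim[of "e \<mu>" 1 \<mu> x] e[OF m] by blast
    moreover have "e \<mu> \<in> span C" by (rule sp) (use m in \<open>simp add: C_def\<close>)
    ultimately show "x \<in> span C" by (simp add: span_scale)
  qed
  then have VpC: "Vp \<subseteq> span C" by (intro order_trans[OF Vp_span span_minimal]) auto
  have "W (- 1) (\<lambda>a. - \<mu> a) \<subseteq> span C" if m: "\<mu> \<in> \<Phi>" for \<mu>
  proof
    fix x assume "x \<in> W (- 1) (\<lambda>a. - \<mu> a)"
    then obtain r where "x = r \<odot> f \<mu>" using W_one_dim[of "f \<mu>" "- 1" "\<lambda>a. - \<mu> a" x] f[OF m] by blast
    moreover have "f \<mu> \<in> span C" by (rule sp) (use m in \<open>simp add: C_def\<close>)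
    ultimately show "x \<in> span C" by (simp add: span_scale)
  qed
  then have VmC: "Vm \<subseteq> span C" by (intro order_trans[OF Vm_span span_minimal]) auto
  have "G \<subseteq> span C"
  proof
    fix x assume "x \<in> G"
    then obtain e p m where "e \<in> span (insert s (range (\<lambda>(i, j). X i j)))" "p \<in> Vp" "m \<in> Vm" "x = e + p + m"
      by (rule even_or_odd_span)
    then show "x \<in> span C" using evC VpC VmC by (auto intro!: span_add)
  qed
  from dim_bound[OF nd finC this] show False using cC by simp
qed

text \<open>Weights of one chirality are separated from the others by more than a root.\<close>

lemma chi_step:
  assumes m: "half \<mu>" and l: "\<gamma> \<in> \<Phi>" and d: "\<And>c. \<mu> c - \<gamma> c = rt i j c" and ij: "i \<noteq> j" "j \<noteq> bar i"
  shows "half \<gamma> \<and> chi \<gamma> = chi \<mu>"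
proof -
  obtain a b where ab: "a \<noteq> b" and sup: "\<And>c. (rt i j c :: 'k) \<noteq> 0 \<longleftrightarrow> c = a \<or> c = b" and vals: "\<And>c. rt i j c \<in> {0, 1, - 1 :: 'k}"
    by (rule rt_support[OF ij]) (rule that, assumption+)
  obtain k where k: "k \<notin> {a, b, b}" using ex_other_index by blast
  obtain k' where k': "k' \<notin> {a, b, k}" using ex_other_index by blast
  have eq: "\<gamma> c = \<mu> c" if "c \<notin> {a, b}" for c using d[of c] sup[of c] that by simp
  have "\<gamma> k \<noteq> 0" "\<gamma> k' \<noteq> 0" using eq[of k] eq[of k'] k k' half_nz(1)[OF m] by auto
  then have h: "half \<gamma>" using \<Phi>_shape[OF l] k k' unfolding half_def by (metis insertCI)
  have "\<gamma> = flip2 \<mu> a b"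
  proof
    fix c
    show "\<gamma> c = flip2 \<mu> a b c"
    proof (cases "c = a \<or> c = b")
      case True
      then have "\<gamma> c \<noteq> \<mu> c" using sup[of c] d[of c] by auto
      then show ?thesis using half_eq_or_neg[OF m h, of c] True by (simp add: flip2_def)
    qed (use eq[of c] in \<open>simp add: flip2_def\<close>)
  qed
  then show ?thesis using h chi_flip2[OF ab] by simp
qed

lemma \<Phi>_neg_iff: assumes "v \<in> W (- 1) \<gamma>" "v \<noteq> 0" "\<And>a. \<gamma> a = - \<mu> a" shows "\<mu> \<in> \<Phi>"
  using \<Phi>_neg[OF assms(1,2)] assms(3) by simp

text \<open>The weight vectors of the chirality of \<open>\<mu>0\<close> and the remaining ones split the odd part into two commuting
  pieces stable under the even part.\<close>

lemma \<Phi>_uniform: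
  assumes m0: "\<mu>0 \<in> \<Phi>" "half \<mu>0" and g0: "\<gamma>0 \<in> \<Phi>"
  shows "half \<gamma>0 \<and> chi \<gamma>0 = chi \<mu>0"
proof (rule ccontr)
  define cl where "cl \<mu> \<longleftrightarrow> half \<mu> \<and> chi \<mu> = chi \<mu>0" for \<mu>
  assume "\<not> ?thesis"
  then have ncl: "\<not> cl \<gamma>0" by (simp add: cl_def)
  have cl0: "cl \<mu>0" using m0 by (simp add: cl_def)
  have step: "cl \<gamma>" if "cl \<mu>" "\<gamma> \<in> \<Phi>" "\<And>c. \<mu> c - \<gamma> c = rt i j c" "i \<noteq> j" "j \<noteq> bar i" for \<mu> \<gamma> i j
    using chi_step[of \<mu> \<gamma> i j] that by (simp add: cl_def)
  define WW where "WW \<mu> = W 1 \<mu> \<union> W (- 1) (\<lambda>a. - \<mu> a)" for \<mu>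
  let ?A = "\<Union>\<mu>\<in>{\<mu>\<in>\<Phi>. cl \<mu>}. WW \<mu>" and ?B = "\<Union>\<mu>\<in>{\<mu>\<in>\<Phi>. \<not> cl \<mu>}. WW \<mu>"
  have odd_sub: "subspace {x \<in> G. \<theta> x = - x}"
    by (rule subspaceI) (auto simp: G_closed lin_0[OF l\<theta>] lin_add[OF l\<theta>] lin_scale[OF l\<theta>])
  have WW_odd: "WW \<mu> \<subseteq> {x \<in> G. \<theta> x = - x}" for \<mu>
    unfolding WW_def using W_Vp W_Vm Vp_odd Vm_odd WD(1) by blast
  have oddA: "span ?A \<subseteq> {x \<in> G. \<theta> x = - x}" by (rule span_minimal[OF _ odd_sub]) (use WW_odd in blast)
  have oddB: "span ?B \<subseteq> {x \<in> G. \<theta> x = - x}" by (rule span_minimal[OF _ odd_sub]) (use WW_odd in blast)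
  have split: "\<exists>u\<in>span ?A. \<exists>w\<in>span ?B. x = u + w" if x: "x \<in> G" "\<theta> x = - x" for x
  proof -
    have "x \<in> odd_part" using x unfolding odd_part_eq by blast
    then have xe: "x = comp_p x + comp_m x" by (rule odd_part_decomp)
    have "(\<Union>\<mu>\<in>\<Phi>. W 1 \<mu>) \<subseteq> ?A \<union> ?B" "(\<Union>\<mu>\<in>\<Phi>. W (- 1) (\<lambda>a. - \<mu> a)) \<subseteq> ?A \<union> ?B" by (auto simp: WW_def)
    then have "Vp \<subseteq> span (?A \<union> ?B)" "Vm \<subseteq> span (?A \<union> ?B)"
      using Vp_span Vm_span span_mono by (meson order_trans)+
    then have "x \<in> span (?A \<union> ?B)" using comp_in[of x] by (subst xe) (auto intro: span_add)
    then show ?thesis unfolding span_Un by blast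
  qed
  have commWW: "br x y = 0" if x: "x \<in> WW \<mu>" "cl \<mu>" and y: "y \<in> WW \<gamma>" "\<not> cl \<gamma>" "\<mu> \<in> \<Phi>" "\<gamma> \<in> \<Phi>" for x y \<mu> \<gamma>
  proof (rule ccontr)
    assume nz: "br x y \<noteq> 0"
    have opp: False if "u \<in> W 1 \<mu>" "v \<in> W (- 1) (\<lambda>a. - \<gamma> a)" "br u v \<noteq> 0" "cl \<mu> \<noteq> cl \<gamma>" "\<mu> \<in> \<Phi>" "\<gamma> \<in> \<Phi>" for u v \<mu> \<gamma>
    proof -
      have w: "br u v \<in> W 0 (\<lambda>a. \<mu> a - \<gamma> a)" using W_br[OF that(1,2)] by simp
      have "\<mu> \<noteq> \<gamma>" using that(4) by blast
      then obtain a where "\<mu> a - \<gamma> a \<noteq> 0" by (auto simp: fun_eq_iff)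
      with even_weight[OF w that(3)] obtain i j where ij: "i \<noteq> j" "j \<noteq> bar i" "(\<lambda>a. \<mu> a - \<gamma> a) = rt i j" by blast
      have d: "\<mu> c - \<gamma> c = rt i j c" "\<gamma> c - \<mu> c = rt j i c" for c using fun_cong[OF ij(3), of c] by (auto simp: rt_def algebra_simps)
      have "j \<noteq> i" "i \<noteq> bar j" using ij by auto
      then show False using step[of \<mu> \<gamma> i j] step[of \<gamma> \<mu> j i] d ij that(4-6) by metis
    qed
    consider "x \<in> W 1 \<mu>" "y \<in> W 1 \<gamma>" | "x \<in> W (- 1) (\<lambda>a. - \<mu> a)" "y \<in> W (- 1) (\<lambda>a. - \<gamma> a)"
      | "x \<in> W 1 \<mu>" "y \<in> W (- 1) (\<lambda>a. - \<gamma> a)" | "x \<in> W (- 1) (\<lambda>a. - \<mu> a)" "y \<in> W 1 \<gamma>"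
      using x y by (auto simp: WW_def)
    then show False
    proof cases
      case 1 then show False using Vp_Vp W_Vp nz by blast
    next
      case 2 then show False using Vm_Vm W_Vm nz by blast
    next
      case 3 then show False using opp[OF 3 nz] x y by blast
    next
      case 4
      have "br y x \<noteq> 0" using nz br_anti[where x = x and y = y] by simp
      then show False using opp[OF 4(2,1)] x y by blast
    qed
  qed
  have comm: "br u w = 0" if u: "u \<in> span ?A" and w: "w \<in> span ?B" for u w
  proof (rule lin_zero_on_span[OF lin_br_l u])
    fix x assume "x \<in> ?A"
    then obtain \<mu> where \<mu>: "\<mu> \<in> \<Phi>" "cl \<mu>" "x \<in> WW \<mu>" by blast
    show "br x w = 0"
    proof (rule lin_zero_on_span[OF lin_br w])
      fix y assume "y \<in> ?B"
      then obtain \<gamma> where \<gamma>: "\<gamma> \<in> \<Phi>" "\<not> cl \<gamma>" "y \<in> WW \<gamma>" by blast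
      show "br x y = 0" by (rule commWW[OF \<mu>(3,2) \<gamma>(3,2) \<mu>(1) \<gamma>(1)])
    qed
  qed
  have stX: "br (X i j) x \<in> span ?A" if x: "x \<in> WW \<mu>" "\<mu> \<in> \<Phi>" "cl \<mu>" for i j x \<mu>
  proof (cases "br (X i j) x = 0 \<or> i = j")
    case True
    have xA: "x \<in> span ?A" by (rule span_base) (use x in blast)
    have "br (X i i) x = ev \<mu> i \<odot> x \<or> br (X i i) x = ev (\<lambda>a. - \<mu> a) i \<odot> x" using x(1) W_X unfolding WW_def by blast
    then have "br (X i i) x \<in> span ?A" using span_scale[OF xA] by metis
    then show ?thesis using True span_zero by auto
  next
    case False
    then have ij: "i \<noteq> j" "j \<noteq> bar i" using X_anti_zero by auto
    have ji: "j \<noteq> i" "i \<noteq> bar j" using ij by auto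
    let ?y = "br (X i j) x"
    have y0: "?y \<noteq> 0" using False by simp
    from x(1) have "\<exists>\<gamma>\<in>\<Phi>. cl \<gamma> \<and> ?y \<in> W 1 \<gamma> \<union> W (- 1) (\<lambda>a. - \<gamma> a)" unfolding WW_def
    proof
      assume x: "x \<in> W 1 \<mu>"
      let ?\<gamma> = "\<lambda>a. rt i j a + \<mu> a"
      have y: "?y \<in> W 1 ?\<gamma>" using W_br[OF X_W x] by simp
      then have g: "?\<gamma> \<in> \<Phi>" using y0 by (auto simp: \<Phi>_def)
      have c: "cl ?\<gamma>" by (rule step[OF \<open>cl \<mu>\<close> g _ ji]) (simp add: rt_def)
      show ?thesis by (intro bexI[OF _ g] conjI c UnI1 y)
    next
      assume x: "x \<in> W (- 1) (\<lambda>a. - \<mu> a)"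
      let ?\<gamma> = "\<lambda>a. \<mu> a - rt i j a"
      have y: "?y \<in> W (- 1) (\<lambda>a. - ?\<gamma> a)" using W_br[OF X_W x] by simp
      then have g: "?\<gamma> \<in> \<Phi>" using \<Phi>_neg_iff[OF _ y0] by simp
      have c: "cl ?\<gamma>" by (rule step[OF \<open>cl \<mu>\<close> g _ ij]) simp
      show ?thesis by (intro bexI[OF _ g] conjI c UnI2 y)
    qed
    then show ?thesis by (intro span_base) (auto simp: WW_def)
  qed
  have st: "br e u \<in> span ?A" if e: "e \<in> G" "\<theta> e = e" and u: "u \<in> span ?A" for e u
  proof (rule lin_span_image_subset[OF lin_br _ subspace_span u])
    fix x assume "x \<in> ?A"
    then obtain \<mu> where \<mu>: "\<mu> \<in> \<Phi>" "cl \<mu>" "x \<in> WW \<mu>" by blast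
    have xA: "x \<in> span ?A" by (rule span_base) (use \<mu> in blast)
    have "br s x = 1 \<odot> x \<or> br s x = (- 1) \<odot> x" using \<mu>(3) WD(2) unfolding WW_def by blast
    then have sx: "br s x \<in> span ?A" using span_scale[OF xA] by metis
    show "br e x \<in> span ?A"
      by (rule lin_span_image_subset[OF lin_br_l _ subspace_span even_span[OF e]]) (use sx stX[OF \<mu>(3,1,2)] in auto)
  qed
  obtain u0 where u0: "u0 \<in> W 1 \<mu>0" "u0 \<noteq> 0" using m0 by (auto simp: \<Phi>_def)
  obtain w0 where w0: "w0 \<in> W 1 \<gamma>0" "w0 \<noteq> 0" using g0 by (auto simp: \<Phi>_def)
  have u0A: "u0 \<in> span ?A" by (rule span_base) (use u0 m0 cl0 in \<open>auto simp: WW_def\<close>)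
  have w0B: "w0 \<in> span ?B" by (rule span_base) (use w0 g0 ncl in \<open>auto simp: WW_def\<close>)
  have "w0 = 0"
    by (rule odd_part_indecomposable[OF subspace_span _ _ split st comm u0A u0(2) w0B]) (use oddA oddB in blast)+
  then show False using w0 by simp
qed

lemma \<Phi>_half: "\<mu> \<in> \<Phi> \<Longrightarrow> half \<mu>" and \<Phi>_chi: "\<mu> \<in> \<Phi> \<Longrightarrow> \<gamma> \<in> \<Phi> \<Longrightarrow> chi \<gamma> = chi \<mu>"
  and cc_val: "cc = 3 / 4" and \<Phi>_nonempty: "\<exists>\<mu>. \<mu> \<in> \<Phi>"
proof -
  obtain \<mu>0 where m0: "\<mu>0 \<in> \<Phi>" "half \<mu>0" "cc = 3 / 4" using half_weight_exists by blast
  show "cc = 3 / 4" "\<exists>\<mu>. \<mu> \<in> \<Phi>" using m0 by auto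
  show "\<mu> \<in> \<Phi> \<Longrightarrow> half \<mu>" "\<mu> \<in> \<Phi> \<Longrightarrow> \<gamma> \<in> \<Phi> \<Longrightarrow> chi \<gamma> = chi \<mu>"
    using \<Phi>_uniform[OF m0(1,2)] by auto
qed

end

section \<open>The criterion holds for the pair of half-spin modules\<close>

lemma five_elements: "\<exists>a b c d. (UNIV :: 5 set) = {p, a, b, c, d} \<and> distinct [p, a, b, c, d]"
proof -
  obtain xs where xs: "set xs = UNIV - {p}" "distinct xs" using finite_distinct_list[of "UNIV - {p}"] by auto
  have "length xs = card (UNIV - {p})" using distinct_card[OF xs(2)] xs(1) by simp
  then have "length xs = 4" by simp
  then obtain a b c d where "xs = [a, b, c, d]" by (auto simp: eval_nat_numeral length_Suc_conv)
  then have u: "UNIV - {p} = {a, b, c, d}" and d: "distinct [a, b, c, d]" using xs by simp_all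
  have "UNIV = insert p (UNIV - {p})" by blast
  then have "UNIV = {p, a, b, c, d}" unfolding u .
  moreover have "p \<notin> {a, b, c, d}" unfolding u[symmetric] by blast
  then have "distinct [p, a, b, c, d]" using d by simp
  ultimately show ?thesis by blast
qed

lemma (in vector_space) subspace_lmap_image:
  assumes f: "lmap f" and S: "subspace S" shows "subspace (f ` S)"
proof (rule subspaceI)
  show "0 \<in> f ` S" using subspace_0[OF S] lin_0[OF f] by (metis image_eqI)
next
  fix x y assume "x \<in> f ` S" "y \<in> f ` S"
  then show "x + y \<in> f ` S" using subspace_add[OF S] lin_add[OF f] by (auto simp: image_iff) metis
next
  fix c x assume "x \<in> f ` S"
  then show "scale c x \<in> f ` S" using subspace_scale[OF S] lin_scale[OF f] by (auto simp: image_iff) metis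
qed

context so10_graded begin

lemma Vp_G: "Vp \<subseteq> G" and Vm_G: "Vm \<subseteq> G"
  by (auto simp: eig_def)

abbreviation "N \<equiv> span (range (\<lambda>(i, j). X i j))"

lemma N_commutes_s: "\<xi> \<in> N \<Longrightarrow> br s \<xi> = 0"
  by (rule lin_zero_on_span[OF lin_br]) (use z_X in auto)

lemma N_G: "N \<subseteq> G"
  by (rule span_minimal[OF _ subspace_G]) (use X_G in auto)

lemma X_N: "X i j \<in> N" by (rule span_base) auto

lemma W_zero: "\<not> half \<mu> \<Longrightarrow> x \<in> W 1 \<mu> \<Longrightarrow> x = 0"
  using \<Phi>_half[of \<mu>] unfolding \<Phi>_def by blast

text \<open>\<open>\<mu>\<close> and \<open>\<nu>\<close> are strongly orthogonal: the sum of their sl2-triples acts on \<open>Vp\<close> with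
  eigenvalues 1 and 2.\<close>

definition "far p \<mu> c = (if c = p then \<mu> c else - \<mu> c)"

lemma far_\<Phi>: assumes "\<mu> \<in> \<Phi>" shows "far p \<mu> \<in> \<Phi>"
proof -
  obtain a b c d where u: "(UNIV :: 5 set) = {p, a, b, c, d}" and ds: "distinct [p, a, b, c, d]" using five_elements by blast
  have "a \<noteq> b" "c \<noteq> d" using ds by auto
  then have "(\<mu>(a := - \<mu> a, b := - \<mu> b))(c := - (\<mu>(a := - \<mu> a, b := - \<mu> b)) c, d := - (\<mu>(a := - \<mu> a, b := - \<mu> b)) d) \<in> \<Phi>"
    using \<Phi>_flip assms by blast
  moreover have "far p \<mu> = (\<mu>(a := - \<mu> a, b := - \<mu> b))(c := - (\<mu>(a := - \<mu> a, b := - \<mu> b)) c, d := - (\<mu>(a := - \<mu> a, b := - \<mu> b)) d)"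
  proof
    fix x :: 5
    have "x \<in> {p, a, b, c, d}" using u by auto
    then show "far p \<mu> x = ((\<mu>(a := - \<mu> a, b := - \<mu> b))(c := - (\<mu>(a := - \<mu> a, b := - \<mu> b)) c, d := - (\<mu>(a := - \<mu> a, b := - \<mu> b)) d)) x"
      using ds by (auto simp: far_def)
  qed
  ultimately show ?thesis by simp
qed

lemma far_difference:
  assumes h: "half \<mu>" and d: "\<And>c. rt i j c = \<mu> c - far p \<mu> c \<or> rt i j c = far p \<mu> c - \<mu> c"
    and ij: "i \<noteq> j" "j \<noteq> bar i"
  shows False
proof -
  obtain a b where sup: "\<And>c. (rt i j c :: 'k) \<noteq> 0 \<longleftrightarrow> c = a \<or> c = b" by (rule rt_support[OF ij]) (rule that, assumption)
  obtain k where k: "k \<notin> {a, b, p}" using ex_other_index by blast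
  have "\<mu> k - far p \<mu> k \<noteq> 0" "far p \<mu> k - \<mu> k \<noteq> 0" using k half_nz[OF h, of k] by (auto simp: far_def)
  then have "rt i j k \<noteq> (0::'k)" using d[of k] by auto
  then show False using sup[of k] k by simp
qed

lemma ip_self: assumes "half \<mu>" shows "ip \<mu> \<mu> = 5 / 4"
proof -
  have "\<mu> e * \<mu> e = 1 / 4" for e by (rule disjE[OF halfD[OF assms, of e]]) (erule ssubst, simp)+
  then have "ip \<mu> \<mu> = (\<Sum>e\<in>(UNIV :: 5 set). 1 / 4)" unfolding ip_def by (intro sum.cong refl)
  then show ?thesis by simp
qed

lemma unit_triple:
  assumes v: "v \<in> W 1 \<mu>" "v \<noteq> 0"
  obtains f where "f \<in> W (- 1) (\<lambda>a. - \<mu> a)"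
    "\<And>\<gamma> u. u \<in> W 1 \<gamma> \<Longrightarrow> br (br v f) u = (ip \<mu> \<gamma> + 3 / 4) \<odot> u"
proof -
  obtain f h q where f: "f \<in> W (- 1) (\<lambda>a. - \<mu> a)" "br v f = h" and q: "q * (ip \<mu> \<mu> + cc) = 2"
    and act: "\<And>\<delta> \<gamma> u. u \<in> W \<delta> \<gamma> \<Longrightarrow> br h u = (q * (ip \<mu> \<gamma> + 1 * \<delta> * cc)) \<odot> u"
    using odd_triple[OF v] by blast
  have "half \<mu>" using v \<Phi>_half by (auto simp: \<Phi>_def)
  then have "ip \<mu> \<mu> + cc = 2" by (simp add: ip_self cc_val)
  then have "q = 1" using q by simp
  then have "br (br v f) u = (ip \<mu> \<gamma> + 3 / 4) \<odot> u" if "u \<in> W 1 \<gamma>" for u \<gamma>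
    using act[OF \<open>u \<in> W 1 \<gamma>\<close>] f(2) by (simp add: cc_val)
  then show ?thesis by (rule that[OF f(1)])
qed

lemma injective_pair:
  obtains u u' where "u \<in> Vp" "u' \<in> Vm" "\<And>x. x \<in> Vp \<Longrightarrow> br (br u u') x = 0 \<Longrightarrow> x = 0"
proof -
  obtain \<mu> where m: "\<mu> \<in> \<Phi>" using \<Phi>_nonempty by blast
  let ?\<nu> = "far 0 \<mu>"
  have n: "?\<nu> \<in> \<Phi>" by (rule far_\<Phi>[OF m])
  have hm: "half \<mu>" by (rule \<Phi>_half[OF m])
  obtain e1 where e1: "e1 \<in> W 1 \<mu>" "e1 \<noteq> 0" using m by (auto simp: \<Phi>_def)
  obtain e2 where e2: "e2 \<in> W 1 ?\<nu>" "e2 \<noteq> 0" using n by (auto simp: \<Phi>_def)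
  obtain f1 where f1: "f1 \<in> W (- 1) (\<lambda>a. - \<mu> a)" "\<And>\<gamma> u. u \<in> W 1 \<gamma> \<Longrightarrow> br (br e1 f1) u = (ip \<mu> \<gamma> + 3 / 4) \<odot> u"
    using unit_triple[OF e1] by blast
  obtain f2 where f2: "f2 \<in> W (- 1) (\<lambda>a. - ?\<nu> a)" "\<And>\<gamma> u. u \<in> W 1 \<gamma> \<Longrightarrow> br (br e2 f2) u = (ip ?\<nu> \<gamma> + 3 / 4) \<odot> u"
    using unit_triple[OF e2] by blast
  have cross: "br e f = 0" if e: "e \<in> W 1 \<alpha>" and f: "f \<in> W (- 1) (\<lambda>a. - \<beta> a)"
    and ab: "\<alpha> = \<mu> \<and> \<beta> = ?\<nu> \<or> \<alpha> = ?\<nu> \<and> \<beta> = \<mu>" for e f \<alpha> \<beta>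
  proof (rule ccontr)
    assume nz: "br e f \<noteq> 0"
    have w: "br e f \<in> W 0 (\<lambda>a. \<alpha> a - \<beta> a)" using W_br[OF e f] by simp
    have "\<mu> 1 - ?\<nu> 1 \<noteq> 0" "?\<nu> 1 - \<mu> 1 \<noteq> 0" using half_nz(2,3)[OF hm, of 1] by (simp_all add: far_def)
    then have "\<alpha> 1 - \<beta> 1 \<noteq> 0" using ab by (elim disjE conjE) (simp_all only: not_False_eq_True)
    from even_weight[OF w nz this] obtain i j where ij: "i \<noteq> j" "j \<noteq> bar i" "(\<lambda>a. \<alpha> a - \<beta> a) = rt i j" by blast
    have "rt i j c = \<mu> c - ?\<nu> c \<or> rt i j c = ?\<nu> c - \<mu> c" for c
      unfolding ij(3)[symmetric] using ab by (elim disjE conjE) (simp_all only: simp_thms)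
    then show False by (rule far_difference[OF hm _ ij(1,2)])
  qed
  have c12: "br e1 f2 = 0" "br e2 f1 = 0" by (rule cross[OF e1(1) f2(1)], simp, rule cross[OF e2(1) f1(1)], simp)
  let ?h = "br (e1 + e2) (f1 + f2)"
  have h: "?h = br e1 f1 + br e2 f2" by (simp add: br_add_l br_add_r c12)
  have eigenvalue: "br ?h v = v \<or> br ?h v = 2 \<odot> v" if g: "\<gamma> \<in> \<Phi>" and v: "v \<in> W 1 \<gamma>" for \<gamma> v
  proof -
    have "ip \<mu> \<gamma> + ip ?\<nu> \<gamma> = (\<Sum>c\<in>UNIV. if c = 0 then 2 * (\<mu> c * \<gamma> c) else 0)"
      unfolding ip_def sum.distrib[symmetric] by (rule sum.cong) (auto simp: far_def)
    then have i: "ip \<mu> \<gamma> + ip ?\<nu> \<gamma> = 2 * (\<mu> 0 * \<gamma> 0)" by simp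
    have "br ?h v = ((ip \<mu> \<gamma> + ip ?\<nu> \<gamma>) + (3 / 4 + 3 / 4)) \<odot> v"
      unfolding h unfolding br_add_l f1(2)[OF v] f2(2)[OF v] by (simp add: add_ac flip: scale_left_distrib)
    then have hv: "br ?h v = (2 * (\<mu> 0 * \<gamma> 0) + 3 / 2) \<odot> v" unfolding i by simp
    have "2 * (\<mu> 0 * \<gamma> 0) + 3 / 2 = 1 \<or> 2 * (\<mu> 0 * \<gamma> 0) + 3 / 2 = 2"
      by (rule disjE[OF halfD[OF hm, of 0]]; rule disjE[OF halfD[OF \<Phi>_half[OF g], of 0]]; simp only:) simp_all
    then show ?thesis using hv by auto
  qed
  show ?thesis
  proof (rule that)
    show "e1 + e2 \<in> Vp" by (intro subspace_add[OF subspace_eig] subsetD[OF W_Vp e1(1)] subsetD[OF W_Vp e2(1)])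
    show "f1 + f2 \<in> Vm" by (intro subspace_add[OF subspace_eig] subsetD[OF W_Vm f1(1)] subsetD[OF W_Vm f2(1)])
    fix x assume x: "x \<in> Vp" and hx: "br ?h x = 0"
    define k where "k x = br ?h x - x" for x
    define g where "g x = br ?h (k x) - 2 \<odot> k x" for x
    have lk: "lmap k" unfolding k_def by (rule lin_minus[OF lin_br lin_id])
    have lg: "lmap g" unfolding g_def by (rule lin_minus[OF lin_comp[OF lin_br lk] lin_smult[OF lk]])
    have "g x = 0"
    proof (rule lin_zero_on_span[OF lg subsetD[OF Vp_span x]])
      fix v assume "v \<in> (\<Union>\<mu>\<in>\<Phi>. W 1 \<mu>)"
      then obtain \<gamma> where "\<gamma> \<in> \<Phi>" "v \<in> W 1 \<gamma>" by blast
      from eigenvalue[OF this] show "g v = 0"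
      proof
        assume "br ?h v = v" then show ?thesis by (simp add: g_def k_def)
      next
        assume e: "br ?h v = 2 \<odot> v"
        have "k v = v" unfolding k_def e using scale_left_distrib[of 1 1 v] by simp
        then show ?thesis by (simp add: g_def e)
      qed
    qed
    then have "2 \<odot> x = 0" by (simp add: g_def k_def hx br_neg_r)
    then show "x = 0" by simp
  qed
qed

text \<open>The root vector that changes the signs \<open>x\<close> and \<open>y\<close> in \<open>\<mu>\<close> moves \<open>\<nu>\<close> out of the cube of half-spin weights, as
  \<open>\<nu>\<close> has the opposite sign at \<open>x\<close>.\<close>

lemma raise:
  assumes u: "u \<in> W 1 \<mu>" "u \<noteq> 0" and v: "v \<in> W 1 \<nu>" and m: "half \<mu>"
    and xy: "x \<noteq> y" and opp: "\<nu> x = - \<mu> x"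
  shows "\<exists>i j. br (X i j) (u + v) \<in> W 1 (flip2 \<mu> x y) \<and> br (X i j) (u + v) \<noteq> 0"
proof -
  define i where "i = (if \<mu> x = 1 / 2 then Inr x else Inl x)"
  define j where "j = (if \<mu> y = 1 / 2 then Inl y else Inr y)"
  have mx: "\<mu> x = 1 / 2 \<and> i = Inr x \<or> \<mu> x = - (1 / 2) \<and> i = Inl x"
  proof (cases "\<mu> x = 1 / 2")
    case True
    have "i = Inr x" unfolding i_def by (rule if_P[OF True])
    with True show ?thesis by blast
  next
    case False
    have "i = Inl x" unfolding i_def by (rule if_not_P[OF False])
    with False halfD[OF m, of x] show ?thesis by blast
  qed
  have my: "\<mu> y = 1 / 2 \<and> j = Inl y \<or> \<mu> y = - (1 / 2) \<and> j = Inr y"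
  proof (cases "\<mu> y = 1 / 2")
    case True
    have "j = Inl y" unfolding j_def by (rule if_P[OF True])
    with True show ?thesis by blast
  next
    case False
    have "j = Inr y" unfolding j_def by (rule if_not_P[OF False])
    with False halfD[OF m, of y] show ?thesis by blast
  qed
  have ix: "i = Inl x \<or> i = Inr x" and jy: "j = Inl y \<or> j = Inr y" using mx my by blast+
  have ij: "i \<noteq> j" "j \<noteq> bar i" using xy ix jy by auto
  have "vpair (Inl x) j = (0 :: 'k)" "vpair (Inl y) i = (0 :: 'k)" using xy ix jy by (auto simp: vpair_def)
  moreover have "vpair (Inl x) i = - 2 * \<mu> x"
    by (rule disjE[OF mx]; elim conjE, erule ssubst, erule ssubst, simp add: vpair_def)
  moreover have "vpair (Inl y) j = 2 * \<mu> y"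
    by (rule disjE[OF my]; elim conjE, erule ssubst, erule ssubst, simp add: vpair_def)
  ultimately have rtx: "rt i j x = - 2 * \<mu> x" and rty: "rt i j y = - 2 * \<mu> y" by (simp_all add: rt_def)
  have rt0: "rt i j c = 0" if "c \<noteq> x" "c \<noteq> y" for c using ix jy that by (auto simp: rt_def vpair_def)
  have evi: "ev \<mu> i = - (1 / 2)" using mx by (elim disjE conjE) (simp_all only: ev_def sum.case minus_minus)
  have evj: "ev \<mu> j = 1 / 2" using my by (elim disjE conjE) (simp_all only: ev_def sum.case minus_minus)
  have fl: "(\<lambda>c. rt i j c + \<mu> c) = flip2 \<mu> x y"
  proof
    fix c show "rt i j c + \<mu> c = flip2 \<mu> x y c"
      using rtx rty rt0[of c] by (cases "c = x"; cases "c = y") (simp_all add: flip2_def)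
  qed
  have triple: "\<not> half \<gamma>" if "\<gamma> c = 3 * \<mu> x \<or> \<gamma> c = - 3 * \<mu> x" for \<gamma> c
  proof
    assume h: "half \<gamma>"
    have ne: "(3 / 2 :: 'k) \<noteq> 1 / 2" "(3 / 2 :: 'k) \<noteq> - (1 / 2)" "- (3 / 2 :: 'k) \<noteq> 1 / 2" "- (3 / 2 :: 'k) \<noteq> - (1 / 2)"
      by simp_all
    have v: "3 * (1 / 2) = (3 / 2 :: 'k)" "- 3 * (1 / 2) = - (3 / 2 :: 'k)" "3 * - (1 / 2) = - (3 / 2 :: 'k)" "- 3 * - (1 / 2) = (3 / 2 :: 'k)"
      by simp_all
    have "\<gamma> c = 3 / 2 \<or> \<gamma> c = - (3 / 2)" using that halfD[OF m, of x] v by metis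
    then show False using halfD[OF h, of c] ne by metis
  qed
  have yv: "br (X i j) v = 0"
  proof (rule W_zero)
    show "br (X i j) v \<in> W 1 (\<lambda>c. rt i j c + \<nu> c)" using W_br[OF X_W v] by simp
    show "\<not> half (\<lambda>c. rt i j c + \<nu> c)" by (rule triple[of _ x]) (simp add: rtx opp)
  qed
  have lower: "br (X j i) u = 0"
  proof (rule W_zero)
    show "br (X j i) u \<in> W 1 (\<lambda>c. rt j i c + \<mu> c)" using W_br[OF X_W u(1)] by simp
    have "rt j i x = - rt i j x" by (simp add: rt_def)
    then show "\<not> half (\<lambda>c. rt j i c + \<mu> c)" by (intro triple[of _ x]) (simp add: rtx)
  qed
  have "br (X i j) u \<noteq> 0"
  proof
    assume 0: "br (X i j) u = 0"
    have "br (X i i - X j j) u = 0" using jacobi[of "X i j" "X j i" u] 0 lower X_opp[OF ij] by simp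
    moreover have "br (X i i - X j j) u = (ev \<mu> i - ev \<mu> j) \<odot> u" by (simp add: br_diff_l W_X[OF u(1)] scale_left_diff_distrib)
    ultimately show False using u(2) unfolding evi evj by simp
  qed
  moreover have "br (X i j) u \<in> W 1 (flip2 \<mu> x y)" using W_br[OF X_W u(1), of i j] fl by simp
  ultimately have "br (X i j) (u + v) \<in> W 1 (flip2 \<mu> x y) \<and> br (X i j) (u + v) \<noteq> 0" by (simp add: br_add_r yv)
  then show ?thesis by blast
qed

text \<open>The orbit of \<open>e\<^sub>\<mu> + e\<^sub>\<nu>\<close> under so10 is open in \<open>Vp\<close>.\<close>

lemma open_orbit:
  obtains x0 where "x0 \<in> Vp" "\<And>y. y \<in> Vp \<Longrightarrow> \<exists>\<xi>\<in>N. y = br \<xi> x0"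
proof -
  obtain \<mu> where m: "\<mu> \<in> \<Phi>" using \<Phi>_nonempty by blast
  let ?\<nu> = "far 0 \<mu>"
  have n: "?\<nu> \<in> \<Phi>" by (rule far_\<Phi>[OF m])
  have hm: "half \<mu>" and hn: "half ?\<nu>" using \<Phi>_half m n by auto
  obtain e1 where e1: "e1 \<in> W 1 \<mu>" "e1 \<noteq> 0" using m by (auto simp: \<Phi>_def)
  obtain e2 where e2: "e2 \<in> W 1 ?\<nu>" "e2 \<noteq> 0" using n by (auto simp: \<Phi>_def)
  let ?x = "e1 + e2"
  define M where "M = (\<lambda>\<xi>. br \<xi> ?x) ` N"
  have subM: "subspace M" unfolding M_def by (rule subspace_lmap_image[OF lin_br_l subspace_span])
  have XM: "br (X i j) ?x \<in> M" for i j unfolding M_def using X_N by blast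
  have "br (H 0) ?x = \<mu> 0 \<odot> (e1 + e2)" using WD(3)[OF e1(1)] WD(3)[OF e2(1)] by (simp add: br_add_r far_def scale_right_distrib)
  then have "(1 / \<mu> 0) \<odot> \<mu> 0 \<odot> (e1 + e2) \<in> M" using subspace_scale[OF subM XM[of "Inl 0" "Inl 0"]] by metis
  then have p: "e1 + e2 \<in> M" using half_nz(1)[OF hm, of 0] by simp
  have "br (H 1) ?x = \<mu> 1 \<odot> (e1 - e2)" using WD(3)[OF e1(1)] WD(3)[OF e2(1)] by (simp add: br_add_r far_def scale_right_diff_distrib)
  then have "(1 / \<mu> 1) \<odot> \<mu> 1 \<odot> (e1 - e2) \<in> M" using subspace_scale[OF subM XM[of "Inl 1" "Inl 1"]] by metis
  then have q: "e1 - e2 \<in> M" using half_nz(1)[OF hm, of 1] by simp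
  have "(1/2) \<odot> ((e1 + e2) + (e1 - e2)) \<in> M" "(1/2) \<odot> ((e1 + e2) - (e1 - e2)) \<in> M"
    by (intro subspace_scale[OF subM] subspace_add[OF subM p q] subspace_diff[OF subM p q])+
  moreover have "(e1 + e2) + (e1 - e2) = e1 + e1" "(e1 + e2) - (e1 - e2) = e2 + e2" by simp_all
  ultimately have e12: "e1 \<in> M" "e2 \<in> M" by (simp_all only: half_double)
  have "\<exists>w\<in>M. w \<in> W 1 \<gamma> \<and> w \<noteq> 0" if g: "\<gamma> \<in> \<Phi>" for \<gamma>
  proof (cases "\<gamma> = \<mu> \<or> \<gamma> = ?\<nu>")
    case True then show ?thesis using e1 e2 e12 by blast
  next
    case False
    then obtain x y where xy: "x \<noteq> y" "x \<noteq> 0" "\<gamma> = flip2 \<mu> x y \<or> \<gamma> = flip2 ?\<nu> x y"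
      using two_flips[OF hm \<Phi>_half[OF g] \<Phi>_chi[OF m g], of ?\<nu> 0] by (auto simp: far_def)
    from xy(3) show ?thesis
    proof
      assume g: "\<gamma> = flip2 \<mu> x y"
      show ?thesis using raise[OF e1 e2(1) hm xy(1)] xy(2) XM unfolding g by (auto simp: far_def)
    next
      assume g: "\<gamma> = flip2 ?\<nu> x y"
      have "e2 + e1 = ?x" by (rule add.commute)
      moreover have "\<mu> x = - ?\<nu> x" using xy(2) by (simp add: far_def)
      ultimately show ?thesis using raise[OF e2 e1(1) hn xy(1)] XM unfolding g by metis
    qed
  qed
  then have "W 1 \<gamma> \<subseteq> M" if g: "\<gamma> \<in> \<Phi>" for \<gamma>
    using W_one_dim[where \<epsilon> = 1 and \<mu> = \<gamma>] g subspace_scale[OF subM] by blast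
  then have "Vp \<subseteq> M" by (intro order_trans[OF Vp_span span_minimal[OF _ subM]]) auto
  moreover have "?x \<in> Vp" by (intro subspace_add[OF subspace_eig] subsetD[OF W_Vp e1(1)] subsetD[OF W_Vp e2(1)])
  ultimately show ?thesis using that[of ?x] unfolding M_def by blast
qed

text \<open>so10 is spanned by commutators.\<close>

lemma N_trace_zero:
  assumes B: "finite B" "independent B" and st: "\<And>h x. br s h = 0 \<Longrightarrow> x \<in> span B \<Longrightarrow> br h x \<in> span B"
    and \<xi>: "\<xi> \<in> N"
  shows "trace_on B (br \<xi>) = 0"
proof -
  define Z where "Z = {h. br s h = 0 \<and> trace_on B (br h) = 0}"
  have stB: "br s h = 0 \<Longrightarrow> b \<in> B \<Longrightarrow> br h b \<in> span B" for h b by (rule st[OF _ span_base])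
  have tadd: "trace_on B (br (x + y)) = trace_on B (br x) + trace_on B (br y)" if "br s x = 0" "br s y = 0" for x y
    unfolding br_add_l[abs_def] by (rule trace_on_add[OF B(2)]) (use stB that in auto)
  have tscale: "trace_on B (br (c \<odot> x)) = c * trace_on B (br x)" if "br s x = 0" for c x
    unfolding br_scale_l[abs_def] by (rule trace_on_scale[OF B(2)]) (use stB that in auto)
  have subZ: "subspace Z"
  proof (rule subspaceI)
    show "0 \<in> Z" using tscale[of 0 0] by (simp add: Z_def)
  qed (simp_all add: Z_def tadd tscale br_add_r br_scale_r)
  have commZ: "br h k \<in> Z" if h: "br s h = 0" and k: "br s k = 0" for h k
  proof -
    have shk: "br s (br h k) = 0" using jacobi[of s h k] h k by simp
    have "trace_on B (\<lambda>x. br h (br k x)) = trace_on B (\<lambda>x. br k (br h x))"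
      by (rule trace_on_cyclic[OF B B lin_br _ lin_br]) (use stB h k in auto)
    moreover have "trace_on B (\<lambda>x. br h (br k x)) = trace_on B (\<lambda>x. br (br h k) x + br k (br h x))"
      by (simp only: jacobi[of h k])
    moreover have "\<dots> = trace_on B (br (br h k)) + trace_on B (\<lambda>x. br k (br h x))"
      by (rule trace_on_add[OF B(2)]) (use stB[OF shk] st[OF k stB[OF h]] in auto)
    ultimately show ?thesis using shk by (simp add: Z_def)
  qed
  have X0: "br s (X i j) = 0" for i j by (rule z_X)
  have "X i j \<in> Z" for i j
  proof (cases "j = bar i")
    case True then show ?thesis using subspace_0[OF subZ] by (simp add: X_anti_zero)
  next
    case ji: False
    show ?thesis
    proof (cases "i = j")
      case False
      have "(1/2) \<odot> br (X i i - X j j) (X i j) \<in> Z"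
        by (intro subspace_scale[OF subZ] commZ X0) (simp add: br_diff_r X0)
      then show ?thesis unfolding X_sl2(2)[OF False ji] by simp
    next
      case True
      define a where "a = (case i of Inl a \<Rightarrow> a | Inr a \<Rightarrow> a)"
      obtain b where b: "b \<notin> {a, a, a}" using ex_other_index by blast
      define k :: "5 + 5" where "k = Inl b"
      have k: "i \<noteq> k" "k \<noteq> bar i" "i \<noteq> bar k" "bar k \<noteq> bar i" using b by (cases i; auto simp: k_def a_def)+
      have "br (X i k) (X k i) + br (X i (bar k)) (X (bar k) i) \<in> Z"
        by (intro subspace_add[OF subZ] commZ X0)
      moreover have "br (X i k) (X k i) + br (X i (bar k)) (X (bar k) i) = X i i + X i i"
        unfolding X_opp[OF k(1,2)] X_opp[OF k(3,4)] X_bar by simp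
      ultimately have "(1/2) \<odot> (X i i + X i i) \<in> Z" using subspace_scale[OF subZ] by metis
      then show ?thesis using True by (simp only: half_double)
    qed
  qed
  then have "N \<subseteq> Z" by (intro span_minimal[OF _ subZ]) auto
  then show ?thesis using \<xi> by (auto simp: Z_def)
qed

text \<open>\<open>Q x\<close> is self-adjoint for the Killing form, which pairs \<open>Vm\<close> with \<open>Vp\<close>.\<close>

lemma Q_injective:
  assumes x: "x \<in> Vp" and onto: "\<And>y. y \<in> Vp \<Longrightarrow> \<exists>a\<in>Vm. Q x a = y" and a: "a \<in> Vm" "Q x a = 0"
  shows "a = 0"
proof (rule kf_nondegenerateD[OF nd VmD(1)[OF a(1)]])
  fix y assume "y \<in> G"
  then obtain e p m where y: "e \<in> span (insert s (range (\<lambda>(i, j). X i j)))" "p \<in> Vp" "m \<in> Vm" "y = e + p + m"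
    by (rule even_or_odd_span)
  have se: "br s e = 0"
    by (rule lin_zero_on_span[OF lin_br y(1)]) (use z_X T_commutes[OF T_gens(1) T_gens(1)] in auto)
  have "kf a e = 0" using kf_even_odd[OF se, of a] a(1) kf_sym[of a e] by simp
  moreover have "kf a m = 0"
  proof -
    have "kf (br s a) m = - kf a (br s m)" by (rule kf_invariant')
    then have "- kf a m = kf a m" unfolding VmD(2)[OF a(1)] VmD(2)[OF y(3)] kf_neg_l kf_neg_r by simp
    then have "kf a m + kf a m = 0" by (simp only: neg_eq_iff_add_eq_0)
    then show ?thesis by simp
  qed
  moreover have "kf a p = 0"
  proof -
    obtain b where b: "b \<in> Vm" "Q x b = p" using onto[OF y(2)] by blast
    have "kf (br x (br x a)) b = kf a (br x (br x b))" by (simp only: kf_invariant' minus_minus)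
    then show ?thesis using a(2) b(2) by simp
  qed
  ultimately show "kf a y = 0" unfolding y(4) kf_add_r by simp
qed

text \<open>A generic \<open>x\<close> with \<open>Q x\<close> onto would satisfy \<open>[\<xi>, x] = x\<close> for some \<open>\<xi>\<close> in so10. Then \<open>Q x\<close> intertwines
  \<open>ad \<xi> + 2\<close> on \<open>Vm\<close> with \<open>ad \<xi>\<close> on \<open>Vp\<close>, contradicting that both traces of \<open>ad \<xi>\<close> vanish.\<close>

lemma Q_onto_no_scaling:
  assumes x: "x \<in> Vp" and onto: "\<And>y. y \<in> Vp \<Longrightarrow> \<exists>a\<in>Vm. Q x a = y" and \<xi>: "\<xi> \<in> N" "br \<xi> x = x"
  shows False
proof -
  obtain Bp where Bp: "finite Bp" "independent Bp" "span Bp = Vp"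
    by (rule subspace_basis[OF subspace_eig Vp_G])
  obtain Bm where Bm: "finite Bm" "independent Bm" "span Bm = Vm"
    by (rule subspace_basis[OF subspace_eig Vm_G])
  have s\<xi>: "br s \<xi> = 0" by (rule N_commutes_s[OF \<xi>(1)])
  have inj: "inj_on (Q x) (span Bm)"
  proof (rule inj_onI)
    fix a b assume ab: "a \<in> span Bm" "b \<in> span Bm" "Q x a = Q x b"
    have "a - b = 0"
      by (rule Q_injective[OF x onto]) (use ab Bm(3) subspace_diff[OF subspace_eig] in \<open>simp_all add: br_diff_r\<close>)
    then show "a = b" by simp
  qed
  interpret vp: vector_space_pair scale scale ..
  obtain R where R: "range R \<subseteq> span Bm" "Vector_Spaces.linear scale scale R" "\<forall>a\<in>span Bm. R (Q x a) = a"
    using vp.linear_inj_on_left_inverse[OF _ inj] lin_Q[of x] unfolding lmap_iff by blast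
  have lR: "lmap R" using R(2) by (simp add: lmap_iff)
  have QR: "Q x (R y) = y" if y: "y \<in> Vp" for y
  proof -
    obtain a where a: "a \<in> Vm" "Q x a = y" using onto[OF y] by blast
    have "R y = a" using R(3) a Bm(3) by auto
    then show ?thesis using a by simp
  qed
  have tp: "trace_on Bp (br \<xi>) = 0" by (rule N_trace_zero[OF Bp(1,2) _ \<xi>(1)]) (simp add: Bp(3) g0_Vp)
  have tm: "trace_on Bm (br \<xi>) = 0" by (rule N_trace_zero[OF Bm(1,2) _ \<xi>(1)]) (simp add: Bm(3) g0_Vm)
  have BpV: "b \<in> Bp \<Longrightarrow> b \<in> Vp" for b using Bp(3) span_base by blast
  have BmV: "b \<in> Bm \<Longrightarrow> b \<in> Vm" for b using Bm(3) span_base by blast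
  have \<xi>Q: "br \<xi> (Q x a) = 2 \<odot> Q x a + Q x (br \<xi> a)" for a
  proof -
    have 1: "br \<xi> (br x b) = br x b + br x (br \<xi> b)" for b using jacobi[of \<xi> x b] \<xi>(2) by simp
    have "br \<xi> (Q x a) = (Q x a + Q x a) + Q x (br \<xi> a)" unfolding 1 br_add_r by (simp add: add.assoc)
    then show ?thesis using scale_left_distrib[of 1 1 "Q x a"] by simp
  qed
  have "trace_on Bm (\<lambda>a. R (br \<xi> (Q x a))) = trace_on Bp (\<lambda>y. br \<xi> (Q x (R y)))"
  proof (rule trace_on_cyclic[where f = "\<lambda>a. br \<xi> (Q x a)", OF Bm(1,2) Bp(1,2) lin_comp[OF lin_br lin_Q] _ lR])
    show "br \<xi> (Q x b) \<in> span Bp" if "b \<in> Bm" for b unfolding Bp(3) by (rule g0_Vp[OF s\<xi> Q_Vp[OF x BmV[OF that]]])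
    show "R c \<in> span Bm" for c using R(1) by blast
  qed
  also have "\<dots> = trace_on Bp (br \<xi>)" unfolding trace_on_def by (intro sum.cong refl) (simp add: QR BpV)
  finally have t0: "trace_on Bm (\<lambda>a. R (br \<xi> (Q x a))) = 0" using tp by simp
  have "R (br \<xi> (Q x a)) = 2 \<odot> a + br \<xi> a" if a: "a \<in> Vm" for a
  proof -
    have "br \<xi> a \<in> Vm" by (rule g0_Vm[OF s\<xi> a])
    then have "R (Q x (br \<xi> a)) = br \<xi> a" "R (Q x a) = a" using R(3) Bm(3) a by auto
    then show ?thesis unfolding \<xi>Q lin_add[OF lR] lin_scale[OF lR] by simp
  qed
  then have "trace_on Bm (\<lambda>a. R (br \<xi> (Q x a))) = trace_on Bm (\<lambda>a. 2 \<odot> a + br \<xi> a)"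
    unfolding trace_on_def by (intro sum.cong refl) (simp add: BmV)
  also have "\<dots> = trace_on Bm (\<lambda>a. 2 \<odot> a) + trace_on Bm (br \<xi>)"
    by (rule trace_on_add[OF Bm(2)]) (auto simp: Bm(3) BmV g0_Vm[OF s\<xi>] subspace_scale[OF subspace_eig])
  also have "trace_on Bm (\<lambda>a. 2 \<odot> a) = (\<Sum>b\<in>Bm. 2)" by (rule trace_on_diagonal[OF Bm(2)]) simp
  finally have "of_nat (card Bm) * (2 :: 'k) = 0" using t0 tm by simp
  then have "card Bm = 0" by simp
  then have "Bm = {}" using Bm(1) by simp
  then have Vm0: "Vm = {0}" using Bm(3) by simp
  obtain \<mu> where "\<mu> \<in> \<Phi>" using \<Phi>_nonempty by blast
  then obtain e where e: "e \<in> W 1 \<mu>" "e \<noteq> 0" by (auto simp: \<Phi>_def)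
  then have "e \<in> Vp" using W_Vp by blast
  then obtain a where "a \<in> Vm" "Q x a = e" using onto by blast
  then show False using Vm0 e(2) by simp
qed

lemma Q_not_onto:
  assumes x1: "x1 \<in> Vp" shows "\<exists>y\<in>Vp. y \<notin> Q x1 ` Vm"
proof (rule ccontr)
  assume "\<not> ?thesis"
  then have "Vp \<subseteq> Q x1 ` Vm" by (auto simp only: subset_iff)
  define a where "a = inv_into Vm (Q x1)"
  have a: "a y \<in> Vm \<and> Q x1 (a y) = y" if "y \<in> Vp" for y
  proof -
    have "y \<in> Q x1 ` Vm" by (rule subsetD[OF \<open>Vp \<subseteq> Q x1 ` Vm\<close> \<open>y \<in> Vp\<close>])
    then show ?thesis unfolding a_def by (intro conjI inv_into_into f_inv_into_f)
  qed
  obtain x0 where x0: "x0 \<in> Vp" "\<And>y. y \<in> Vp \<Longrightarrow> \<exists>\<xi>\<in>N. y = br \<xi> x0" by (rule open_orbit) blast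
  obtain \<xi> where \<xi>: "\<And>y. y \<in> Vp \<Longrightarrow> \<xi> y \<in> N \<and> y = br (\<xi> y) x0" using x0(2) by metis
  obtain B where B: "finite B" "independent B" "span B = Vp"
    by (rule subspace_basis[OF subspace_eig Vp_G])
  have BV: "b \<in> B \<Longrightarrow> b \<in> Vp" for b using B(3) span_base by blast
  have indB: "indep_family B (\<lambda>b. b)" by (rule independent_imp_indep_family[OF B(1,2)])
  have cG: "comp_p v \<in> G" for v using comp_in(1) VpD(1) by blast
  have pc: "poly_vec scale scale comp_p" by (rule poly_vec_linear) (use lin_comp_p in \<open>simp add: lmap_iff\<close>)
  define w1 where "w1 b v = Q (comp_p v) (a b)" for b v
  define w2 where "w2 b v = br (\<xi> b) (comp_p v)" for b v
  have aG: "b \<in> B \<Longrightarrow> a b \<in> G" and \<xi>G: "b \<in> B \<Longrightarrow> \<xi> b \<in> G" for b using a \<xi> BV VmD(1) N_G by blast+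
  have 1: "poly_vec scale scale (w1 b)" if "b \<in> B" for b
    unfolding w1_def by (rule poly_vec_br[OF pc cG poly_vec_br[OF pc cG poly_vec_const aG[OF that]] br_in])
  have 2: "poly_vec scale scale (w2 b)" if "b \<in> B" for b
    unfolding w2_def by (rule poly_vec_br[OF poly_vec_const \<xi>G[OF that] pc cG])
  have i1: "indep_family B (\<lambda>b. w1 b x1)"
    using indB a BV by (simp add: w1_def comp_of_Vp[OF x1] indep_family_def)
  have i2: "indep_family B (\<lambda>b. w2 b x0)"
    using indB \<xi> BV by (simp add: w2_def comp_of_Vp[OF x0(1)] indep_family_def)
  obtain p where p: "p \<in> polynomial_maps scale" "p x1 \<noteq> 0" "\<And>v. p v \<noteq> 0 \<Longrightarrow> indep_family B (\<lambda>b. w1 b v)"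
    using independence_open[where w = w1, OF B(1) 1 i1] by blast
  obtain q where q: "q \<in> polynomial_maps scale" "q x0 \<noteq> 0" "\<And>v. q v \<noteq> 0 \<Longrightarrow> indep_family B (\<lambda>b. w2 b v)"
    using independence_open[where w = w2, OF B(1) 2 i2] by blast
  obtain v where v: "p v \<noteq> 0" "q v \<noteq> 0"
    using nonvanishing_common_point[OF vector_space_axioms p(1) q(1) p(2) q(2)] by blast
  let ?x = "comp_p v"
  have xV: "?x \<in> Vp" by (rule comp_in)
  have spans: "Vp \<subseteq> span (w ` B)" if w: "indep_family B w" "\<And>b. b \<in> B \<Longrightarrow> w b \<in> Vp" for w
  proof -
    have "span (w ` B) = span B"
    proof (rule independent_max_spans[OF B(1)])
      show "independent (w ` B)" "w ` B \<subseteq> span B" "card B \<le> card (w ` B)"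
        using indep_family_imp[OF B(1) w(1)] w(2) B(3) by (auto simp: card_image)
    qed
    then show ?thesis using B(3) by simp
  qed
  have s1: "Vp \<subseteq> span ((\<lambda>b. w1 b v) ` B)"
    by (rule spans[OF p(3)[OF v(1)]]) (use a BV Q_Vp[OF xV] in \<open>simp add: w1_def\<close>)
  have s2: "Vp \<subseteq> span ((\<lambda>b. w2 b v) ` B)"
    by (rule spans[OF q(3)[OF v(2)]]) (use \<xi> BV g0_Vp[OF N_commutes_s xV] in \<open>simp add: w2_def\<close>)
  have "span ((\<lambda>b. w1 b v) ` B) \<subseteq> Q ?x ` Vm"
    by (rule span_minimal[OF _ subspace_lmap_image[OF lin_Q subspace_eig]]) (use a BV in \<open>auto simp: w1_def\<close>)
  then have "\<exists>a\<in>Vm. Q ?x a = y" if "y \<in> Vp" for y using s1 that by blast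
  moreover have "span ((\<lambda>b. w2 b v) ` B) \<subseteq> (\<lambda>\<eta>. br \<eta> ?x) ` N"
    by (rule span_minimal[OF _ subspace_lmap_image[OF lin_br_l subspace_span]]) (use \<xi> BV in \<open>auto simp: w2_def\<close>)
  then obtain \<eta> where "\<eta> \<in> N" "br \<eta> ?x = ?x" using s2 xV by (metis (no_types, lifting) imageE subsetD)
  ultimately show False using Q_onto_no_scaling[OF xV] by blast
qed

end

section \<open>Type E6\<close>

definition so_gen :: "'n::finite + 'n \<Rightarrow> 'n + 'n \<Rightarrow> 'k::field^('n + 'n)^('n + 'n)" where
  "so_gen i j = (\<chi> a b. (if a = i \<and> b = j then 1 else 0) - (if a = bar j \<and> b = bar i then 1 else 0))"

lemma bar_eq_iff: "bar i = j \<longleftrightarrow> i = bar j" by (cases i; cases j) auto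

lemma so_even_bar: "M \<in> lie_carrier so_even \<longleftrightarrow> (\<forall>i j. M $ bar j $ bar i = - M $ i $ j)"
proof
  assume M: "M \<in> lie_carrier so_even"
  show "\<forall>i j. M $ bar j $ bar i = - M $ i $ j"
  proof (intro allI)
    fix i j show "M $ bar j $ bar i = - M $ i $ j"
      using M unfolding in_so_even_iff by (cases i; cases j) (metis bar.simps minus_minus)+
  qed
next
  assume *: "\<forall>i j. M $ bar j $ bar i = - M $ i $ j"
  show "M \<in> lie_carrier so_even" unfolding in_so_even_iff
  proof (intro allI conjI)
    fix i j
    show "M $ Inl i $ Inl j = - M $ Inr j $ Inr i" using *[rule_format, of "Inl j" "Inl i"] by simp
    show "M $ Inl i $ Inr j = - M $ Inl j $ Inr i" using *[rule_format, of "Inr i" "Inl j"] by simp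
    show "M $ Inr i $ Inl j = - M $ Inr j $ Inl i" using *[rule_format, of "Inl i" "Inr j"] by simp
  qed
qed

lemma so_gen_bar: "so_gen (bar j) (bar i) = - so_gen i j"
  by (simp add: so_gen_def vec_eq_iff)

lemma so_gen_in: "so_gen i j \<in> lie_carrier so_even"
  unfolding so_even_bar by (simp add: so_gen_def bar_eq_iff conj_commute)

lemma delta_diff:
  "((if p \<and> q then 1 else 0) - (if r \<and> t then 1 else 0)) * m
    = (if q then if p then m else 0 else 0) - (if t then if r then m else 0 else (0::'k::comm_ring_1))"
  by simp

lemma times_delta_diff:
  "m * ((if p then 1 else 0) - (if r then 1 else 0)) = (if p then m else 0) - (if r then m else (0::'k::comm_ring_1))"
  by simp

lemma so_gen_mult:
  "(so_gen i j ** M) $ a $ b = (if a = i then M $ j $ b else 0) - (if a = bar j then M $ bar i $ b else 0)"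
proof -
  have "(so_gen i j ** M) $ a $ b
      = (\<Sum>c\<in>UNIV. (if c = j then if a = i then M $ c $ b else 0 else 0) -
          (if c = bar i then if a = bar j then M $ c $ b else 0 else 0))"
    unfolding matrix_matrix_mult_def so_gen_def by (simp only: vec_lambda_beta delta_diff)
  then show ?thesis by (simp add: sum_subtractf)
qed

lemma so_gen_opposite:
  assumes "i \<noteq> j" "j \<noteq> bar i"
  shows "so_gen i j ** so_gen j i - so_gen j i ** so_gen i j = so_gen i i - so_gen j j"
proof -
  have n: "j \<noteq> i" "i \<noteq> bar j" "bar i \<noteq> j" "bar j \<noteq> i" "bar i \<noteq> bar j" "bar j \<noteq> bar i"
    using assms by (auto simp: bar_eq_iff)
  show ?thesis
    unfolding vec_eq_iff vector_minus_component so_gen_mult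
    using assms n by (auto simp: so_gen_def)
qed

lemma so_gen_diagonal:
  "so_gen i i ** so_gen k l - so_gen k l ** so_gen i i = matrix_scale (vpair i k - vpair i l) (so_gen k l)"
proof -
  have d: "so_gen i i = diag_matrix (vpair i)"
    by (auto simp: so_gen_def diag_matrix_def vec_eq_iff vpair_def)
  have b: "vpair i (bar m) = (- vpair i m :: 'a)" for m by (auto simp: vpair_def bar_eq_iff)
  have e: "(vpair i x - vpair i y) * (if x = k \<and> y = l then 1 else 0) = (vpair i k - vpair i l) * (if x = k \<and> y = l then 1 else (0::'a))"
    "(vpair i x - vpair i y) * (if x = bar l \<and> y = bar k then 1 else 0) = (vpair i k - vpair i l) * (if x = bar l \<and> y = bar k then 1 else (0::'a))"
    for x y by (auto simp: b)
  show ?thesis unfolding d vec_eq_iff diag_matrix_commutator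
    by (simp only: so_gen_def matrix_scale_def vec_lambda_beta right_diff_distrib e) simp
qed

lemma so_gen_span:
  fixes M :: "'k::field_char_0^('n::finite + 'n)^('n + 'n)"
  assumes "M \<in> lie_carrier so_even"
  shows "M = (\<Sum>(i, j)\<in>UNIV. matrix_scale (M $ i $ j / 2) (so_gen i j))"
proof -
  have half: "x / 2 - (- x) / 2 = x" for x :: 'k
    using distrib_left[of x "1 / 2" "1 / 2"] by (simp; fail | simp add: field_simps; fail | simp flip: mult_2)
  have "(\<Sum>(i, j)\<in>UNIV. matrix_scale (M $ i $ j / 2) (so_gen i j)) $ a $ b = M $ a $ b" for a b
  proof -
    have "(\<Sum>(i, j)\<in>UNIV. matrix_scale (M $ i $ j / 2) (so_gen i j)) $ a $ b
        = (\<Sum>p\<in>UNIV. (if p = (a, b) then M $ fst p $ snd p / 2 else 0) -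
            (if p = (bar b, bar a) then M $ fst p $ snd p / 2 else 0))"
      unfolding sum_component
    proof (intro sum.cong refl)
      fix p :: "('n + 'n) \<times> ('n + 'n)"
      have c: "a = fst p \<and> b = snd p \<longleftrightarrow> p = (a, b)" "a = bar (snd p) \<and> b = bar (fst p) \<longleftrightarrow> p = (bar b, bar a)"
        by (cases p, simp, blast) (cases p, simp, metis bar_bar)
      show "(case p of (i, j) \<Rightarrow> matrix_scale (M $ i $ j / 2) (so_gen i j)) $ a $ b
          = (if p = (a, b) then M $ fst p $ snd p / 2 else 0) - (if p = (bar b, bar a) then M $ fst p $ snd p / 2 else 0)"
        by (simp only: case_prod_unfold matrix_scale_def so_gen_def vec_lambda_beta c times_delta_diff)
    qed
    also have "\<dots> = M $ a $ b / 2 - M $ bar b $ bar a / 2" by (simp add: sum_subtractf)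
    also have "\<dots> = M $ a $ b" 
      unfolding assms[unfolded so_even_bar, rule_format, of b a] by (rule half)
    finally show ?thesis .
  qed
  then show ?thesis by (simp add: vec_eq_iff)
qed

lemma lie_scale_so10_plus_line: "lie_scale so10_plus_line c p = (matrix_scale c (fst p), c * snd p)"
proof -
  interpret vector_space_pair "matrix_scale :: 'a \<Rightarrow> 'a^(5+5)^(5+5) \<Rightarrow> _" "(*) :: 'a \<Rightarrow> 'a \<Rightarrow> 'a"
    by (intro vector_space_pair.intro vector_space_matrix_scale) (unfold_locales, simp_all add: algebra_simps)
  interpret vector_space_prod "matrix_scale :: 'a \<Rightarrow> 'a^(5+5)^(5+5) \<Rightarrow> _" "(*) :: 'a \<Rightarrow> 'a \<Rightarrow> 'a" ..
  show ?thesis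
    by (simp add: so10_plus_line_def lie_sum_def lie_line_def so_even_def so_form_def gl_def scale_def)
qed

lemma lie_bracket_so10_plus_line:
  "lie_bracket so10_plus_line p q = (fst p ** fst q - fst q ** fst p, 0)"
  by (simp add: so10_plus_line_def lie_sum_def lie_line_def so_even_def so_form_def gl_def split: prod.splits)

lemma (in so10_graded) odd_commuting_variety_reducible:
  fixes L :: "('k, 'g) lie_alg"
  assumes L: "lie_scale L = scale" "lie_carrier L = G"
    and br: "\<And>x y. x \<in> G \<Longrightarrow> y \<in> G \<Longrightarrow> br x y = lie_bracket L x y"
    and odd: "minus_eigenspace L \<sigma> = {x \<in> G. \<theta> x = - x}"
  shows "commuting_variety_reducible L \<sigma>"
proof -
  obtain u u' where u: "u \<in> Vp" "u' \<in> Vm" "\<And>x. x \<in> Vp \<Longrightarrow> br (br u u') x = 0 \<Longrightarrow> x = 0"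
    by (rule injective_pair) (rule that, assumption+)
  have tg: "three_graded (lie_scale L) (lie_carrier L) br s"
    unfolding L by (rule three_graded_axioms)
  show ?thesis
    by (rule three_graded_commuting_variety_reducible[OF tg, unfolded L, OF br _ u Q_not_onto])
      (simp_all only: odd odd_part_eq)
qed

text \<open>The isomorphism transports the matrices \<open>so_gen i j\<close> and the generator of the line to the fixed subalgebra.\<close>

lemma reducible_E6:
  fixes L :: "('k::{alg_closed_field,field_char_0}, 'g::ab_group_add) lie_alg"
  assumes E6: "simple_of_type_E6 L" and inv: "lie_involution L \<sigma>"
    and iso: "lie_isomorphic (fixed_subalgebra L \<sigma>) (so10_plus_line :: ('k, ('k^(5 + 5)^(5 + 5)) \<times> 'k) lie_alg)"
  shows "commuting_variety_reducible L \<sigma>"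
proof -
  let ?G = "lie_carrier L" and ?S = "lie_scale L"
  have L: "lie_algebra L" "lie_finite_dim L" "lie_simple L" using E6 by (auto simp: simple_of_type_E6_def)
  obtain br where ls: "lie_space ?S ?G br"
    and br: "\<And>x y. x \<in> ?G \<Longrightarrow> y \<in> ?G \<Longrightarrow> br x y = lie_bracket L x y"
    using lie_space_of_lie_alg[OF L(1,2)] by blast
  interpret lie_space ?S ?G br by (rule ls)
  have iso\<sigma>: "lie_iso \<sigma> L L" using inv by (simp add: lie_involution_def)
  have \<sigma>_in: "\<sigma> x \<in> ?G" if "x \<in> ?G" for x using iso\<sigma> that unfolding lie_iso_def bij_betw_def by blast
  have \<sigma>_add: "\<sigma> (x + y) = \<sigma> x + \<sigma> y" if "x \<in> ?G" "y \<in> ?G" for x y using iso\<sigma> that unfolding lie_iso_def by blast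
  have \<sigma>_scale: "\<sigma> (?S c x) = ?S c (\<sigma> x)" if "x \<in> ?G" for c x using iso\<sigma> that unfolding lie_iso_def by blast
  have \<sigma>_br: "\<sigma> (br x y) = br (\<sigma> x) (\<sigma> y)" if "x \<in> ?G" "y \<in> ?G" for x y
    using iso\<sigma> that \<sigma>_in unfolding lie_iso_def by (simp add: br)
  have \<sigma>_\<sigma>: "\<sigma> (\<sigma> x) = x" if "x \<in> ?G" for x using inv that by (simp add: lie_involution_def)
  obtain B where B: "finite B" "independent B" "span B = ?G" by (rule G_basis)
  obtain P where P: "lmap P" "\<And>x. P x \<in> ?G" "\<And>x. x \<in> ?G \<Longrightarrow> P x = x"
    using projection_exists[OF B(2), unfolded B(3)] by auto
  define \<theta> where "\<theta> x = \<sigma> (P x)" for x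
  have \<theta>: "\<theta> x = \<sigma> x" if "x \<in> ?G" for x using P(3)[OF that] by (simp add: \<theta>_def)
  have endo\<theta>: "endo \<theta>"
    using P(2) \<sigma>_in by (simp add: endo_def lmap_def \<theta>_def lin_add[OF P(1)] lin_scale[OF P(1)] \<sigma>_add \<sigma>_scale)
  define F where "F = {x \<in> ?G. \<sigma> x = x}"
  have FG: "x \<in> F \<Longrightarrow> x \<in> ?G" and F\<theta>: "x \<in> F \<Longrightarrow> \<theta> x = x" for x using \<theta> by (auto simp: F_def)
  have subF: "subspace F"
  proof (rule subspaceI)
    have "\<theta> 0 = 0" by (rule lin_0[OF endo_lmap[OF endo\<theta>]])
    then show "0 \<in> F" using \<theta>[OF G_closed(1)] G_closed(1) by (simp add: F_def)
  qed (auto simp: F_def G_closed \<sigma>_add \<sigma>_scale)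
  have F_br: "br x y \<in> F" if "x \<in> F" "y \<in> F" for x y using that \<sigma>_br[of x y] by (simp add: F_def)
  let ?M = "so10_plus_line :: ('k, ('k^(5 + 5)^(5 + 5)) \<times> 'k) lie_alg"
  obtain \<phi> where \<phi>: "lie_iso \<phi> (fixed_subalgebra L \<sigma>) ?M" using iso unfolding lie_isomorphic_def by blast
  have cF: "lie_carrier (fixed_subalgebra L \<sigma>) = F" "lie_scale (fixed_subalgebra L \<sigma>) = ?S"
    "lie_bracket (fixed_subalgebra L \<sigma>) = lie_bracket L" by (simp_all add: fixed_subalgebra_def F_def)
  have cM: "lie_carrier ?M = lie_carrier so_even \<times> UNIV"
    by (simp add: so10_plus_line_def lie_sum_def lie_line_def)
  note \<phi>' = \<phi>[unfolded lie_iso_def cF cM lie_scale_so10_plus_line lie_bracket_so10_plus_line]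
  have bij: "bij_betw \<phi> F (lie_carrier so_even \<times> UNIV)" using \<phi>' by blast
  have \<phi>_add: "\<phi> (x + y) = \<phi> x + \<phi> y" if "x \<in> F" "y \<in> F" for x y using \<phi>' that by blast
  have \<phi>_scale: "\<phi> (?S c x) = (matrix_scale c (fst (\<phi> x)), c * snd (\<phi> x))" if "x \<in> F" for c x using \<phi>' that by blast
  have \<phi>_br: "\<phi> (br x y) = (fst (\<phi> x) ** fst (\<phi> y) - fst (\<phi> y) ** fst (\<phi> x), 0)" if "x \<in> F" "y \<in> F" for x y
    using \<phi>' that by (simp add: br FG)
  have \<phi>_inj: "x = y" if "\<phi> x = \<phi> y" "x \<in> F" "y \<in> F" for x y
    using bij that unfolding bij_betw_def inj_on_def by blast
  have \<phi>_0: "\<phi> 0 = 0" using \<phi>_add[OF subspace_0[OF subF] subspace_0[OF subF]] by simp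
  have \<phi>_neg: "\<phi> (- x) = - \<phi> x" if "x \<in> F" for x
    using \<phi>_add[OF that subspace_neg[OF subF that]] \<phi>_0 by (simp add: eq_neg_iff_add_eq_0 add.commute)
  have \<phi>_diff: "\<phi> (x - y) = \<phi> x - \<phi> y" if "x \<in> F" "y \<in> F" for x y
    using \<phi>_add[OF that(1) subspace_neg[OF subF that(2)]] \<phi>_neg[OF that(2)] by simp
  have \<phi>_sum: "\<phi> (sum f A) = (\<Sum>a\<in>A. \<phi> (f a))" if "finite A" "\<And>a. f a \<in> F" for f :: "(5 + 5) \<times> (5 + 5) \<Rightarrow> 'g" and A
    using that(1) by (induction A rule: finite_induct) (simp_all add: \<phi>_0 \<phi>_add that(2) subspace_sum[OF subF])
  have surj: "\<exists>x. x \<in> F \<and> \<phi> x = p" if "fst p \<in> lie_carrier so_even" for p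
  proof -
    have "p \<in> \<phi> ` F" unfolding bij_betw_imp_surj_on[OF bij] using that by (simp add: mem_Times_iff)
    then show ?thesis by blast
  qed
  have "\<exists>x. x \<in> F \<and> \<phi> x = (so_gen i j, 0)" for i j by (rule surj) (simp add: so_gen_in)
  then obtain X where X: "\<And>i j. X i j \<in> F" "\<And>i j. \<phi> (X i j) = (so_gen i j, 0)" by metis
  have "\<exists>x. x \<in> F \<and> \<phi> x = (0, 1)" by (rule surj) (simp add: so_even_bar)
  then obtain z where z: "z \<in> F" "\<phi> z = (0, 1)" by blast
  note F_closed = subspace_add[OF subF] subspace_diff[OF subF] subspace_scale[OF subF] subspace_neg[OF subF]
  have so10: "so10_even ?S ?G br X z \<theta>"
  proof unfold_locales
    show "endo \<theta>" by (rule endo\<theta>)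
    show "\<theta> (\<theta> x) = x" if "x \<in> ?G" for x using that by (simp add: \<theta> \<sigma>_in \<sigma>_\<sigma>)
    show "\<theta> (br x y) = br (\<theta> x) (\<theta> y)" if "x \<in> ?G" "y \<in> ?G" for x y using that by (simp add: \<theta> \<sigma>_br)
    show "X i j \<in> ?G" "\<theta> (X i j) = X i j" for i j using X FG F\<theta> by blast+
    show "z \<in> ?G" "\<theta> z = z" using z FG F\<theta> by blast+
    show "z \<noteq> 0" using z(2) \<phi>_0 by (auto simp: zero_prod_def)
    show "X (bar j) (bar i) = - X i j" for i j
      by (rule \<phi>_inj) (simp_all add: X \<phi>_neg F_closed so_gen_bar)
    show "X i j \<noteq> 0" if "i \<noteq> j" "j \<noteq> bar i" for i j
    proof
      assume "X i j = 0"
      then have "so_gen i j $ i $ j = (0::'k)" using X(2)[of i j] \<phi>_0 by (simp add: zero_prod_def)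
      then show False using that by (simp add: so_gen_def)
    qed
    show "br (X i i) (X k l) = ?S (vpair i k - vpair i l) (X k l)" for i k l
      by (rule \<phi>_inj) (simp_all add: X \<phi>_br \<phi>_scale F_closed F_br so_gen_diagonal)
    show "br (X i j) (X j i) = X i i - X j j" if "i \<noteq> j" "j \<noteq> bar i" for i j
      by (rule \<phi>_inj) (simp_all add: X \<phi>_br \<phi>_diff F_closed F_br so_gen_opposite[OF that])
    show "br z (X i j) = 0" for i j
      by (rule \<phi>_inj) (simp_all add: X z \<phi>_br \<phi>_0 subspace_0[OF subF] F_br zero_prod_def vec_eq_iff matrix_matrix_mult_def)
    show "x \<in> span (insert z (range (\<lambda>(i, j). X i j)))" if "x \<in> ?G" "\<theta> x = x" for x
    proof -
      have xF: "x \<in> F" using that \<theta> by (simp add: F_def)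
      obtain M c where Mc: "\<phi> x = (M, c)" by (cases "\<phi> x")
      have "M \<in> lie_carrier so_even" using bij_betw_apply[OF bij xF] by (simp add: Mc)
      note M = so_gen_span[OF this]
      let ?f = "\<lambda>p. ?S (M $ fst p $ snd p / 2) (X (fst p) (snd p))"
      let ?y = "?S c z + (\<Sum>p\<in>UNIV. ?f p)"
      have fF: "?f p \<in> F" for p using X F_closed by blast
      have sF: "(\<Sum>p\<in>UNIV. ?f p) \<in> F" by (intro subspace_sum[OF subF] fF)
      have zF: "?S c z \<in> F" using z F_closed by blast
      have m0: "matrix_scale c (0 :: 'k^(5 + 5)^(5 + 5)) = 0" by (simp add: matrix_scale_def vec_eq_iff)
      have "\<phi> (\<Sum>p\<in>UNIV. ?f p) = (\<Sum>p\<in>UNIV. \<phi> (?f p))" by (rule \<phi>_sum[OF finite fF])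
      also have "\<dots> = (\<Sum>p\<in>UNIV. (matrix_scale (M $ fst p $ snd p / 2) (so_gen (fst p) (snd p)), 0))"
        by (intro sum.cong refl) (simp add: \<phi>_scale X)
      also have "\<dots> = (M, 0)"
        by (rule prod_eqI) (use M in \<open>simp_all add: fst_sum snd_sum case_prod_unfold\<close>)
      finally have "\<phi> ?y = \<phi> x" unfolding \<phi>_add[OF zF sF] \<phi>_scale[OF z(1)] z(2) Mc by (simp add: m0)
      then have "x = ?y" by (intro \<phi>_inj[OF sym] xF F_closed zF sF)
      moreover have "?y \<in> span (insert z (range (\<lambda>(i, j). X i j)))"
        by (intro span_add span_scale span_sum span_base) auto
      ultimately show ?thesis by simp
    qed
    show "simple" unfolding simple_def
    proof (intro allI impI)
      fix I assume I: "subspace I \<and> I \<subseteq> ?G \<and> (\<forall>x\<in>?G. \<forall>y\<in>I. br x y \<in> I)"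
      have "lie_bracket L x y \<in> I" if xy: "x \<in> ?G" "y \<in> I" for x y
      proof -
        have "y \<in> ?G" "br x y \<in> I" using I xy by blast+
        then show ?thesis using br[OF xy(1), of y] by simp
      qed
      then have "lie_ideal L I" using I by (simp add: lie_ideal_def)
      then show "I = {0} \<or> I = ?G" using L(3) unfolding lie_simple_def by blast
    qed
    show "72 \<le> card C" if "kf_nondegenerate" "finite C" "?G \<subseteq> span C" for C
      by (rule E6_dimension[OF refl refl br that(1) E6 that(2,3)])
  qed
  obtain s where "so10_graded ?S ?G br X s \<theta>" using so10_even.grading_exists[OF so10] by (rule exE)
  then show ?thesis
  proof (rule so10_graded.odd_commuting_variety_reducible[OF _ refl refl br])
    show "minus_eigenspace L \<sigma> = {x \<in> ?G. \<theta> x = - x}"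
      unfolding minus_eigenspace_def using \<theta> by auto
  qed
qed

theorem mainTheorem2:
  fixes L :: "('k::{alg_closed_field, field_char_0}, 'g::ab_group_add) lie_alg"
    and \<sigma> :: "'g \<Rightarrow> 'g"
  shows
    "(CARD('n::finite) \<noteq> CARD('m::finite) \<longrightarrow>
        commuting_variety_reducible (gl :: ('k, 'k^('n + 'm)^('n + 'm)) lie_alg) sigma_gl) \<and>
     (odd CARD('r::finite) \<and> CARD('r) \<ge> 3 \<longrightarrow>
        commuting_variety_reducible (so_even :: ('k, 'k^('r + 'r)^('r + 'r)) lie_alg) sigma_so) \<and>
     (simple_of_type_E6 L \<and> lie_involution L \<sigma> \<and>
      lie_isomorphic (fixed_subalgebra L \<sigma>) (so10_plus_line :: ('k, ('k^(5 + 5)^(5 + 5)) \<times> 'k) lie_alg) \<longrightarrow>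
        commuting_variety_reducible L \<sigma>)"
  using reducible_gl reducible_so reducible_E6[of L \<sigma>] by blast

end
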